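(* Let $\pi$ be a set of primes, let $G$ be a finite $\pi$-separable group, let $H$ be a Hall $\pi$-subgroup and $H'$ a Hall $\pi'$-subgroup of $G$, and let $c\in H^2G$. Let $V$ be a primitive irreducible $c$-module of $G$. Then $V\cong V_\pi\otimes V_{\pi'}$ for some $c_\pi$-module $V_\pi$ of $G$ and some $c_{\pi'}$-module $V_{\pi'}$ of $G$ such that the restrictions $V_\pi|_H$ and $V_{\pi'}|_{H'}$ are irreducible. In particular $(\dim V)_\pi=\dim V_\pi$ and $(\dim V)_{\pi'}=\dim V_{\pi'}$. Moreover, since $c_\pi|_{H'}=1$ and $c_{\pi'}|_{H}=1$, the restrictions $V_\pi|_{H'}$ and $V_{\pi'}|_{H}$ are ordinary modules.
   Context: All groups are finite and all modules are finite-dimensional over $\mathbb{C}$. $H^2G=Z^2G/B^2G$ is the Schur multiplier $H^2(G,\mathbb{C}^\times)$ (trivial action), a finite abelian group whose elements are called coclasses. For $c=[\alpha]\in H^2G$, a $c$-module is a nonzero space $V$ with a map $\varphi:G\to \mathrm{GL}(V)$ satisfying $\varphi(x)\varphi(y)=\alpha(x,y)\varphi(xy)$; equivalently, a module over the twisted group algebra $\mathbb{C}^cG$ with basis $\{g\sigma : g\in G\}$ and product $g\sigma\, h\sigma=\alpha(g,h)\,(gh)\sigma$ (the choice of representing cocycle is immaterial). For $K\le G$, restriction to $K$ gives a module for the restricted coclass $c|_K$. A module for a trivial coclass is an ordinary module (a linear representation, after rescaling the maps $\varphi(x)$ so that the cocycle becomes $1$). If $A$ is an $a$-module and $B$ a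 $b$-module then $A\otimes B$, with diagonal action, is an $ab$-module (the cocycles being multiplied; representing cocycles are chosen compatibly). $\pi'$ is the complement of $\pi$ in the set of all primes. For a positive integer $n$, $n=n_\pi n_{\pi'}$ with $n_\pi$ having all its prime divisors in $\pi$ and $n_{\pi'}$ having none in $\pi$. Each coclass decomposes uniquely as $c=c_\pi c_{\pi'}$ with $c_\pi,c_{\pi'}\in H^2G$ of order a $\pi$-number and a $\pi'$-number respectively. $G$ is $\pi$-separable if it has a series $1=N_0\le\dots\le N_l=G$ of normal subgroups such that each $|N_i/N_{i-1}|$ is a $\pi$-number or a $\pi'$-number. A Hall $\pi$-subgroup is a subgroup whose order is a $\pi$-number and whose index is a $\pi'$-number. For $K\le G$ and a $c|_K$-module $U$, the induced $c$-module is $U\otimes_{\mathbb{C}^cK}\mathbb{C}^cG$. An irreducible $c$-module of $G$ is primitive if it is not isomorphic to a $c$-module induced from a $c|_K$-module of a proper subgroup $K<G$. *)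

theory Defs
  imports
    "HOL-Algebra.Multiplicative_Group"
    "HOL-Computational_Algebra.Primes"
    "Jordan_Normal_Form.VS_Connect"
begin

section \<open>Sets of primes\<close>

definition compl_primes :: "nat set \<Rightarrow> nat set" where
  "compl_primes \<pi> = {p. prime p \<and> p \<notin> \<pi>}"

text \<open>The condition \<open>0 < n\<close> excludes the value \<open>0\<close> that \<^const>\<open>group.ord\<close> and \<^const>\<open>card\<close>
  take in the infinite case.\<close>

definition pi_number :: "nat set \<Rightarrow> nat \<Rightarrow> bool" where
  "pi_number \<pi> n \<longleftrightarrow> 0 < n \<and> (\<forall>p. prime p \<and> p dvd n \<longrightarrow> p \<in> \<pi>)"

definition pi_part :: "nat set \<Rightarrow> nat \<Rightarrow> nat" where
  "pi_part \<pi> n = (\<Prod>p\<in>prime_factors n \<inter> \<pi>. p ^ multiplicity p n)"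

definition pi_separable :: "nat set \<Rightarrow> ('a, 'b) monoid_scheme \<Rightarrow> bool" where
  "pi_separable \<pi> G \<longleftrightarrow>
    (\<exists>(N :: nat \<Rightarrow> 'a set) l.
       N 0 = {\<one>\<^bsub>G\<^esub>} \<and> N l = carrier G \<and>
       (\<forall>i\<le>l. N i \<lhd> G) \<and>
       (\<forall>i<l. N i \<subseteq> N (Suc i) \<and>
          (let q = Coset.order (G\<lparr>carrier := N (Suc i)\<rparr> Mod N i)
           in pi_number \<pi> q \<or> pi_number (compl_primes \<pi>) q)))"

definition hall_subgroup :: "nat set \<Rightarrow> ('a, 'b) monoid_scheme \<Rightarrow> 'a set \<Rightarrow> bool" where
  "hall_subgroup \<pi> G H \<longleftrightarrow>
    subgroup H G \<and> pi_number \<pi> (card H) \<and>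
    pi_number (compl_primes \<pi>) (card (rcosets\<^bsub>G\<^esub> H))"


section \<open>The Schur multiplier\<close>

text \<open>Cocycles are extensional functions on \<open>carrier G \<times> carrier G\<close>, so that they form a group
  in which coclasses are cosets.\<close>

definition Z2 :: "('a, 'b) monoid_scheme \<Rightarrow> ('a \<times> 'a \<Rightarrow> complex) monoid" where
  "Z2 G =
    \<lparr>carrier = {\<alpha> \<in> carrier G \<times> carrier G \<rightarrow>\<^sub>E UNIV - {0}.
        \<forall>x\<in>carrier G. \<forall>y\<in>carrier G. \<forall>z\<in>carrier G.
          \<alpha> (x, y) * \<alpha> (x \<otimes>\<^bsub>G\<^esub> y, z) = \<alpha> (x, y \<otimes>\<^bsub>G\<^esub> z) * \<alpha> (y, z)},
     mult = (\<lambda>\<alpha> \<beta>. \<lambda>p\<in>carrier G \<times> carrier G. \<alpha> p * \<beta> p),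
     one = (\<lambda>p\<in>carrier G \<times> carrier G. 1)\<rparr>"

definition B2 :: "('a, 'b) monoid_scheme \<Rightarrow> ('a \<times> 'a \<Rightarrow> complex) set" where
  "B2 G = {\<lambda>(x, y)\<in>carrier G \<times> carrier G. \<mu> x * \<mu> y / \<mu> (x \<otimes>\<^bsub>G\<^esub> y) | \<mu>.
             \<mu> \<in> carrier G \<rightarrow> UNIV - {0}}"

definition H2 :: "('a, 'b) monoid_scheme \<Rightarrow> ('a \<times> 'a \<Rightarrow> complex) set monoid" where
  "H2 G = Z2 G Mod B2 G"

text \<open>The elementwise image of a coset of \<open>B2 G\<close> is a full coset of \<open>B2\<close> of the subgroup \<open>K\<close>,
  because every function from \<open>K\<close> to the nonzero complex numbers extends to \<open>G\<close>.\<close>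

definition restrict_coclass ::
  "'a set \<Rightarrow> ('a \<times> 'a \<Rightarrow> complex) set \<Rightarrow> ('a \<times> 'a \<Rightarrow> complex) set" where
  "restrict_coclass K c = (\<lambda>\<alpha>. restrict \<alpha> (K \<times> K)) ` c"

definition pi_component :: "nat set \<Rightarrow> ('c, 'd) monoid_scheme \<Rightarrow> 'c \<Rightarrow> 'c" where
  "pi_component \<pi> A c =
    (THE a. a \<in> carrier A \<and> pi_number \<pi> (group.ord A a) \<and>
       (\<exists>b\<in>carrier A. pi_number (compl_primes \<pi>) (group.ord A b) \<and> c = a \<otimes>\<^bsub>A\<^esub> b))"


section \<open>Modules for a cocycle\<close>

abbreviation complex_field :: "complex ring" where
  "complex_field \<equiv> class_ring"

abbreviation cdim :: "(complex, 'v, 'm) module_scheme \<Rightarrow> nat" where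
  "cdim V \<equiv> vectorspace.dim complex_field V"

text \<open>Modules are right modules, \<open>\<phi> g v\<close> being \<open>v\<close> times the basis element of the twisted group
  algebra at \<open>g\<close>; so \<open>\<phi> y (\<phi> x v)\<close> is the result of applying the product \<open>\<phi>(x)\<phi>(y)\<close>
  to \<open>v\<close>. Only the values of \<open>\<alpha>\<close> on \<open>carrier G\<close> matter, so that the restriction of a module to
  a subgroup \<open>K\<close> is given by the same data over \<open>G\<lparr>carrier := K\<rparr>\<close>.\<close>

definition twisted_module ::
  "('a, 'b) monoid_scheme \<Rightarrow> ('a \<times> 'a \<Rightarrow> complex) \<Rightarrow>
   (complex, 'v, 'm) module_scheme \<Rightarrow> ('a \<Rightarrow> 'v \<Rightarrow> 'v) \<Rightarrow> bool" where
  "twisted_module G \<alpha> V \<phi> \<longleftrightarrow>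
    vectorspace complex_field V \<and> vectorspace.fin_dim complex_field V \<and>
    carrier V \<noteq> {\<zero>\<^bsub>V\<^esub>} \<and>
    (\<forall>g\<in>carrier G. linear_map complex_field V V (\<phi> g) \<and>
                    bij_betw (\<phi> g) (carrier V) (carrier V)) \<and>
    (\<forall>x\<in>carrier G. \<forall>y\<in>carrier G. \<forall>v\<in>carrier V.
       \<phi> y (\<phi> x v) = \<alpha> (x, y) \<odot>\<^bsub>V\<^esub> \<phi> (x \<otimes>\<^bsub>G\<^esub> y) v)"

definition module_iso ::
  "('a, 'b) monoid_scheme \<Rightarrow>
   (complex, 'v, 'm) module_scheme \<Rightarrow> ('a \<Rightarrow> 'v \<Rightarrow> 'v) \<Rightarrow>
   (complex, 'w, 'n) module_scheme \<Rightarrow> ('a \<Rightarrow> 'w \<Rightarrow> 'w) \<Rightarrow> bool" where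
  "module_iso G V \<phi> W \<psi> \<longleftrightarrow>
    (\<exists>f. linear_map complex_field V W f \<and> bij_betw f (carrier V) (carrier W) \<and>
         (\<forall>g\<in>carrier G. \<forall>v\<in>carrier V. f (\<phi> g v) = \<psi> g (f v)))"

definition irreducible_module ::
  "('a, 'b) monoid_scheme \<Rightarrow> (complex, 'v, 'm) module_scheme \<Rightarrow> ('a \<Rightarrow> 'v \<Rightarrow> 'v) \<Rightarrow> bool" where
  "irreducible_module G V \<phi> \<longleftrightarrow>
    carrier V \<noteq> {\<zero>\<^bsub>V\<^esub>} \<and>
    (\<forall>W. subspace complex_field W V \<and> (\<forall>g\<in>carrier G. \<phi> g ` W \<subseteq> W) \<longrightarrow>
         W = {\<zero>\<^bsub>V\<^esub>} \<or> W = carrier V)"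

definition ordinary_module ::
  "('a, 'b) monoid_scheme \<Rightarrow> (complex, 'v, 'm) module_scheme \<Rightarrow> ('a \<Rightarrow> 'v \<Rightarrow> 'v) \<Rightarrow> bool" where
  "ordinary_module G V \<phi> \<longleftrightarrow>
    (\<exists>\<mu> \<in> carrier G \<rightarrow> UNIV - {0}. twisted_module G (\<lambda>_. 1) V (\<lambda>g v. \<mu> g \<odot>\<^bsub>V\<^esub> \<phi> g v))"


section \<open>Induced modules\<close>

definition quotient_space ::
  "('k, 'v, 'm) module_scheme \<Rightarrow> 'v set \<Rightarrow> ('k, 'v set) module" where
  "quotient_space V N =
    \<lparr>carrier = a_rcosets\<^bsub>V\<^esub> N, mult = undefined, one = undefined, zero = N,
     add = set_add V, smult = (\<lambda>a X. \<Union>v\<in>X. N +>\<^bsub>V\<^esub> (a \<odot>\<^bsub>V\<^esub> v))\<rparr>"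

text \<open>A function \<open>f\<close> on \<open>G\<close> with values in \<open>U\<close> stands for the element
  \<open>\<Sum>g. f g \<otimes> g\<sigma>\<close> of the tensor product, over the complex numbers, of \<open>U\<close> with the twisted group
  algebra of \<open>G\<close>, whose basis is \<open>{g\<sigma> | g \<in> G}\<close>.\<close>

definition tensor_group_algebra ::
  "('a, 'b) monoid_scheme \<Rightarrow> (complex, 'u, 'm) module_scheme \<Rightarrow> (complex, 'a \<Rightarrow> 'u) module" where
  "tensor_group_algebra G U =
    \<lparr>carrier = carrier G \<rightarrow>\<^sub>E carrier U, mult = undefined, one = undefined,
     zero = (\<lambda>g\<in>carrier G. \<zero>\<^bsub>U\<^esub>),
     add = (\<lambda>f h. \<lambda>g\<in>carrier G. f g \<oplus>\<^bsub>U\<^esub> h g),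
     smult = (\<lambda>a f. \<lambda>g\<in>carrier G. a \<odot>\<^bsub>U\<^esub> f g)\<rparr>"

text \<open>The element \<open>u \<otimes> x\<sigma>\<close>.\<close>

definition pure_tensor ::
  "('a, 'b) monoid_scheme \<Rightarrow> (complex, 'u, 'm) module_scheme \<Rightarrow> 'u \<Rightarrow> 'a \<Rightarrow> 'a \<Rightarrow> 'u" where
  "pure_tensor G U u x = (\<lambda>g\<in>carrier G. if g = x then u else \<zero>\<^bsub>U\<^esub>)"

text \<open>The subspace spanned by all \<open>u k\<sigma> \<otimes> g\<sigma> - u \<otimes> k\<sigma> g\<sigma>\<close> with \<open>k \<in> K\<close>, where
  \<open>k\<sigma> g\<sigma> = \<alpha>(k, g) (k g)\<sigma>\<close>.\<close>

definition balanced_relations ::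
  "('a, 'b) monoid_scheme \<Rightarrow> ('a \<times> 'a \<Rightarrow> complex) \<Rightarrow> 'a set \<Rightarrow>
   (complex, 'u, 'm) module_scheme \<Rightarrow> ('a \<Rightarrow> 'u \<Rightarrow> 'u) \<Rightarrow> ('a \<Rightarrow> 'u) set" where
  "balanced_relations G \<alpha> K U \<psi> =
    LinearCombinations.module.span complex_field (tensor_group_algebra G U)
      {pure_tensor G U (\<psi> k u) g \<ominus>\<^bsub>tensor_group_algebra G U\<^esub>
         pure_tensor G U (\<alpha> (k, g) \<odot>\<^bsub>U\<^esub> u) (k \<otimes>\<^bsub>G\<^esub> g)
       | k g u. k \<in> K \<and> g \<in> carrier G \<and> u \<in> carrier U}"

definition induced_space ::
  "('a, 'b) monoid_scheme \<Rightarrow> ('a \<times> 'a \<Rightarrow> complex) \<Rightarrow> 'a set \<Rightarrow>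
   (complex, 'u, 'm) module_scheme \<Rightarrow> ('a \<Rightarrow> 'u \<Rightarrow> 'u) \<Rightarrow> (complex, ('a \<Rightarrow> 'u) set) module" where
  "induced_space G \<alpha> K U \<psi> =
    quotient_space (tensor_group_algebra G U) (balanced_relations G \<alpha> K U \<psi>)"

text \<open>Right multiplication by \<open>x\<sigma>\<close> takes \<open>u \<otimes> g\<sigma>\<close> to \<open>\<alpha>(g, x) u \<otimes> (g x)\<sigma>\<close>. It maps the
  balanced relations onto themselves, hence permutes their cosets elementwise.\<close>

definition induced_action ::
  "('a, 'b) monoid_scheme \<Rightarrow> ('a \<times> 'a \<Rightarrow> complex) \<Rightarrow> (complex, 'u, 'm) module_scheme \<Rightarrow>
   'a \<Rightarrow> ('a \<Rightarrow> 'u) set \<Rightarrow> ('a \<Rightarrow> 'u) set" where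
  "induced_action G \<alpha> U x X =
    (\<lambda>f. \<lambda>h\<in>carrier G. \<alpha> (h \<otimes>\<^bsub>G\<^esub> inv\<^bsub>G\<^esub> x, x) \<odot>\<^bsub>U\<^esub> f (h \<otimes>\<^bsub>G\<^esub> inv\<^bsub>G\<^esub> x)) ` X"

abbreviation coord_space :: "nat \<Rightarrow> (complex, complex vec) module" where
  "coord_space n \<equiv> module_vec TYPE(complex) n"

text \<open>Every module for the subgroup \<open>K\<close> is isomorphic to one on a coordinate space, so it is enough
  that \<open>U\<close> ranges over these.\<close>

definition primitive_module ::
  "('a, 'b) monoid_scheme \<Rightarrow> ('a \<times> 'a \<Rightarrow> complex) \<Rightarrow>
   (complex, 'v, 'm) module_scheme \<Rightarrow> ('a \<Rightarrow> 'v \<Rightarrow> 'v) \<Rightarrow> bool" where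
  "primitive_module G \<alpha> V \<phi> \<longleftrightarrow>
    \<not> (\<exists>K n \<psi>. subgroup K G \<and> K \<noteq> carrier G \<and>
          twisted_module (G\<lparr>carrier := K\<rparr>) \<alpha> (coord_space n) \<psi> \<and>
          module_iso G V \<phi>
            (induced_space G \<alpha> K (coord_space n) \<psi>) (induced_action G \<alpha> (coord_space n)))"


section \<open>Tensor products\<close>

text \<open>The tensor product of \<open>coord_space m\<close> and \<open>coord_space n\<close> is \<open>coord_space (m * n)\<close>, the
  coordinate at \<open>i * n + j\<close> belonging to \<open>unit_vec m i \<otimes> unit_vec n j\<close>.\<close>

definition tensor_vec :: "nat \<Rightarrow> nat \<Rightarrow> complex vec \<Rightarrow> complex vec \<Rightarrow> complex vec" where
  "tensor_vec m n u v = vec (m * n) (\<lambda>t. u $ (t div n) * v $ (t mod n))"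

text \<open>The diagonal action: the linear extension of
  \<open>u \<otimes> v \<mapsto> \<phi> g u \<otimes> \<psi> g v\<close> from the basis of unit vectors.\<close>

definition tensor_action ::
  "nat \<Rightarrow> nat \<Rightarrow> ('a \<Rightarrow> complex vec \<Rightarrow> complex vec) \<Rightarrow> ('a \<Rightarrow> complex vec \<Rightarrow> complex vec) \<Rightarrow>
   'a \<Rightarrow> complex vec \<Rightarrow> complex vec" where
  "tensor_action m n \<phi> \<psi> g w =
    finsum (coord_space (m * n))
      (\<lambda>(i, j). w $ (i * n + j) \<cdot>\<^sub>v tensor_vec m n (\<phi> g (unit_vec m i)) (\<psi> g (unit_vec n j)))
      ({..<m} \<times> {..<n})"

end

theory Submission
  imports Defs "HOL-Library.Groups_Big_Fun" "HOL-Algebra.Zassenhaus" "Jordan_Normal_Form.Spectral_Radius"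
begin

text \<open>In coordinates the module is a projective matrix representation \<open>F\<close> of \<open>G\<close> of some
  degree \<open>d\<close>. For a normal subgroup \<open>N\<close> let \<open>A(N)\<close> be the algebra spanned by \<open>F(N)\<close>;
  conjugation by \<open>F(G)\<close> maps it to itself.

  Primitivity is used through a single consequence. The centre of \<open>A(N)\<close> is a commuting set of
  matrices permuted by conjugation with \<open>F(G)\<close>, so \<open>G\<close> permutes its joint eigenspaces, and
  if there were more than one of them the module would be induced from the stabilizer of one
  (\<open>primitive_commuting_scalar\<close>, \<open>induced_module_iso\<close>). Hence the centre consists of
  scalars, which forces \<open>A(N)\<close> to be a full matrix algebra
  (\<open>span_scalar_center_matrix_units\<close>). By the Skolem-Noether theorem conjugation by \<open>F g\<close> is
  then inner on \<open>A(N)\<close>, so that \<open>F g = a b\<close> with \<open>a\<close> in \<open>A(N)\<close> and \<open>b\<close> centralizing \<open>A(N)\<close>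
  (\<open>factor_over_subgroup\<close>).

  Such splittings are refined along a normal series whose factors have \<open>\<pi>\<close>-order or
  \<open>\<pi>'\<close>-order. At the term \<open>N\<close> one has \<open>F g = x g * y g * z g\<close>, where \<open>x\<close> and \<open>y\<close> take values
  in \<open>A(N)\<close> that commute with each other, \<open>z\<close> centralizes \<open>A(N)\<close>, and \<open>x(G)\<close>, \<open>y(G)\<close> lie in
  the spans of \<open>x(H \<inter> N)\<close>, \<open>y(H' \<inter> N)\<close>. For the next term \<open>N'\<close> write \<open>z = p b\<close> with \<open>p\<close> in
  \<open>A(N')\<close> and \<open>b\<close> centralizing \<open>A(N')\<close>. If \<open>N'/N\<close> is a \<open>\<pi>\<close>-group, then \<open>N' = (H \<inter> N') N\<close>
  (\<open>coprime_index_covers\<close>), and averaging over \<open>N\<close> shows that \<open>p(G)\<close> lies in the span of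
  \<open>p(H \<inter> N')\<close>; so \<open>p\<close> can be absorbed into \<open>x\<close>, and in the other case into \<open>y\<close>
  (\<open>partial_factorization_step\<close>). At the top \<open>F = x y\<close>, and \<open>x\<close>, \<open>y\<close> are projective
  representations because their failure to be multiplicative commutes with \<open>F\<close> and is
  therefore scalar (\<open>proj_rep_of_commuting_factor\<close>).

  The algebra spanned by \<open>x(G)\<close> is again a full matrix algebra and commutes with \<open>y(G)\<close>; this
  identifies \<open>F\<close> with a tensor product \<open>X \<otimes> Y\<close> in which \<open>X\<close> on \<open>H\<close> and \<open>Y\<close> on \<open>H'\<close> are
  irreducible (\<open>tensor_decomposition\<close>). Degrees of irreducible projective representations
  divide the group order (\<open>degree_dvd_order\<close>), so \<open>X\<close> has \<open>\<pi>\<close>-degree and \<open>Y\<close> has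
  \<open>\<pi>'\<close>-degree. Taking determinants, the degree annihilates the coclass (\<open>proj_rep_cocycle\<close>);
  the coclasses of \<open>X\<close> and \<open>Y\<close> have product \<open>c\<close>, so they are its two components
  (\<open>pi_component_eqI\<close>). On \<open>H'\<close> the coclass of \<open>X\<close> is annihilated both by the degree of \<open>X\<close>
  and by the order of \<open>H'\<close>, hence is trivial (\<open>restrict_coclass_trivial\<close>); likewise that of
  \<open>Y\<close> on \<open>H\<close>.\<close>

section \<open>The ring of finitely supported matrices\<close>

text \<open>Columns are elements of \<open>Mat n 1\<close>; without this the simplifier would rewrite the
  numeral to \<open>Suc 0\<close>.\<close>

declare One_nat_def [simp del]

text \<open>Matrices of all sizes are elements of one ring, as infinite matrices of finite
  support. Products then carry no dimension conditions, and associativity and distributivity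
  are those of a ring; the size is recorded by membership in \<open>Mat m n\<close> where it matters. The
  unit of the \<open>n \<times> n\<close> matrices is \<open>idm n\<close>.\<close>

typedef fmat = "{f :: nat \<Rightarrow> nat \<Rightarrow> complex. \<exists>n. \<forall>i j. i \<ge> n \<or> j \<ge> n \<longrightarrow> f i j = 0}"
  morphisms entry Abs_fmat
  by (intro exI[of _ "\<lambda>_ _. 0"]) auto

setup_lifting type_definition_fmat

lemma fmat_eqI: "(\<And>i j. entry A i j = entry B i j) \<Longrightarrow> A = B"
  by (simp add: entry_inject[symmetric] fun_eq_iff)

lemma fmat_bound: obtains n where "\<And>i j. i \<ge> n \<or> j \<ge> n \<Longrightarrow> entry A i j = 0"
  using entry[of A] by auto

definition fmult_fun :: "(nat \<Rightarrow> nat \<Rightarrow> complex) \<Rightarrow> (nat \<Rightarrow> nat \<Rightarrow> complex) \<Rightarrow> nat \<Rightarrow> nat \<Rightarrow> complex" where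
  "fmult_fun f g i j = Sum_any (\<lambda>k. f i k * g k j)"

instantiation fmat :: ab_group_add
begin

lift_definition zero_fmat :: fmat is "\<lambda>_ _. 0" by auto
lift_definition plus_fmat :: "fmat \<Rightarrow> fmat \<Rightarrow> fmat" is "\<lambda>f g i j. f i j + g i j"
proof -
  fix f g :: "nat \<Rightarrow> nat \<Rightarrow> complex"
  assume "\<exists>n. \<forall>i j. i \<ge> n \<or> j \<ge> n \<longrightarrow> f i j = 0" "\<exists>n. \<forall>i j. i \<ge> n \<or> j \<ge> n \<longrightarrow> g i j = 0"
  then obtain m n where "\<forall>i j. i \<ge> m \<or> j \<ge> m \<longrightarrow> f i j = 0" "\<forall>i j. i \<ge> n \<or> j \<ge> n \<longrightarrow> g i j = 0"
    by blast
  then show "\<exists>n. \<forall>i j. i \<ge> n \<or> j \<ge> n \<longrightarrow> f i j + g i j = 0"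
    by (intro exI[of _ "max m n"]) auto
qed
lift_definition uminus_fmat :: "fmat \<Rightarrow> fmat" is "\<lambda>f i j. - f i j" by auto
lift_definition minus_fmat :: "fmat \<Rightarrow> fmat \<Rightarrow> fmat" is "\<lambda>f g i j. f i j - g i j"
proof -
  fix f g :: "nat \<Rightarrow> nat \<Rightarrow> complex"
  assume "\<exists>n. \<forall>i j. i \<ge> n \<or> j \<ge> n \<longrightarrow> f i j = 0" "\<exists>n. \<forall>i j. i \<ge> n \<or> j \<ge> n \<longrightarrow> g i j = 0"
  then obtain m n where "\<forall>i j. i \<ge> m \<or> j \<ge> m \<longrightarrow> f i j = 0" "\<forall>i j. i \<ge> n \<or> j \<ge> n \<longrightarrow> g i j = 0"
    by blast
  then show "\<exists>n. \<forall>i j. i \<ge> n \<or> j \<ge> n \<longrightarrow> f i j - g i j = 0"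
    by (intro exI[of _ "max m n"]) auto
qed

instance by standard (transfer; auto simp: fun_eq_iff)+

end

lemma entry_simps [simp]:
  "entry 0 i j = 0" "entry (A + B) i j = entry A i j + entry B i j"
  "entry (A - B) i j = entry A i j - entry B i j" "entry (- A) i j = - entry A i j"
  by (transfer; simp)+

lemma entry_sum [simp]: "entry (sum f S) i j = (\<Sum>x\<in>S. entry (f x) i j)"
  by (induction S rule: infinite_finite_induct) auto

lemma fmult_fun_expand:
  assumes "\<And>k. k \<ge> n \<Longrightarrow> f i k * g k j = 0"
  shows "fmult_fun f g i j = (\<Sum>k<n. f i k * g k j)"
  unfolding fmult_fun_def by (rule Sum_any.expand_superset) (use assms leI in \<open>auto\<close>)

instantiation fmat :: ring
begin

lift_definition times_fmat :: "fmat \<Rightarrow> fmat \<Rightarrow> fmat" is fmult_fun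
proof -
  fix f g :: "nat \<Rightarrow> nat \<Rightarrow> complex"
  assume "\<exists>n. \<forall>i j. i \<ge> n \<or> j \<ge> n \<longrightarrow> f i j = 0" "\<exists>n. \<forall>i j. i \<ge> n \<or> j \<ge> n \<longrightarrow> g i j = 0"
  then obtain m n where "\<forall>i j. i \<ge> m \<or> j \<ge> m \<longrightarrow> f i j = 0" "\<forall>i j. i \<ge> n \<or> j \<ge> n \<longrightarrow> g i j = 0"
    by blast
  then show "\<exists>n. \<forall>i j. i \<ge> n \<or> j \<ge> n \<longrightarrow> fmult_fun f g i j = 0"
    by (intro exI[of _ "max m n"]) (auto simp: fmult_fun_def)
qed

lemma entry_mult:
  assumes "\<And>k. k \<ge> n \<Longrightarrow> entry A i k = 0 \<or> entry B k j = 0"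
  shows "entry (A * B) i j = (\<Sum>k<n. entry A i k * entry B k j)"
  using assms by transfer (rule fmult_fun_expand, auto)

instance
proof
  fix A B C :: fmat
  obtain a b c where a: "\<And>i j. i \<ge> a \<or> j \<ge> a \<Longrightarrow> entry A i j = 0"
    and b: "\<And>i j. i \<ge> b \<or> j \<ge> b \<Longrightarrow> entry B i j = 0"
    and c: "\<And>i j. i \<ge> c \<or> j \<ge> c \<Longrightarrow> entry C i j = 0"
    using fmat_bound by metis
  define n where "n = max a (max b c)"
  have z: "entry A i j = 0 \<and> entry B i j = 0 \<and> entry C i j = 0" if "i \<ge> n \<or> j \<ge> n" for i j
    using that a b c by (auto simp: n_def)
  have AX: "entry (A * X) i j = (\<Sum>k<n. entry A i k * entry X k j)" for X i j
    by (rule entry_mult) (use z in auto)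
  have BX: "entry (B * X) i j = (\<Sum>k<n. entry B i k * entry X k j)" for X i j
    by (rule entry_mult) (use z in auto)
  have XC: "entry (X * C) i j = (\<Sum>k<n. entry X i k * entry C k j)" for X i j
    by (rule entry_mult) (use z in auto)
  show "A * B * C = A * (B * C)"
    by (rule fmat_eqI)
      (simp add: AX BX XC sum_distrib_left sum_distrib_right mult.assoc, rule sum.swap)
  show "(A + B) * C = A * C + B * C"
    by (rule fmat_eqI) (simp add: XC sum.distrib distrib_right)
  show "A * (B + C) = A * B + A * C"
    by (rule fmat_eqI) (simp add: AX sum.distrib distrib_left)
qed

end

lift_definition scaleC :: "complex \<Rightarrow> fmat \<Rightarrow> fmat" (infixr "*\<^sub>C" 75) is "\<lambda>c f i j. c * f i j"
  by auto

lemma entry_scaleC [simp]: "entry (c *\<^sub>C A) i j = c * entry A i j"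
  by transfer simp

interpretation fm: vector_space scaleC
  by standard (rule fmat_eqI, simp add: algebra_simps)+

lemma mult_scaleC_left [simp]: "(c *\<^sub>C A) * B = c *\<^sub>C (A * B)"
proof (rule fmat_eqI)
  fix i j
  obtain n where n: "\<And>i j. i \<ge> n \<or> j \<ge> n \<Longrightarrow> entry A i j = 0" using fmat_bound by metis
  show "entry ((c *\<^sub>C A) * B) i j = entry (c *\<^sub>C (A * B)) i j"
    using n by (simp add: entry_mult[of n] sum_distrib_left mult.assoc)
qed

lemma mult_scaleC_right [simp]: "A * (c *\<^sub>C B) = c *\<^sub>C (A * B)"
proof (rule fmat_eqI)
  fix i j
  obtain n where n: "\<And>i j. i \<ge> n \<or> j \<ge> n \<Longrightarrow> entry A i j = 0" using fmat_bound by metis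
  show "entry (A * (c *\<^sub>C B)) i j = entry (c *\<^sub>C (A * B)) i j"
    using n by (simp add: entry_mult[of n] sum_distrib_left ac_simps)
qed

definition Mat :: "nat \<Rightarrow> nat \<Rightarrow> fmat set" where
  "Mat m n = {A. \<forall>i j. m \<le> i \<or> n \<le> j \<longrightarrow> entry A i j = 0}"

lift_definition mk :: "nat \<Rightarrow> nat \<Rightarrow> (nat \<Rightarrow> nat \<Rightarrow> complex) \<Rightarrow> fmat" is
  "\<lambda>m n f i j. if i < m \<and> j < n then f i j else 0"
proof -
  fix m n :: nat and f :: "nat \<Rightarrow> nat \<Rightarrow> complex"
  show "\<exists>N. \<forall>i j. i \<ge> N \<or> j \<ge> N \<longrightarrow> (if i < m \<and> j < n then f i j else 0) = 0"
    by (intro exI[of _ "max m n"]) auto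
qed

definition idm :: "nat \<Rightarrow> fmat" where "idm n = mk n n (\<lambda>i j. if i = j then 1 else 0)"

definition eunit :: "nat \<Rightarrow> nat \<Rightarrow> fmat" where
  "eunit i j = mk (Suc i) (Suc j) (\<lambda>a b. if a = i \<and> b = j then 1 else 0)"

definition tr :: "nat \<Rightarrow> fmat \<Rightarrow> complex" where "tr n A = (\<Sum>i<n. entry A i i)"

lemma entry_mk [simp]: "entry (mk m n f) i j = (if i < m \<and> j < n then f i j else 0)"
  by transfer simp

lemma entry_idm [simp]: "entry (idm n) i j = (if i = j \<and> i < n then 1 else 0)"
  by (auto simp: idm_def)

lemma entry_eunit [simp]: "entry (eunit i j) a b = (if a = i \<and> b = j then 1 else 0)"
  by (auto simp: eunit_def)

lemma mk_Mat [simp, intro]: "mk m n f \<in> Mat m n" by (auto simp: Mat_def)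
lemma idm_Mat [simp, intro]: "idm n \<in> Mat n n" by (auto simp: Mat_def)
lemma eunit_Mat [intro]: "i < m \<Longrightarrow> j < n \<Longrightarrow> eunit i j \<in> Mat m n" by (auto simp: Mat_def)

lemma Mat_entry: "A \<in> Mat m n \<Longrightarrow> m \<le> i \<or> n \<le> j \<Longrightarrow> entry A i j = 0"
  by (auto simp: Mat_def)

lemma Mat_eqI:
  assumes "A \<in> Mat m n" "B \<in> Mat m n" "\<And>i j. i < m \<Longrightarrow> j < n \<Longrightarrow> entry A i j = entry B i j"
  shows "A = B"
  by (rule fmat_eqI) (metis Mat_entry assms not_le)

lemma entry_mult_Mat:
  "A \<in> Mat m n \<Longrightarrow> entry (A * B) i j = (\<Sum>k<n. entry A i k * entry B k j)"
  by (rule entry_mult) (auto simp: Mat_def)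

lemma entry_mult_Mat2:
  "B \<in> Mat n l \<Longrightarrow> entry (A * B) i j = (\<Sum>k<n. entry A i k * entry B k j)"
  by (rule entry_mult) (auto simp: Mat_def)

lemma Mat_closed [simp, intro]:
  "0 \<in> Mat m n" "A \<in> Mat m n \<Longrightarrow> B \<in> Mat m n \<Longrightarrow> A + B \<in> Mat m n"
  "A \<in> Mat m n \<Longrightarrow> B \<in> Mat m n \<Longrightarrow> A - B \<in> Mat m n" "A \<in> Mat m n \<Longrightarrow> - A \<in> Mat m n"
  "A \<in> Mat m n \<Longrightarrow> c *\<^sub>C A \<in> Mat m n"
  by (auto simp: Mat_def)

lemma Mat_sum [simp, intro]: "(\<And>x. x \<in> S \<Longrightarrow> f x \<in> Mat m n) \<Longrightarrow> sum f S \<in> Mat m n"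
  by (auto simp: Mat_def intro!: sum.neutral)

lemma Mat_mult [intro]: "A \<in> Mat m n \<Longrightarrow> B \<in> Mat n l \<Longrightarrow> A * B \<in> Mat m l"
  by (auto simp: Mat_def entry_mult[of n])

lemma subspace_Mat: "fm.subspace (Mat m n)"
  by (auto simp: fm.subspace_def)

lemma idm_mult_entry: "entry (idm m * A) i j = (if i < m then entry A i j else 0)"
  by (simp add: entry_mult_Mat[OF idm_Mat] if_distrib[of "\<lambda>x. x * _"] sum.delta cong: if_cong)

lemma idm_left [simp]: "A \<in> Mat m n \<Longrightarrow> idm m * A = A"
  by (rule fmat_eqI) (simp add: idm_mult_entry Mat_entry)

lemma idm_right [simp]: "A \<in> Mat m n \<Longrightarrow> A * idm n = A"
  by (rule fmat_eqI) (auto simp: entry_mult_Mat2[OF idm_Mat] if_distrib[of "\<lambda>x. _ * x"] sum.delta' Mat_entry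
      cong: if_cong)

lemma idm_square [simp]: "A \<in> Mat n n \<Longrightarrow> idm n * A = A" "A \<in> Mat n n \<Longrightarrow> A * idm n = A"
  by simp_all

lemma idm_idm [simp]: "idm n * idm n = idm n" by (rule idm_left[OF idm_Mat])

lemma tr_simps: "tr n (A + B) = tr n A + tr n B" "tr n (c *\<^sub>C A) = c * tr n A"
  "tr n (sum f S) = (\<Sum>x\<in>S. tr n (f x))" "tr n 0 = 0"
  by (auto simp: tr_def sum.distrib sum_distrib_left intro: sum.swap)

lemma tr_idm [simp]: "tr n (idm n) = of_nat n"
  by (simp add: tr_def)

lemma tr_comm:
  assumes "A \<in> Mat m n" "B \<in> Mat n m" shows "tr m (A * B) = tr n (B * A)"
  unfolding tr_def entry_mult_Mat[OF assms(1)] entry_mult_Mat[OF assms(2)]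
  by (subst sum.swap) (simp add: mult.commute)

text \<open>Sandwiched matrix units pick out products of two entries. Summed over a group this
  turns statements about averages into orthogonality relations.\<close>

lemma eunit_sandwich:
  assumes "A \<in> Mat m n" "B \<in> Mat n l" "b < n" "c < n"
  shows "entry (A * eunit b c * B) a e = entry A a b * entry B c e"
proof -
  have "eunit b c \<in> Mat n n" using assms by (simp add: eunit_Mat)
  then have *: "A * eunit b c \<in> Mat m n" using assms by auto
  have "entry (A * eunit b c) a k = (if k = c then entry A a b else 0)" for k
    using assms by (auto simp: entry_mult_Mat[of _ m n] if_distrib[of "\<lambda>x. _ * x"] sum.delta' cong: if_cong)
  then show ?thesis
    using assms by (simp add: entry_mult_Mat[OF *] if_distrib[of "\<lambda>x. x * _"] sum.delta' sum.delta cong: if_cong)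
qed

subsection \<open>Transfer to matrices with a carrier\<close>

definition to_mat :: "nat \<Rightarrow> nat \<Rightarrow> fmat \<Rightarrow> complex mat" where
  "to_mat m n A = mat m n (\<lambda>(i, j). entry A i j)"

definition of_mat :: "complex mat \<Rightarrow> fmat" where
  "of_mat M = mk (dim_row M) (dim_col M) (\<lambda>i j. M $$ (i, j))"

definition to_vec :: "nat \<Rightarrow> fmat \<Rightarrow> complex vec" where
  "to_vec n A = vec n (\<lambda>i. entry A i 0)"

definition of_vec :: "complex vec \<Rightarrow> fmat" where
  "of_vec v = mk (dim_vec v) 1 (\<lambda>i j. v $ i)"

lemma to_mat_carrier [simp, intro]: "to_mat m n A \<in> carrier_mat m n"
  by (simp add: to_mat_def)

lemma dim_to_mat [simp]: "dim_row (to_mat m n A) = m" "dim_col (to_mat m n A) = n"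
  by (simp_all add: to_mat_def)

lemma to_vec_carrier [simp, intro]: "to_vec n A \<in> carrier_vec n"
  by (simp add: to_vec_def)

lemma dim_to_vec [simp]: "dim_vec (to_vec n A) = n"
  by (simp add: to_vec_def)

lemma of_vec_Mat [simp, intro]: "v \<in> carrier_vec n \<Longrightarrow> of_vec v \<in> Mat n 1"
  by (auto simp: of_vec_def)

lemma of_mat_Mat [simp, intro]: "M \<in> carrier_mat m n \<Longrightarrow> of_mat M \<in> Mat m n"
  by (auto simp: of_mat_def)

lemma to_mat_of_mat [simp]: "M \<in> carrier_mat m n \<Longrightarrow> to_mat m n (of_mat M) = M"
  by (auto simp: to_mat_def of_mat_def)

lemma of_mat_to_mat [simp]: "A \<in> Mat m n \<Longrightarrow> of_mat (to_mat m n A) = A"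
  by (rule fmat_eqI) (auto simp: to_mat_def of_mat_def Mat_entry)

lemma to_vec_of_vec [simp]: "v \<in> carrier_vec n \<Longrightarrow> to_vec n (of_vec v) = v"
  by (auto simp: to_vec_def of_vec_def)

lemma of_vec_to_vec [simp]: "A \<in> Mat n 1 \<Longrightarrow> of_vec (to_vec n A) = A"
  by (rule fmat_eqI) (auto simp: to_vec_def of_vec_def Mat_entry)

lemma to_mat_mult:
  assumes "A \<in> Mat m n" "B \<in> Mat n l" shows "to_mat m l (A * B) = to_mat m n A * to_mat n l B"
  by (rule eq_matI) (auto simp: to_mat_def scalar_prod_def entry_mult_Mat[OF assms(1)] atLeast0LessThan)

lemma to_mat_idm [simp]: "to_mat n n (idm n) = 1\<^sub>m n"
  by (rule eq_matI) (auto simp: to_mat_def)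

lemma to_mat_scaleC: "to_mat m n (c *\<^sub>C A) = c \<cdot>\<^sub>m to_mat m n A"
  by (rule eq_matI) (auto simp: to_mat_def)

lemma to_mat_inj: "A \<in> Mat m n \<Longrightarrow> B \<in> Mat m n \<Longrightarrow> to_mat m n A = to_mat m n B \<Longrightarrow> A = B"
  by (metis of_mat_to_mat)

lemma to_vec_mult:
  assumes "A \<in> Mat m n" "B \<in> Mat n 1" shows "to_vec m (A * B) = to_mat m n A *\<^sub>v to_vec n B"
  by (rule eq_vecI)
    (auto simp: to_mat_def to_vec_def scalar_prod_def entry_mult_Mat[OF assms(1)] atLeast0LessThan)

lemma to_vec_simps:
  "to_vec n (A + B) = to_vec n A + to_vec n B" "to_vec n (c *\<^sub>C A) = c \<cdot>\<^sub>v to_vec n A"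
  "to_vec n 0 = 0\<^sub>v n"
  by (auto simp: to_vec_def)

lemma to_vec_inj: "A \<in> Mat n 1 \<Longrightarrow> B \<in> Mat n 1 \<Longrightarrow> to_vec n A = to_vec n B \<Longrightarrow> A = B"
  by (metis of_vec_to_vec)

section \<open>Subspaces and invertible matrices\<close>

text \<open>The columns of such a \<open>B\<close> are a basis of a subspace, and the equation \<open>F * B = B * X\<close>
  says that the subspace is invariant under \<open>F\<close> and that \<open>X\<close> is the restriction of \<open>F\<close> to
  it.\<close>

definition inj_mat :: "nat \<Rightarrow> nat \<Rightarrow> fmat \<Rightarrow> bool" where
  "inj_mat d k B \<longleftrightarrow> B \<in> Mat d k \<and> (\<forall>v\<in>Mat k 1. B * v = 0 \<longrightarrow> v = 0)"

lemma inj_mat_cancel0: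
  assumes B: "inj_mat d k B" and M: "M \<in> Mat k l" and 0: "B * M = 0"
  shows "M = 0"
proof (rule fmat_eqI)
  fix i j
  show "entry M i j = entry 0 i j"
  proof (cases "j < l")
    case True
    then have u: "eunit j 0 \<in> Mat l 1" by (simp add: eunit_Mat)
    then have "M * eunit j 0 \<in> Mat k 1" using M by auto
    moreover have "B * (M * eunit j 0) = 0" by (simp add: mult.assoc[symmetric] 0)
    ultimately have "M * eunit j 0 = 0" using B by (auto simp: inj_mat_def)
    then have "entry (M * eunit j 0) i 0 = 0" by simp
    then show ?thesis using True
      by (simp add: entry_mult_Mat[OF M] if_distrib[of "\<lambda>x. _ * x"] sum.delta' cong: if_cong)
  qed (use M in \<open>auto simp: Mat_entry\<close>)
qed

lemma inj_mat_cancel: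
  assumes "inj_mat d k B" and "M \<in> Mat k l" "N \<in> Mat k l" and "B * M = B * N"
  shows "M = N"
proof -
  have "B * (M - N) = 0" using assms(4) by (simp add: right_diff_distrib)
  then show ?thesis using inj_mat_cancel0[OF assms(1), of "M - N" l] assms by auto
qed

lemma inj_mat_mult:
  assumes "inj_mat d k B" "inj_mat k l C" shows "inj_mat d l (B * C)"
proof -
  have "v = 0" if "v \<in> Mat l 1" "B * C * v = 0" for v
  proof -
    have "C * v = 0"
      using that assms inj_mat_cancel0[OF assms(1), of "C * v" 1]
      by (auto simp: inj_mat_def mult.assoc)
    then show ?thesis using that assms by (auto simp: inj_mat_def)
  qed
  then show ?thesis using assms by (auto simp: inj_mat_def)
qed

lemma inj_mat_idm: "inj_mat d d (idm d)"
  by (auto simp: inj_mat_def)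

lemma mult_column_expand:
  assumes "v \<in> Mat k 1" "\<And>j. j < k \<Longrightarrow> b j \<in> Mat d 1"
  shows "mk d k (\<lambda>i j. entry (b j) i 0) * v = (\<Sum>j<k. entry v j 0 *\<^sub>C b j)"
proof (rule Mat_eqI)
  show "mk d k (\<lambda>i j. entry (b j) i 0) * v \<in> Mat d 1" using assms by auto
  show "(\<Sum>j<k. entry v j 0 *\<^sub>C b j) \<in> Mat d 1" using assms by auto
  fix i j assume "i < d" "j < (1::nat)"
  then show "entry (mk d k (\<lambda>i j. entry (b j) i 0) * v) i j
      = entry (\<Sum>j<k. entry v j 0 *\<^sub>C b j) i j"
    by (simp add: entry_mult_Mat[OF mk_Mat] mult.commute)
qed

lemma Mat_1_expand: "v \<in> Mat d 1 \<Longrightarrow> v = (\<Sum>j<d. entry v j 0 *\<^sub>C eunit j 0)"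
proof (rule fmat_eqI)
  fix i j :: nat assume v: "v \<in> Mat d 1"
  have "(\<Sum>x<d. entry v x 0 * (if i = x \<and> j = 0 then 1 else 0))
      = (\<Sum>x<d. if i = x then (if j = 0 then entry v x 0 else 0) else 0)"
    by (intro sum.cong) auto
  also have "\<dots> = entry v i j"
    using v by (auto simp: Mat_entry sum.delta)
  finally show "entry v i j = entry (\<Sum>j<d. entry v j 0 *\<^sub>C eunit j 0) i j" by simp
qed

lemma independent_Mat_1:
  assumes "fm.independent S" "S \<subseteq> Mat d 1"
  shows "finite S \<and> card S \<le> d"
proof -
  define E where "E = (\<lambda>i. eunit i 0) ` {..<d}"
  have "Mat d 1 \<subseteq> fm.span E"
  proof
    fix v assume "v \<in> Mat d 1"
    then show "v \<in> fm.span E"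
      by (subst Mat_1_expand, assumption)
        (intro fm.span_sum fm.span_scale fm.span_base, auto simp: E_def)
  qed
  then have "finite S \<and> card S \<le> card E"
    using assms by (intro fm.independent_span_bound) (auto simp: E_def)
  moreover have "card E \<le> d" unfolding E_def by (metis card_image_le card_lessThan finite_lessThan)
  ultimately show ?thesis by auto
qed

lemma subspace_basis:
  assumes W: "fm.subspace W" "W \<subseteq> Mat d 1"
  obtains k B where "inj_mat d k B" "W = {B * v | v. v \<in> Mat k 1}" "k \<le> d"
    "W \<noteq> Mat d 1 \<longrightarrow> k < d"
proof -
  obtain S where S: "S \<subseteq> W" "fm.independent S" "W \<subseteq> fm.span S"
    using fm.maximal_independent_subset by blast
  have spanS: "fm.span S = W" using S W fm.span_minimal by blast
  have fin: "finite S" "card S \<le> d" using independent_Mat_1 S W by blast+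
  obtain b where b: "bij_betw b {..<card S} S"
    using ex_bij_betw_nat_finite[OF fin(1)] by (metis atLeast0LessThan)
  define k where "k = card S"
  have b: "bij_betw b {..<k} S" using b by (simp add: k_def)
  have bW: "b j \<in> W" if "j < k" for j
    using b that S by (auto simp: bij_betw_def)
  then have bM: "b j \<in> Mat d 1" if "j < k" for j
    using that W by auto
  define B where "B = mk d k (\<lambda>i j. entry (b j) i 0)"
  have Bv: "B * v = (\<Sum>j<k. entry v j 0 *\<^sub>C b j)" if "v \<in> Mat k 1" for v
    unfolding B_def by (rule mult_column_expand) (use that bM in auto)
  have inj: "inj_mat d k B"
    unfolding inj_mat_def
  proof safe
    show "B \<in> Mat d k" by (simp add: B_def)
    fix v assume v: "v \<in> Mat k 1" and 0: "B * v = 0"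
    let ?u = "\<lambda>x. entry v (the_inv_into {..<k} b x) 0"
    have "(\<Sum>x\<in>S. ?u x *\<^sub>C x) = (\<Sum>j<k. ?u (b j) *\<^sub>C b j)"
      by (rule sum.reindex_bij_betw[OF b, symmetric])
    also have "\<dots> = (\<Sum>j<k. entry v j 0 *\<^sub>C b j)"
      using b by (intro sum.cong) (auto simp: bij_betw_def the_inv_into_f_f)
    also have "\<dots> = 0" using Bv[OF v] 0 by simp
    finally have z: "(\<Sum>x\<in>S. ?u x *\<^sub>C x) = 0" .
    have "?u x = 0" if "x \<in> S" for x
      using fm.independentD[OF S(2) fin(1) subset_refl z that] .
    then have "entry v j 0 = 0" if "j < k" for j
      using b that by (force simp: bij_betw_def the_inv_into_f_f)
    then show "v = 0" using v by (intro Mat_eqI[of _ k 1]) auto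
  qed
  have WB: "W = {B * v | v. v \<in> Mat k 1}"
  proof safe
    fix w assume "w \<in> W"
    then have "w \<in> fm.span S" using S by auto
    then obtain u where u: "w = (\<Sum>x\<in>S. u x *\<^sub>C x)" using fm.span_finite[OF fin(1)] by auto
    define v where "v = mk k 1 (\<lambda>j _. u (b j))"
    have "B * v = (\<Sum>j<k. u (b j) *\<^sub>C b j)"
      by (subst Bv) (auto simp: v_def)
    also have "\<dots> = w" unfolding u by (rule sum.reindex_bij_betw[OF b])
    finally show "\<exists>v. w = B * v \<and> v \<in> Mat k 1" by (auto simp: v_def)
  next
    fix v assume "v \<in> Mat k 1"
    then show "B * v \<in> W"
      using W bW by (subst Bv) (auto intro!: fm.subspace_sum fm.subspace_scale)
  qed
  have "k < d" if ne: "W \<noteq> Mat d 1"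
  proof -
    obtain w where w: "w \<in> Mat d 1" "w \<notin> W" using ne W(2) by blast
    then have "fm.independent (insert w S)" "w \<notin> S"
      using S spanS by (auto simp: fm.independent_insert)
    moreover have "insert w S \<subseteq> Mat d 1" using w S W by auto
    ultimately have "card (insert w S) \<le> d" using independent_Mat_1 by blast
    then show ?thesis using \<open>w \<notin> S\<close> fin by (simp add: k_def)
  qed
  then show ?thesis using that[OF inj WB] fin by (simp add: k_def)
qed

subsection \<open>Invertible matrices\<close>

definition GL :: "nat \<Rightarrow> fmat set" where
  "GL d = {A \<in> Mat d d. \<exists>B\<in>Mat d d. A * B = idm d \<and> B * A = idm d}"

definition minv :: "nat \<Rightarrow> fmat \<Rightarrow> fmat" where
  "minv d A = (SOME B. B \<in> Mat d d \<and> A * B = idm d \<and> B * A = idm d)"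

lemma GL_Mat: "A \<in> GL d \<Longrightarrow> A \<in> Mat d d" by (simp add: GL_def)

lemma minv:
  assumes "A \<in> GL d"
  shows "minv d A \<in> Mat d d" "A * minv d A = idm d" "minv d A * A = idm d"
proof -
  have "\<exists>B. B \<in> Mat d d \<and> A * B = idm d \<and> B * A = idm d" using assms by (auto simp: GL_def)
  from someI_ex[OF this] show "minv d A \<in> Mat d d" "A * minv d A = idm d" "minv d A * A = idm d"
    by (auto simp: minv_def)
qed

lemma minv_cancel:
  assumes "A \<in> GL d"
  shows "B \<in> Mat d k \<Longrightarrow> A * (minv d A * B) = B" "B \<in> Mat d k \<Longrightarrow> minv d A * (A * B) = B"
    "B \<in> Mat k d \<Longrightarrow> B * A * minv d A = B" "B \<in> Mat k d \<Longrightarrow> B * minv d A * A = B"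
proof -
  note m = minv[OF assms]
  show "B \<in> Mat d k \<Longrightarrow> A * (minv d A * B) = B" "B \<in> Mat d k \<Longrightarrow> minv d A * (A * B) = B"
    by (simp_all add: mult.assoc[symmetric] m)
  show "B \<in> Mat k d \<Longrightarrow> B * A * minv d A = B" "B \<in> Mat k d \<Longrightarrow> B * minv d A * A = B"
    by (simp_all add: mult.assoc m)
qed

lemma minv_unique:
  assumes "A \<in> GL d" "B \<in> Mat d d" "A * B = idm d \<or> B * A = idm d"
  shows "minv d A = B"
  using assms(3)
proof
  assume "A * B = idm d"
  then have "minv d A * (A * B) = minv d A" using minv[OF assms(1)] by simp
  then show ?thesis using minv_cancel(2)[OF assms(1,2)] by simp
next
  assume "B * A = idm d"
  then have "B * A * minv d A = minv d A" using minv[OF assms(1)] by simp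
  then show ?thesis using minv_cancel(3)[OF assms(1,2)] by simp
qed

lemma GL_idm [simp, intro]: "idm d \<in> GL d" by (auto simp: GL_def intro!: bexI[of _ "idm d"])

lemma minv_idm [simp]: "minv d (idm d) = idm d" by (rule minv_unique) auto

lemma GL_minv [intro]:
  assumes "A \<in> GL d" shows "minv d A \<in> GL d"
  unfolding GL_def using minv[OF assms] GL_Mat[OF assms]
  by (intro CollectI conjI bexI[of _ A]) auto

lemma GL_mult [intro]:
  assumes "A \<in> GL d" "B \<in> GL d" shows "A * B \<in> GL d"
proof -
  have "A * B * (minv d B * minv d A) = idm d" "(minv d B * minv d A) * (A * B) = idm d"
    using minv_cancel(1)[OF assms(2) minv(1)[OF assms(1)]] minv_cancel(2)[OF assms(1) GL_Mat[OF assms(2)]]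
      minv[OF assms(1)] minv[OF assms(2)] by (simp_all add: mult.assoc)
  moreover have "A * B \<in> Mat d d" "minv d B * minv d A \<in> Mat d d"
    using assms minv(1) GL_Mat by blast+
  ultimately show ?thesis unfolding GL_def by blast
qed

lemma minv_mult:
  assumes "A \<in> GL d" "B \<in> GL d" shows "minv d (A * B) = minv d B * minv d A"
proof (rule minv_unique)
  show "A * B \<in> GL d" using assms by auto
  show "A * B * (minv d B * minv d A) = idm d \<or> minv d B * minv d A * (A * B) = idm d"
    using minv_cancel(1)[OF assms(2) minv(1)[OF assms(1)]] minv[OF assms(1)] by (simp add: mult.assoc)
qed (use assms minv(1) in auto)

lemma GL_scaleC [intro]:
  assumes "A \<in> GL d" "c \<noteq> 0" shows "c *\<^sub>C A \<in> GL d"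
  unfolding GL_def using minv[OF assms(1)] GL_Mat[OF assms(1)] assms(2)
  by (intro CollectI conjI bexI[of _ "inverse c *\<^sub>C minv d A"]) auto

lemma minv_scaleC: "A \<in> GL d \<Longrightarrow> c \<noteq> 0 \<Longrightarrow> minv d (c *\<^sub>C A) = inverse c *\<^sub>C minv d A"
  by (rule minv_unique) (auto simp: minv GL_scaleC)

lemma left_inverse_GL:
  assumes "A \<in> Mat d d" "B \<in> Mat d d" "B * A = idm d" shows "A \<in> GL d"
proof -
  have "to_mat d d B * to_mat d d A = 1\<^sub>m d" using assms to_mat_mult[of B d d A d] by simp
  then have "to_mat d d A * to_mat d d B = 1\<^sub>m d" by (rule mat_mult_left_right_inverse[rotated 2]) auto
  then have "A * B = idm d"
    using assms by (intro to_mat_inj[of _ d d]) (auto simp: to_mat_mult[of A d d B d])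
  then show ?thesis using assms unfolding GL_def by blast
qed

lemma inj_mat_GL: "inj_mat d d A \<longleftrightarrow> A \<in> GL d"
proof
  assume A: "inj_mat d d A"
  then have AM: "A \<in> Mat d d" by (simp add: inj_mat_def)
  have "det (to_mat d d A) \<noteq> 0"
  proof
    assume "det (to_mat d d A) = 0"
    then obtain v where v: "v \<in> carrier_vec d" "v \<noteq> 0\<^sub>v d" "to_mat d d A *\<^sub>v v = 0\<^sub>v d"
      using det_0_iff_vec_prod_zero[of "to_mat d d A" d] by auto
    have "to_vec d (A * of_vec v) = 0\<^sub>v d" using v AM by (subst to_vec_mult) auto
    then have "A * of_vec v = 0"
      using AM v by (intro to_vec_inj[of _ d]) (auto simp: to_vec_simps)
    then have "of_vec v = 0" using A v by (auto simp: inj_mat_def)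
    then have "v = to_vec d 0" using v by (metis to_vec_of_vec)
    then show False using v by (simp add: to_vec_simps)
  qed
  then have "to_mat d d A \<in> Units (ring_mat TYPE(complex) d undefined)"
    by (intro det_non_zero_imp_unit) auto
  then obtain M where M: "M \<in> carrier_mat d d" "M * to_mat d d A = 1\<^sub>m d"
    unfolding Units_def ring_mat_def by auto
  then have "of_mat M * A = idm d"
    using M AM by (intro to_mat_inj[of _ d d]) (auto simp: to_mat_mult[of _ d d _ d])
  then show "A \<in> GL d" by (intro left_inverse_GL[OF AM of_mat_Mat[OF M(1)]])
next
  assume A: "A \<in> GL d"
  show "inj_mat d d A"
    unfolding inj_mat_def
  proof safe
    fix v assume v: "v \<in> Mat d 1" "A * v = 0"
    then have "v = minv d A * 0" using minv_cancel(2)[OF A v(1)] by simp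
    then show "v = 0" by simp
  qed (rule GL_Mat[OF A])
qed

lemma eigenvector_exists:
  assumes "M \<in> Mat k k" "0 < k"
  obtains \<mu> v where "v \<in> Mat k 1" "v \<noteq> 0" "M * v = \<mu> *\<^sub>C v"
proof -
  obtain \<mu> where "eigenvalue (to_mat k k M) \<mu>"
    using spectrum_non_empty[OF to_mat_carrier, of k M] assms(2) unfolding spectrum_def by blast
  then obtain v where v: "v \<in> carrier_vec k" "v \<noteq> 0\<^sub>v k" "to_mat k k M *\<^sub>v v = \<mu> \<cdot>\<^sub>v v"
    unfolding eigenvalue_def eigenvector_def by auto
  have "to_vec k (M * of_vec v) = to_vec k (\<mu> *\<^sub>C of_vec v)"
    using v assms by (subst to_vec_mult) (auto simp: to_vec_simps)
  then have "M * of_vec v = \<mu> *\<^sub>C of_vec v" using v assms by (intro to_vec_inj) auto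
  moreover have "of_vec v \<noteq> 0" using v by (metis to_vec_of_vec to_vec_simps(3))
  ultimately show ?thesis using v(1) by (intro that[of "of_vec v" \<mu>]) auto
qed

section \<open>Projective representations\<close>

text \<open>The order of the factors on the left is that of right modules: acting by \<open>g\<close> and then
  by \<open>h\<close> is acting by \<open>\<alpha> (g, h)\<close> times the product \<open>g h\<close>.\<close>

definition proj_rep ::
  "('a, 'b) monoid_scheme \<Rightarrow> ('a \<times> 'a \<Rightarrow> complex) \<Rightarrow> nat \<Rightarrow> ('a \<Rightarrow> fmat) \<Rightarrow> bool" where
  "proj_rep G \<alpha> d F \<longleftrightarrow> (\<forall>g\<in>carrier G. F g \<in> GL d) \<and>
    (\<forall>g\<in>carrier G. \<forall>h\<in>carrier G.
       \<alpha> (g, h) \<noteq> 0 \<and> F h * F g = \<alpha> (g, h) *\<^sub>C F (g \<otimes>\<^bsub>G\<^esub> h))"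

text \<open>For a representation of a finite group this is irreducibility (Schur's lemma and its
  converse). It is the convenient form because it depends only on the span of the matrices
  \<open>F i\<close>.\<close>

definition scalar_commutant :: "nat \<Rightarrow> 'i set \<Rightarrow> ('i \<Rightarrow> fmat) \<Rightarrow> bool" where
  "scalar_commutant d I F \<longleftrightarrow>
    (\<forall>M\<in>Mat d d. (\<forall>i\<in>I. M * F i = F i * M) \<longrightarrow> (\<exists>c. M = c *\<^sub>C idm d))"

lemma entry_mult_eunit: "entry (A * eunit j l) i q = (if q = l then entry A i j else 0)"
proof -
  have "eunit j l \<in> Mat (Suc j) (Suc l)" by (simp add: eunit_Mat)
  then show ?thesis
    by (simp add: entry_mult_Mat2 if_distrib[of "\<lambda>x. _ * x"] sum.delta' cong: if_cong)
qed

lemma Mat_ext: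
  assumes "A \<in> Mat m n" "B \<in> Mat m n" "\<And>v. v \<in> Mat n 1 \<Longrightarrow> A * v = B * v"
  shows "A = B"
proof (rule Mat_eqI[OF assms(1,2)])
  fix i j assume "i < m" "j < n"
  then have "A * eunit j 0 = B * eunit j 0" using assms(3)[OF eunit_Mat[of j n 0 1]] by simp
  then have "entry (A * eunit j 0) i 0 = entry (B * eunit j 0) i 0" by simp
  then show "entry A i j = entry B i j" by (simp add: entry_mult_eunit)
qed

text \<open>If the image of \<open>N\<close> lies in the column space of \<open>B\<close>, then the coordinates of the
  columns of \<open>N\<close> form the matrix \<open>Y\<close>. With \<open>N = F * B\<close> this restricts an operator to an
  invariant subspace.\<close>

lemma factor_through:
  assumes "N \<in> Mat d l" "B \<in> Mat d k" "\<And>u. u \<in> Mat l 1 \<Longrightarrow> \<exists>v\<in>Mat k 1. N * u = B * v"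
  obtains Y where "Y \<in> Mat k l" "N = B * Y"
proof -
  have "\<exists>v. v \<in> Mat k 1 \<and> N * eunit j 0 = B * v" if "j < l" for j
    using assms(3)[OF eunit_Mat[of j l 0 1]] that by auto
  then have "\<forall>j. \<exists>v. j < l \<longrightarrow> v \<in> Mat k 1 \<and> N * eunit j 0 = B * v" by blast
  from choice[OF this] obtain y where
    y: "\<And>j. j < l \<Longrightarrow> y j \<in> Mat k 1" "\<And>j. j < l \<Longrightarrow> N * eunit j 0 = B * y j"
    by blast
  define Y where "Y = mk k l (\<lambda>i j. entry (y j) i 0)"
  have "N = B * Y"
  proof (rule Mat_eqI[of _ d l])
    fix i j assume "i < d" "j < l"
    have "entry N i j = entry (N * eunit j 0) i 0" by (simp add: entry_mult_eunit)
    also have "\<dots> = entry (B * Y) i j"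
      using y[OF \<open>j < l\<close>] \<open>j < l\<close> assms(2) by (simp add: entry_mult_Mat[of _ d k] Y_def)
    finally show "entry N i j = entry (B * Y) i j" .
  qed (use assms Y_def in auto)
  then show ?thesis using that[of Y] by (simp add: Y_def)
qed

lemma eigenspace_subspace:
  assumes "M \<in> Mat k k" shows "fm.subspace {w \<in> Mat k 1. M * w = \<mu> *\<^sub>C w}"
  by (auto simp: fm.subspace_def algebra_simps fm.scale_right_distrib)

text \<open>Take an invariant subspace of least positive dimension. An eigenspace of a matrix
  commuting with the action on it is again invariant, so by minimality it is everything.\<close>

lemma minimal_invariant_subspace:
  assumes d: "0 < d" and F: "\<And>i. i \<in> I \<Longrightarrow> F i \<in> Mat d d"
  obtains k B X where "0 < k" "inj_mat d k B" "\<forall>i\<in>I. X i \<in> Mat k k"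
    "\<forall>i\<in>I. F i * B = B * X i" "scalar_commutant k I X"
proof -
  define P where "P k \<longleftrightarrow> 0 < k \<and>
    (\<exists>B X. inj_mat d k B \<and> (\<forall>i\<in>I. X i \<in> Mat k k \<and> F i * B = B * X i))" for k
  have "P d" unfolding P_def
    using d F by (intro conjI exI[of _ "idm d"] exI[of _ F]) (auto simp: inj_mat_idm)
  define k where "k = (LEAST k. P k)"
  have "P k" unfolding k_def by (rule LeastI) fact
  then obtain B X where k: "0 < k" and B: "inj_mat d k B"
    and X: "\<And>i. i \<in> I \<Longrightarrow> X i \<in> Mat k k" and FB: "\<And>i. i \<in> I \<Longrightarrow> F i * B = B * X i"
    unfolding P_def by auto
  have "scalar_commutant k I X"
    unfolding scalar_commutant_def
  proof (intro ballI impI)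
    fix M assume M: "M \<in> Mat k k" and comm: "\<forall>i\<in>I. M * X i = X i * M"
    obtain \<mu> v where v: "v \<in> Mat k 1" "v \<noteq> 0" "M * v = \<mu> *\<^sub>C v"
      using eigenvector_exists[OF M k] .
    define W where "W = {w \<in> Mat k 1. M * w = \<mu> *\<^sub>C w}"
    have "fm.subspace W" "W \<subseteq> Mat k 1" using eigenspace_subspace[OF M] by (auto simp: W_def)
    then obtain l C where C: "inj_mat k l C" "W = {C * u | u. u \<in> Mat l 1}"
      "l \<le> k" "W \<noteq> Mat k 1 \<longrightarrow> l < k"
      by (rule subspace_basis)
    have CM: "C \<in> Mat k l" using C by (simp add: inj_mat_def)
    have "W = Mat k 1"
    proof (rule ccontr)
      assume "W \<noteq> Mat k 1"
      then have "l < k" using C by simp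
      have "v \<in> W" using v by (simp add: W_def)
      then obtain u where u: "u \<in> Mat l 1" "v = C * u" using C(2) by auto
      have "0 < l"
      proof (rule ccontr)
        assume "\<not> 0 < l"
        then have "u = 0" using u(1) by (intro fmat_eqI) (auto simp: Mat_entry)
        then show False using v u by simp
      qed
      have "\<exists>Y\<in>Mat l l. X i * C = C * Y" if i: "i \<in> I" for i
      proof -
        have "\<exists>v\<in>Mat l 1. X i * C * u = C * v" if u: "u \<in> Mat l 1" for u
        proof -
          have Cu: "C * u \<in> W" using C(2) u by auto
          have "M * (X i * (C * u)) = X i * (M * (C * u))"
            using comm i by (metis mult.assoc)
          also have "\<dots> = \<mu> *\<^sub>C (X i * (C * u))" using Cu by (simp add: W_def)
          finally have "X i * (C * u) \<in> W"
            using X[OF i] Cu by (auto simp: W_def)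
          then show ?thesis using C(2) by (auto simp: mult.assoc)
        qed
        then show ?thesis
          using factor_through[of "X i * C" k l C l] X[OF i] CM by blast
      qed
      then obtain Y where Y: "\<And>i. i \<in> I \<Longrightarrow> Y i \<in> Mat l l \<and> X i * C = C * Y i" by metis
      have "P l"
        unfolding P_def
      proof (intro conjI exI[of _ "B * C"] exI[of _ Y] ballI)
        fix i assume i: "i \<in> I"
        have "F i * (B * C) = B * (X i * C)" by (simp add: mult.assoc[symmetric] FB[OF i])
        then show "F i * (B * C) = B * C * Y i" using Y[OF i] by (simp add: mult.assoc)
      qed (use \<open>0 < l\<close> B C(1) Y in \<open>auto intro: inj_mat_mult\<close>)
      then have "k \<le> l" unfolding k_def by (rule Least_le)
      then show False using \<open>l < k\<close> by simp
    qed
    then have "M * v = (\<mu> *\<^sub>C idm k) * v" if "v \<in> Mat k 1" for v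
      using that W_def by auto
    then have "M = \<mu> *\<^sub>C idm k"
      using M by (intro Mat_ext[of M k k "\<mu> *\<^sub>C idm k"] Mat_closed idm_Mat)
    then show "\<exists>c. M = c *\<^sub>C idm k" by blast
  qed
  moreover have "\<forall>i\<in>I. X i \<in> Mat k k" "\<forall>i\<in>I. F i * B = B * X i" using X FB by auto
  ultimately show ?thesis using that[OF k B] by blast
qed

subsection \<open>Averaging over a finite group\<close>

lemma (in group) bij_betw_mult_left: "h \<in> carrier G \<Longrightarrow> bij_betw (\<lambda>g. h \<otimes> g) (carrier G) (carrier G)"
  by (rule bij_betwI[of _ _ _ "\<lambda>g. inv h \<otimes> g"]) (auto simp: m_assoc[symmetric])

lemma (in group) bij_betw_mult_right: "h \<in> carrier G \<Longrightarrow> bij_betw (\<lambda>g. g \<otimes> h) (carrier G) (carrier G)"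
  by (rule bij_betwI[of _ _ _ "\<lambda>g. g \<otimes> inv h"]) (auto simp: m_assoc)

lemma (in group) bij_betw_conj:
  assumes h: "h \<in> carrier G" shows "bij_betw (\<lambda>g. h \<otimes> g \<otimes> inv h) (carrier G) (carrier G)"
proof -
  have "inv h \<otimes> (h \<otimes> g \<otimes> inv h) \<otimes> h = g" "h \<otimes> (inv h \<otimes> g \<otimes> h) \<otimes> inv h = g"
    if "g \<in> carrier G" for g
    using h that by (metis inv_closed m_assoc m_closed l_inv l_one r_inv r_one)+
  then show ?thesis
    by (intro bij_betwI[of _ _ _ "\<lambda>g. inv h \<otimes> g \<otimes> h"]) (use h in auto)
qed

lemma proj_repD:
  assumes "proj_rep G \<alpha> d F" "g \<in> carrier G"
  shows "F g \<in> GL d" "F g \<in> Mat d d"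
    "h \<in> carrier G \<Longrightarrow> \<alpha> (g, h) \<noteq> 0" "h \<in> carrier G \<Longrightarrow> F h * F g = \<alpha> (g, h) *\<^sub>C F (g \<otimes>\<^bsub>G\<^esub> h)"
  using assms GL_Mat by (auto simp: proj_rep_def)

lemma (in group) proj_rep_one:
  assumes F: "proj_rep G \<alpha> d F"
  shows "F \<one> = \<alpha> (\<one>, \<one>) *\<^sub>C idm d"
proof -
  note [simp] = proj_repD[OF F one_closed]
  have "F \<one> * F \<one> * minv d (F \<one>) = (\<alpha> (\<one>, \<one>) *\<^sub>C F \<one>) * minv d (F \<one>)"
    by simp
  then show ?thesis using minv_cancel(3)[OF proj_repD(1)[OF F one_closed], of "F \<one>" d]
      minv[OF proj_repD(1)[OF F one_closed]] by simp
qed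

lemma (in group) proj_rep_minv:
  assumes F: "proj_rep G \<alpha> d F" and g: "g \<in> carrier G"
  obtains c where "c \<noteq> 0" "minv d (F g) = c *\<^sub>C F (inv g)"
proof -
  let ?c = "\<alpha> (\<one>, \<one>) * \<alpha> (g, inv g)"
  have nz: "?c \<noteq> 0" using proj_repD(3)[OF F] g by simp
  have 1: "F (inv g) * F g = ?c *\<^sub>C idm d"
    using proj_repD(4)[OF F g, of "inv g"] g proj_rep_one[OF F] by (simp add: mult.commute)
  have "minv d (F g) = inverse ?c *\<^sub>C F (inv g)"
  proof (rule minv_unique)
    have "(inverse ?c *\<^sub>C F (inv g)) * F g = (inverse ?c * ?c) *\<^sub>C idm d" by (simp only: mult_scaleC_left 1 fm.scale_scale)
    then show "F g * inverse ?c *\<^sub>C F (inv g) = idm d \<or> (inverse ?c *\<^sub>C F (inv g)) * F g = idm d"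
      using nz by (metis fm.scale_one left_inverse)
  qed (use proj_repD(1,2)[OF F] g in auto)
  then show ?thesis using that nz by (metis inverse_nonzero_iff_nonzero)
qed

text \<open>The projection onto the commutant of \<open>F\<close>, multiplied by the order of \<open>G\<close>.\<close>

definition avg :: "('a, 'b) monoid_scheme \<Rightarrow> nat \<Rightarrow> ('a \<Rightarrow> fmat) \<Rightarrow> fmat \<Rightarrow> fmat" where
  "avg G d F M = (\<Sum>g\<in>carrier G. minv d (F g) * M * F g)"

lemma avg_Mat [intro]: "proj_rep G \<alpha> d F \<Longrightarrow> M \<in> Mat d d \<Longrightarrow> avg G d F M \<in> Mat d d"
  unfolding avg_def by (intro Mat_sum Mat_mult[of _ d d]) (auto simp: proj_repD minv)

text \<open>Translating the summation index by \<open>h\<close> conjugates each term with \<open>F h\<close>; the values of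
  the cocycle cancel between \<open>F\<close> and its inverse.\<close>

lemma avg_commutes:
  assumes "group G" and F: "proj_rep G \<alpha> d F" and M: "M \<in> Mat d d" and h: "h \<in> carrier G"
  shows "F h * avg G d F M = avg G d F M * F h"
proof -
  interpret group G by fact
  note Fh = proj_repD(1)[OF F h]
  let ?f = "\<lambda>g. minv d (F g) * M * F g"
  have step: "minv d (F h) * ?f g * F h = ?f (h \<otimes>\<^bsub>G\<^esub> g)" if g: "g \<in> carrier G" for g
  proof -
    note a = proj_repD(3,4)[OF F h g]
    note Fg = proj_repD(1)[OF F g] and Fhg = proj_repD(1)[OF F m_closed[OF h g]]
    have "minv d (F h) * minv d (F g) = inverse (\<alpha> (h, g)) *\<^sub>C minv d (F (h \<otimes>\<^bsub>G\<^esub> g))"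
      using minv_mult[OF Fg Fh] a minv_scaleC[OF Fhg] by simp
    then show ?thesis using a by (simp add: mult.assoc[symmetric]) (simp add: mult.assoc)
  qed
  have "minv d (F h) * avg G d F M * F h = (\<Sum>g\<in>carrier G. ?f (h \<otimes>\<^bsub>G\<^esub> g))"
    unfolding avg_def sum_distrib_left sum_distrib_right by (intro sum.cong step refl)
  also have "\<dots> = avg G d F M"
    unfolding avg_def by (rule sum.reindex_bij_betw[OF bij_betw_mult_left[OF h]])
  finally have "F h * (minv d (F h) * (avg G d F M * F h)) = F h * avg G d F M"
    by (simp add: mult.assoc)
  then show ?thesis
    using minv_cancel(1)[OF Fh Mat_mult[OF avg_Mat[OF F M] GL_Mat[OF Fh]]] by simp
qed

lemma avg_mult_commuting:
  assumes A: "\<And>g. g \<in> carrier G \<Longrightarrow> A * F g = F g * A"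
  shows "avg G d F (M * A) = avg G d F M * A"
  unfolding avg_def sum_distrib_right
  by (intro sum.cong refl) (use A in \<open>simp add: mult.assoc\<close>)

lemma avg_fixed:
  assumes F: "proj_rep G \<alpha> d F" and A: "A \<in> Mat d d" "\<And>g. g \<in> carrier G \<Longrightarrow> A * F g = F g * A"
  shows "avg G d F A = of_nat (card (carrier G)) *\<^sub>C A"
proof -
  have "minv d (F g) * A * F g = A" if g: "g \<in> carrier G" for g
    using minv_cancel(2)[OF proj_repD(1)[OF F g] A(1)] A(2)[OF g] by (simp add: mult.assoc)
  then have "avg G d F A = (\<Sum>g\<in>carrier G. A)" unfolding avg_def by (intro sum.cong) auto
  also have "\<dots> = of_nat (card (carrier G)) *\<^sub>C A"
    by (rule fmat_eqI) (simp)
  finally show ?thesis .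
qed

lemma tr_avg:
  assumes F: "proj_rep G \<alpha> d F" and M: "M \<in> Mat d d"
  shows "tr d (avg G d F M) = of_nat (card (carrier G)) * tr d M"
proof -
  have "tr d (minv d (F g) * M * F g) = tr d M" if g: "g \<in> carrier G" for g
  proof -
    note Fg = proj_repD(1)[OF F g]
    have "minv d (F g) * M \<in> Mat d d" using minv[OF Fg] M by auto
    then have "tr d (minv d (F g) * M * F g) = tr d (F g * (minv d (F g) * M))"
      using GL_Mat[OF Fg] by (intro tr_comm)
    then show ?thesis using minv_cancel(1)[OF Fg M] by simp
  qed
  then show ?thesis by (simp add: avg_def tr_simps)
qed

text \<open>The average is scalar by Schur's lemma, and its trace determines the scalar.\<close>

lemma avg_scalar:
  assumes G: "group G" and F: "proj_rep G \<alpha> d F" and "0 < d"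
    and sc: "scalar_commutant d (carrier G) F" and M: "M \<in> Mat d d"
  shows "avg G d F M = (of_nat (card (carrier G)) * tr d M / of_nat d) *\<^sub>C idm d"
proof -
  obtain c where c: "avg G d F M = c *\<^sub>C idm d"
    using sc avg_Mat[OF F M] avg_commutes[OF G F M] unfolding scalar_commutant_def by metis
  then have "c * of_nat d = of_nat (card (carrier G)) * tr d M"
    using tr_avg[OF F M] by (simp add: tr_simps)
  then have "c = of_nat (card (carrier G)) * tr d M / of_nat d" using \<open>0 < d\<close> by (simp add: field_simps)
  then show ?thesis using c by simp
qed

text \<open>These are the entries of the average of the matrix unit \<open>eunit b c\<close>.\<close>

lemma schur_orthogonality:
  assumes G: "group G" and F: "proj_rep G \<alpha> d F" and "0 < d"
    and sc: "scalar_commutant d (carrier G) F"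
    and "a < d" "b < d" "c < d" "e < d"
  shows "(\<Sum>g\<in>carrier G. entry (minv d (F g)) a b * entry (F g) c e)
    = (if a = e \<and> b = c then of_nat (card (carrier G)) / of_nat d else 0)"
proof -
  have u: "eunit b c \<in> Mat d d" using assms by (simp add: eunit_Mat)
  have "entry (avg G d F (eunit b c)) a e = (\<Sum>g\<in>carrier G. entry (minv d (F g)) a b * entry (F g) c e)"
    unfolding avg_def entry_sum
    by (intro sum.cong refl eunit_sandwich[of _ d d _ d])
      (use assms proj_repD[OF F] minv in auto)
  moreover have "tr d (eunit b c) = (if b = c then 1 else 0)"
    using assms by (auto simp: tr_def intro!: sum.neutral)
  ultimately show ?thesis
    using avg_scalar[OF G F \<open>0 < d\<close> sc u] assms by (auto simp: split: if_splits)
qed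

text \<open>The orthogonality relations give the coefficients that express an arbitrary matrix by
  the matrices of an irreducible representation.\<close>

lemma schur_expansion:
  assumes G: "group G" and F: "proj_rep G \<alpha> d F" and "0 < d"
    and sc: "scalar_commutant d (carrier G) F" and M: "M \<in> Mat d d"
  shows "(\<Sum>g\<in>carrier G. tr d (minv d (F g) * M) *\<^sub>C F g)
    = (of_nat (card (carrier G)) / of_nat d) *\<^sub>C M"
proof (rule Mat_eqI[of _ d d])
  fix c e assume ce: "c < d" "e < d"
  let ?q = "of_nat (card (carrier G)) / of_nat d :: complex"
  have "entry (\<Sum>g\<in>carrier G. tr d (minv d (F g) * M) *\<^sub>C F g) c e
      = (\<Sum>g\<in>carrier G. \<Sum>a<d. \<Sum>b<d. entry M b a * (entry (minv d (F g)) a b * entry (F g) c e))"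
    unfolding entry_sum entry_scaleC tr_def sum_distrib_right
    by (intro sum.cong refl)
      (simp add: entry_mult_Mat[OF minv(1)[OF proj_repD(1)[OF F]]] sum_distrib_right sum_distrib_left ac_simps)
  also have "\<dots> = (\<Sum>a<d. \<Sum>b<d. \<Sum>g\<in>carrier G. entry M b a * (entry (minv d (F g)) a b * entry (F g) c e))"
    by (subst sum.swap, intro sum.cong refl, subst sum.swap, intro sum.cong refl)
  also have "\<dots> = (\<Sum>a<d. \<Sum>b<d. entry M b a * (if a = e \<and> b = c then ?q else 0))"
    by (intro sum.cong refl, subst sum_distrib_left[symmetric], subst schur_orthogonality[OF assms(1-4)])
      (use ce in auto)
  also have "\<dots> = (\<Sum>a<d. if a = e then (\<Sum>b<d. if b = c then entry M b a * ?q else 0) else 0)"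
    by (intro sum.cong refl) (auto simp: sum.delta if_distrib[of "\<lambda>x. _ * x"] cong: if_cong)
  also have "\<dots> = ?q * entry M c e"
    using ce by (simp only: sum.delta finite_lessThan lessThan_iff if_True mult.commute)
  finally show "entry (\<Sum>g\<in>carrier G. tr d (minv d (F g) * M) *\<^sub>C F g) c e = entry (?q *\<^sub>C M) c e"
    by simp
qed (use M proj_repD[OF F] in auto)

section \<open>Full matrix algebras spanned by a group\<close>

text \<open>Such a system spans a copy of the algebra of \<open>k \<times> k\<close> matrices with unit \<open>idm d\<close>.\<close>

definition matrix_units :: "nat \<Rightarrow> nat \<Rightarrow> (nat \<Rightarrow> nat \<Rightarrow> fmat) \<Rightarrow> bool" where
  "matrix_units d k e \<longleftrightarrow> 0 < k \<and> (\<forall>i<k. \<forall>j<k. e i j \<in> Mat d d) \<and>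
    (\<forall>i<k. \<forall>j<k. \<forall>p<k. \<forall>q<k. e i j * e p q = (if j = p then e i q else 0)) \<and>
    (\<Sum>i<k. e i i) = idm d"

lemma matrix_unitsD:
  assumes "matrix_units d k e"
  shows "0 < k" "i < k \<Longrightarrow> j < k \<Longrightarrow> e i j \<in> Mat d d"
    "i < k \<Longrightarrow> j < k \<Longrightarrow> p < k \<Longrightarrow> q < k \<Longrightarrow> e i j * e p q = (if j = p then e i q else 0)"
    "(\<Sum>i<k. e i i) = idm d"
  using assms by (auto simp: matrix_units_def)

lemma matrix_units_nonzero:
  assumes e: "matrix_units d k e" and d: "0 < d" and ij: "i < k" "j < k"
  shows "e i j \<noteq> 0"
proof
  assume 0: "e i j = 0"
  note m = matrix_unitsD[OF e]
  have "e p p = 0" if "p < k" for p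
  proof -
    have "e p p = e p i * e i j * e j p" using m(3) that ij by simp
    then show ?thesis using 0 by simp
  qed
  then have "idm d = 0" using m(4) by simp
  then have "entry (idm d) 0 0 = 0" by simp
  then show False using d by simp
qed

lemma span_mult_closed:
  assumes "\<And>x y. x \<in> S \<Longrightarrow> y \<in> S \<Longrightarrow> x * y \<in> fm.span S"
    and "a \<in> fm.span S" "b \<in> fm.span S"
  shows "a * b \<in> fm.span S"
  using assms(2)
proof (induction rule: fm.span_induct_alt)
  case (step c x y)
  have "x * b \<in> fm.span S" using assms(3)
  proof (induction rule: fm.span_induct_alt)
    case (step c' x' y')
    then show ?case using assms(1)[OF \<open>x \<in> S\<close>]
      by (auto simp: distrib_left intro!: fm.span_add fm.span_scale)
  qed (auto intro: fm.span_zero)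
  then show ?case using step by (auto simp: distrib_right intro!: fm.span_add fm.span_scale)
qed (auto intro: fm.span_zero)

lemma proj_rep_span_mult:
  assumes F: "proj_rep G \<alpha> d F" and "group G"
    and "a \<in> fm.span (F ` carrier G)" "b \<in> fm.span (F ` carrier G)"
  shows "a * b \<in> fm.span (F ` carrier G)"
proof -
  interpret group G by fact
  show ?thesis
    by (rule span_mult_closed[OF _ assms(3,4)], elim imageE)
      (simp add: proj_repD(4)[OF F] fm.span_scale fm.span_base)
qed

lemma span_image_Mat:
  assumes "\<And>g. g \<in> I \<Longrightarrow> F g \<in> Mat d d"
  shows "fm.span (F ` I) \<subseteq> Mat d d"
  using assms by (intro fm.span_minimal subspace_Mat) auto

lemma proj_rep_idm_span:
  assumes F: "proj_rep G \<alpha> d F" and "group G"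
  shows "idm d \<in> fm.span (F ` carrier G)"
proof -
  interpret group G by fact
  have "idm d = inverse (\<alpha> (\<one>\<^bsub>G\<^esub>, \<one>\<^bsub>G\<^esub>)) *\<^sub>C F \<one>\<^bsub>G\<^esub>"
    using proj_rep_one[OF F] proj_repD(3)[OF F, of "\<one>\<^bsub>G\<^esub>" "\<one>\<^bsub>G\<^esub>"] by simp
  then show ?thesis by (auto intro: fm.span_scale fm.span_base)
qed

lemma span_image_finite:
  assumes "finite I" "a \<in> fm.span (F ` I)"
  obtains c where "a = (\<Sum>i\<in>I. c i *\<^sub>C F i)"
  using assms(2)
proof (induction arbitrary: thesis rule: fm.span_induct_alt)
  case base
  show ?case by (rule base[of "\<lambda>_. 0"]) simp
next
  case (step c x y)
  obtain i where i: "i \<in> I" "x = F i" using step by auto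
  obtain r where r: "y = (\<Sum>i\<in>I. r i *\<^sub>C F i)" using step by blast
  have "(\<Sum>j\<in>I. (r j + (if j = i then c else 0)) *\<^sub>C F j) = y + c *\<^sub>C x"
    using i assms(1) by (simp add: fm.scale_left_distrib sum.distrib r if_distrib[of "\<lambda>x. x *\<^sub>C _"]
        sum.delta cong: if_cong)
  then show ?case using step.prems[of "\<lambda>j. r j + (if j = i then c else 0)"] by (simp add: add.commute)
qed

text \<open>The cocycle identity and invertibility can be checked after multiplication by the
  injective \<open>B\<close>.\<close>

lemma sub_rep:
  assumes "group G" and F: "proj_rep G \<alpha> d F" and B: "inj_mat d k B"
    and X: "\<And>g. g \<in> carrier G \<Longrightarrow> X g \<in> Mat k k"
    and FB: "\<And>g. g \<in> carrier G \<Longrightarrow> F g * B = B * X g"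
  shows "proj_rep G \<alpha> k X"
proof -
  interpret group G by fact
  have BM: "B \<in> Mat d k" using B by (simp add: inj_mat_def)
  have mul: "X h * X g = \<alpha> (g, h) *\<^sub>C X (g \<otimes>\<^bsub>G\<^esub> h)" if g: "g \<in> carrier G" "h \<in> carrier G" for g h
  proof (rule inj_mat_cancel[OF B])
    have "B * (X h * X g) = F h * (B * X g)"
      using g by (simp only: mult.assoc[symmetric] FB)
    also have "\<dots> = F h * F g * B"
      using g by (simp only: mult.assoc FB)
    also have "\<dots> = B * (\<alpha> (g, h) *\<^sub>C X (g \<otimes>\<^bsub>G\<^esub> h))"
      using g by (simp add: proj_repD(4)[OF F] FB)
    finally show "B * (X h * X g) = B * (\<alpha> (g, h) *\<^sub>C X (g \<otimes>\<^bsub>G\<^esub> h))" .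
  qed (use X g in auto)
  have one: "X \<one>\<^bsub>G\<^esub> = \<alpha> (\<one>\<^bsub>G\<^esub>, \<one>\<^bsub>G\<^esub>) *\<^sub>C idm k"
  proof (rule inj_mat_cancel[OF B])
    show "B * X \<one>\<^bsub>G\<^esub> = B * (\<alpha> (\<one>\<^bsub>G\<^esub>, \<one>\<^bsub>G\<^esub>) *\<^sub>C idm k)"
      using BM by (simp add: FB[symmetric] proj_rep_one[OF F])
  qed (use X in auto)
  have GL: "X g \<in> GL k" if g: "g \<in> carrier G" for g
  proof -
    let ?c = "\<alpha> (g, inv\<^bsub>G\<^esub> g) * \<alpha> (\<one>\<^bsub>G\<^esub>, \<one>\<^bsub>G\<^esub>)"
    have nz: "?c \<noteq> 0" using g proj_repD(3)[OF F] by simp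
    have "(inverse ?c *\<^sub>C X (inv\<^bsub>G\<^esub> g)) * X g = (inverse ?c * ?c) *\<^sub>C idm k"
      using g mul[of g "inv\<^bsub>G\<^esub> g"] one by (simp only: mult_scaleC_left fm.scale_scale inv_closed r_inv mult.assoc)
    also have "\<dots> = idm k" using left_inverse[OF nz] by (simp only: fm.scale_one)
    finally show ?thesis using X g by (intro left_inverse_GL[OF X[OF g] Mat_closed(5)]) auto
  qed
  show ?thesis unfolding proj_rep_def using GL mul proj_repD(3)[OF F] by blast
qed

lemma (in group) conj_mult: "m \<in> carrier G \<Longrightarrow> n \<in> carrier G \<Longrightarrow> (m \<otimes> n \<otimes> inv m) \<otimes> m = m \<otimes> n"
  by (simp add: m_assoc)

lemma proj_rep_conj:
  assumes "group G" and F: "proj_rep G \<alpha> d F" and mn: "m \<in> carrier G" "n \<in> carrier G"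
  shows "F n * F m = (\<alpha> (m, n) / \<alpha> (m \<otimes>\<^bsub>G\<^esub> n \<otimes>\<^bsub>G\<^esub> inv\<^bsub>G\<^esub> m, m)) *\<^sub>C (F m * F (m \<otimes>\<^bsub>G\<^esub> n \<otimes>\<^bsub>G\<^esub> inv\<^bsub>G\<^esub> m))"
proof -
  interpret group G by fact
  show ?thesis
    using mn proj_repD(3,4)[OF F, of "m \<otimes>\<^bsub>G\<^esub> n \<otimes>\<^bsub>G\<^esub> inv\<^bsub>G\<^esub> m" m] proj_repD(4)[OF F mn]
    by (simp add: conj_mult)
qed

text \<open>The correcting factor is the one in \<open>proj_rep_conj\<close>. Thus a sum of the matrices \<open>F n\<close>
  weighted by these traces is invariant under conjugation.\<close>

lemma tr_minv_conj:
  assumes "group G" and F: "proj_rep G \<alpha> d F" and mn: "m \<in> carrier G" "n \<in> carrier G"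
  shows "tr d (minv d (F n)) * (\<alpha> (m, n) / \<alpha> (m \<otimes>\<^bsub>G\<^esub> n \<otimes>\<^bsub>G\<^esub> inv\<^bsub>G\<^esub> m, m))
    = tr d (minv d (F (m \<otimes>\<^bsub>G\<^esub> n \<otimes>\<^bsub>G\<^esub> inv\<^bsub>G\<^esub> m)))"
proof -
  interpret group G by fact
  let ?n = "m \<otimes>\<^bsub>G\<^esub> n \<otimes>\<^bsub>G\<^esub> inv\<^bsub>G\<^esub> m"
  define \<kappa> where "\<kappa> = \<alpha> (m, n) / \<alpha> (?n, m)"
  have nG: "?n \<in> carrier G" using mn by simp
  have \<kappa>: "\<kappa> \<noteq> 0" using proj_repD(3)[OF F] mn nG by (simp add: \<kappa>_def)
  note Fm = proj_repD(1)[OF F mn(1)] and Fn = proj_repD(1)[OF F mn(2)] and Fn' = proj_repD(1)[OF F nG]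
  have "F n * F m = \<kappa> *\<^sub>C (F m * F ?n)" unfolding \<kappa>_def by (rule proj_rep_conj[OF assms])
  then have "minv d (F n * F m) = inverse \<kappa> *\<^sub>C minv d (F m * F ?n)"
    using minv_scaleC[OF GL_mult[OF Fm Fn'] \<kappa>] by simp
  then have eq: "minv d (F m) * minv d (F n) = inverse \<kappa> *\<^sub>C (minv d (F ?n) * minv d (F m))"
    by (simp add: minv_mult Fm Fn Fn')
  have "minv d (F n) = F m * (minv d (F m) * minv d (F n))"
    using minv_cancel(1)[OF Fm minv(1)[OF Fn]] by simp
  also have "\<dots> = inverse \<kappa> *\<^sub>C (F m * (minv d (F ?n) * minv d (F m)))" by (simp add: eq)
  finally have "tr d (minv d (F n)) = inverse \<kappa> * tr d (F m * (minv d (F ?n) * minv d (F m)))"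
    by (simp add: tr_simps)
  also have "tr d (F m * (minv d (F ?n) * minv d (F m))) = tr d (minv d (F ?n) * minv d (F m) * F m)"
    using GL_Mat[OF Fm] minv[OF Fm] minv[OF Fn'] by (intro tr_comm) auto
  also have "minv d (F ?n) * minv d (F m) * F m = minv d (F ?n)"
    by (rule minv_cancel(4)[OF Fm minv(1)[OF Fn']])
  finally show ?thesis using \<kappa> by (simp add: \<kappa>_def)
qed

lemma minv_mult_commute:
  assumes "A \<in> GL d" "M \<in> Mat d d" "A * M = M * A" shows "minv d A * M = M * minv d A"
proof -
  have "minv d A * M = minv d A * M * A * minv d A"
    using minv_cancel(3)[OF assms(1) Mat_mult[OF minv(1)[OF assms(1)] assms(2)]] by simp
  also have "\<dots> = minv d A * (A * M) * minv d A" by (simp add: mult.assoc assms(3))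
  also have "\<dots> = M * minv d A" by (simp only: minv_cancel(2)[OF assms(1,2)])
  finally show ?thesis .
qed

text \<open>A semisimple algebra whose centre consists of scalars is simple. Concretely, let \<open>X\<close>
  be the restriction of \<open>F\<close> to a minimal invariant subspace. The sum \<open>z\<close> of the \<open>F n\<close>
  weighted by the traces of the inverses of the \<open>X n\<close> is a multiple of the central
  idempotent belonging to \<open>X\<close>; being central it is scalar, and it is not zero. An element
  \<open>a\<close> of the span that vanishes on the minimal subspace satisfies \<open>a z = 0\<close>, so \<open>a = 0\<close>.
  Therefore identities in the span can be checked on the minimal subspace, where the
  orthogonality relations exhibit matrix units.\<close>

lemma span_scalar_center_matrix_units:
  assumes G: "group G" and fin: "finite (carrier G)" and F: "proj_rep G \<alpha> d F" and d: "0 < d"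
    and center: "\<And>z. z \<in> fm.span (F ` carrier G) \<Longrightarrow> (\<And>g. g \<in> carrier G \<Longrightarrow> z * F g = F g * z)
      \<Longrightarrow> \<exists>c. z = c *\<^sub>C idm d"
  obtains k X e where "proj_rep G \<alpha> k X" "scalar_commutant k (carrier G) X"
    "matrix_units d k e" "\<forall>i<k. \<forall>j<k. e i j \<in> fm.span (F ` carrier G)"
    "\<forall>g\<in>carrier G. F g = (\<Sum>i<k. \<Sum>j<k. entry (X g) i j *\<^sub>C e i j)"
proof -
  interpret group G by fact
  define A where "A = fm.span (F ` carrier G)"
  have FM: "F g \<in> Mat d d" if "g \<in> carrier G" for g using proj_repD[OF F that] by simp
  have AM: "A \<subseteq> Mat d d" unfolding A_def using FM by (rule span_image_Mat)
  obtain k B X where k: "0 < k" and B: "inj_mat d k B"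
    and XM': "\<forall>g\<in>carrier G. X g \<in> Mat k k" and FB': "\<forall>g\<in>carrier G. F g * B = B * X g"
    and sc: "scalar_commutant k (carrier G) X"
    by (rule minimal_invariant_subspace[OF d FM])
  have XM: "X g \<in> Mat k k" and FB: "F g * B = B * X g" if "g \<in> carrier G" for g
    using XM' FB' that by auto
  have X: "proj_rep G \<alpha> k X" by (rule sub_rep[OF G F B XM FB])
  have BM: "B \<in> Mat d k" using B by (simp add: inj_mat_def)
  let ?N = "of_nat (card (carrier G)) :: complex"
  have N: "?N \<noteq> 0" using fin one_closed by auto
  \<comment> \<open>the multiple \<open>|G|/k\<close> of the central idempotent belonging to \<open>X\<close>\<close>
  define z where "z = (\<Sum>n\<in>carrier G. tr k (minv k (X n)) *\<^sub>C F n)"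
  have zA: "z \<in> A" unfolding z_def A_def
    by (intro fm.span_sum fm.span_scale fm.span_base) auto
  have zcomm: "z * F m = F m * z" if m: "m \<in> carrier G" for m
  proof -
    let ?c = "\<lambda>n. m \<otimes>\<^bsub>G\<^esub> n \<otimes>\<^bsub>G\<^esub> inv\<^bsub>G\<^esub> m"
    have "z * F m = (\<Sum>n\<in>carrier G. tr k (minv k (X n)) *\<^sub>C (F n * F m))"
      by (simp add: z_def sum_distrib_right)
    also have "\<dots> = (\<Sum>n\<in>carrier G. tr k (minv k (X (?c n))) *\<^sub>C (F m * F (?c n)))"
      by (intro sum.cong refl)
        (simp add: proj_rep_conj[OF G F m] tr_minv_conj[OF G X m, symmetric])
    also have "\<dots> = (\<Sum>n\<in>carrier G. tr k (minv k (X n)) *\<^sub>C (F m * F n))"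
      by (rule sum.reindex_bij_betw[OF bij_betw_conj[OF m]])
    also have "\<dots> = F m * z" by (simp add: z_def sum_distrib_left)
    finally show ?thesis .
  qed
  obtain s where s: "z = s *\<^sub>C idm d" using center[OF zA[unfolded A_def] zcomm] by blast
  have BmultX: "(\<Sum>n\<in>carrier G. c n *\<^sub>C F n) * B = B * (\<Sum>n\<in>carrier G. c n *\<^sub>C X n)" for c
    by (simp add: sum_distrib_right sum_distrib_left FB)
  have XMk: "(\<Sum>n\<in>carrier G. c n *\<^sub>C X n) \<in> Mat k k" for c
    using XM by auto
  have sk: "s = ?N / of_nat k"
  proof -
    have "z * B = B * (\<Sum>n\<in>carrier G. tr k (minv k (X n)) *\<^sub>C X n)"
      unfolding z_def by (rule BmultX)
    also have "(\<Sum>n\<in>carrier G. tr k (minv k (X n)) *\<^sub>C X n)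
        = (\<Sum>n\<in>carrier G. tr k (minv k (X n) * idm k) *\<^sub>C X n)"
      by (intro sum.cong refl) (simp add: minv(1)[OF proj_repD(1)[OF X]])
    also have "\<dots> = (?N / of_nat k) *\<^sub>C idm k"
      by (rule schur_expansion[OF G X k sc idm_Mat])
    finally have "B * (s *\<^sub>C idm k) = B * ((?N / of_nat k) *\<^sub>C idm k)" using BM s by simp
    then have "s *\<^sub>C idm k = (?N / of_nat k) *\<^sub>C idm k"
      by (rule inj_mat_cancel[OF B, rotated 2]) auto
    then have "entry (s *\<^sub>C idm k) 0 0 = entry ((?N / of_nat k) *\<^sub>C idm k) 0 0" by (rule arg_cong)
    then show ?thesis using k by simp
  qed
  have s0: "s \<noteq> 0" using sk N k by simp
  \<comment> \<open>An element of the span is determined by its action on the minimal subspace.\<close>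
  have faithful: "a = 0" if a: "a \<in> A" and aB: "a * B = 0" for a
  proof -
    obtain c where c: "a = (\<Sum>m\<in>carrier G. c m *\<^sub>C F m)"
      using span_image_finite[OF fin a[unfolded A_def]] .
    have "B * (\<Sum>m\<in>carrier G. c m *\<^sub>C X m) = 0" using aB BmultX[of c] by (simp add: c)
    then have r0: "(\<Sum>m\<in>carrier G. c m *\<^sub>C X m) = 0"
      by (rule inj_mat_cancel0[OF B XMk])
    have shift: "F m * z = (\<Sum>n\<in>carrier G. tr k (minv k (X n) * X m) *\<^sub>C F n)"
      if m: "m \<in> carrier G" for m
    proof -
      have "F m * z = (\<Sum>n\<in>carrier G. tr k (minv k (X n)) *\<^sub>C (F m * F n))"
        by (simp add: z_def sum_distrib_left)
      also have "\<dots> = (\<Sum>n\<in>carrier G. tr k (minv k (X (n \<otimes>\<^bsub>G\<^esub> m)) * X m) *\<^sub>C F (n \<otimes>\<^bsub>G\<^esub> m))"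
      proof (intro sum.cong refl)
        fix n assume n: "n \<in> carrier G"
        note a = proj_repD(3)[OF F n m]
        note Xn = proj_repD(1)[OF X n] and Xm = proj_repD(1)[OF X m]
          and Xnm = proj_repD(1)[OF X m_closed[OF n m]]
        have "minv k (X n) * minv k (X m) = inverse (\<alpha> (n, m)) *\<^sub>C minv k (X (n \<otimes>\<^bsub>G\<^esub> m))"
          using minv_mult[OF Xm Xn] proj_repD(4)[OF X n m] minv_scaleC[OF Xnm a] by simp
        then have "minv k (X n) * minv k (X m) * X m = inverse (\<alpha> (n, m)) *\<^sub>C (minv k (X (n \<otimes>\<^bsub>G\<^esub> m)) * X m)"
          by simp
        then have "minv k (X n) = inverse (\<alpha> (n, m)) *\<^sub>C (minv k (X (n \<otimes>\<^bsub>G\<^esub> m)) * X m)"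
          by (simp only: minv_cancel(4)[OF Xm minv(1)[OF Xn]])
        then show "tr k (minv k (X n)) *\<^sub>C (F m * F n)
            = tr k (minv k (X (n \<otimes>\<^bsub>G\<^esub> m)) * X m) *\<^sub>C F (n \<otimes>\<^bsub>G\<^esub> m)"
          using a by (simp add: tr_simps proj_repD(4)[OF F n m])
      qed
      also have "\<dots> = (\<Sum>n\<in>carrier G. tr k (minv k (X n) * X m) *\<^sub>C F n)"
        by (rule sum.reindex_bij_betw[OF bij_betw_mult_right[OF m]])
      finally show ?thesis .
    qed
    have "a * z = (\<Sum>m\<in>carrier G. c m *\<^sub>C (F m * z))"
      by (simp add: c sum_distrib_right)
    also have "\<dots> = (\<Sum>m\<in>carrier G. \<Sum>n\<in>carrier G. (c m * tr k (minv k (X n) * X m)) *\<^sub>C F n)"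
      by (intro sum.cong refl) (simp add: shift fm.scale_sum_right)
    also have "\<dots> = (\<Sum>n\<in>carrier G. (\<Sum>m\<in>carrier G. c m * tr k (minv k (X n) * X m)) *\<^sub>C F n)"
      by (subst sum.swap) (simp add: fm.scale_sum_left)
    also have "\<dots> = (\<Sum>n\<in>carrier G. tr k (minv k (X n) * (\<Sum>m\<in>carrier G. c m *\<^sub>C X m)) *\<^sub>C F n)"
      by (simp add: sum_distrib_left tr_simps)
    also have "\<dots> = 0" by (simp add: r0 tr_simps)
    finally have "s *\<^sub>C a = 0" using s a AM by auto
    then show "a = 0" using s0 by simp
  qed
  have eqI: "a = b" if "a \<in> A" "b \<in> A" "a * B = b * B" for a b
    using faithful[of "a - b"] that by (auto simp: A_def left_diff_distrib intro: fm.span_diff)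
  \<comment> \<open>By the orthogonality relations \<open>e i j\<close> acts on the minimal subspace as \<open>eunit i j\<close>.\<close>
  define e where "e i j = (\<Sum>n\<in>carrier G. (of_nat k / ?N * entry (minv k (X n)) j i) *\<^sub>C F n)" for i j
  have eA: "e i j \<in> A" for i j unfolding e_def A_def
    by (intro fm.span_sum fm.span_scale fm.span_base) auto
  have eB: "e i j * B = B * eunit i j" if "i < k" "j < k" for i j
  proof -
    have "(\<Sum>n\<in>carrier G. (of_nat k / ?N * entry (minv k (X n)) j i) *\<^sub>C X n) = eunit i j"
    proof (rule Mat_eqI[OF XMk eunit_Mat[OF that]])
      fix c l assume cl: "c < k" "l < k"
      have "entry (\<Sum>n\<in>carrier G. (of_nat k / ?N * entry (minv k (X n)) j i) *\<^sub>C X n) c l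
          = of_nat k / ?N * (\<Sum>n\<in>carrier G. entry (minv k (X n)) j i * entry (X n) c l)"
        by (simp add: sum_distrib_left mult.assoc)
      then show "entry (\<Sum>n\<in>carrier G. (of_nat k / ?N * entry (minv k (X n)) j i) *\<^sub>C X n) c l
          = entry (eunit i j) c l"
        using schur_orthogonality[OF G X k sc \<open>j < k\<close> \<open>i < k\<close> cl] N k by auto
    qed
    then show ?thesis unfolding e_def BmultX by simp
  qed
  have mulA: "a * b \<in> A" if "a \<in> A" "b \<in> A" for a b
    using that proj_rep_span_mult[OF F G] by (simp add: A_def)
  have "matrix_units d k e"
    unfolding matrix_units_def
  proof (intro conjI allI impI)
    fix i j p q assume i: "i < k" and j: "j < k" and p: "p < k" and q: "q < k"
    have "eunit i j * eunit p q = (if j = p then eunit i q else 0)"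
      by (rule fmat_eqI) (auto simp: entry_mult_eunit)
    moreover have "e i j * e p q * B = B * (eunit i j * eunit p q)"
      using i j p q by (metis eB mult.assoc)
    moreover have "B * (if j = p then eunit i q else 0) = (if j = p then e i q else 0) * B"
      using i q by (simp add: eB)
    moreover have "(if j = p then e i q else 0) \<in> A"
      using eA by (simp add: A_def fm.span_zero)
    ultimately show "e i j * e p q = (if j = p then e i q else 0)"
      by (intro eqI[OF mulA[OF eA eA]]) auto
  next
    have "(\<Sum>i<k. eunit i i) = idm k"
      by (rule fmat_eqI) (auto simp: sum.delta intro!: sum.neutral)
    then have "(\<Sum>i<k. e i i) * B = idm d * B"
      using BM by (simp add: sum_distrib_right eB flip: sum_distrib_left)
    then show "(\<Sum>i<k. e i i) = idm d"
      by (rule eqI[rotated 2]) (use eA proj_rep_idm_span[OF F G] in \<open>auto simp: A_def intro: fm.span_sum\<close>)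
  qed (use k eA AM in auto)
  moreover have "F g = (\<Sum>i<k. \<Sum>j<k. entry (X g) i j *\<^sub>C e i j)" if g: "g \<in> carrier G" for g
  proof (rule eqI)
    have "X g = (\<Sum>i<k. \<Sum>j<k. entry (X g) i j *\<^sub>C eunit i j)"
    proof (rule Mat_eqI[of _ k k])
      fix a b assume ab: "a < k" "b < k"
      have "entry (\<Sum>i<k. \<Sum>j<k. entry (X g) i j *\<^sub>C eunit i j) a b
          = (\<Sum>i<k. \<Sum>j<k. if j = b then (if i = a then entry (X g) i j else 0) else 0)"
        unfolding entry_sum by (intro sum.cong refl) auto
      also have "\<dots> = entry (X g) a b" using ab by (simp add: sum.delta)
      finally show "entry (X g) a b = entry (\<Sum>i<k. \<Sum>j<k. entry (X g) i j *\<^sub>C eunit i j) a b" by simp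
    qed (use XM[OF g] eunit_Mat in \<open>auto intro!: Mat_sum Mat_closed(5)\<close>)
    then show "F g * B = (\<Sum>i<k. \<Sum>j<k. entry (X g) i j *\<^sub>C e i j) * B"
      using g by (simp add: FB sum_distrib_right eB) (simp flip: sum_distrib_left mult_scaleC_right)
    show "F g \<in> A" using g by (auto simp: A_def intro: fm.span_base)
    show "(\<Sum>i<k. \<Sum>j<k. entry (X g) i j *\<^sub>C e i j) \<in> A"
      unfolding A_def by (intro fm.span_sum fm.span_scale eA[unfolded A_def])
  qed
  ultimately show ?thesis using that[OF X sc] eA by (auto simp: A_def)
qed

text \<open>The corner of a full matrix algebra cut out by the idempotent \<open>e 0 0\<close> is
  one-dimensional.\<close>

lemma matrix_units_corner:
  assumes e: "matrix_units d k e" and span: "A \<subseteq> fm.span {e i j | i j. i < k \<and> j < k}"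
    and a: "a \<in> A" and pq: "p < k" "q < k"
  obtains t where "e 0 p * a * e q 0 = t *\<^sub>C e 0 0"
proof -
  note m = matrix_unitsD[OF e]
  have "a \<in> fm.span {e i j | i j. i < k \<and> j < k}" using a span by auto
  then have "\<exists>t. e 0 p * a * e q 0 = t *\<^sub>C e 0 0"
  proof (induction rule: fm.span_induct_alt)
    case base
    show ?case by (rule exI[of _ 0]) simp
  next
    case (step c x y)
    obtain i j where ij: "x = e i j" "i < k" "j < k" using step by auto
    obtain t where t: "e 0 p * y * e q 0 = t *\<^sub>C e 0 0" using step by auto
    have "e 0 p * x * e q 0 = (if p = i \<and> j = q then 1 else 0) *\<^sub>C e 0 0"
      using ij pq m(1,3) by simp
    then have "e 0 p * (c *\<^sub>C x + y) * e q 0 = (c * (if p = i \<and> j = q then 1 else 0) + t) *\<^sub>C e 0 0"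
      by (simp add: distrib_left distrib_right t fm.scale_left_distrib)
    then show ?case by blast
  qed
  then show ?thesis using that by blast
qed

text \<open>Conjugation by \<open>\<psi>\<close> takes the matrix units \<open>e i j\<close> to a second system \<open>f i j\<close> in \<open>A\<close>.
  For a nonzero \<open>u\<close> with \<open>f 0 0 * u = u = u * e 0 0\<close> the sum \<open>a\<close> of the \<open>f j 0 * u * e 0 j\<close>
  satisfies \<open>f q r * a = a * e q r\<close>, so \<open>a\<close> and \<open>\<psi>\<close> induce the same conjugation on \<open>A\<close>. It
  is invertible because a sum of the same shape with the roles of \<open>e\<close> and \<open>f\<close> exchanged is
  its left inverse up to a scalar.\<close>

lemma skolem_noether:
  assumes e: "matrix_units d k e" and d: "0 < d" and psi: "\<psi> \<in> GL d"
    and A: "fm.subspace A" "\<And>a b. a \<in> A \<Longrightarrow> b \<in> A \<Longrightarrow> a * b \<in> A"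
    and eA: "\<And>i j. i < k \<Longrightarrow> j < k \<Longrightarrow> e i j \<in> A"
    and span: "A \<subseteq> fm.span {e i j | i j. i < k \<and> j < k}"
    and norm: "\<And>a. a \<in> A \<Longrightarrow> \<psi> * a * minv d \<psi> \<in> A"
  obtains a where "a \<in> A" "a \<in> GL d" "minv d a \<in> A"
    "\<forall>x\<in>A. (minv d a * \<psi>) * x = x * (minv d a * \<psi>)"
proof -
  note m = matrix_unitsD[OF e]
  define f where "f i j = \<psi> * e i j * minv d \<psi>" for i j
  have fA: "f i j \<in> A" if "i < k" "j < k" for i j using norm eA that by (simp add: f_def)
  have f: "f i j * f p q = (if j = p then f i q else 0)" if "i < k" "j < k" "p < k" "q < k" for i j p q
  proof -
    have "f i j * f p q = \<psi> * (e i j * (minv d \<psi> * (\<psi> * e p q))) * minv d \<psi>"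
      by (simp add: f_def mult.assoc)
    also have "\<dots> = \<psi> * (e i j * e p q) * minv d \<psi>"
      using minv_cancel(2)[OF psi m(2)[OF that(3,4)]] by simp
    finally show ?thesis using m(3)[OF that] by (simp add: f_def)
  qed
  have sum_f: "(\<Sum>i<k. f i i) = idm d"
  proof -
    have "(\<Sum>i<k. f i i) = \<psi> * (\<Sum>i<k. e i i) * minv d \<psi>"
      by (simp add: f_def sum_distrib_left sum_distrib_right)
    then show ?thesis using m(4) minv[OF psi] GL_Mat[OF psi] by simp
  qed
  have AM: "A \<subseteq> Mat d d"
    by (rule subset_trans[OF span fm.span_minimal[OF _ subspace_Mat]]) (auto simp: m(2))
  have fu: "matrix_units d k f"
    unfolding matrix_units_def using m(1) f sum_f fA AM by auto
  note k = m(1)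
  \<comment> \<open>A nonzero \<open>u\<close> exists because the \<open>e i i\<close> sum to the identity, and for the same reason
    some \<open>e 0 p * u\<close> is not zero.\<close>
  have "f 0 0 \<noteq> 0" using matrix_units_nonzero[OF fu d] k by simp
  have "\<exists>i<k. f 0 0 * e i 0 \<noteq> 0"
  proof (rule ccontr)
    assume none: "\<not> ?thesis"
    have "f 0 0 = f 0 0 * (\<Sum>i<k. e i i)" using m(4) fA[of 0 0] AM k by auto
    also have "\<dots> = (\<Sum>i<k. f 0 0 * e i 0 * e 0 i)"
      using m(3)[of _ 0 0] k by (simp add: sum_distrib_left mult.assoc)
    also have "\<dots> = 0" using none by (intro sum.neutral) auto
    finally show False using \<open>f 0 0 \<noteq> 0\<close> by simp
  qed
  then obtain i where i: "i < k" "f 0 0 * e i 0 \<noteq> 0" by auto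
  define u where "u = f 0 0 * e i 0"
  have uA: "u \<in> A" unfolding u_def using A(2) fA eA i k by simp
  have fu0: "f 0 0 * u = u" unfolding u_def using f[of 0 0 0 0] k by (simp add: mult.assoc[symmetric])
  have ue0: "u * e 0 0 = u" unfolding u_def using m(3)[of i 0 0 0] k i by (simp add: mult.assoc)
  have "\<exists>p<k. e 0 p * u \<noteq> 0"
  proof (rule ccontr)
    assume none: "\<not> ?thesis"
    have "u = (\<Sum>p<k. e p p) * u" using m(4) uA AM by auto
    also have "\<dots> = (\<Sum>p<k. e p 0 * (e 0 p * u))"
      using m(3)[of _ 0 0] k by (simp add: sum_distrib_right mult.assoc[symmetric])
    also have "\<dots> = 0" using none by (intro sum.neutral) auto
    finally show False using i by (simp add: u_def)
  qed
  then obtain p where p: "p < k" "e 0 p * u \<noteq> 0" by auto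
  obtain t where "e 0 p * u * e 0 0 = t *\<^sub>C e 0 0"
    using matrix_units_corner[OF e span uA p(1) k] .
  then have t: "e 0 p * u = t *\<^sub>C e 0 0" by (simp add: mult.assoc ue0)
  have t0: "t \<noteq> 0" using t p by auto
  define a where "a = (\<Sum>j<k. f j 0 * u * e 0 j)"
  have aA: "a \<in> A" unfolding a_def
    using A fA eA uA k by (intro fm.subspace_sum[OF A(1)]) auto
  have twist: "f q r * a = a * e q r" if "q < k" "r < k" for q r
  proof -
    have "f q r * a = (\<Sum>j<k. if j = r then f q 0 * u * e 0 j else 0)"
      unfolding a_def sum_distrib_left
      by (intro sum.cong refl) (use f[OF that] k in \<open>auto simp: mult.assoc[symmetric]\<close>)
    also have "\<dots> = f q 0 * u * e 0 r" using that by (simp add: sum.delta)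
    also have "\<dots> = (\<Sum>j<k. if j = q then f j 0 * u * e 0 r else 0)" using that by (simp add: sum.delta)
    also have "\<dots> = a * e q r"
      unfolding a_def sum_distrib_right
      by (intro sum.cong refl) (use m(3)[of 0 _ q r] k that in \<open>auto simp: mult.assoc\<close>)
    finally show ?thesis .
  qed
  define b where "b = (\<Sum>j<k. e j 0 * e 0 p * f 0 j)"
  have bA: "b \<in> A" unfolding b_def
    using A fA eA p k by (intro fm.subspace_sum[OF A(1)]) auto
  have "b * a = (\<Sum>j<k. \<Sum>l<k. if l = j then t *\<^sub>C e j l else 0)"
    unfolding a_def b_def sum_distrib_left sum_distrib_right
  proof (subst sum.swap, intro sum.cong refl)
    fix l j assume "l \<in> {..<k}" "j \<in> {..<k}"
    then have lj: "l < k" "j < k" by auto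
    have "e j 0 * e 0 p * f 0 j * (f l 0 * u * e 0 l) = e j 0 * e 0 p * (f 0 j * f l 0) * u * e 0 l"
      by (simp add: mult.assoc)
    also have "\<dots> = (if l = j then e j 0 * (e 0 p * (f 0 0 * u)) * e 0 l else 0)"
      using f[of 0 j l 0] lj k by (auto simp: mult.assoc)
    also have "\<dots> = (if l = j then t *\<^sub>C (e j 0 * e 0 0 * e 0 l) else 0)"
      by (simp add: fu0 t)
    also have "\<dots> = (if l = j then t *\<^sub>C e j l else 0)"
    proof -
      have "e j 0 * e 0 0 * e 0 l = e j l"
        using m(3)[of j 0 0 0] m(3)[of j 0 0 l] lj k by simp
      then show ?thesis by (simp only:)
    qed
    finally show "e j 0 * e 0 p * f 0 j * (f l 0 * u * e 0 l) = (if l = j then t *\<^sub>C e j l else 0)" .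
  qed
  also have "\<dots> = t *\<^sub>C idm d"
    unfolding m(4)[symmetric] fm.scale_sum_right by (intro sum.cong refl) (simp add: sum.delta)
  finally have ba: "b * a = t *\<^sub>C idm d" .
  have aM: "a \<in> Mat d d" and bM: "b \<in> Mat d d" using aA bA AM by auto
  have aGL: "a \<in> GL d"
    by (rule left_inverse_GL[OF aM Mat_closed(5)[OF bM, of "inverse t"]]) (simp add: ba t0)
  have "minv d a = inverse t *\<^sub>C b"
    by (rule minv_unique[OF aGL Mat_closed(5)[OF bM]]) (simp add: ba t0)
  then have "minv d a \<in> A" using bA A(1) by (simp add: fm.subspace_scale)
  have comm: "(minv d a * \<psi>) * e q r = e q r * (minv d a * \<psi>)" if "q < k" "r < k" for q r
  proof -
    have "f q r * \<psi> = \<psi> * e q r"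
      unfolding f_def using minv_cancel(4)[OF psi Mat_mult[OF GL_Mat[OF psi] m(2)[OF that]]] by simp
    then have "(minv d a * \<psi>) * e q r = minv d a * (f q r * \<psi>)" by (simp add: mult.assoc)
    also have "f q r * \<psi> = f q r * a * minv d a * \<psi>"
      using minv_cancel(3)[OF aGL, of "f q r" d] fA[OF that] AM by (simp add: subset_iff)
    also have "minv d a * \<dots> = minv d a * (a * (e q r * (minv d a * \<psi>)))"
      by (simp add: twist[OF that] mult.assoc)
    also have "\<dots> = e q r * (minv d a * \<psi>)"
      using m(2)[OF that] minv[OF aGL] GL_Mat[OF psi] by (intro minv_cancel(2)[OF aGL]) auto
    finally show ?thesis .
  qed
  have "(minv d a * \<psi>) * x = x * (minv d a * \<psi>)" if "x \<in> A" for x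
  proof -
    have "x \<in> fm.span {e i j | i j. i < k \<and> j < k}" using that span by auto
    then show ?thesis
      by (induction rule: fm.span_induct_alt) (auto simp: distrib_left distrib_right comm)
  qed
  then show ?thesis using that[OF aA aGL \<open>minv d a \<in> A\<close>] by blast
qed

text \<open>An operator normalizing a full matrix algebra is a product of an inner part and a part
  that centralizes the algebra.\<close>

lemma factor_over_subgroup:
  assumes G: "group G" and fin: "finite (carrier G)" and F: "proj_rep G \<alpha> d F" and d: "0 < d"
    and center: "\<And>z. z \<in> fm.span (F ` carrier G) \<Longrightarrow> (\<And>g. g \<in> carrier G \<Longrightarrow> z * F g = F g * z)
      \<Longrightarrow> \<exists>c. z = c *\<^sub>C idm d"
    and psi: "\<psi> \<in> GL d"
    and norm: "\<And>g. g \<in> carrier G \<Longrightarrow> \<psi> * F g * minv d \<psi> \<in> fm.span (F ` carrier G)"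
  obtains a b where "a \<in> fm.span (F ` carrier G)" "a \<in> GL d" "minv d a \<in> fm.span (F ` carrier G)"
    "b \<in> GL d" "\<psi> = a * b"
    "\<forall>x\<in>fm.span (F ` carrier G). b * x = x * b"
proof -
  let ?A = "fm.span (F ` carrier G)"
  obtain k X e where "proj_rep G \<alpha> k X" "scalar_commutant k (carrier G) X"
    and e1: "matrix_units d k e" and e': "\<forall>i<k. \<forall>j<k. e i j \<in> ?A"
    and Fe: "\<forall>g\<in>carrier G. F g = (\<Sum>i<k. \<Sum>j<k. entry (X g) i j *\<^sub>C e i j)"
    by (rule span_scalar_center_matrix_units[OF G fin F d center])
  have e2: "e i j \<in> ?A" if "i < k" "j < k" for i j using e' that by blast
  have "F g \<in> fm.span {e i j | i j. i < k \<and> j < k}" if "g \<in> carrier G" for g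
    unfolding Fe[rule_format, OF that] by (intro fm.span_sum fm.span_scale fm.span_base) auto
  then have span: "?A \<subseteq> fm.span {e i j | i j. i < k \<and> j < k}"
    by (intro fm.span_minimal fm.subspace_span) auto
  have norm': "\<psi> * a * minv d \<psi> \<in> ?A" if "a \<in> ?A" for a
    using that by (induction rule: fm.span_induct_alt)
      (auto simp: distrib_left distrib_right fm.span_zero intro: fm.span_add fm.span_scale norm)
  obtain a where a: "a \<in> ?A" "a \<in> GL d" "minv d a \<in> ?A" "\<forall>x\<in>?A. (minv d a * \<psi>) * x = x * (minv d a * \<psi>)"
    by (rule skolem_noether[OF e1 d psi fm.subspace_span proj_rep_span_mult[OF F G] e2 span norm'])
  have "\<psi> = a * (minv d a * \<psi>)" using minv_cancel(1)[OF a(2) GL_Mat[OF psi]] by simp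
  then show ?thesis using that[OF a(1-3) _ _ a(4)] a(2) psi by (meson GL_minv GL_mult)
qed

section \<open>Factorization along a normal series\<close>

lemma proj_rep_restrict:
  assumes "proj_rep G \<alpha> d F" "subgroup K G"
  shows "proj_rep (G\<lparr>carrier := K\<rparr>) \<alpha> d F"
  using assms subgroup.subset[OF assms(2)] unfolding proj_rep_def by (auto simp: subset_iff)

text \<open>Let \<open>w\<close> be the defect \<open>u(gh)\<inverse> u(h) u(g)\<close>. As a product of values of \<open>u\<close> it commutes
  with all values of \<open>v\<close>. The relation for \<open>F\<close> makes \<open>w (v(h) v(g))\<close> a multiple of \<open>v(gh)\<close>,
  so \<open>w\<close> also commutes with all values of \<open>u\<close>. Thus it commutes with \<open>F\<close> and is scalar.\<close>

lemma proj_rep_of_commuting_factor: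
  assumes G: "group G" and F: "proj_rep G \<alpha> d F" and d: "0 < d"
    and sc: "scalar_commutant d (carrier G) F"
    and u: "\<And>g. g \<in> carrier G \<Longrightarrow> u g \<in> GL d" and v: "\<And>g. g \<in> carrier G \<Longrightarrow> v g \<in> GL d"
    and Fuv: "\<And>g. g \<in> carrier G \<Longrightarrow> F g = u g * v g"
    and comm: "\<And>g h. g \<in> carrier G \<Longrightarrow> h \<in> carrier G \<Longrightarrow> u g * v h = v h * u g"
  obtains \<beta> where "proj_rep G \<beta> d u"
proof -
  interpret group G by fact
  have "\<exists>c. c \<noteq> 0 \<and> u h * u g = c *\<^sub>C u (g \<otimes>\<^bsub>G\<^esub> h)" if g: "g \<in> carrier G" and h: "h \<in> carrier G" for g h
  proof -
    let ?gh = "g \<otimes>\<^bsub>G\<^esub> h"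
    have gh: "?gh \<in> carrier G" using g h by simp
    define w where "w = minv d (u ?gh) * (u h * u g)"
    have wGL: "w \<in> GL d"
      unfolding w_def by (rule GL_mult[OF GL_minv[OF u[OF gh]] GL_mult[OF u[OF h] u[OF g]]])
    have "u h * u g * (v h * v g) = \<alpha> (g, h) *\<^sub>C (u ?gh * v ?gh)"
    proof -
      have "u h * u g * (v h * v g) = u h * (u g * v h) * v g" by (simp add: mult.assoc)
      also have "\<dots> = u h * (v h * u g) * v g" by (simp only: comm[OF g h])
      also have "\<dots> = F h * F g" by (simp add: Fuv g h mult.assoc)
      also have "\<dots> = \<alpha> (g, h) *\<^sub>C (u ?gh * v ?gh)" by (simp add: proj_repD(4)[OF F g h] Fuv gh)
      finally show ?thesis .
    qed
    then have "w * (v h * v g) = \<alpha> (g, h) *\<^sub>C (minv d (u ?gh) * (u ?gh * v ?gh))"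
      by (simp add: w_def mult.assoc)
    then have wv: "w * (v h * v g) = \<alpha> (g, h) *\<^sub>C v ?gh"
      by (simp add: minv_cancel(2)[OF u[OF gh] GL_Mat[OF v[OF gh]]])
    have "w * u k = u k * w" if k: "k \<in> carrier G" for k
    proof -
      let ?V = "v h * v g"
      have V: "?V \<in> GL d" using v g h by auto
      have c1: "u k * ?V = ?V * u k" using comm[OF k h] comm[OF k g] by (metis mult.assoc)
      have "w * u k * ?V = w * ?V * u k" by (simp add: mult.assoc c1)
      also have "\<dots> = u k * (w * ?V)" by (simp add: wv comm[OF k gh])
      finally have "w * u k * ?V * minv d ?V = u k * w * ?V * minv d ?V" by (simp add: mult.assoc)
      then show ?thesis
        using minv_cancel(3)[OF V GL_Mat[OF GL_mult[OF wGL u[OF k]]]]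
          minv_cancel(3)[OF V GL_Mat[OF GL_mult[OF u[OF k] wGL]]] by simp
    qed
    moreover have "w * v k = v k * w" if k: "k \<in> carrier G" for k
    proof -
      have "minv d (u ?gh) * v k = v k * minv d (u ?gh)"
        by (rule minv_mult_commute[OF u[OF gh] GL_Mat[OF v[OF k]] comm[OF gh k]])
      then show ?thesis unfolding w_def using comm[OF g k] comm[OF h k] by (metis mult.assoc)
    qed
    ultimately have "w * F k = F k * w" if "k \<in> carrier G" for k
      using that by (simp add: Fuv) (metis mult.assoc)
    then obtain c where c: "w = c *\<^sub>C idm d"
      using sc GL_Mat[OF wGL] unfolding scalar_commutant_def by blast
    have "c \<noteq> 0"
    proof
      assume "c = 0"
      then have "idm d = 0" using c minv(2)[OF wGL] by simp
      then have "entry (idm d) 0 0 = 0" by simp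
      then show False using d by simp
    qed
    have "u h * u g = u ?gh * w"
      unfolding w_def using minv_cancel(1)[OF u[OF gh] Mat_mult[OF GL_Mat[OF u[OF h]] GL_Mat[OF u[OF g]]]]
      by simp
    also have "\<dots> = c *\<^sub>C u ?gh" using GL_Mat[OF u[OF gh]] by (simp add: c)
    finally show ?thesis using \<open>c \<noteq> 0\<close> by blast
  qed
  then have "\<forall>q. \<exists>c. fst q \<in> carrier G \<and> snd q \<in> carrier G \<longrightarrow>
      c \<noteq> 0 \<and> u (snd q) * u (fst q) = c *\<^sub>C u (fst q \<otimes>\<^bsub>G\<^esub> snd q)" by blast
  from choice[OF this] obtain \<beta> where "\<forall>q. fst q \<in> carrier G \<and> snd q \<in> carrier G \<longrightarrow>
      \<beta> q \<noteq> 0 \<and> u (snd q) * u (fst q) = \<beta> q *\<^sub>C u (fst q \<otimes>\<^bsub>G\<^esub> snd q)" by blast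
  then have "proj_rep G \<beta> d u" unfolding proj_rep_def using u by auto
  then show ?thesis by (rule that)
qed

lemma (in group) proj_rep_conj_span:
  assumes F: "proj_rep G \<alpha> d F" and N: "N \<lhd> G" and g: "g \<in> carrier G" and n: "n \<in> N"
  shows "F g * F n * minv d (F g) \<in> fm.span (F ` N)" "minv d (F g) * F n * F g \<in> fm.span (F ` N)"
proof -
  have NG: "N \<subseteq> carrier G" using subgroup.subset[OF normal_imp_subgroup[OF N]] .
  have nG: "n \<in> carrier G" using NG n by auto
  note GLg = proj_repD(1)[OF F g]
  show "F g * F n * minv d (F g) \<in> fm.span (F ` N)"
  proof -
    let ?m = "inv g \<otimes> n \<otimes> g"
    have m: "?m \<in> N" using normal.inv_op_closed1[OF N g n] .
    have mG: "?m \<in> carrier G" using NG m by auto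
    have n_eq: "g \<otimes> ?m \<otimes> inv g = n"
      using g nG by (simp add: m_assoc[symmetric]) (simp add: m_assoc)
    let ?k = "\<alpha> (g, ?m) / \<alpha> (n, g)"
    have "?k \<noteq> 0" using proj_repD(3)[OF F] g mG nG by simp
    have "F ?m * F g = ?k *\<^sub>C (F g * F n)"
      using proj_rep_conj[OF is_group F g mG] n_eq by simp
    then have "F g * F n = inverse ?k *\<^sub>C (F ?m * F g)" using \<open>?k \<noteq> 0\<close> by simp
    then have "F g * F n * minv d (F g) = inverse ?k *\<^sub>C (F ?m * F g * minv d (F g))" by simp
    also have "F ?m * F g * minv d (F g) = F ?m"
      by (rule minv_cancel(3)[OF GLg proj_repD(2)[OF F mG]])
    finally show ?thesis using m by (auto intro: fm.span_scale fm.span_base)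
  qed
  let ?m = "g \<otimes> n \<otimes> inv g"
  have m: "?m \<in> N" using normal.inv_op_closed2[OF N g n] .
  have mG: "?m \<in> carrier G" using NG m by auto
  have "minv d (F g) * (F n * F g) = (\<alpha> (g, n) / \<alpha> (?m, g)) *\<^sub>C (minv d (F g) * (F g * F ?m))"
    by (simp add: proj_rep_conj[OF is_group F g nG])
  also have "minv d (F g) * (F g * F ?m) = F ?m"
    by (rule minv_cancel(2)[OF GLg proj_repD(2)[OF F mG]])
  finally show "minv d (F g) * F n * F g \<in> fm.span (F ` N)"
    using m by (auto simp: mult.assoc intro: fm.span_scale fm.span_base)
qed

text \<open>The invariant of the induction along the normal series, at the term \<open>M\<close>. The part of
  \<open>F\<close> lying in the algebra of \<open>M\<close> is split into \<open>x\<close> and \<open>y\<close>, which come from \<open>H\<close> and \<open>H'\<close>;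
  the remainder \<open>z\<close> centralizes that algebra.\<close>

definition partial_factorization where
  "partial_factorization G d F M H H' x y z \<longleftrightarrow>
    (\<forall>g\<in>carrier G. x g \<in> GL d \<and> x g \<in> fm.span (F ` M) \<and> minv d (x g) \<in> fm.span (F ` M) \<and>
       y g \<in> GL d \<and> y g \<in> fm.span (F ` M) \<and> minv d (y g) \<in> fm.span (F ` M) \<and>
       z g \<in> GL d \<and> (\<forall>s\<in>fm.span (F ` M). z g * s = s * z g) \<and> F g = x g * y g * z g) \<and>
    (\<forall>g\<in>carrier G. \<forall>h\<in>carrier G. x g * y h = y h * x g) \<and>
    x ` carrier G \<subseteq> fm.span (x ` (H \<inter> M)) \<and> y ` carrier G \<subseteq> fm.span (y ` (H' \<inter> M))"

lemma partial_factorization_swap: "partial_factorization G d F M H H' x y z \<Longrightarrow> partial_factorization G d F M H' H y x z"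
  unfolding partial_factorization_def by auto

text \<open>The condition on normal subgroups says that \<open>F\<close> restricts to each of them as a
  multiple of one irreducible representation. This is the only trace of primitivity in the
  construction of the factors.\<close>

locale quasi_primitive = group G for G :: "('a, 'b) monoid_scheme" (structure) +
  fixes \<alpha> :: "'a \<times> 'a \<Rightarrow> complex" and d :: nat and F :: "'a \<Rightarrow> fmat"
  assumes fin: "finite (carrier G)" and F: "proj_rep G \<alpha> d F" and d: "0 < d"
    and sc: "scalar_commutant d (carrier G) F"
    and center: "\<And>N z. N \<lhd> G \<Longrightarrow> z \<in> fm.span (F ` N) \<Longrightarrow> (\<And>g. g \<in> N \<Longrightarrow> z * F g = F g * z)
      \<Longrightarrow> \<exists>c. z = c *\<^sub>C idm d"
begin

lemma scalar_nonzero: "c *\<^sub>C idm d \<in> GL d \<Longrightarrow> c \<noteq> 0"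
proof
  assume "c *\<^sub>C idm d \<in> GL d" "c = 0"
  then have "idm d = 0" using minv(2)[of "c *\<^sub>C idm d" d] by simp
  then have "entry (idm d) 0 0 = 0" by simp
  then show False using d by simp
qed

lemma normal_subgroupD:
  assumes "N \<lhd> G"
  shows "subgroup N G" "N \<subseteq> carrier G" "group (G\<lparr>carrier := N\<rparr>)" "proj_rep (G\<lparr>carrier := N\<rparr>) \<alpha> d F"
    "finite N"
proof -
  show N: "subgroup N G" using assms by (rule normal_imp_subgroup)
  show "N \<subseteq> carrier G" using N by (rule subgroup.subset)
  then show "finite N" using fin finite_subset by blast
  show "group (G\<lparr>carrier := N\<rparr>)" by (rule subgroup.subgroup_is_group[OF N]) unfold_locales
  show "proj_rep (G\<lparr>carrier := N\<rparr>) \<alpha> d F" by (rule proj_rep_restrict[OF F N])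
qed

lemma span_mult: "N \<lhd> G \<Longrightarrow> a \<in> fm.span (F ` N) \<Longrightarrow> b \<in> fm.span (F ` N) \<Longrightarrow> a * b \<in> fm.span (F ` N)"
  using proj_rep_span_mult[OF normal_subgroupD(4,3)] by simp

lemma span_Mat: "N \<lhd> G \<Longrightarrow> a \<in> fm.span (F ` N) \<Longrightarrow> a \<in> Mat d d"
  using span_image_Mat[of N F d] proj_repD(2)[OF F] normal_subgroupD(2) by blast

lemma span_center_scalar: "N \<lhd> G \<Longrightarrow> z \<in> fm.span (F ` N) \<Longrightarrow> (\<And>s. s \<in> fm.span (F ` N) \<Longrightarrow> z * s = s * z)
      \<Longrightarrow> \<exists>c. z = c *\<^sub>C idm d"
  by (rule center) (auto intro: fm.span_base)

lemma commute_span: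
  assumes "\<And>g. g \<in> N \<Longrightarrow> z * F g = F g * z" and "s \<in> fm.span (F ` N)"
  shows "z * s = s * z"
  using assms(2)
  by (induction rule: fm.span_induct_alt) (auto simp: distrib_left distrib_right assms(1))

text \<open>Here \<open>H\<close> covers the factor \<open>N'/N\<close>. By Skolem-Noether \<open>F = a b\<close> over \<open>N'\<close>, and
  comparison with \<open>F = x y z\<close> gives \<open>z = p b\<close>, where \<open>p\<close> takes values in the relative
  commutant of the algebra of \<open>N\<close> in that of \<open>N'\<close>. The new factors are \<open>x p\<close>, \<open>y\<close> and \<open>b\<close>;
  what has to be shown is that \<open>x p\<close> is still spanned by its values on \<open>H\<close>.\<close>

lemma partial_factorization_step:
  assumes N: "N \<lhd> G" and N': "N' \<lhd> G" and NN': "N \<subseteq> N'"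
    and H: "subgroup H G" and cover: "N' \<subseteq> (H \<inter> N') <#> N"
    and st: "partial_factorization G d F N H H' x y z"
  obtains x' y' z' where "partial_factorization G d F N' H H' x' y' z'"
proof -
  let ?A = "fm.span (F ` N)" and ?A' = "fm.span (F ` N')"
  note NG = normal_subgroupD[OF N] and NG' = normal_subgroupD[OF N']
  have AA': "?A \<subseteq> ?A'" using NN' by (intro fm.span_mono) auto
  have x: "x g \<in> GL d" "x g \<in> ?A" "minv d (x g) \<in> ?A" and y: "y g \<in> GL d" "y g \<in> ?A" "minv d (y g) \<in> ?A"
    and z: "z g \<in> GL d" "\<And>s. s \<in> ?A \<Longrightarrow> z g * s = s * z g" and Fxyz: "F g = x g * y g * z g"
    if "g \<in> carrier G" for g
    using st that unfolding partial_factorization_def by auto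
  have xy: "x g * y h = y h * x g" if "g \<in> carrier G" "h \<in> carrier G" for g h
    using st that unfolding partial_factorization_def by auto
  have xH: "x ` carrier G \<subseteq> fm.span (x ` (H \<inter> N))" and yH: "y ` carrier G \<subseteq> fm.span (y ` (H' \<inter> N))"
    using st unfolding partial_factorization_def by auto
  have "\<exists>a b. a \<in> ?A' \<and> a \<in> GL d \<and> minv d a \<in> ?A' \<and> b \<in> GL d \<and> F g = a * b \<and> (\<forall>s\<in>?A'. b * s = s * b)"
    if g: "g \<in> carrier G" for g
  proof -
    have c: "\<exists>c. z = c *\<^sub>C idm d" if "z \<in> fm.span (F ` carrier (G\<lparr>carrier := N'\<rparr>))"
      "\<And>g. g \<in> carrier (G\<lparr>carrier := N'\<rparr>) \<Longrightarrow> z * F g = F g * z" for z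
      using center[OF N'] that by simp
    obtain a b where "a \<in> fm.span (F ` carrier (G\<lparr>carrier := N'\<rparr>))" "a \<in> GL d"
      "minv d a \<in> fm.span (F ` carrier (G\<lparr>carrier := N'\<rparr>))" "b \<in> GL d" "F g = a * b"
      "\<forall>s\<in>fm.span (F ` carrier (G\<lparr>carrier := N'\<rparr>)). b * s = s * b"
      by (rule factor_over_subgroup[OF NG'(3) _ NG'(4) d c proj_repD(1)[OF F g]])
        (use NG'(5) proj_rep_conj_span(1)[OF F N' g] in auto)
    then show ?thesis by auto
  qed
  then obtain a b where a: "\<And>g. g \<in> carrier G \<Longrightarrow> a g \<in> ?A' \<and> a g \<in> GL d \<and> minv d (a g) \<in> ?A'"
    and b: "\<And>g. g \<in> carrier G \<Longrightarrow> b g \<in> GL d \<and> (\<forall>s\<in>?A'. b g * s = s * b g)"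
    and Fab: "\<And>g. g \<in> carrier G \<Longrightarrow> F g = a g * b g"
    by metis
  \<comment> \<open>Since \<open>x y z = F = a b\<close>, this is both \<open>z b\<inverse>\<close>, which commutes with the algebra of \<open>N\<close>, and
    \<open>y\<inverse> x\<inverse> a\<close>, which lies in the algebra of \<open>N'\<close>.\<close>
  define p where "p g = z g * minv d (b g)" for g
  have bGL: "b g \<in> GL d" if "g \<in> carrier G" for g using b that by simp
  have aGL: "a g \<in> GL d" if "g \<in> carrier G" for g using a that by simp
  have pGL: "p g \<in> GL d" if "g \<in> carrier G" for g
    unfolding p_def by (rule GL_mult[OF z(1)[OF that] GL_minv[OF bGL[OF that]]])
  have pb: "p g * b g = z g" if "g \<in> carrier G" for g
    unfolding p_def using minv_cancel(4)[OF bGL[OF that] GL_Mat[OF z(1)[OF that]]] by simp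
  have xyp: "x g * y g * p g = a g" if g: "g \<in> carrier G" for g
  proof -
    have "x g * y g * p g = F g * minv d (b g)" unfolding p_def Fxyz[OF g] by (simp add: mult.assoc)
    then show ?thesis
      unfolding Fab[OF g] using minv_cancel(3)[OF bGL[OF g] GL_Mat[OF aGL[OF g]]] by simp
  qed
  have pA: "p g \<in> ?A'" "minv d (p g) \<in> ?A'" if g: "g \<in> carrier G" for g
  proof -
    have 1: "p g = minv d (y g) * (minv d (x g) * a g)"
    proof -
      have "minv d (x g) * a g = minv d (x g) * (x g * (y g * p g))"
        by (simp only: xyp[OF g, symmetric] mult.assoc)
      also have "\<dots> = y g * p g"
        using GL_Mat[OF GL_mult[OF y(1)[OF g] pGL[OF g]]] by (rule minv_cancel(2)[OF x(1)[OF g]])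
      finally show ?thesis
        using minv_cancel(2)[OF y(1)[OF g] GL_Mat[OF pGL[OF g]]] by simp
    qed
    show "p g \<in> ?A'"
      unfolding 1 using x[OF g] y[OF g] a[OF g] AA' by (intro span_mult[OF N']) auto
    have "minv d (p g) = minv d (a g) * (x g * y g)"
    proof (rule minv_unique[OF pGL[OF g]])
      have "minv d (a g) * (x g * y g) * p g = idm d"
        using minv(3)[OF aGL[OF g]] by (simp add: mult.assoc xyp[OF g, simplified mult.assoc])
      then show "p g * (minv d (a g) * (x g * y g)) = idm d \<or> minv d (a g) * (x g * y g) * p g = idm d"
        by simp
      show "minv d (a g) * (x g * y g) \<in> Mat d d"
        using GL_Mat[OF GL_mult[OF GL_minv[OF aGL[OF g]] GL_mult[OF x(1)[OF g] y(1)[OF g]]]] .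
    qed
    then show "minv d (p g) \<in> ?A'"
      using x[OF g] y[OF g] a[OF g] AA' by (simp only:) (intro span_mult[OF N'], auto)
  qed
  have pc: "p g * s = s * p g" if g: "g \<in> carrier G" and s: "s \<in> ?A" for g s
  proof -
    have "minv d (b g) * s = s * minv d (b g)"
      using b[OF g] s AA' by (intro minv_mult_commute[OF bGL[OF g] span_Mat[OF N s]]) auto
    then show ?thesis unfolding p_def using z(2)[OF g s] by (metis mult.assoc)
  qed
  \<comment> \<open>On \<open>N'\<close> the values of \<open>b\<close> lie in the algebra that they centralize; similarly for \<open>p\<close> on
    \<open>N\<close>.\<close>
  have b_scalar: "\<exists>c. c \<noteq> 0 \<and> b g = c *\<^sub>C idm d" if g: "g \<in> N'" for g
  proof -
    have gG: "g \<in> carrier G" using g NG' by auto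
    have "b g = minv d (a g) * F g"
      unfolding Fab[OF gG] using minv_cancel(2)[OF aGL[OF gG] GL_Mat[OF bGL[OF gG]]] by simp
    then have "b g \<in> ?A'"
      using a[OF gG] g by (simp only:) (intro span_mult[OF N'], auto intro: fm.span_base)
    then obtain c where "b g = c *\<^sub>C idm d" using span_center_scalar[OF N'] b[OF gG] by blast
    then show ?thesis using bGL[OF gG] scalar_nonzero by auto
  qed
  have p_scalar: "\<exists>c. c \<noteq> 0 \<and> p h = c *\<^sub>C idm d" if h: "h \<in> N" for h
  proof -
    have hG: "h \<in> carrier G" using h NG by auto
    obtain c where c: "c \<noteq> 0" "b h = c *\<^sub>C idm d" using b_scalar h NN' by blast
    have "F h = c *\<^sub>C a h" using Fab[OF hG] c GL_Mat[OF aGL[OF hG]] by simp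
    then have "a h = inverse c *\<^sub>C F h" using c by simp
    then have "a h \<in> ?A" using h by (auto intro: fm.span_scale fm.span_base)
    moreover have "p h = minv d (y h) * (minv d (x h) * a h)"
      unfolding xyp[OF hG, symmetric]
      using minv_cancel(2)[OF x(1)[OF hG] GL_Mat[OF GL_mult[OF y(1)[OF hG] pGL[OF hG]]]]
        minv_cancel(2)[OF y(1)[OF hG] GL_Mat[OF pGL[OF hG]]] by (simp add: mult.assoc)
    ultimately have "p h \<in> ?A"
      using x[OF hG] y[OF hG] by (simp only:) (intro span_mult[OF N], auto)
    then obtain c where "p h = c *\<^sub>C idm d" using span_center_scalar[OF N] pc[OF hG] by blast
    then show ?thesis using pGL[OF hG] scalar_nonzero by auto
  qed
  define x' where "x' g = x g * p g" for g
  have x'GL: "x' g \<in> GL d" if "g \<in> carrier G" for g unfolding x'_def using x pGL that by auto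
  have ybGL: "y g * b g \<in> GL d" if "g \<in> carrier G" for g using y bGL that by auto
  have x'y: "x' g * y h = y h * x' g" if "g \<in> carrier G" "h \<in> carrier G" for g h
    unfolding x'_def using xy[OF that] pc[OF that(1) y(2)[OF that(2)]] by (metis mult.assoc)
  have Fx': "F g = x' g * y g * b g" if g: "g \<in> carrier G" for g
  proof -
    have "x' g * y g * b g = x g * (p g * y g) * b g" by (simp add: x'_def mult.assoc)
    also have "\<dots> = x g * y g * (p g * b g)" by (simp add: pc[OF g y(2)[OF g]] mult.assoc)
    finally show ?thesis by (simp add: pb[OF g] Fxyz[OF g])
  qed
  have x'A: "x' g \<in> ?A'" "minv d (x' g) \<in> ?A'" if g: "g \<in> carrier G" for g
  proof -
    show "x' g \<in> ?A'" unfolding x'_def using x[OF g] pA[OF g] AA' by (intro span_mult[OF N']) auto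
    show "minv d (x' g) \<in> ?A'" unfolding x'_def minv_mult[OF x(1)[OF g] pGL[OF g]]
      using x[OF g] pA[OF g] AA' by (intro span_mult[OF N']) auto
  qed
  obtain \<beta>' where x'rep: "proj_rep G \<beta>' d x'"
  proof (rule proj_rep_of_commuting_factor[OF is_group F d sc, of x' "\<lambda>g. y g * b g"])
    fix g h assume gh: "g \<in> carrier G" "h \<in> carrier G"
    have "b h * x' g = x' g * b h" using b[OF gh(2)] x'A(1)[OF gh(1)] by simp
    then show "x' g * (y h * b h) = y h * b h * x' g" using x'y[OF gh] by (metis mult.assoc)
  qed (use x'GL ybGL Fx' in \<open>auto simp: mult.assoc\<close>)
  obtain \<beta> where xrep: "proj_rep G \<beta> d x"
  proof (rule proj_rep_of_commuting_factor[OF is_group F d sc, of x "\<lambda>g. y g * z g"])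
    fix g h assume gh: "g \<in> carrier G" "h \<in> carrier G"
    show "x g * (y h * z h) = y h * z h * x g"
      using xy[OF gh] z(2)[OF gh(2) x(2)[OF gh(1)]] by (metis mult.assoc)
  qed (use x y z Fxyz in \<open>auto simp: mult.assoc\<close>)
  let ?K = "H \<inter> N'"
  have K: "subgroup ?K G" using H NG'(1) by (rule subgroups_Inter_pair)
  have KG: "?K \<subseteq> carrier G" using NG'(2) by auto
  \<comment> \<open>Since \<open>p\<close> is scalar on \<open>N\<close>, the old span of \<open>x(H \<inter> N)\<close> is contained in this one, which
    therefore contains \<open>x(G)\<close> and \<open>p(K)\<close>.\<close>
  let ?D = "fm.span (x' ` ?K)"
  have Dmult: "s * t \<in> ?D" if "s \<in> ?D" "t \<in> ?D" for s t
    using proj_rep_span_mult[OF proj_rep_restrict[OF x'rep K]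
        subgroup.subgroup_is_group[OF K is_group], of s t] that by simp
  have "x h \<in> ?D" if h: "h \<in> H \<inter> N" for h
  proof -
    have hG: "h \<in> carrier G" using h NG by auto
    obtain c where c: "c \<noteq> 0" "p h = c *\<^sub>C idm d" using p_scalar h by blast
    then have "x' h = c *\<^sub>C x h" using GL_Mat[OF x(1)[OF hG]] by (simp add: x'_def)
    then have "x h = inverse c *\<^sub>C x' h" using c by simp
    then show ?thesis using h NN' by (auto intro: fm.span_scale fm.span_base)
  qed
  then have "fm.span (x ` (H \<inter> N)) \<subseteq> ?D" by (intro fm.span_minimal) auto
  then have xD: "x g \<in> ?D" if "g \<in> carrier G" for g using xH that by auto
  have pKD: "p h \<in> ?D" if h: "h \<in> ?K" for h
  proof -
    have hG: "h \<in> carrier G" using h KG by auto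
    obtain c where "minv d (x h) = c *\<^sub>C x (inv h)" using proj_rep_minv[OF xrep hG] by metis
    then have "minv d (x h) \<in> ?D" using xD[of "inv h"] hG by (simp add: fm.span_scale)
    moreover have "p h = minv d (x h) * x' h"
      unfolding x'_def using minv_cancel(2)[OF x(1)[OF hG] GL_Mat[OF pGL[OF hG]]] by simp
    ultimately show ?thesis using Dmult h by (auto intro: fm.span_base)
  qed
  \<comment> \<open>Averages over \<open>N\<close> of elements of the algebra of \<open>N'\<close> lie in the span of \<open>p\<close> on \<open>K\<close>, because
    \<open>N' = K N\<close>; on the values of \<open>p\<close> averaging is multiplication by the order of \<open>N\<close>.\<close>
  let ?P = "fm.span (p ` ?K)"
  let ?E = "avg (G\<lparr>carrier := N\<rparr>) d F"
  have E_lin: "?E (c *\<^sub>C s + t) = c *\<^sub>C ?E s + ?E t" for c s t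
    by (simp add: avg_def distrib_left distrib_right sum.distrib fm.scale_sum_right)
  have E_ap: "?E (s * p k) \<in> ?P" if s: "s \<in> ?A" and k: "k \<in> ?K" for s k
  proof -
    have kG: "k \<in> carrier G" using k KG by auto
    have "?E (s * p k) = ?E s * p k"
      using pc[OF kG] by (intro avg_mult_commuting) (auto intro: fm.span_base)
    moreover have "?E s \<in> ?A"
      unfolding avg_def
    proof (intro fm.span_sum span_mult[OF N] s)
      fix g assume "g \<in> carrier (G\<lparr>carrier := N\<rparr>)"
      then have g: "g \<in> N" "inv g \<in> N" "g \<in> carrier G" using NG(1,2) subgroup.m_inv_closed by auto
      obtain c where "minv d (F g) = c *\<^sub>C F (inv g)" using proj_rep_minv[OF F g(3)] by metis
      then show "minv d (F g) \<in> ?A" using g by (auto intro: fm.span_scale fm.span_base)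
      show "F g \<in> ?A" using g by (auto intro: fm.span_base)
    qed
    moreover have "?E s * F g = F g * ?E s" if "g \<in> N" for g
      using avg_commutes[OF NG(3,4) span_Mat[OF N s], of g] that by simp
    ultimately obtain c where "?E s = c *\<^sub>C idm d" "?E (s * p k) = ?E s * p k"
      using center[OF N, of "?E s"] by blast
    then have "?E (s * p k) = (c *\<^sub>C idm d) * p k" by simp
    then show ?thesis using GL_Mat[OF pGL[OF kG]] k by (auto intro: fm.span_scale fm.span_base)
  qed
  have E_A': "?E s \<in> ?P" if "s \<in> ?A'" for s
    using that
  proof (induction rule: fm.span_induct_alt)
    case base
    then show ?case by (simp add: avg_def fm.span_zero)
  next
    case (step c s t)
    then obtain n where n: "n \<in> N'" "s = F n" by auto
    then obtain k m where km: "k \<in> ?K" "m \<in> N" "n = k \<otimes> m" using cover by (auto simp: set_mult_def)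
    have kG: "k \<in> carrier G" and mG: "m \<in> carrier G" using km KG NG by auto
    obtain c' where c': "c' \<noteq> 0" "b k = c' *\<^sub>C idm d" using b_scalar[of k] km by auto
    have "F n = inverse (\<alpha> (k, m)) *\<^sub>C (F m * F k)"
      using proj_repD(3,4)[OF F kG mG] km(3) by simp
    also have "F k = c' *\<^sub>C (x k * y k * p k)"
      unfolding Fab[OF kG] xyp[OF kG] using c' GL_Mat[OF aGL[OF kG]] by simp
    also have "inverse (\<alpha> (k, m)) *\<^sub>C (F m * c' *\<^sub>C (x k * y k * p k))
        = ((inverse (\<alpha> (k, m)) * c') *\<^sub>C (F m * (x k * y k))) * p k"
      by (simp add: mult.assoc)
    finally have Fn: "F n = ((inverse (\<alpha> (k, m)) * c') *\<^sub>C (F m * (x k * y k))) * p k" .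
    have "(inverse (\<alpha> (k, m)) * c') *\<^sub>C (F m * (x k * y k)) \<in> ?A"
      using x[OF kG] y[OF kG] km by (intro fm.span_scale span_mult[OF N]) (auto intro: fm.span_base)
    then have "?E s \<in> ?P" unfolding n(2) Fn by (rule E_ap[OF _ km(1)])
    then show ?case using step.IH by (simp only: E_lin) (intro fm.span_add fm.span_scale)
  qed
  have pP: "p g \<in> ?P" if g: "g \<in> carrier G" for g
  proof -
    have "?E (p g) = of_nat (card (carrier (G\<lparr>carrier := N\<rparr>))) *\<^sub>C p g"
      using pc[OF g] by (intro avg_fixed[OF NG(4) GL_Mat[OF pGL[OF g]]]) (auto intro: fm.span_base)
    then have "of_nat (card N) *\<^sub>C p g \<in> ?P" using E_A'[OF pA(1)[OF g]] by simp
    then have "inverse (of_nat (card N)) *\<^sub>C (of_nat (card N) *\<^sub>C p g) \<in> ?P" by (rule fm.span_scale)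
    moreover have "card N \<noteq> 0" using NG(5) subgroup.one_closed[OF NG(1)] by auto
    ultimately show ?thesis by simp
  qed
  have "?P \<subseteq> ?D" using pKD by (intro fm.span_minimal) auto
  then have "x g * p g \<in> ?D" if "g \<in> carrier G" for g
    using xD[OF that] pP[OF that] by (intro Dmult) auto
  moreover have "x' g = x g * p g" for g by (simp add: x'_def)
  ultimately have "x' ` carrier G \<subseteq> ?D" by auto
  moreover have "y ` carrier G \<subseteq> fm.span (y ` (H' \<inter> N'))"
    using yH fm.span_mono[of "y ` (H' \<inter> N)" "y ` (H' \<inter> N')"] NN' by blast
  moreover have "y g \<in> ?A'" "minv d (y g) \<in> ?A'" if "g \<in> carrier G" for g
    using y[OF that] AA' by auto
  ultimately have "partial_factorization G d F N' H H' x' y b"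
    unfolding partial_factorization_def using x'GL x'A y(1) b x'y Fx' by simp
  then show ?thesis by (rule that)
qed

lemma partial_factorization_base: "partial_factorization G d F {\<one>} H H' (\<lambda>_. idm d) (\<lambda>_. idm d) F" if "\<one> \<in> H" "\<one> \<in> H'"
proof -
  have N: "{\<one>} \<lhd> G" by (rule one_is_normal)
  have "idm d \<in> fm.span (F ` {\<one>})"
    using proj_rep_idm_span[OF normal_subgroupD(4,3)[OF N]] by simp
  moreover have "F g * s = s * F g" if g: "g \<in> carrier G" and s: "s \<in> fm.span (F ` {\<one>})" for g s
    using proj_rep_one[OF F] proj_repD(2)[OF F g] by (intro commute_span[OF _ s]) simp
  moreover have "F g = idm d * idm d * F g" if "g \<in> carrier G" for g
    using proj_repD(2)[OF F that] by simp
  moreover have "(\<lambda>_. idm d) ` carrier G \<subseteq> fm.span ((\<lambda>_. idm d) ` (K \<inter> {\<one>}))" if "\<one> \<in> K" for K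
    using that by (auto intro!: fm.span_base)
  ultimately show ?thesis
    unfolding partial_factorization_def using that proj_repD(1)[OF F] by auto
qed

text \<open>At the top of the series the remainder is scalar and is absorbed into \<open>y\<close>. A step of
  the series extends \<open>x\<close> or \<open>y\<close> according to which of \<open>H\<close> and \<open>H'\<close> covers it.\<close>

theorem commuting_factorization:
  fixes N :: "nat \<Rightarrow> 'a set"
  assumes H: "subgroup H G" "subgroup H' G"
    and N: "N 0 = {\<one>}" "N l = carrier G" "\<And>i. i \<le> l \<Longrightarrow> N i \<lhd> G"
    and cover: "\<And>i. i < l \<Longrightarrow> N i \<subseteq> N (Suc i) \<and>
      (N (Suc i) \<subseteq> (H \<inter> N (Suc i)) <#> N i \<or> N (Suc i) \<subseteq> (H' \<inter> N (Suc i)) <#> N i)"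
  obtains x y where "\<forall>g\<in>carrier G. x g \<in> GL d" "\<forall>g\<in>carrier G. y g \<in> GL d"
    "\<forall>g\<in>carrier G. F g = x g * y g" "\<forall>g\<in>carrier G. \<forall>h\<in>carrier G. x g * y h = y h * x g"
    "x ` carrier G \<subseteq> fm.span (x ` H)" "y ` carrier G \<subseteq> fm.span (y ` H')"
proof -
  have "i \<le> l \<Longrightarrow> \<exists>x y z. partial_factorization G d F (N i) H H' x y z" for i
  proof (induction i)
    case 0
    then show ?case using partial_factorization_base subgroup.one_closed[OF H(1)] subgroup.one_closed[OF H(2)] N(1) by metis
  next
    case (Suc i)
    then obtain x y z where st: "partial_factorization G d F (N i) H H' x y z" by auto
    note n = N(3)[of i] N(3)[of "Suc i"] cover[of i]
    consider "N (Suc i) \<subseteq> (H \<inter> N (Suc i)) <#> N i" | "N (Suc i) \<subseteq> (H' \<inter> N (Suc i)) <#> N i"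
      using n(3) Suc by auto
    then show ?case
    proof cases
      case 1
      then show ?thesis using partial_factorization_step[OF _ _ _ H(1) 1 st] n Suc by (metis Suc_leD Suc_le_lessD)
    next
      case 2
      then obtain x' y' z' where "partial_factorization G d F (N (Suc i)) H' H x' y' z'"
        using partial_factorization_step[OF _ _ _ H(2) 2 partial_factorization_swap[OF st]] n Suc by (metis Suc_leD Suc_le_lessD)
      then show ?thesis using partial_factorization_swap by blast
    qed
  qed
  from this[of l] obtain x y z where "partial_factorization G d F (carrier G) H H' x y z" using N(2) by auto
  note st = this[unfolded partial_factorization_def]
  have "\<exists>c. c \<noteq> 0 \<and> z g = c *\<^sub>C idm d" if g: "g \<in> carrier G" for g
  proof -
    have zg: "z g \<in> GL d" "\<And>s. s \<in> fm.span (F ` carrier G) \<Longrightarrow> z g * s = s * z g" using st g by auto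
    have "z g * F h = F h * z g" if "h \<in> carrier G" for h
      using zg(2) that by (auto intro: fm.span_base)
    then obtain c where "z g = c *\<^sub>C idm d" using sc GL_Mat[OF zg(1)] unfolding scalar_commutant_def by blast
    then show ?thesis using zg(1) scalar_nonzero by auto
  qed
  then obtain c where c: "\<And>g. g \<in> carrier G \<Longrightarrow> c g \<noteq> 0 \<and> z g = c g *\<^sub>C idm d" by metis
  have HG: "H \<inter> carrier G = H" "H' \<inter> carrier G = H'" using H subgroup.subset by blast+
  define y' where "y' g = c g *\<^sub>C y g" for g
  have "y h \<in> fm.span (y' ` H')" if "h \<in> H'" for h
  proof -
    have "y h = inverse (c h) *\<^sub>C y' h" using c[of h] that subgroup.subset[OF H(2)] by (auto simp: y'_def)
    then show ?thesis using that by (auto intro: fm.span_scale fm.span_base)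
  qed
  then have "fm.span (y ` H') \<subseteq> fm.span (y' ` H')" by (intro fm.span_minimal) auto
  then have f6: "y' ` carrier G \<subseteq> fm.span (y' ` H')"
    using st HG by (auto simp: y'_def intro!: fm.span_scale)
  have f3: "\<forall>g\<in>carrier G. F g = x g * y' g"
  proof
    fix g assume g: "g \<in> carrier G"
    then have "x g \<in> GL d" "y g \<in> GL d" using st by blast+
    then have "x g * y g \<in> Mat d d" by (intro GL_Mat GL_mult)
    moreover have "F g = x g * y g * z g" using st g by blast
    ultimately show "F g = x g * y' g" using c[OF g] by (simp add: y'_def)
  qed
  have f2: "\<forall>g\<in>carrier G. y' g \<in> GL d" using st c by (auto simp: y'_def)
  have f4: "\<forall>g\<in>carrier G. \<forall>h\<in>carrier G. x g * y' h = y' h * x g" using st by (auto simp: y'_def)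
  have f1: "\<forall>g\<in>carrier G. x g \<in> GL d" and f5: "x ` carrier G \<subseteq> fm.span (x ` H)"
    using st HG by auto
  show ?thesis by (rule that[OF f1 f2 f3 f4 f5 f6])
qed

end

section \<open>The degree divides the group order\<close>

text \<open>The elements of \<open>S\<close> are the coordinates of an eigenvector, with eigenvalue \<open>r\<close>, of the
  integer matrix of the coefficients. So \<open>r\<close> is a root of the characteristic polynomial of
  that matrix.\<close>

lemma algebraic_int_of_finite_module:
  fixes r :: complex
  assumes fin: "finite S" and nz: "s0 \<in> S" "s0 \<noteq> 0"
    and act: "\<And>s. s \<in> S \<Longrightarrow> \<exists>f. r * s = (\<Sum>t\<in>S. of_int (f t) * t)"
  shows "algebraic_int r"
proof -
  define n where "n = card S"
  obtain b where b: "bij_betw b {..<n} S"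
    using ex_bij_betw_nat_finite[OF fin] by (metis atLeast0LessThan n_def)
  have bS: "b i \<in> S" if "i < n" for i using b that by (auto simp: bij_betw_def)
  obtain f where f: "\<And>s. s \<in> S \<Longrightarrow> r * s = (\<Sum>t\<in>S. of_int (f s t) * t)" using act by metis
  define M :: "int mat" where "M = mat n n (\<lambda>(i, j). f (b i) (b j))"
  define M' :: "complex mat" where "M' = map_mat of_int M"
  define v where "v = vec n b"
  have M: "M \<in> carrier_mat n n" and M': "M' \<in> carrier_mat n n" by (simp_all add: M_def M'_def)
  have "M' *\<^sub>v v = r \<cdot>\<^sub>v v"
  proof (rule eq_vecI)
    fix i assume "i < dim_vec (r \<cdot>\<^sub>v v)"
    then have i: "i < n" by (simp add: v_def)
    have "(M' *\<^sub>v v) $ i = (\<Sum>j<n. of_int (f (b i) (b j)) * b j)"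
      using i by (simp add: M'_def M_def v_def scalar_prod_def atLeast0LessThan)
    also have "\<dots> = (\<Sum>t\<in>S. of_int (f (b i) t) * t)" by (rule sum.reindex_bij_betw[OF b])
    also have "\<dots> = r * b i" using f[OF bS[OF i]] by simp
    finally show "(M' *\<^sub>v v) $ i = (r \<cdot>\<^sub>v v) $ i" using i by (simp add: v_def)
  qed (simp add: M'_def M_def v_def)
  moreover have "v \<noteq> 0\<^sub>v n"
  proof -
    obtain i where i: "i < n" "b i = s0" using b nz by (force simp: bij_betw_def)
    then show ?thesis using nz by (metis v_def index_vec index_zero_vec(1))
  qed
  moreover have "v \<in> carrier_vec n" by (simp add: v_def)
  ultimately have "eigenvalue M' r"
    using M' unfolding eigenvalue_def eigenvector_def by auto
  then have root: "poly (char_poly M') r = 0" using eigenvalue_root_char_poly[OF M'] by simp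
  have cp: "char_poly M' = map_poly of_int (char_poly M)"
    unfolding M'_def by (rule of_int_hom.char_poly_hom[OF M])
  show ?thesis
  proof (rule algebraic_int.intros)
    show "lead_coeff (char_poly M') = 1" using degree_monic_char_poly[OF M'] by simp
    show "\<forall>i. coeff (char_poly M') i \<in> \<int>" by (simp add: cp coeff_map_poly)
  qed (rule root)
qed

lemma exists_complex_root:
  assumes "0 < n" obtains z :: complex where "z ^ n = c"
proof (cases "c = 0")
  case True
  then show ?thesis using that[of 0] assms by simp
next
  case False
  then have "card {z::complex. z ^ n = c} = n" using assms by (intro card_nth_roots) auto
  then have "{z::complex. z ^ n = c} \<noteq> {}" using assms by (metis card.empty less_irrefl)
  then show ?thesis using that by blast
qed

definition mdet :: "nat \<Rightarrow> fmat \<Rightarrow> complex" where "mdet d A = det (to_mat d d A)"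

lemma mdet_mult: "A \<in> Mat d d \<Longrightarrow> B \<in> Mat d d \<Longrightarrow> mdet d (A * B) = mdet d A * mdet d B"
  by (simp add: mdet_def to_mat_mult[of A d d B d] det_mult[of _ d])

lemma mdet_scaleC: "mdet d (c *\<^sub>C A) = c ^ d * mdet d A"
  by (simp add: mdet_def to_mat_scaleC det_smult)

lemma mdet_nonzero: "A \<in> GL d \<Longrightarrow> mdet d A \<noteq> 0"
proof
  assume A: "A \<in> GL d" and "mdet d A = 0"
  then have "mdet d (A * minv d A) = 0" using minv(1) GL_Mat by (simp add: mdet_mult)
  then show False using minv(2)[OF A] by (simp add: mdet_def)
qed

text \<open>Determinants turn the cocycle relation of a representation of degree \<open>d\<close> into one
  exhibiting the \<open>d\<close>-th power of the cocycle as a coboundary.\<close>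

lemma cocycle_power_degree:
  assumes F: "proj_rep G \<alpha> d F" and g: "g \<in> carrier G" and h: "h \<in> carrier G"
    and gh: "g \<otimes>\<^bsub>G\<^esub> h \<in> carrier G"
  shows "mdet d (F h) * mdet d (F g) = \<alpha> (g, h) ^ d * mdet d (F (g \<otimes>\<^bsub>G\<^esub> h))"
  using proj_repD(4)[OF F g h] proj_repD(2)[OF F g] proj_repD(2)[OF F h]
  by (simp add: mdet_mult[symmetric] mdet_scaleC)

text \<open>After rescaling all matrices to determinant \<open>1\<close> the cocycle takes values in the \<open>d\<close>-th
  roots of unity. Let \<open>f\<close> be the matrix coefficient at \<open>(0, 0)\<close>. By the orthogonality
  relations \<open>|G|/d\<close> times \<open>f x * f y\<close> is the sum over all \<open>g\<close> of the products of the values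
  of \<open>f\<close> at \<open>x g\<inverse>\<close> and \<open>y g\<close>, up to roots of unity. Thus \<open>|G|/d\<close> maps a finite set into the
  integer combinations of its elements and is a rational algebraic integer.\<close>

theorem degree_dvd_order:
  assumes G: "group G" and fin: "finite (carrier G)" and F: "proj_rep G \<alpha> d F" and d: "0 < d"
    and sc: "scalar_commutant d (carrier G) F"
  shows "d dvd card (carrier G)"
proof -
  interpret group G by fact
  \<comment> \<open>\<open>c g\<close> rescales \<open>F g\<close> to determinant \<open>1\<close>\<close>
  have "\<exists>c. c ^ d = inverse (mdet d (F g))" for g using exists_complex_root[OF d] by metis
  then obtain c where c: "\<And>g. c g ^ d = inverse (mdet d (F g))" by metis
  have c0: "c g \<noteq> 0" if "g \<in> carrier G" for g
    using c[of g] mdet_nonzero[OF proj_repD(1)[OF F that]] d by (metis inverse_nonzero_iff_nonzero power_0_left not_gr_zero)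
  define E where "E g = c g *\<^sub>C F g" for g
  define \<epsilon> where "\<epsilon> = (\<lambda>(g, h). c g * c h * \<alpha> (g, h) / c (g \<otimes>\<^bsub>G\<^esub> h))"
  have E: "proj_rep G \<epsilon> d E"
    unfolding proj_rep_def
  proof (intro conjI ballI)
    fix g assume "g \<in> carrier G" then show "E g \<in> GL d"
      unfolding E_def using proj_repD(1)[OF F] c0 by auto
  next
    fix g h assume gh: "g \<in> carrier G" "h \<in> carrier G"
    then show "\<epsilon> (g, h) \<noteq> 0" using c0 proj_repD(3)[OF F] by (simp add: \<epsilon>_def)
    show "E h * E g = \<epsilon> (g, h) *\<^sub>C E (g \<otimes>\<^bsub>G\<^esub> h)"
      using c0[of "g \<otimes>\<^bsub>G\<^esub> h"] gh by (simp add: E_def \<epsilon>_def proj_repD(4)[OF F] mult_ac)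
  qed
  have detE: "mdet d (E g) = 1" if "g \<in> carrier G" for g
    unfolding E_def mdet_scaleC c using mdet_nonzero[OF proj_repD(1)[OF F that]] by simp
  have \<epsilon>d: "\<epsilon> (g, h) ^ d = 1" if "g \<in> carrier G" "h \<in> carrier G" for g h
    using cocycle_power_degree[OF E that] that detE by simp
  have scE: "scalar_commutant d (carrier G) E"
    unfolding scalar_commutant_def
  proof (intro ballI impI)
    fix M assume M: "M \<in> Mat d d" "\<forall>i\<in>carrier G. M * E i = E i * M"
    then have "M * F g = F g * M" if "g \<in> carrier G" for g
      using that c0[OF that] by (auto simp: E_def)
    then show "\<exists>c. M = c *\<^sub>C idm d" using sc M unfolding scalar_commutant_def by blast
  qed
  define r where "r = (of_nat (card (carrier G)) / of_nat d :: complex)"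
  define f where "f g = entry (E g) 0 0" for g
  \<comment> \<open>the finite set on which \<open>|G|/d\<close> acts with integer coefficients\<close>
  define S where "S = (\<lambda>(\<zeta>, x, y). \<zeta> * f x * f y) ` ({z::complex. z ^ d = 1} \<times> carrier G \<times> carrier G)"
  have finS: "finite S"
    unfolding S_def using fin d by (intro finite_imageI finite_cartesian_product finite_roots_unity) auto
  have SI: "\<zeta> * f x * f y \<in> S" if "\<zeta> ^ d = 1" "x \<in> carrier G" "y \<in> carrier G" for \<zeta> x y
    using that unfolding S_def by (intro image_eqI[of _ _ "(\<zeta>, x, y)"]) auto
  have key: "(\<Sum>g\<in>carrier G. entry (minv d (E g) * E x) 0 0 * entry (E g * E y) 0 0) = r * f x * f y"
    if x: "x \<in> carrier G" and y: "y \<in> carrier G" for x y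
  proof -
    note m = minv(1)[OF proj_repD(1)[OF E]] and M = proj_repD(2)[OF E]
    have "(\<Sum>g\<in>carrier G. entry (minv d (E g) * E x) 0 0 * entry (E g * E y) 0 0)
        = (\<Sum>g\<in>carrier G. \<Sum>b<d. \<Sum>e<d. entry (E x) b 0 * entry (E y) e 0 *
            (entry (minv d (E g)) 0 b * entry (E g) 0 e))"
      by (intro sum.cong refl, simp only: entry_mult_Mat[OF m] entry_mult_Mat[OF M] sum_product,
          intro sum.cong refl, simp only: mult_ac)
    also have "\<dots> = (\<Sum>b<d. \<Sum>e<d. \<Sum>g\<in>carrier G. entry (E x) b 0 * entry (E y) e 0 *
            (entry (minv d (E g)) 0 b * entry (E g) 0 e))"
      by (subst sum.swap, intro sum.cong refl, subst sum.swap, intro sum.cong refl)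
    also have "\<dots> = (\<Sum>b<d. \<Sum>e<d. if e = 0 then (if b = 0 then r * entry (E x) b 0 * entry (E y) e 0 else 0) else 0)"
      by (intro sum.cong refl, subst sum_distrib_left[symmetric], subst schur_orthogonality[OF G E d scE])
        (auto simp: r_def)
    also have "\<dots> = r * f x * f y" using d by (simp add: sum.delta f_def)
    finally show ?thesis .
  qed
  have "algebraic_int r"
  proof (rule algebraic_int_of_finite_module[OF finS])
    have "E \<one>\<^bsub>G\<^esub> = \<epsilon> (\<one>\<^bsub>G\<^esub>, \<one>\<^bsub>G\<^esub>) *\<^sub>C idm d" by (rule proj_rep_one[OF E])
    then have "f \<one>\<^bsub>G\<^esub> \<noteq> 0" using d proj_repD(3)[OF E] by (simp add: f_def)
    then show "1 * f \<one>\<^bsub>G\<^esub> * f \<one>\<^bsub>G\<^esub> \<noteq> 0" by simp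
    show "1 * f \<one>\<^bsub>G\<^esub> * f \<one>\<^bsub>G\<^esub> \<in> S" by (rule SI) auto
  next
    fix s assume "s \<in> S"
    then obtain \<zeta> x y where z: "\<zeta> ^ d = 1" and x: "x \<in> carrier G" and y: "y \<in> carrier G"
      and s: "s = \<zeta> * f x * f y" unfolding S_def by auto
    define t where "t g = \<zeta> * (entry (minv d (E g) * E x) 0 0 * entry (E g * E y) 0 0)" for g
    have tS: "t g \<in> S" if g: "g \<in> carrier G" for g
    proof -
      let ?w = "x \<otimes>\<^bsub>G\<^esub> inv\<^bsub>G\<^esub> g"
      have w: "?w \<in> carrier G" "?w \<otimes>\<^bsub>G\<^esub> g = x" using x g by (simp_all add: m_assoc)
      have "E x = inverse (\<epsilon> (?w, g)) *\<^sub>C (E g * E ?w)"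
        using proj_repD(3,4)[OF E w(1) g] w(2) by simp
      then have "minv d (E g) * E x = inverse (\<epsilon> (?w, g)) *\<^sub>C E ?w"
        using minv_cancel(2)[OF proj_repD(1)[OF E g] proj_repD(2)[OF E w(1)]] by simp
      moreover have "E g * E y = \<epsilon> (y, g) *\<^sub>C E (y \<otimes>\<^bsub>G\<^esub> g)" by (rule proj_repD(4)[OF E y g])
      ultimately have "t g = (\<zeta> * (inverse (\<epsilon> (?w, g)) * \<epsilon> (y, g))) * f ?w * f (y \<otimes>\<^bsub>G\<^esub> g)"
        by (simp add: t_def f_def)
      moreover have "(\<zeta> * (inverse (\<epsilon> (?w, g)) * \<epsilon> (y, g))) ^ d = 1"
        using z \<epsilon>d[OF w(1) g] \<epsilon>d[OF y g] by (simp add: power_mult_distrib power_inverse)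
      ultimately show ?thesis using SI w(1) y g by (simp only:) simp
    qed
    have "r * s = (\<Sum>g\<in>carrier G. t g)"
      unfolding t_def sum_distrib_left[symmetric] key[OF x y] s by simp
    also have "\<dots> = (\<Sum>r\<in>S. \<Sum>g\<in>{g \<in> carrier G. t g = r}. t g)"
      using fin finS tS by (intro sum.group[symmetric]) auto
    also have "\<dots> = (\<Sum>r\<in>S. of_int (int (card {g \<in> carrier G. t g = r})) * r)"
      by (intro sum.cong refl) simp
    finally show "\<exists>f. r * s = (\<Sum>t\<in>S. of_int (f t) * t)"
      by (rule exI[of _ "\<lambda>q. int (card {g \<in> carrier G. t g = q})"])
  qed
  moreover have "r \<in> \<rat>" unfolding r_def by (intro Rats_divide) auto
  ultimately have "r \<in> \<int>" by (rule rational_algebraic_int_is_int)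
  then obtain k where "r = of_int k" by (auto elim: Ints_cases)
  then have "of_int (int (card (carrier G))) = (of_int (k * int d) :: complex)"
    using d by (simp add: r_def field_simps)
  then have "int (card (carrier G)) = k * int d" by (simp only: of_int_eq_iff)
  then have "int d dvd int (card (carrier G))" by simp
  then show ?thesis by (simp only: int_dvd_int_iff)
qed

section \<open>Hall subgroups and normal series\<close>

text \<open>The fibres of the multiplication map on \<open>A \<times> B\<close> are in bijection with \<open>A \<inter> B\<close>.\<close>

lemma (in group) card_set_mult_subgroups:
  assumes A: "subgroup A G" and B: "subgroup B G" and fin: "finite (carrier G)"
  shows "card (A <#> B) * card (A \<inter> B) = card A * card B"
proof -
  note AG = subgroup.subset[OF A] and BG = subgroup.subset[OF B]
  have fA: "finite A" and fB: "finite B" using AG BG fin finite_subset by auto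
  have AB: "A <#> B = (\<lambda>(a, b). a \<otimes> b) ` (A \<times> B)" by (auto simp: set_mult_def)
  have fAB: "finite (A <#> B)" unfolding AB using fA fB by auto
  have fiber: "card {q \<in> A \<times> B. fst q \<otimes> snd q = x} = card (A \<inter> B)" if x: "x \<in> A <#> B" for x
  proof -
    obtain a b where ab: "a \<in> A" "b \<in> B" "x = a \<otimes> b" using x by (auto simp: set_mult_def)
    have abG: "a \<in> carrier G" "b \<in> carrier G" using ab AG BG by auto
    have "bij_betw (\<lambda>c. (a \<otimes> c, inv c \<otimes> b)) (A \<inter> B) {q \<in> A \<times> B. fst q \<otimes> snd q = x}"
    proof (rule bij_betwI[of _ _ _ "\<lambda>q. inv a \<otimes> fst q"])
      show "(\<lambda>c. (a \<otimes> c, inv c \<otimes> b)) \<in> A \<inter> B \<rightarrow> {q \<in> A \<times> B. fst q \<otimes> snd q = x}"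
      proof
        fix c assume c: "c \<in> A \<inter> B"
        then have cG: "c \<in> carrier G" using AG by auto
        have "c \<otimes> (inv c \<otimes> b) = b"
          using abG cG by (simp add: m_assoc[symmetric])
        then have "a \<otimes> c \<otimes> (inv c \<otimes> b) = a \<otimes> b"
          using abG cG by (simp add: m_assoc)
        then show "(a \<otimes> c, inv c \<otimes> b) \<in> {q \<in> A \<times> B. fst q \<otimes> snd q = x}"
          using c ab abG cG A B by (auto simp: subgroup.m_closed subgroup.m_inv_closed)
      qed
      show "(\<lambda>q. inv a \<otimes> fst q) \<in> {q \<in> A \<times> B. fst q \<otimes> snd q = x} \<rightarrow> A \<inter> B"
      proof
        fix q assume "q \<in> {q \<in> A \<times> B. fst q \<otimes> snd q = x}"
        then obtain a' b' where q: "q = (a', b')" "a' \<in> A" "b' \<in> B" "a' \<otimes> b' = a \<otimes> b" using ab by auto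
        have G': "a' \<in> carrier G" "b' \<in> carrier G" using q AG BG by auto
        have "inv a \<otimes> a' = inv a \<otimes> (a' \<otimes> b') \<otimes> inv b'" using G' abG by (simp add: m_assoc)
        also have "\<dots> = b \<otimes> inv b'" using G' abG by (simp add: q(4) m_assoc[symmetric])
        finally have "inv a \<otimes> a' \<in> B" using B ab q by (simp add: subgroup.m_closed subgroup.m_inv_closed)
        then show "inv a \<otimes> fst q \<in> A \<inter> B"
          using A ab q by (simp add: subgroup.m_closed subgroup.m_inv_closed)
      qed
    next
      fix c assume "c \<in> A \<inter> B"
      then show "inv a \<otimes> fst (a \<otimes> c, inv c \<otimes> b) = c" using AG abG by (auto simp: m_assoc[symmetric])
    next
      fix q assume "q \<in> {q \<in> A \<times> B. fst q \<otimes> snd q = x}"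
      then obtain a' b' where q: "q = (a', b')" "a' \<in> A" "b' \<in> B" "a' \<otimes> b' = a \<otimes> b" using ab by auto
      have G': "a' \<in> carrier G" "b' \<in> carrier G" using q AG BG by auto
      have "inv (inv a \<otimes> a') \<otimes> b = inv a' \<otimes> (a \<otimes> b)" using G' abG by (simp add: inv_mult_group m_assoc)
      also have "\<dots> = b'" using G' by (simp add: q(4)[symmetric] m_assoc[symmetric])
      finally show "(a \<otimes> (inv a \<otimes> fst q), inv (inv a \<otimes> fst q) \<otimes> b) = q"
        using q G' abG by (simp add: m_assoc[symmetric])
    qed
    then show ?thesis by (simp add: bij_betw_same_card)
  qed
  have "card A * card B = card (A \<times> B)" by (simp add: card_cartesian_product)
  also have "\<dots> = (\<Sum>q\<in>A \<times> B. 1)" by simp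
  also have "\<dots> = (\<Sum>x\<in>A <#> B. \<Sum>q\<in>{q \<in> A \<times> B. fst q \<otimes> snd q = x}. 1)"
    using fA fB fAB by (intro sum.group[symmetric]) (auto simp: AB)
  also have "\<dots> = (\<Sum>x\<in>A <#> B. card (A \<inter> B))" using fiber by (intro sum.cong refl) simp
  finally show ?thesis by simp
qed

lemma (in group) card_subgroup_dvd:
  assumes A: "subgroup A G" and B: "subgroup B G" and "A \<subseteq> B"
  shows "card A dvd card B"
proof -
  interpret B: group "G\<lparr>carrier := B\<rparr>" by (rule subgroup.subgroup_is_group[OF B is_group])
  have "subgroup A (G\<lparr>carrier := B\<rparr>)" using subgroup_incl[OF A B \<open>A \<subseteq> B\<close>] .
  from B.lagrange[OF this] show ?thesis by (simp add: Coset.order_def) (metis dvd_triv_right)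
qed

text \<open>For \<open>R = M H\<close> the number \<open>q = |N : N \<inter> R|\<close> is also \<open>|N R : R|\<close>, so it divides the
  index of \<open>H\<close>; it divides \<open>|N : M|\<close> as well. Coprimality gives \<open>q = 1\<close>, that is \<open>N \<subseteq> M H\<close>,
  and the claim is Dedekind's law.\<close>

lemma (in group) coprime_index_covers:
  assumes fin: "finite (carrier G)" and H: "subgroup H G"
    and M: "M \<lhd> G" and N: "N \<lhd> G" and MN: "M \<subseteq> N"
    and cop: "coprime (card (rcosets H)) (Coset.order (G\<lparr>carrier := N\<rparr> Mod M))"
  shows "N \<subseteq> (H \<inter> N) <#> M"
proof -
  have Ms: "subgroup M G" and Ns: "subgroup N G" using M N normal_imp_subgroup by auto
  note HG = subgroup.subset[OF H] and MG = subgroup.subset[OF Ms] and NG = subgroup.subset[OF Ns]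
  define R where "R = M <#> H"
  have R: "subgroup R G" unfolding R_def by (rule mult_norm_subgroup[OF M H])
  define S where "S = N <#> R"
  have S: "subgroup S G" unfolding S_def by (rule mult_norm_subgroup[OF N R])
  have HR: "H \<subseteq> R"
  proof
    fix h assume "h \<in> H"
    then have "h = \<one> \<otimes> h" using HG by auto
    then show "h \<in> R" unfolding R_def set_mult_def using \<open>h \<in> H\<close> subgroup.one_closed[OF Ms] by blast
  qed
  have MR: "M \<subseteq> R"
  proof
    fix m assume "m \<in> M"
    then have "m = m \<otimes> \<one>" using MG by auto
    then show "m \<in> R" unfolding R_def set_mult_def using \<open>m \<in> M\<close> subgroup.one_closed[OF H] by blast
  qed
  have NR: "subgroup (N \<inter> R) G" by (rule subgroups_Inter_pair[OF Ns R])
  have pos: "0 < card A" if "subgroup A G" for A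
    using subgroup.finite_imp_card_positive[OF that fin] .
  obtain r where r: "card R = card H * r" using card_subgroup_dvd[OF H R HR] by (auto elim: dvdE)
  obtain s where s: "card (N \<inter> R) = card M * s"
    using card_subgroup_dvd[OF Ms NR Int_greatest[OF MN MR]] by (auto elim: dvdE)
  obtain q where q: "card N = card (N \<inter> R) * q"
    using card_subgroup_dvd[OF NR Ns] by (auto elim: dvdE)
  obtain t where t: "card (carrier G) = card S * t"
    using card_subgroup_dvd[OF S subgroup_self subgroup.subset[OF S]] by (auto elim: dvdE)
  have "card S * card (N \<inter> R) = card N * card R"
    unfolding S_def by (rule card_set_mult_subgroups[OF Ns R fin])
  then have Sq: "card S = q * card R" using q pos[OF NR] by simp
  have "card (rcosets H) * card H = card (carrier G)" using lagrange[OF H] by (simp add: Coset.order_def)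
  then have idx: "card (rcosets H) = r * q * t" using t Sq r pos[OF H] by simp
  have "card (rcosets\<^bsub>G\<lparr>carrier := N\<rparr>\<^esub> M) * card M = card N"
  proof -
    interpret N: group "G\<lparr>carrier := N\<rparr>" by (rule subgroup.subgroup_is_group[OF Ns is_group])
    have "subgroup M (G\<lparr>carrier := N\<rparr>)" using subgroup_incl[OF Ms Ns MN] .
    from N.lagrange[OF this] show ?thesis by (simp add: Coset.order_def)
  qed
  then have "Coset.order (G\<lparr>carrier := N\<rparr> Mod M) * card M = s * q * card M"
    using q s by (simp add: Coset.order_def FactGroup_def mult_ac)
  then have "Coset.order (G\<lparr>carrier := N\<rparr> Mod M) = s * q" using pos[OF Ms] by simp
  then have "coprime (r * q * t) (s * q)" using cop idx by simp
  then have "coprime q q" by (meson coprime_mult_left_iff coprime_mult_right_iff)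
  then have "q = 1" by simp
  then have "card (N \<inter> R) = card N" using q by simp
  then have "N \<inter> R = N" using NG fin by (intro card_subset_eq) (auto intro: finite_subset)
  show ?thesis
  proof
    fix n assume n: "n \<in> N"
    then have "n \<in> R" using \<open>N \<inter> R = N\<close> by auto
    then obtain m h where mh: "m \<in> M" "h \<in> H" "n = m \<otimes> h" by (auto simp: R_def set_mult_def)
    have G': "m \<in> carrier G" "h \<in> carrier G" using mh MG HG by auto
    have "h = inv m \<otimes> n" using G' mh by (simp add: m_assoc[symmetric])
    moreover have "inv m \<otimes> n \<in> N"
      using n mh(1) MN by (intro subgroup.m_closed[OF Ns] subgroup.m_inv_closed[OF Ns]) auto
    ultimately have "h \<in> N" by simp
    moreover have "inv h \<otimes> m \<otimes> h \<in> M" by (rule normal.inv_op_closed1[OF M G'(2) mh(1)])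
    moreover have "n = h \<otimes> (inv h \<otimes> m \<otimes> h)" using G' mh by (simp add: m_assoc[symmetric])
    ultimately show "n \<in> (H \<inter> N) <#> M" using mh unfolding set_mult_def by blast
  qed
qed

section \<open>Induced modules\<close>

lemma complex_vectorspace:
  assumes "abelian_group V"
    and "\<And>a v. v \<in> carrier V \<Longrightarrow> a \<odot>\<^bsub>V\<^esub> v \<in> carrier V"
    and "\<And>a b v. v \<in> carrier V \<Longrightarrow> (a + b) \<odot>\<^bsub>V\<^esub> v = a \<odot>\<^bsub>V\<^esub> v \<oplus>\<^bsub>V\<^esub> b \<odot>\<^bsub>V\<^esub> v"
    and "\<And>a v w. v \<in> carrier V \<Longrightarrow> w \<in> carrier V \<Longrightarrow> a \<odot>\<^bsub>V\<^esub> (v \<oplus>\<^bsub>V\<^esub> w) = a \<odot>\<^bsub>V\<^esub> v \<oplus>\<^bsub>V\<^esub> a \<odot>\<^bsub>V\<^esub> w"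
    and "\<And>a b v. v \<in> carrier V \<Longrightarrow> (a * b) \<odot>\<^bsub>V\<^esub> v = a \<odot>\<^bsub>V\<^esub> (b \<odot>\<^bsub>V\<^esub> v)"
    and "\<And>v. v \<in> carrier V \<Longrightarrow> 1 \<odot>\<^bsub>V\<^esub> v = v"
  shows "vectorspace complex_field V"
proof -
  interpret V: abelian_group V by fact
  show ?thesis
    by unfold_locales (use assms in \<open>auto simp: class_ring_simps\<close>)
qed

lemma complex_vectorspaceD:
  assumes "vectorspace complex_field V"
  shows "abelian_group V"
    "v \<in> carrier V \<Longrightarrow> a \<odot>\<^bsub>V\<^esub> v \<in> carrier V"
    "v \<in> carrier V \<Longrightarrow> (a + b) \<odot>\<^bsub>V\<^esub> v = a \<odot>\<^bsub>V\<^esub> v \<oplus>\<^bsub>V\<^esub> b \<odot>\<^bsub>V\<^esub> v"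
    "v \<in> carrier V \<Longrightarrow> w \<in> carrier V \<Longrightarrow> a \<odot>\<^bsub>V\<^esub> (v \<oplus>\<^bsub>V\<^esub> w) = a \<odot>\<^bsub>V\<^esub> v \<oplus>\<^bsub>V\<^esub> a \<odot>\<^bsub>V\<^esub> w"
    "v \<in> carrier V \<Longrightarrow> (a * b) \<odot>\<^bsub>V\<^esub> v = a \<odot>\<^bsub>V\<^esub> (b \<odot>\<^bsub>V\<^esub> v)"
    "v \<in> carrier V \<Longrightarrow> 1 \<odot>\<^bsub>V\<^esub> v = v"
    "v \<in> carrier V \<Longrightarrow> 0 \<odot>\<^bsub>V\<^esub> v = \<zero>\<^bsub>V\<^esub>"
proof -
  interpret V: vectorspace complex_field V by fact
  show "abelian_group V" by unfold_locales
  show "v \<in> carrier V \<Longrightarrow> a \<odot>\<^bsub>V\<^esub> v \<in> carrier V"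
    "v \<in> carrier V \<Longrightarrow> (a + b) \<odot>\<^bsub>V\<^esub> v = a \<odot>\<^bsub>V\<^esub> v \<oplus>\<^bsub>V\<^esub> b \<odot>\<^bsub>V\<^esub> v"
    "v \<in> carrier V \<Longrightarrow> w \<in> carrier V \<Longrightarrow> a \<odot>\<^bsub>V\<^esub> (v \<oplus>\<^bsub>V\<^esub> w) = a \<odot>\<^bsub>V\<^esub> v \<oplus>\<^bsub>V\<^esub> a \<odot>\<^bsub>V\<^esub> w"
    "v \<in> carrier V \<Longrightarrow> (a * b) \<odot>\<^bsub>V\<^esub> v = a \<odot>\<^bsub>V\<^esub> (b \<odot>\<^bsub>V\<^esub> v)"
    "v \<in> carrier V \<Longrightarrow> 1 \<odot>\<^bsub>V\<^esub> v = v"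
    "v \<in> carrier V \<Longrightarrow> 0 \<odot>\<^bsub>V\<^esub> v = \<zero>\<^bsub>V\<^esub>"
    using V.smult_closed V.smult_l_distr V.smult_r_distr V.smult_assoc1 V.smult_one V.lmult_0
    by (auto simp: class_ring_simps)
qed

lemma linear_mapI:
  assumes "vectorspace complex_field V" "vectorspace complex_field W"
    and "\<And>v. v \<in> carrier V \<Longrightarrow> f v \<in> carrier W"
    and "\<And>v w. v \<in> carrier V \<Longrightarrow> w \<in> carrier V \<Longrightarrow> f (v \<oplus>\<^bsub>V\<^esub> w) = f v \<oplus>\<^bsub>W\<^esub> f w"
    and "\<And>a v. v \<in> carrier V \<Longrightarrow> f (a \<odot>\<^bsub>V\<^esub> v) = a \<odot>\<^bsub>W\<^esub> f v"
  shows "linear_map complex_field V W f"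
proof -
  interpret V: vectorspace complex_field V by fact
  interpret W: vectorspace complex_field W by fact
  show ?thesis
    by unfold_locales (use assms in \<open>auto simp: module_hom_def class_ring_simps\<close>)
qed

lemma linear_mapD:
  assumes "linear_map complex_field V W f"
  shows "vectorspace complex_field V" "vectorspace complex_field W"
    "v \<in> carrier V \<Longrightarrow> f v \<in> carrier W"
    "v \<in> carrier V \<Longrightarrow> w \<in> carrier V \<Longrightarrow> f (v \<oplus>\<^bsub>V\<^esub> w) = f v \<oplus>\<^bsub>W\<^esub> f w"
    "v \<in> carrier V \<Longrightarrow> f (a \<odot>\<^bsub>V\<^esub> v) = a \<odot>\<^bsub>W\<^esub> f v"
    "f \<zero>\<^bsub>V\<^esub> = \<zero>\<^bsub>W\<^esub>"
proof -
  interpret linear_map complex_field V W f by fact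
  show "vectorspace complex_field V" "vectorspace complex_field W" by unfold_locales
  show "v \<in> carrier V \<Longrightarrow> f v \<in> carrier W"
    "v \<in> carrier V \<Longrightarrow> w \<in> carrier V \<Longrightarrow> f (v \<oplus>\<^bsub>V\<^esub> w) = f v \<oplus>\<^bsub>W\<^esub> f w"
    "v \<in> carrier V \<Longrightarrow> f (a \<odot>\<^bsub>V\<^esub> v) = a \<odot>\<^bsub>W\<^esub> f v"
    "f \<zero>\<^bsub>V\<^esub> = \<zero>\<^bsub>W\<^esub>"
    using f_hom by (auto simp: module_hom_def class_ring_simps)
qed

lemma linear_map_comp:
  assumes "linear_map complex_field U V f" "linear_map complex_field V W g"
  shows "linear_map complex_field U W (\<lambda>x. g (f x))"
  by (rule linear_mapI) (use linear_mapD[OF assms(1)] linear_mapD[OF assms(2)] in auto)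

text \<open>Only \<open>V\<close> is assumed to be a vector space: the operations of \<open>Q\<close> inherit the axioms
  along \<open>h\<close>.\<close>

lemma transport_vectorspace:
  assumes V: "vectorspace complex_field V" and h: "bij_betw h (carrier V) (carrier Q)"
    and add: "\<And>v w. v \<in> carrier V \<Longrightarrow> w \<in> carrier V \<Longrightarrow> h v \<oplus>\<^bsub>Q\<^esub> h w = h (v \<oplus>\<^bsub>V\<^esub> w)"
    and smult: "\<And>a v. v \<in> carrier V \<Longrightarrow> a \<odot>\<^bsub>Q\<^esub> h v = h (a \<odot>\<^bsub>V\<^esub> v)"
    and zero: "\<zero>\<^bsub>Q\<^esub> = h \<zero>\<^bsub>V\<^esub>"
  shows "linear_map complex_field V Q h"
proof -
  interpret V: abelian_group V by (rule complex_vectorspaceD(1)[OF V])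
  note vs = complex_vectorspaceD[OF V]
  have Q: "\<exists>v\<in>carrier V. x = h v" if "x \<in> carrier Q" for x
    using that h by (auto simp: bij_betw_def)
  have hQ: "h v \<in> carrier Q" if "v \<in> carrier V" for v using that h by (auto simp: bij_betw_def)
  have "abelian_group Q"
  proof (rule abelian_groupI)
    fix x y z assume "x \<in> carrier Q" "y \<in> carrier Q" "z \<in> carrier Q"
    then obtain u v w where [simp]: "u \<in> carrier V" "x = h u" "v \<in> carrier V" "y = h v" "w \<in> carrier V" "z = h w"
      using Q by metis
    show "x \<oplus>\<^bsub>Q\<^esub> y \<oplus>\<^bsub>Q\<^esub> z = x \<oplus>\<^bsub>Q\<^esub> (y \<oplus>\<^bsub>Q\<^esub> z)" by (simp add: add V.a_assoc)
  next
    fix x y assume "x \<in> carrier Q" "y \<in> carrier Q"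
    then obtain u v where [simp]: "u \<in> carrier V" "x = h u" "v \<in> carrier V" "y = h v"
      using Q by metis
    show "x \<oplus>\<^bsub>Q\<^esub> y = y \<oplus>\<^bsub>Q\<^esub> x" by (simp add: add V.a_comm)
    show "x \<oplus>\<^bsub>Q\<^esub> y \<in> carrier Q" by (simp add: add hQ)
  next
    fix x assume "x \<in> carrier Q"
    then obtain u where u: "u \<in> carrier V" "x = h u" using Q by metis
    then show "\<zero>\<^bsub>Q\<^esub> \<oplus>\<^bsub>Q\<^esub> x = x" by (simp add: zero add)
    show "\<exists>y\<in>carrier Q. y \<oplus>\<^bsub>Q\<^esub> x = \<zero>\<^bsub>Q\<^esub>"
      by (rule bexI[of _ "h (\<ominus>\<^bsub>V\<^esub> u)"]) (use u in \<open>auto simp: zero add hQ V.l_neg\<close>)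
  qed (simp add: zero hQ)
  then have "vectorspace complex_field Q"
  proof (rule complex_vectorspace)
    fix a b v assume "v \<in> carrier Q"
    then obtain u where [simp]: "u \<in> carrier V" "v = h u" using Q by metis
    show "a \<odot>\<^bsub>Q\<^esub> v \<in> carrier Q" by (simp add: smult vs hQ)
    show "(a + b) \<odot>\<^bsub>Q\<^esub> v = a \<odot>\<^bsub>Q\<^esub> v \<oplus>\<^bsub>Q\<^esub> b \<odot>\<^bsub>Q\<^esub> v" by (simp add: smult vs add)
    show "(a * b) \<odot>\<^bsub>Q\<^esub> v = a \<odot>\<^bsub>Q\<^esub> (b \<odot>\<^bsub>Q\<^esub> v)" by (simp add: smult vs add)
    show "1 \<odot>\<^bsub>Q\<^esub> v = v" by (simp add: smult vs)
  next
    fix a v w assume "v \<in> carrier Q" "w \<in> carrier Q"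
    then obtain x y where [simp]: "x \<in> carrier V" "v = h x" "y \<in> carrier V" "w = h y" using Q by metis
    show "a \<odot>\<^bsub>Q\<^esub> (v \<oplus>\<^bsub>Q\<^esub> w) = a \<odot>\<^bsub>Q\<^esub> v \<oplus>\<^bsub>Q\<^esub> a \<odot>\<^bsub>Q\<^esub> w" by (simp add: smult vs add)
  qed
  then show ?thesis using V by (intro linear_mapI) (auto simp: hQ add smult)
qed

text \<open>The cosets of the kernel are the fibres of \<open>\<Phi>\<close>. Applied to the tensor space, this
  turns the description of an induced module as a quotient into a statement about a map on
  the tensor space.\<close>

lemma quotient_space_iso:
  assumes lin: "linear_map complex_field T V \<Phi>" and surj: "\<Phi> ` carrier T = carrier V"
    and N: "N = {f \<in> carrier T. \<Phi> f = \<zero>\<^bsub>V\<^esub>}"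
  shows "linear_map complex_field V (quotient_space T N) (\<lambda>v. {f \<in> carrier T. \<Phi> f = v})"
    "bij_betw (\<lambda>v. {f \<in> carrier T. \<Phi> f = v}) (carrier V) (carrier (quotient_space T N))"
proof -
  note L = linear_mapD[OF lin]
  interpret T: abelian_group T by (rule complex_vectorspaceD(1)[OF L(1)])
  interpret V: abelian_group V by (rule complex_vectorspaceD(1)[OF L(2)])
  note vT = complex_vectorspaceD[OF L(1)] and vV = complex_vectorspaceD[OF L(2)]
  define h where "h v = {f \<in> carrier T. \<Phi> f = v}" for v
  have diff: "\<Phi> (f \<ominus>\<^bsub>T\<^esub> g) = \<Phi> f \<ominus>\<^bsub>V\<^esub> \<Phi> g" if f: "f \<in> carrier T" and g: "g \<in> carrier T" for f g
  proof -
    have "\<Phi> (f \<ominus>\<^bsub>T\<^esub> g) \<oplus>\<^bsub>V\<^esub> \<Phi> g = \<Phi> (f \<ominus>\<^bsub>T\<^esub> g \<oplus>\<^bsub>T\<^esub> g)" using f g by (simp add: L(4))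
    also have "f \<ominus>\<^bsub>T\<^esub> g \<oplus>\<^bsub>T\<^esub> g = f" using f g by (simp add: a_minus_def T.a_assoc T.l_neg)
    finally have "\<Phi> (f \<ominus>\<^bsub>T\<^esub> g) \<oplus>\<^bsub>V\<^esub> \<Phi> g \<oplus>\<^bsub>V\<^esub> \<ominus>\<^bsub>V\<^esub> \<Phi> g = \<Phi> f \<oplus>\<^bsub>V\<^esub> \<ominus>\<^bsub>V\<^esub> \<Phi> g" by simp
    then show ?thesis using f g L(3) by (simp add: a_minus_def V.a_assoc V.r_neg)
  qed
  have coset: "N +>\<^bsub>T\<^esub> f = h (\<Phi> f)" if f: "f \<in> carrier T" for f
  proof
    show "N +>\<^bsub>T\<^esub> f \<subseteq> h (\<Phi> f)" using f L(3) by (auto simp: a_r_coset_def' N h_def L(4))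
    show "h (\<Phi> f) \<subseteq> N +>\<^bsub>T\<^esub> f"
    proof
      fix g assume g: "g \<in> h (\<Phi> f)"
      then have "g \<ominus>\<^bsub>T\<^esub> f \<in> N" using f L(3) by (simp add: N h_def diff)
      moreover have "g = g \<ominus>\<^bsub>T\<^esub> f \<oplus>\<^bsub>T\<^esub> f" using f g by (simp add: h_def a_minus_def T.a_assoc T.l_neg)
      ultimately show "g \<in> N +>\<^bsub>T\<^esub> f" by (auto simp: a_r_coset_def')
    qed
  qed
  have ex: "\<exists>f\<in>carrier T. \<Phi> f = v" if "v \<in> carrier V" for v using that surj by (metis imageE)
  have h_eq: "(\<lambda>v. {f \<in> carrier T. \<Phi> f = v}) = h" by (simp add: h_def fun_eq_iff)
  have carr: "carrier (quotient_space T N) = h ` carrier V"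
  proof -
    have "carrier (quotient_space T N) = (\<lambda>f. N +>\<^bsub>T\<^esub> f) ` carrier T"
      by (auto simp: quotient_space_def A_RCOSETS_def')
    also have "\<dots> = (\<lambda>f. h (\<Phi> f)) ` carrier T" using coset by auto
    also have "\<dots> = h ` carrier V" using surj by (metis image_image)
    finally show ?thesis .
  qed
  have inj: "inj_on h (carrier V)"
  proof (rule inj_onI)
    fix v w assume "v \<in> carrier V" "h v = h w"
    then show "v = w" using ex[of v] by (auto simp: h_def)
  qed
  have bij: "bij_betw h (carrier V) (carrier (quotient_space T N))"
    using carr inj by (simp add: bij_betw_def)
  then show "bij_betw (\<lambda>v. {f \<in> carrier T. \<Phi> f = v}) (carrier V) (carrier (quotient_space T N))"
    unfolding h_eq .
  have "linear_map complex_field V (quotient_space T N) h"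
  proof (rule transport_vectorspace[OF L(2) bij])
    fix v w assume v: "v \<in> carrier V" and w: "w \<in> carrier V"
    have "set_add T (h v) (h w) = h (v \<oplus>\<^bsub>V\<^esub> w)"
    proof
      show "set_add T (h v) (h w) \<subseteq> h (v \<oplus>\<^bsub>V\<^esub> w)" by (auto simp: set_add_def' h_def L(4))
      show "h (v \<oplus>\<^bsub>V\<^esub> w) \<subseteq> set_add T (h v) (h w)"
      proof
        fix g assume g: "g \<in> h (v \<oplus>\<^bsub>V\<^esub> w)"
        obtain f where f: "f \<in> carrier T" "\<Phi> f = v" using ex[OF v] by auto
        have "v \<oplus>\<^bsub>V\<^esub> w \<ominus>\<^bsub>V\<^esub> v = w"
          using v w by (simp add: a_minus_def V.a_comm[of v w] V.a_assoc V.r_neg)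
        then have "g \<ominus>\<^bsub>T\<^esub> f \<in> h w" using f g by (simp add: h_def diff)
        moreover have "g = f \<oplus>\<^bsub>T\<^esub> (g \<ominus>\<^bsub>T\<^esub> f)"
          using f g by (simp add: h_def a_minus_def T.a_comm[of g] T.a_assoc[symmetric] T.r_neg)
        moreover have "f \<in> h v" using f by (simp add: h_def)
        ultimately show "g \<in> set_add T (h v) (h w)" unfolding set_add_def' by blast
      qed
    qed
    then show "h v \<oplus>\<^bsub>quotient_space T N\<^esub> h w = h (v \<oplus>\<^bsub>V\<^esub> w)" by (simp add: quotient_space_def)
  next
    fix a v assume v: "v \<in> carrier V"
    have "(\<Union>f\<in>h v. N +>\<^bsub>T\<^esub> (a \<odot>\<^bsub>T\<^esub> f)) = (\<Union>f\<in>h v. h (a \<odot>\<^bsub>V\<^esub> v))"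
      by (intro SUP_cong refl) (auto simp: h_def coset vT L(5))
    also have "\<dots> = h (a \<odot>\<^bsub>V\<^esub> v)" using ex[OF v] by (auto simp: h_def)
    finally show "a \<odot>\<^bsub>quotient_space T N\<^esub> h v = h (a \<odot>\<^bsub>V\<^esub> v)" by (simp add: quotient_space_def)
  next
    show "\<zero>\<^bsub>quotient_space T N\<^esub> = h \<zero>\<^bsub>V\<^esub>" by (simp add: quotient_space_def N h_def)
  qed
  then show "linear_map complex_field V (quotient_space T N) (\<lambda>v. {f \<in> carrier T. \<Phi> f = v})"
    unfolding h_eq .
qed

lemma coord_vectorspace: "vectorspace complex_field (coord_space n)"
  by (rule vec_vs)

lemma of_vec_simps:
  "v \<in> carrier_vec n \<Longrightarrow> w \<in> carrier_vec n \<Longrightarrow> of_vec (v + w) = of_vec v + of_vec w"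
  "of_vec (a \<cdot>\<^sub>v v) = a *\<^sub>C of_vec v" "of_vec (0\<^sub>v n) = 0"
  by (auto intro!: fmat_eqI simp: of_vec_def)

lemma tensor_group_algebra_vectorspace:
  assumes U: "vectorspace complex_field U"
  shows "vectorspace complex_field (tensor_group_algebra G U)"
proof -
  interpret U: abelian_group U by (rule complex_vectorspaceD(1)[OF U])
  note v = complex_vectorspaceD[OF U]
  have "abelian_group (tensor_group_algebra G U)"
  proof (rule abelian_groupI)
    fix x assume x: "x \<in> carrier (tensor_group_algebra G U)"
    then show "\<exists>y\<in>carrier (tensor_group_algebra G U). y \<oplus>\<^bsub>tensor_group_algebra G U\<^esub> x = \<zero>\<^bsub>tensor_group_algebra G U\<^esub>"
      by (intro bexI[of _ "\<lambda>g\<in>carrier G. \<ominus>\<^bsub>U\<^esub> x g"])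
        (auto simp: tensor_group_algebra_def fun_eq_iff U.l_neg restrict_def PiE_def Pi_def extensional_def)
  qed (auto simp: tensor_group_algebra_def fun_eq_iff restrict_def PiE_def Pi_def extensional_def
      U.a_ac)
  then show ?thesis
    by (rule complex_vectorspace)
      (auto simp: tensor_group_algebra_def fun_eq_iff restrict_def PiE_def Pi_def extensional_def v)
qed

definition rep_action :: "nat \<Rightarrow> ('a \<Rightarrow> fmat) \<Rightarrow> 'a \<Rightarrow> complex vec \<Rightarrow> complex vec" where
  "rep_action d F g v = to_vec d (F g * of_vec v)"

lemma rep_action_carrier [simp]: "rep_action d F g v \<in> carrier_vec d"
  by (simp add: rep_action_def)

lemma rep_action_alt:
  assumes "F g \<in> Mat d d" "v \<in> carrier_vec d"
  shows "rep_action d F g v = to_vec d (F g * of_vec v)" "of_vec (rep_action d F g v) = F g * of_vec v"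
  using of_vec_to_vec[OF Mat_mult[OF assms(1) of_vec_Mat[OF assms(2)]]] by (simp_all add: rep_action_def)

lemma rep_action_inj:
  assumes F: "F g \<in> GL d" and v: "v \<in> carrier_vec d" and w: "w \<in> carrier_vec d"
    and eq: "rep_action d F g v = rep_action d F g w"
  shows "v = w"
proof -
  have "F g * of_vec v = F g * of_vec w"
    using eq rep_action_alt(2)[where F = F and g = g, OF GL_Mat[OF F]] v w by metis
  then have "minv d (F g) * (F g * of_vec v) = minv d (F g) * (F g * of_vec w)" by simp
  then have "of_vec v = of_vec w"
    using minv_cancel(2)[OF F of_vec_Mat[OF v]] minv_cancel(2)[OF F of_vec_Mat[OF w]] by simp
  then show ?thesis using v w by (metis to_vec_of_vec)
qed

lemma rep_action_linear:
  "linear_map complex_field (coord_space d) (coord_space d) (rep_action d F g)"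
  by (rule linear_mapI[OF coord_vectorspace coord_vectorspace])
    (auto simp: module_vec_simps rep_action_def of_vec_simps(1)[of _ d] of_vec_simps(2) distrib_left to_vec_simps)

lemma rep_action_bij:
  assumes GLg: "F g \<in> GL d"
  shows "bij_betw (rep_action d F g) (carrier (coord_space d)) (carrier (coord_space d))"
proof -
  note Mg = GL_Mat[OF GLg]
  show ?thesis
  proof (rule bij_betwI[of _ _ _ "\<lambda>v. to_vec d (minv d (F g) * of_vec v)"])
    fix v assume "v \<in> carrier (coord_space d)"
    then have v: "v \<in> carrier_vec d" by (simp add: module_vec_simps)
    note ov = of_vec_Mat[OF v]
    show "to_vec d (minv d (F g) * of_vec (rep_action d F g v)) = v"
      by (simp add: rep_action_alt(2)[where F = F and g = g, OF Mg v] minv_cancel(2)[OF GLg ov] v)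
    show "rep_action d F g (to_vec d (minv d (F g) * of_vec v)) = v"
      using of_vec_to_vec[OF Mat_mult[OF minv(1)[OF GLg] ov]]
      by (simp add: rep_action_alt[where F = F and g = g, OF Mg to_vec_carrier] minv_cancel(1)[OF GLg ov] v)
  qed (auto simp: module_vec_simps rep_action_alt[where F = F and g = g, OF Mg])
qed

lemma rep_action_twisted_module:
  assumes F: "proj_rep G \<alpha> d F" and d: "0 < d" and G: "group G"
  shows "twisted_module G \<alpha> (coord_space d) (rep_action d F)"
  unfolding twisted_module_def
proof (intro conjI ballI)
  interpret V: vec_space "TYPE(complex)" d .
  show "vectorspace complex_field (coord_space d)" by (rule coord_vectorspace)
  show "vectorspace.fin_dim complex_field (coord_space d)" by (rule V.fin_dim)
  have "unit_vec d 0 \<in> carrier (coord_space d)" "unit_vec d 0 \<noteq> \<zero>\<^bsub>coord_space d\<^esub>"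
    using d by (auto simp: module_vec_simps)
  then show "carrier (coord_space d) \<noteq> {\<zero>\<^bsub>coord_space d\<^esub>}" by blast
  fix g assume g: "g \<in> carrier G"
  note GLg = proj_repD(1)[OF F g] and Mg = proj_repD(2)[OF F g]
  show "linear_map complex_field (coord_space d) (coord_space d) (rep_action d F g)"
    by (rule rep_action_linear)
  show "bij_betw (rep_action d F g) (carrier (coord_space d)) (carrier (coord_space d))"
    by (rule rep_action_bij[where F = F and g = g, OF GLg])
  fix h v assume h: "h \<in> carrier G" and "v \<in> carrier (coord_space d)"
  then have v: "v \<in> carrier_vec d" by (simp add: module_vec_simps)
  interpret group G by fact
  have "rep_action d F h (rep_action d F g v) = to_vec d (F h * (F g * of_vec v))"
    using rep_action_alt[where F = F and g = h and v = "rep_action d F g v", OF proj_repD(2)[OF F h]] rep_action_alt[where F = F and g = g, OF Mg v]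
      Mat_mult[OF Mg of_vec_Mat[OF v]] by simp
  also have "F h * (F g * of_vec v) = \<alpha> (g, h) *\<^sub>C (F (g \<otimes>\<^bsub>G\<^esub> h) * of_vec v)"
    by (simp add: mult.assoc[symmetric] proj_repD(4)[OF F g h])
  also have "to_vec d \<dots> = \<alpha> (g, h) \<cdot>\<^sub>v rep_action d F (g \<otimes>\<^bsub>G\<^esub> h) v"
    using g h by (simp add: rep_action_alt[where F = F and g = "g \<otimes>\<^bsub>G\<^esub> h", OF proj_repD(2)[OF F] v] to_vec_simps)
  finally show "rep_action d F h (rep_action d F g v)
      = \<alpha> (g, h) \<odot>\<^bsub>coord_space d\<^esub> rep_action d F (g \<otimes>\<^bsub>G\<^esub> h) v"
    by (simp add: module_vec_simps)
qed

text \<open>The subspace spanned by the columns of \<open>B\<close> is a module for \<open>K\<close>, and \<open>rep\<close> chooses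
  representatives of the right cosets of \<open>K\<close>. The map taking \<open>f\<close> to the sum of the
  \<open>F g * B * f g\<close> sends the tensor space onto the whole space and kills the balanced
  relations. Modulo the relations every element is supported on the representatives, where
  the directness of the sum of the translates leaves no kernel. Hence the kernel is exactly
  the space of relations.\<close>

lemma induced_module_iso:
  fixes G (structure)
  assumes G: "group G" and fin: "finite (carrier G)" and F: "proj_rep G \<alpha> d F"
    and K: "subgroup K G" and P: "proj_rep (G\<lparr>carrier := K\<rparr>) \<alpha> n P"
    and B: "B \<in> Mat d n" and FB: "\<And>k. k \<in> K \<Longrightarrow> F k * B = B * P k"
    and rep: "\<And>g. g \<in> carrier G \<Longrightarrow> rep g \<in> carrier G \<and> (\<exists>k\<in>K. g = k \<otimes> rep g)"
    and spans: "\<And>v. v \<in> Mat d 1 \<Longrightarrow> \<exists>f. (\<forall>g\<in>carrier G. f g \<in> Mat n 1) \<and> v = (\<Sum>g\<in>carrier G. F g * B * f g)"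
    and direct: "\<And>f. (\<And>t. t \<in> rep ` carrier G \<Longrightarrow> f t \<in> Mat n 1) \<Longrightarrow>
      (\<Sum>t\<in>rep ` carrier G. F t * B * f t) = 0 \<Longrightarrow> \<forall>t\<in>rep ` carrier G. f t = 0"
  shows "module_iso G (coord_space d) (rep_action d F)
    (induced_space G \<alpha> K (coord_space n) (rep_action n P)) (induced_action G \<alpha> (coord_space n))"
proof -
  interpret group G by fact
  let ?U = "coord_space n"
  define T where "T = tensor_group_algebra G ?U"
  have vT: "vectorspace complex_field T" unfolding T_def by (rule tensor_group_algebra_vectorspace[OF coord_vectorspace])
  interpret T: vectorspace complex_field T by (rule vT)
  have T_carrier: "carrier T = carrier G \<rightarrow>\<^sub>E carrier_vec n"
    and T_zero: "\<zero>\<^bsub>T\<^esub> = (\<lambda>g\<in>carrier G. 0\<^sub>v n)"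
    and T_add: "\<And>f h. f \<oplus>\<^bsub>T\<^esub> h = (\<lambda>g\<in>carrier G. f g + h g)"
    and T_smult: "\<And>a f. a \<odot>\<^bsub>T\<^esub> f = (\<lambda>g\<in>carrier G. a \<cdot>\<^sub>v f g)"
    by (auto simp: T_def tensor_group_algebra_def module_vec_simps)
  have FM: "F g \<in> Mat d d" if "g \<in> carrier G" for g using proj_repD(2)[OF F that] .
  have FBM: "F g * B \<in> Mat d n" if "g \<in> carrier G" for g using Mat_mult[OF FM[OF that] B] .
  have PM: "P k \<in> Mat n n" if "k \<in> K" for k using proj_repD(2)[OF P, of k] that by simp
  note KG = subgroup.subset[OF K]
  \<comment> \<open>the element \<open>u \<otimes> g\<sigma>\<close> of the tensor space is sent to \<open>F g * B * u\<close>\<close>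
  define \<Psi> where "\<Psi> f = (\<Sum>g\<in>carrier G. F g * B * of_vec (f g))" for f :: "'a \<Rightarrow> complex vec"
  have \<Psi>M: "\<Psi> f \<in> Mat d 1" if "f \<in> carrier T" for f
    unfolding \<Psi>_def by (intro Mat_sum Mat_mult[OF FBM]) (use that T_carrier in auto)
  define \<Phi> where "\<Phi> f = to_vec d (\<Psi> f)" for f
  have lin: "linear_map complex_field T (coord_space d) \<Phi>"
  proof (rule linear_mapI[OF vT coord_vectorspace])
    fix f h assume f: "f \<in> carrier T" and h: "h \<in> carrier T"
    have "\<Psi> (f \<oplus>\<^bsub>T\<^esub> h) = (\<Sum>g\<in>carrier G. F g * B * of_vec (f g) + F g * B * of_vec (h g))"
      unfolding \<Psi>_def by (intro sum.cong refl)
        (use f h in \<open>auto simp: T_add T_carrier of_vec_simps(1)[of _ n] PiE_iff distrib_left\<close>)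
    then show "\<Phi> (f \<oplus>\<^bsub>T\<^esub> h) = \<Phi> f \<oplus>\<^bsub>coord_space d\<^esub> \<Phi> h"
      by (simp add: \<Phi>_def \<Psi>_def sum.distrib to_vec_simps module_vec_simps)
  next
    fix a f assume f: "f \<in> carrier T"
    show "\<Phi> f \<in> carrier (coord_space d)" by (simp add: \<Phi>_def module_vec_simps)
    have "\<Psi> (a \<odot>\<^bsub>T\<^esub> f) = a *\<^sub>C \<Psi> f"
      by (simp add: \<Psi>_def T_smult of_vec_simps fm.scale_sum_right)
    then show "\<Phi> (a \<odot>\<^bsub>T\<^esub> f) = a \<odot>\<^bsub>coord_space d\<^esub> \<Phi> f"
      by (simp add: \<Phi>_def to_vec_simps module_vec_simps)
  qed
  note L = linear_mapD[OF lin]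
  have surj: "\<Phi> ` carrier T = carrier (coord_space d)"
  proof
    show "carrier (coord_space d) \<subseteq> \<Phi> ` carrier T"
    proof
      fix v assume "v \<in> carrier (coord_space d)"
      then have v: "v \<in> carrier_vec d" by (simp add: module_vec_simps)
      obtain f where f: "\<forall>g\<in>carrier G. f g \<in> Mat n 1" "of_vec v = (\<Sum>g\<in>carrier G. F g * B * f g)"
        using spans[OF of_vec_Mat[OF v]] by blast
      define f' where "f' = (\<lambda>g\<in>carrier G. to_vec n (f g))"
      have "f' \<in> carrier T" by (auto simp: f'_def T_carrier)
      moreover have "\<Psi> f' = of_vec v"
        unfolding \<Psi>_def f(2) by (intro sum.cong refl) (use f(1) in \<open>simp add: f'_def\<close>)
      then have "\<Phi> f' = v" using v by (simp add: \<Phi>_def)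
      ultimately show "v \<in> \<Phi> ` carrier T" by blast
    qed
  qed (use L(3) in auto)
  have \<Phi>0: "\<Phi> f = \<zero>\<^bsub>coord_space d\<^esub> \<longleftrightarrow> \<Psi> f = 0" if "f \<in> carrier T" for f
    using to_vec_inj[OF \<Psi>M[OF that], of 0] by (auto simp: \<Phi>_def module_vec_simps to_vec_simps)
  let ?pure = "pure_tensor G ?U"
  have pure_T: "?pure u g \<in> carrier T" if "u \<in> carrier_vec n" for u g
    using that by (auto simp: pure_tensor_def T_carrier module_vec_simps)
  have \<Psi>_pure: "\<Psi> (?pure u g) = F g * B * of_vec u" if "g \<in> carrier G" for u g
  proof -
    have "\<Psi> (?pure u g) = (\<Sum>h\<in>carrier G. if h = g then F h * B * of_vec u else 0)"
      unfolding \<Psi>_def by (intro sum.cong refl) (auto simp: pure_tensor_def module_vec_simps of_vec_simps)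
    then show ?thesis using that fin by (simp add: sum.delta)
  qed
  let ?S = "{?pure (rep_action n P k u) g \<ominus>\<^bsub>T\<^esub> ?pure (\<alpha> (k, g) \<odot>\<^bsub>?U\<^esub> u) (k \<otimes> g)
       | k g u. k \<in> K \<and> g \<in> carrier G \<and> u \<in> carrier ?U}"
  define R where "R = balanced_relations G \<alpha> K ?U (rep_action n P)"
  have R: "R = T.span ?S" by (simp add: R_def balanced_relations_def T_def)
  have rep_car: "rep_action n P k u \<in> carrier_vec n" if "k \<in> K" "u \<in> carrier_vec n" for k u
    using that PM by (simp add: rep_action_alt)
  have ST: "?S \<subseteq> carrier T"
  proof safe
    fix k g u assume "k \<in> K" "g \<in> carrier G" "u \<in> carrier ?U"
    then show "?pure (rep_action n P k u) g \<ominus>\<^bsub>T\<^esub> ?pure (\<alpha> (k, g) \<odot>\<^bsub>?U\<^esub> u) (k \<otimes> g) \<in> carrier T"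
      by (intro T.minus_closed pure_T) (auto simp: module_vec_simps rep_car)
  qed
  have subR: "submodule complex_field R T" unfolding R by (rule T.span_is_submodule[OF ST])
  note RS = submodule.m_closed[OF subR] submodule.zero_closed[OF subR] submodule.smult_closed[OF subR]
  have RT: "R \<subseteq> carrier T" by (rule submodule.subset[OF subR])
  have diffT: "f \<ominus>\<^bsub>T\<^esub> h = f \<oplus>\<^bsub>T\<^esub> (-1) \<odot>\<^bsub>T\<^esub> h" if "f \<in> carrier T" "h \<in> carrier T" for f h
    using T.smult_minus_1[OF that(2)] by (simp add: a_minus_def class_ring_simps)
  have \<Phi>diff: "\<Phi> (f \<ominus>\<^bsub>T\<^esub> h) = \<zero>\<^bsub>coord_space d\<^esub> \<longleftrightarrow> \<Psi> f = \<Psi> h"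
    if f: "f \<in> carrier T" and h: "h \<in> carrier T" for f h
  proof -
    have m: "(-1) \<odot>\<^bsub>T\<^esub> h \<in> carrier T" using complex_vectorspaceD(2)[OF vT h] .
    have "\<Phi> (f \<ominus>\<^bsub>T\<^esub> h) = \<Phi> f + (-1) \<cdot>\<^sub>v \<Phi> h"
      using f h m by (simp add: diffT L(4,5) module_vec_simps)
    also have "\<dots> = to_vec d (\<Psi> f - \<Psi> h)" by (auto simp: \<Phi>_def to_vec_def)
    finally show ?thesis
      using to_vec_inj[of "\<Psi> f - \<Psi> h" d 0] \<Psi>M[OF f] \<Psi>M[OF h]
      by (auto simp: module_vec_simps to_vec_simps)
  qed
  define N where "N = {f \<in> carrier T. \<Phi> f = \<zero>\<^bsub>coord_space d\<^esub>}"
  interpret \<Phi>: linear_map complex_field T "coord_space d" \<Phi> by (rule lin)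
  have subN: "submodule complex_field N T"
    using \<Phi>.ker_is_submodule unfolding \<Phi>.ker_def N_def .
  have "?S \<subseteq> N"
  proof safe
    fix k g u assume k: "k \<in> K" and g: "g \<in> carrier G" and "u \<in> carrier ?U"
    then have u: "u \<in> carrier_vec n" by (simp add: module_vec_simps)
    have kG: "k \<in> carrier G" using k KG by auto
    let ?a = "?pure (rep_action n P k u) g" and ?b = "?pure (\<alpha> (k, g) \<odot>\<^bsub>?U\<^esub> u) (k \<otimes> g)"
    have ab: "?a \<in> carrier T" "?b \<in> carrier T"
      using pure_T rep_car[OF k u] u by (auto simp: module_vec_simps)
    have "\<Psi> ?a = F g * B * (P k * of_vec u)"
      using g by (simp add: \<Psi>_pure rep_action_alt(2)[where F = P and g = k, OF PM[OF k] u])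
    also have "\<dots> = F g * F k * B * of_vec u" by (simp add: mult.assoc FB[OF k, symmetric]) (simp add: mult.assoc[symmetric] FB[OF k])
    also have "\<dots> = \<Psi> ?b"
      using g kG by (simp add: \<Psi>_pure proj_repD(4)[OF F kG g] module_vec_simps of_vec_simps)
    finally have "\<Psi> ?a = \<Psi> ?b" .
    then have "\<Phi> (?a \<ominus>\<^bsub>T\<^esub> ?b) = \<zero>\<^bsub>coord_space d\<^esub>" using \<Phi>diff[OF ab] by simp
    then show "?a \<ominus>\<^bsub>T\<^esub> ?b \<in> N" unfolding N_def using T.minus_closed[OF ab] by simp
  qed
  then have RN: "R \<subseteq> N" unfolding R by (rule T.span_is_subset[OF _ subN])
  \<comment> \<open>modulo the relations every element is supported on the transversal\<close>
  define Q where "Q = {f \<in> carrier T. \<exists>f'\<in>carrier T. (\<forall>g\<in>carrier G - rep ` carrier G. f' g = 0\<^sub>v n) \<and> f \<ominus>\<^bsub>T\<^esub> f' \<in> R}"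
  have Q_add: "f \<oplus>\<^bsub>T\<^esub> h \<in> Q" if fh: "f \<in> Q" "h \<in> Q" for f h
  proof -
    obtain f' where f: "f \<in> carrier T" "f' \<in> carrier T" "\<forall>g\<in>carrier G - rep ` carrier G. f' g = 0\<^sub>v n" "f \<ominus>\<^bsub>T\<^esub> f' \<in> R"
      using fh unfolding Q_def by blast
    obtain h' where h: "h \<in> carrier T" "h' \<in> carrier T" "\<forall>g\<in>carrier G - rep ` carrier G. h' g = 0\<^sub>v n" "h \<ominus>\<^bsub>T\<^esub> h' \<in> R"
      using fh unfolding Q_def by blast
    have "(f \<oplus>\<^bsub>T\<^esub> h) \<ominus>\<^bsub>T\<^esub> (f' \<oplus>\<^bsub>T\<^esub> h') = (f \<ominus>\<^bsub>T\<^esub> f') \<oplus>\<^bsub>T\<^esub> (h \<ominus>\<^bsub>T\<^esub> h')"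
      using f h by (simp add: a_minus_def T.a_ac T.minus_add)
    then have "(f \<oplus>\<^bsub>T\<^esub> h) \<ominus>\<^bsub>T\<^esub> (f' \<oplus>\<^bsub>T\<^esub> h') \<in> R" using f h RS(1) by simp
    moreover have "\<forall>g\<in>carrier G - rep ` carrier G. (f' \<oplus>\<^bsub>T\<^esub> h') g = 0\<^sub>v n"
      using f(3) h(3) by (simp add: T_add)
    ultimately show ?thesis unfolding Q_def using f h T.a_closed by blast
  qed
  have Q_pure: "?pure u g \<in> Q" if u: "u \<in> carrier_vec n" and g: "g \<in> carrier G" for u g
  proof -
    obtain k where k: "k \<in> K" "g = k \<otimes> rep g" and t: "rep g \<in> carrier G" using rep[OF g] by blast
    have kG: "k \<in> carrier G" using k KG by auto
    let ?c = "\<alpha> (k, rep g)"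
    have c: "?c \<noteq> 0" using proj_repD(3)[OF F kG t] .
    define u' where "u' = inverse ?c \<cdot>\<^sub>v u"
    have u': "u' \<in> carrier_vec n" "?c \<cdot>\<^sub>v u' = u" using u c by (auto simp: u'_def smult_smult_assoc)
    let ?f = "?pure (rep_action n P k u') (rep g)"
    have "?f \<ominus>\<^bsub>T\<^esub> ?pure (?c \<odot>\<^bsub>?U\<^esub> u') (k \<otimes> rep g) \<in> ?S"
      by (intro CollectI exI[of _ k] exI[of _ "rep g"] exI[of _ u']) (use k t u' in \<open>simp add: module_vec_simps\<close>)
    then have "?f \<ominus>\<^bsub>T\<^esub> ?pure u g \<in> ?S" using u' k by (simp add: module_vec_simps)
    then have "?f \<ominus>\<^bsub>T\<^esub> ?pure u g \<in> R" unfolding R using T.in_own_span[OF ST] by blast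
    then have "(-1) \<odot>\<^bsub>T\<^esub> (?f \<ominus>\<^bsub>T\<^esub> ?pure u g) \<in> R" by (intro RS(3)) (auto simp: class_ring_simps)
    moreover have fT: "?f \<in> carrier T" "?pure u g \<in> carrier T" using pure_T rep_car k u u' by auto
    moreover have "(-1) \<odot>\<^bsub>T\<^esub> (?f \<ominus>\<^bsub>T\<^esub> ?pure u g) = ?pure u g \<ominus>\<^bsub>T\<^esub> ?f"
    proof -
      have "(-1) \<odot>\<^bsub>T\<^esub> (?f \<ominus>\<^bsub>T\<^esub> ?pure u g) = \<ominus>\<^bsub>T\<^esub> (?f \<ominus>\<^bsub>T\<^esub> ?pure u g)"
        using T.smult_minus_1[OF T.minus_closed[OF fT]] by (simp add: class_ring_simps)
      then show ?thesis using fT by (simp add: a_minus_def T.minus_add T.a_comm)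
    qed
    ultimately have "?pure u g \<ominus>\<^bsub>T\<^esub> ?f \<in> R" by simp
    moreover have "\<forall>h\<in>carrier G - rep ` carrier G. ?f h = 0\<^sub>v n"
      using g by (auto simp: pure_tensor_def module_vec_simps)
    ultimately show ?thesis unfolding Q_def using fT by blast
  qed
  have Q_supp: "f \<in> Q" if "finite A" "f \<in> carrier T" "\<forall>g\<in>carrier G - A. f g = 0\<^sub>v n" "A \<subseteq> carrier G" for A f
    using that
  proof (induction A arbitrary: f rule: finite_induct)
    case empty
    then have "f = \<zero>\<^bsub>T\<^esub>" by (auto simp: T_zero T_carrier fun_eq_iff PiE_def extensional_def restrict_def)
    moreover have "\<zero>\<^bsub>T\<^esub> \<ominus>\<^bsub>T\<^esub> \<zero>\<^bsub>T\<^esub> \<in> R"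
      using RS(2) by (simp only: a_minus_def T.r_neg[OF T.zero_closed])
    moreover have "\<forall>g\<in>carrier G - rep ` carrier G. \<zero>\<^bsub>T\<^esub> g = 0\<^sub>v n" by (simp add: T_zero)
    ultimately show ?case unfolding Q_def
      by (intro CollectI conjI bexI[of _ "\<zero>\<^bsub>T\<^esub>"]) auto
  next
    case (insert a A)
    have fa: "f a \<in> carrier_vec n" and aG: "a \<in> carrier G" using insert.prems by (auto simp: T_carrier)
    define f1 where "f1 = (\<lambda>g\<in>carrier G. if g = a then 0\<^sub>v n else f g)"
    have "f1 \<in> Q"
      by (rule insert.IH) (use insert.prems in \<open>auto simp: f1_def T_carrier\<close>)
    moreover have "f = f1 \<oplus>\<^bsub>T\<^esub> ?pure (f a) a"
    proof
      fix g
      show "f g = (f1 \<oplus>\<^bsub>T\<^esub> ?pure (f a) a) g"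
        using insert.prems(1) fa
        by (cases "g \<in> carrier G") (auto simp: T_add f1_def pure_tensor_def T_carrier module_vec_simps PiE_iff extensional_def)
    qed
    ultimately show ?case using Q_add Q_pure[OF fa aG] by metis
  qed
  have "N \<subseteq> R"
  proof
    fix f assume fN: "f \<in> N"
    then have fT: "f \<in> carrier T" "\<Phi> f = \<zero>\<^bsub>coord_space d\<^esub>" by (auto simp: N_def)
    have "f \<in> Q" by (rule Q_supp[OF fin fT(1)]) auto
    then obtain f' where f': "f' \<in> carrier T" "\<forall>g\<in>carrier G - rep ` carrier G. f' g = 0\<^sub>v n" "f \<ominus>\<^bsub>T\<^esub> f' \<in> R"
      unfolding Q_def by blast
    have "\<Phi> (f \<ominus>\<^bsub>T\<^esub> f') = \<zero>\<^bsub>coord_space d\<^esub>" using f'(3) RN by (auto simp: N_def)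
    then have "\<Psi> f = \<Psi> f'" using \<Phi>diff[OF fT(1) f'(1)] by simp
    then have "\<Psi> f' = 0" using \<Phi>0[OF fT(1)] fT(2) by simp
    moreover have sum_eq: "\<Psi> f' = (\<Sum>t\<in>rep ` carrier G. F t * B * of_vec (f' t))"
      unfolding \<Psi>_def using rep f'(2) fin
      by (intro sum.mono_neutral_right) (auto simp: of_vec_simps)
    moreover have f'M: "of_vec (f' t) \<in> Mat n 1" if "t \<in> rep ` carrier G" for t
      using that rep f'(1) by (auto simp: T_carrier)
    ultimately have "(\<Sum>t\<in>rep ` carrier G. F t * B * of_vec (f' t)) = 0" by simp
    from direct[of "\<lambda>t. of_vec (f' t)", OF f'M this]
    have "\<forall>t\<in>rep ` carrier G. of_vec (f' t) = 0" by simp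
    then have z: "f' t = 0\<^sub>v n" if "t \<in> rep ` carrier G" for t
    proof -
      have "t \<in> carrier G" using that rep by auto
      then have "f' t \<in> carrier_vec n" using f'(1) by (auto simp: T_carrier)
      then have "f' t = to_vec n (of_vec (f' t))" by simp
      then show ?thesis using \<open>\<forall>t\<in>rep ` carrier G. of_vec (f' t) = 0\<close> that by (simp add: to_vec_simps)
    qed
    have "f' = \<zero>\<^bsub>T\<^esub>"
    proof
      fix g show "f' g = \<zero>\<^bsub>T\<^esub> g"
        using f'(1,2) z by (cases "g \<in> carrier G") (auto simp: T_zero T_carrier PiE_def extensional_def)
    qed
    then have "f \<ominus>\<^bsub>T\<^esub> f' = f" using fT by (simp add: a_minus_def)
    then show "f \<in> R" using f'(3) by simp
  qed
  with RN have NR: "R = {f \<in> carrier T. \<Phi> f = \<zero>\<^bsub>coord_space d\<^esub>}" by (auto simp: N_def)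
  note iso = quotient_space_iso[OF lin surj NR]
  have act: "\<Phi> (\<lambda>h\<in>carrier G. \<alpha> (h \<otimes> inv x, x) \<cdot>\<^sub>v f (h \<otimes> inv x)) = rep_action d F x (\<Phi> f)"
    if x: "x \<in> carrier G" and f: "f \<in> carrier T" for x f
  proof -
    have "\<Psi> (\<lambda>h\<in>carrier G. \<alpha> (h \<otimes> inv x, x) \<cdot>\<^sub>v f (h \<otimes> inv x))
        = (\<Sum>h\<in>carrier G. \<alpha> (h \<otimes> inv x, x) *\<^sub>C (F h * B * of_vec (f (h \<otimes> inv x))))"
      unfolding \<Psi>_def by (intro sum.cong refl) (simp add: of_vec_simps)
    also have "\<dots> = (\<Sum>g\<in>carrier G. \<alpha> (g \<otimes> x \<otimes> inv x, x) *\<^sub>C (F (g \<otimes> x) * B * of_vec (f (g \<otimes> x \<otimes> inv x))))"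
      by (rule sum.reindex_bij_betw[OF bij_betw_mult_right[OF x], symmetric])
    also have "\<dots> = (\<Sum>g\<in>carrier G. F x * (F g * B * of_vec (f g)))"
    proof (intro sum.cong refl)
      fix g assume g: "g \<in> carrier G"
      have "g \<otimes> x \<otimes> inv x = g" using g x by (simp add: m_assoc)
      then show "\<alpha> (g \<otimes> x \<otimes> inv x, x) *\<^sub>C (F (g \<otimes> x) * B * of_vec (f (g \<otimes> x \<otimes> inv x)))
          = F x * (F g * B * of_vec (f g))"
        using proj_repD(4)[OF F g x] by (simp add: mult.assoc[symmetric])
    qed
    also have "\<dots> = F x * \<Psi> f" by (simp add: \<Psi>_def sum_distrib_left)
    finally show ?thesis
      using rep_action_alt(1)[where F = F and g = x and v = "\<Phi> f", OF FM[OF x]] \<Psi>M[OF f] by (simp add: \<Phi>_def)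
  qed
  have comm: "{f \<in> carrier T. \<Phi> f = rep_action d F x v}
      = induced_action G \<alpha> ?U x {f \<in> carrier T. \<Phi> f = v}"
    if x: "x \<in> carrier G" and v: "v \<in> carrier (coord_space d)" for x v
  proof
    show "induced_action G \<alpha> ?U x {f \<in> carrier T. \<Phi> f = v} \<subseteq> {f \<in> carrier T. \<Phi> f = rep_action d F x v}"
      using x act[OF x] by (auto simp: induced_action_def module_vec_simps T_carrier)
    show "{f \<in> carrier T. \<Phi> f = rep_action d F x v} \<subseteq> induced_action G \<alpha> ?U x {f \<in> carrier T. \<Phi> f = v}"
    proof
      fix g assume "g \<in> {f \<in> carrier T. \<Phi> f = rep_action d F x v}"
      then have g: "g \<in> carrier T" "\<Phi> g = rep_action d F x v" by auto
      define f where "f = (\<lambda>h\<in>carrier G. inverse (\<alpha> (h, x)) \<cdot>\<^sub>v g (h \<otimes> x))"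
      have f: "f \<in> carrier T" using g x by (auto simp: f_def T_carrier)
      have gf: "g = (\<lambda>h\<in>carrier G. \<alpha> (h \<otimes> inv x, x) \<cdot>\<^sub>v f (h \<otimes> inv x))"
      proof
        fix h
        show "g h = (\<lambda>h\<in>carrier G. \<alpha> (h \<otimes> inv x, x) \<cdot>\<^sub>v f (h \<otimes> inv x)) h"
        proof (cases "h \<in> carrier G")
          case True
          then have "h \<otimes> inv x \<otimes> x = h" using x by (simp add: m_assoc)
          then show ?thesis using True x proj_repD(3)[OF F _ x, of "h \<otimes> inv x"]
            by (simp add: f_def smult_smult_assoc)
        qed (use g in \<open>auto simp: T_carrier PiE_def extensional_def\<close>)
      qed
      have "rep_action d F x (\<Phi> f) = rep_action d F x v" using act[OF x f] gf g(2) by simp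
      then have "\<Phi> f = v"
        using L(3)[OF f] v rep_action_inj[where F = F and g = x, OF proj_repD(1)[OF F x]]
        by (simp add: module_vec_simps)
      then show "g \<in> induced_action G \<alpha> ?U x {f \<in> carrier T. \<Phi> f = v}"
        unfolding induced_action_def using f gf by (auto simp: module_vec_simps intro!: image_eqI[of _ _ f])
    qed
  qed
  show ?thesis
    unfolding module_iso_def induced_space_def T_def[symmetric] R_def[symmetric]
    using iso comm by blast
qed

section \<open>Primitive modules\<close>

definition joint_eigenspace :: "nat \<Rightarrow> fmat set \<Rightarrow> (fmat \<Rightarrow> complex) \<Rightarrow> fmat set" where
  "joint_eigenspace d Z \<theta> = {v \<in> Mat d 1. \<forall>z\<in>Z. z * v = \<theta> z *\<^sub>C v}"

lemma joint_eigenspace_subspace: "fm.subspace (joint_eigenspace d Z \<theta>)"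
  by (auto simp: fm.subspace_def joint_eigenspace_def distrib_left fm.scale_right_distrib)

text \<open>Applying \<open>z - \<theta> a z\<close> to a vanishing sum removes the term at \<open>a\<close> and multiplies the
  others by scalars, the one at \<open>b\<close> by a nonzero one if \<open>z\<close> separates \<open>a\<close> from \<open>b\<close>.\<close>

lemma joint_eigenspaces_independent:
  assumes "finite T" and "\<And>s t. s \<in> T \<Longrightarrow> t \<in> T \<Longrightarrow> s \<noteq> t \<Longrightarrow> \<exists>z\<in>Z. \<theta> s z \<noteq> \<theta> t z"
    and "\<And>t. t \<in> T \<Longrightarrow> v t \<in> joint_eigenspace d Z (\<theta> t)" and "(\<Sum>t\<in>T. v t) = 0"
  shows "\<forall>t\<in>T. v t = 0"
  using assms
proof (induction T arbitrary: v rule: finite_induct)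
  case (insert a T)
  have v: "z * v t = \<theta> t z *\<^sub>C v t" if "t \<in> insert a T" "z \<in> Z" for t z
    using insert.prems(2)[OF that(1)] that(2) by (simp add: joint_eigenspace_def)
  have T0: "v b = 0" if b: "b \<in> T" for b
  proof -
    have "a \<noteq> b" using b insert.hyps by auto
    then obtain z where z: "z \<in> Z" "\<theta> a z \<noteq> \<theta> b z" using insert.prems(1)[of a b] b by auto
    define v' where "v' t = (\<theta> t z - \<theta> a z) *\<^sub>C v t" for t
    have "(\<Sum>t\<in>insert a T. v' t) = (\<Sum>t\<in>insert a T. z * v t - \<theta> a z *\<^sub>C v t)"
      using v z by (intro sum.cong refl) (auto simp: v'_def fm.scale_left_diff_distrib)
    also have "\<dots> = z * (\<Sum>t\<in>insert a T. v t) - \<theta> a z *\<^sub>C (\<Sum>t\<in>insert a T. v t)"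
      by (simp only: sum_subtractf sum_distrib_left fm.scale_sum_right)
    also have "\<dots> = 0" using insert.prems(3) by simp
    finally have s0: "(\<Sum>t\<in>T. v' t) = 0" using insert.hyps by (simp add: v'_def)
    have v'W: "v' t \<in> joint_eigenspace d Z (\<theta> t)" if "t \<in> T" for t
      unfolding v'_def using insert.prems(2)[of t] that
      by (intro fm.subspace_scale[OF joint_eigenspace_subspace]) simp
    have "\<forall>t\<in>T. v' t = 0"
      by (rule insert.IH[OF insert.prems(1) v'W s0]) auto
    then show ?thesis using b z by (auto simp: v'_def)
  qed
  then have "v a = 0" using insert.prems(3) insert.hyps by simp
  then show ?case using T0 by simp
qed simp

text \<open>Commuting matrices have a joint eigenspace, with eigenvalues \<open>\<chi>\<close> say. Since \<open>Z\<close> is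
  normalized, \<open>F g\<close> maps it to the joint eigenspace for the conjugate \<open>tw g\<close> of \<open>\<chi>\<close>. Let \<open>K\<close>
  be the stabilizer of \<open>\<chi>\<close>. Translates of the eigenspace by representatives of the cosets of
  \<open>K\<close> are independent, and by irreducibility they span; so the module is induced from \<open>K\<close>,
  and primitivity forces \<open>K = G\<close>. Then the eigenspace is invariant, hence everything, which
  says that \<open>Z\<close> acts by scalars.\<close>

lemma primitive_commuting_scalar:
  fixes G (structure)
  assumes G: "group G" and fin: "finite (carrier G)" and F: "proj_rep G \<alpha> d F" and d: "0 < d"
    and irr: "\<And>W. fm.subspace W \<Longrightarrow> W \<subseteq> Mat d 1 \<Longrightarrow> W \<noteq> {0} \<Longrightarrow>
      (\<And>g w. g \<in> carrier G \<Longrightarrow> w \<in> W \<Longrightarrow> F g * w \<in> W) \<Longrightarrow> W = Mat d 1"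
    and prim: "primitive_module G \<alpha> (coord_space d) (rep_action d F)"
    and Z: "Z \<subseteq> Mat d d" and comm: "\<And>y z. y \<in> Z \<Longrightarrow> z \<in> Z \<Longrightarrow> y * z = z * y"
    and norm: "\<And>g z. g \<in> carrier G \<Longrightarrow> z \<in> Z \<Longrightarrow> minv d (F g) * z * F g \<in> Z"
    and z: "z \<in> Z"
  shows "\<exists>c. z = c *\<^sub>C idm d"
proof -
  interpret group G by fact
  note GL = proj_repD(1)[OF F] and FM = proj_repD(2)[OF F]
  have ZM: "z \<in> Mat d d" if "z \<in> Z" for z using Z that by auto
  obtain m B0 X where m: "0 < m" and B0: "inj_mat d m B0" and XM': "\<forall>z\<in>Z. X z \<in> Mat m m"
    and ZB': "\<forall>z\<in>Z. z * B0 = B0 * X z" and sc: "scalar_commutant m Z X"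
    by (rule minimal_invariant_subspace[where F = "\<lambda>z. z" and I = Z, OF d ZM])
  have XM: "X z \<in> Mat m m" and ZB: "z * B0 = B0 * X z" if "z \<in> Z" for z
    using XM' ZB' that by auto
  have "\<exists>c. X z = c *\<^sub>C idm m" if z: "z \<in> Z" for z
  proof -
    have "X z * X y = X y * X z" if y: "y \<in> Z" for y
    proof (rule inj_mat_cancel[OF B0])
      have "B0 * (X z * X y) = z * y * B0"
        by (simp only: mult.assoc[symmetric] ZB[OF z, symmetric]) (simp only: mult.assoc ZB[OF y])
      moreover have "B0 * (X y * X z) = y * z * B0"
        by (simp only: mult.assoc[symmetric] ZB[OF y, symmetric]) (simp only: mult.assoc ZB[OF z])
      ultimately show "B0 * (X z * X y) = B0 * (X y * X z)" using comm[OF z y] by simp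
    qed (use XM[OF z] XM[OF y] in auto)
    then show ?thesis using sc XM[OF z] unfolding scalar_commutant_def by blast
  qed
  then obtain \<chi> where \<chi>: "\<And>z. z \<in> Z \<Longrightarrow> X z = \<chi> z *\<^sub>C idm m" by metis
  have B0M: "B0 \<in> Mat d m" using B0 by (simp add: inj_mat_def)
  define W where "W = joint_eigenspace d Z"
  have W_sub: "fm.subspace (W \<theta>)" and W_Mat: "W \<theta> \<subseteq> Mat d 1" for \<theta>
    by (auto simp: W_def joint_eigenspace_subspace) (auto simp: joint_eigenspace_def)
  have W_ne: "\<exists>v\<in>W \<chi>. v \<noteq> 0"
  proof
    let ?e = "eunit 0 0"
    have e: "?e \<in> Mat m 1" using m by (simp add: eunit_Mat)
    show "B0 * ?e \<in> W \<chi>"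
      using Mat_mult[OF B0M e] ZB \<chi> B0M by (simp add: W_def joint_eigenspace_def mult.assoc[symmetric])
    show "B0 * ?e \<noteq> 0"
    proof
      assume "B0 * ?e = 0"
      then have "?e = 0" using B0 e by (auto simp: inj_mat_def)
      then have "entry ?e 0 0 = 0" by simp
      then show False by simp
    qed
  qed
  define cj where "cj g z = minv d (F g) * z * F g" for g z
  have cjZ: "cj g z \<in> Z" if "g \<in> carrier G" "z \<in> Z" for g z using norm[OF that] by (simp add: cj_def)
  \<comment> \<open>\<open>tw g\<close> is the family of eigenvalues of \<open>Z\<close> on the image of \<open>W \<chi>\<close> under \<open>F g\<close>\<close>
  define tw where "tw g z = \<chi> (cj g z)" for g z
  have moves: "F g * v \<in> W (tw g)" if g: "g \<in> carrier G" and v: "v \<in> W \<chi>" for g v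
  proof -
    have "z * (F g * v) = tw g z *\<^sub>C (F g * v)" if z: "z \<in> Z" for z
    proof -
      have zM: "z \<in> Mat d d" using z Z by auto
      have "z * (F g * v) = F g * (minv d (F g) * (z * F g)) * v"
        using minv_cancel(1)[OF GL[OF g] Mat_mult[OF zM FM[OF g]]] by (simp add: mult.assoc)
      also have "\<dots> = F g * (cj g z * v)" by (simp add: cj_def mult.assoc)
      also have "cj g z * v = tw g z *\<^sub>C v"
        using v cjZ[OF g z] by (simp add: W_def joint_eigenspace_def tw_def)
      finally show ?thesis by simp
    qed
    moreover have "F g * v \<in> Mat d 1" using v W_Mat Mat_mult[OF FM[OF g]] by blast
    ultimately show ?thesis by (simp add: W_def joint_eigenspace_def)
  qed
  have cj_mult: "cj (g \<otimes> h) z = cj g (cj h z)" if g: "g \<in> carrier G" and h: "h \<in> carrier G" for g h z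
  proof -
    let ?c = "\<alpha> (g, h)"
    have c: "?c \<noteq> 0" using proj_repD(3)[OF F g h] .
    have eq: "F (g \<otimes> h) = inverse ?c *\<^sub>C (F h * F g)" using proj_repD(4)[OF F g h] c by simp
    have "minv d (F (g \<otimes> h)) = ?c *\<^sub>C (minv d (F g) * minv d (F h))"
      unfolding eq using c by (simp add: minv_scaleC[OF GL_mult[OF GL[OF h] GL[OF g]]] minv_mult[OF GL[OF h] GL[OF g]])
    then show ?thesis using c by (simp add: cj_def eq mult.assoc)
  qed
  have cj_one: "cj \<one> z = z" if "z \<in> Z" for z
  proof -
    let ?c = "\<alpha> (\<one>, \<one>)"
    have c: "?c \<noteq> 0" using proj_repD(3)[OF F] by simp
    have "z \<in> Mat d d" using that Z by auto
    then show ?thesis using c by (simp add: cj_def proj_rep_one[OF F] minv_scaleC[OF GL_idm])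
  qed
  have tw_mult: "tw (g \<otimes> h) z = tw g (cj h z)" if "g \<in> carrier G" "h \<in> carrier G" for g h z
    using cj_mult[OF that] by (simp add: tw_def)
  have tw_one: "tw \<one> z = \<chi> z" if "z \<in> Z" for z using cj_one[OF that] by (simp add: tw_def)
  define K where "K = {g \<in> carrier G. \<forall>z\<in>Z. tw g z = \<chi> z}"
  have twK: "tw (k \<otimes> h) z = tw h z" if "k \<in> K" "h \<in> carrier G" "z \<in> Z" for k h z
    using that tw_mult[of k h z] cjZ[of h z] by (simp add: K_def tw_def)
  have K: "subgroup K G"
  proof (rule subgroupI)
    show "K \<subseteq> carrier G" by (auto simp: K_def)
    show "K \<noteq> {}" using tw_one by (auto simp: K_def intro!: exI[of _ \<one>])
    fix a assume a: "a \<in> K"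
    then have aG: "a \<in> carrier G" by (simp add: K_def)
    have "tw (inv a) z = \<chi> z" if "z \<in> Z" for z
      using twK[OF a inv_closed[OF aG] that] aG tw_one[OF that] by simp
    then show "inv a \<in> K" using aG by (simp add: K_def)
    fix b assume b: "b \<in> K"
    then have bG: "b \<in> carrier G" by (simp add: K_def)
    show "a \<otimes> b \<in> K" using twK[OF a bG] aG bG b by (simp add: K_def)
  qed
  note KG = subgroup.subset[OF K]
  have "K = carrier G"
  proof (rule ccontr)
    assume proper: "K \<noteq> carrier G"
    obtain n B where B: "inj_mat d n B" and WB: "W \<chi> = {B * v | v. v \<in> Mat n 1}"
      and "n \<le> d" "W \<chi> \<noteq> Mat d 1 \<longrightarrow> n < d"
      by (rule subspace_basis[OF W_sub[of \<chi>] W_Mat[of \<chi>]])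
    have BM: "B \<in> Mat d n" using B by (simp add: inj_mat_def)
    have n: "0 < n"
    proof (rule ccontr)
      assume "\<not> 0 < n"
      then have "u = 0" if "u \<in> Mat n 1" for u
        using that by (intro fmat_eqI) (auto simp: Mat_entry)
      then have "v = 0" if "v \<in> W \<chi>" for v using that unfolding WB by force
      then show False using W_ne by blast
    qed
    have "\<exists>Y. Y \<in> Mat n n \<and> F k * B = B * Y" if k: "k \<in> K" for k
    proof -
      have kG: "k \<in> carrier G" using k KG by auto
      have "\<exists>v\<in>Mat n 1. F k * B * u = B * v" if u: "u \<in> Mat n 1" for u
      proof -
        have "B * u \<in> W \<chi>" using WB u by auto
        then have "F k * (B * u) \<in> W (tw k)" by (rule moves[OF kG])
        then have "F k * (B * u) \<in> W \<chi>" using k by (auto simp: W_def joint_eigenspace_def K_def)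
        then show ?thesis using WB by (auto simp: mult.assoc)
      qed
      then show ?thesis
        using factor_through[OF Mat_mult[OF FM[OF kG] BM] BM] by metis
    qed
    then obtain P where PM: "\<And>k. k \<in> K \<Longrightarrow> P k \<in> Mat n n" and FB: "\<And>k. k \<in> K \<Longrightarrow> F k * B = B * P k" by metis
    have P: "proj_rep (G\<lparr>carrier := K\<rparr>) \<alpha> n P"
      by (rule sub_rep[OF subgroup.subgroup_is_group[OF K G] proj_rep_restrict[OF F K] B]) (use PM FB in auto)
    define rep where "rep g = (SOME h. h \<in> K #> g)" for g
    have rep_in: "rep g \<in> K #> g" if "g \<in> carrier G" for g
      unfolding rep_def by (rule someI[of _ g]) (rule rcos_self[OF that K])
    have rep: "rep g \<in> carrier G \<and> (\<exists>k\<in>K. g = k \<otimes> rep g)" if g: "g \<in> carrier G" for g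
    proof -
      obtain k where k: "k \<in> K" "rep g = k \<otimes> g" using rep_in[OF g] by (auto simp: r_coset_def)
      have kG: "k \<in> carrier G" using k KG by auto
      have "g = inv k \<otimes> rep g" using k g kG by (simp add: m_assoc[symmetric])
      then show ?thesis using k g kG subgroup.m_inv_closed[OF K k(1)] by auto
    qed
    have rep_rep: "rep (rep g) = rep g" if g: "g \<in> carrier G" for g
      using repr_independence[OF rep_in[OF g] g K] by (simp add: rep_def)
    have spans: "\<exists>f. (\<forall>g\<in>carrier G. f g \<in> Mat n 1) \<and> v = (\<Sum>g\<in>carrier G. F g * B * f g)"
      if v: "v \<in> Mat d 1" for v
    proof -
      define S where "S = {(\<Sum>g\<in>carrier G. F g * B * f g) | f. \<forall>g\<in>carrier G. f g \<in> Mat n 1}"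
      have SI: "(\<Sum>g\<in>carrier G. F g * B * f g) \<in> S" if "\<And>g. g \<in> carrier G \<Longrightarrow> f g \<in> Mat n 1" for f
        using that unfolding S_def by blast
      have single: "F g * (B * u) \<in> S" if g: "g \<in> carrier G" and u: "u \<in> Mat n 1" for g u
      proof -
        have "(\<Sum>h\<in>carrier G. F h * B * (if h = g then u else 0)) = (\<Sum>h\<in>carrier G. if h = g then F h * B * u else 0)"
          by (intro sum.cong refl) auto
        also have "\<dots> = F g * (B * u)" using g fin by (simp add: sum.delta mult.assoc)
        finally show ?thesis using SI[of "\<lambda>h. if h = g then u else 0"] u by simp
      qed
      have "S = Mat d 1"
      proof (rule irr)
        show sub: "fm.subspace S"
          unfolding fm.subspace_def
        proof (intro conjI ballI allI)
          show "0 \<in> S" using SI[of "\<lambda>_. 0"] by simp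
          fix x assume "x \<in> S"
          then obtain f where f: "\<forall>g\<in>carrier G. f g \<in> Mat n 1" "x = (\<Sum>g\<in>carrier G. F g * B * f g)"
            unfolding S_def by blast
          show "c *\<^sub>C x \<in> S" for c
            using SI[of "\<lambda>g. c *\<^sub>C f g"] f by (simp add: fm.scale_sum_right)
          fix y assume "y \<in> S"
          then obtain h where h: "\<forall>g\<in>carrier G. h g \<in> Mat n 1" "y = (\<Sum>g\<in>carrier G. F g * B * h g)"
            unfolding S_def by blast
          show "x + y \<in> S"
            using SI[of "\<lambda>g. f g + h g"] f h by (simp add: distrib_left sum.distrib)
        qed
        show "S \<subseteq> Mat d 1"
          unfolding S_def using Mat_mult[OF Mat_mult[OF FM BM]] by (auto intro!: Mat_sum)
        obtain v where v: "v \<in> W \<chi>" "v \<noteq> 0" using W_ne by blast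
        obtain u where u: "u \<in> Mat n 1" "v = B * u" using v WB by auto
        have "F \<one> * (B * u) \<in> S" using single u by simp
        moreover have "F \<one> * (B * u) \<noteq> 0"
        proof
          assume "F \<one> * (B * u) = 0"
          then have "\<alpha> (\<one>, \<one>) *\<^sub>C v = 0"
            using u Mat_mult[OF BM u(1)] by (simp add: proj_rep_one[OF F])
          then show False using v proj_repD(3)[OF F] by simp
        qed
        ultimately show "S \<noteq> {0}" by blast
        fix x w assume x: "x \<in> carrier G" and "w \<in> S"
        then obtain f where f: "\<forall>g\<in>carrier G. f g \<in> Mat n 1" "w = (\<Sum>g\<in>carrier G. F g * B * f g)"
          unfolding S_def by blast
        have "F x * w = (\<Sum>g\<in>carrier G. \<alpha> (g, x) *\<^sub>C (F (g \<otimes> x) * (B * f g)))"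
          unfolding f(2) sum_distrib_left
          by (intro sum.cong refl) (simp add: mult.assoc[symmetric] proj_repD(4)[OF F _ x])
        also have "\<dots> \<in> S" using f x single by (intro fm.subspace_sum[OF sub] fm.subspace_scale[OF sub]) auto
        finally show "F x * w \<in> S" .
      qed
      then have "v \<in> S" using v by simp
      then show ?thesis unfolding S_def by blast
    qed
    have direct: "\<forall>t\<in>rep ` carrier G. f t = 0"
      if f: "\<And>t. t \<in> rep ` carrier G \<Longrightarrow> f t \<in> Mat n 1"
        and sum0: "(\<Sum>t\<in>rep ` carrier G. F t * B * f t) = 0" for f
    proof -
      have repG: "t \<in> carrier G" if "t \<in> rep ` carrier G" for t using that rep by auto
      have ind: "\<forall>t\<in>rep ` carrier G. F t * B * f t = 0"
      proof (rule joint_eigenspaces_independent[where Z = Z and \<theta> = tw and d = d])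
        show "finite (rep ` carrier G)" using fin by simp
        show "(\<Sum>t\<in>rep ` carrier G. F t * B * f t) = 0" by (rule sum0)
        fix t assume t: "t \<in> rep ` carrier G"
        have "B * f t \<in> W \<chi>" using WB f[OF t] by auto
        then have "F t * (B * f t) \<in> W (tw t)" by (rule moves[OF repG[OF t]])
        then show "F t * B * f t \<in> joint_eigenspace d Z (tw t)" by (simp add: W_def mult.assoc)
      next
        fix s t assume s: "s \<in> rep ` carrier G" and t: "t \<in> rep ` carrier G" and "s \<noteq> t"
        have sG: "s \<in> carrier G" and tG: "t \<in> carrier G" using repG s t by auto
        show "\<exists>z\<in>Z. tw s z \<noteq> tw t z"
        proof (rule ccontr)
          assume "\<not> ?thesis"
          then have eq: "tw s z = tw t z" if "z \<in> Z" for z using that by auto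
          have "tw (s \<otimes> inv t) z = \<chi> z" if z: "z \<in> Z" for z
          proof -
            have "tw (s \<otimes> inv t) z = tw t (cj (inv t) z)"
              using tw_mult[OF sG inv_closed[OF tG]] eq[OF cjZ[OF inv_closed[OF tG] z]] by simp
            also have "\<dots> = tw (t \<otimes> inv t) z" using tw_mult[OF tG inv_closed[OF tG]] by simp
            finally show ?thesis using tG tw_one[OF z] by simp
          qed
          then have "s \<otimes> inv t \<in> K" using sG tG by (simp add: K_def)
          moreover have "s = s \<otimes> inv t \<otimes> t" using sG tG by (simp add: m_assoc)
          ultimately have "s \<in> K #> t" unfolding r_coset_def by blast
          then have "K #> t = K #> s" by (rule repr_independence[OF _ tG K])
          then have "rep s = rep t" by (simp add: rep_def)
          then show False using s t rep_rep \<open>s \<noteq> t\<close> by auto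
        qed
      qed
      show ?thesis
      proof
        fix t assume t: "t \<in> rep ` carrier G"
        have BfM: "B * f t \<in> Mat d 1" using Mat_mult[OF BM f[OF t]] .
        have "F t * B * f t = 0" using ind t by blast
        then have "F t * (B * f t) = 0" by (simp add: mult.assoc)
        then have "minv d (F t) * (F t * (B * f t)) = 0" by simp
        then have "B * f t = 0" using minv_cancel(2)[OF GL[OF repG[OF t]] BfM] by simp
        then show "f t = 0" using B f[OF t] by (auto simp: inj_mat_def)
      qed
    qed
    have "module_iso G (coord_space d) (rep_action d F)
        (induced_space G \<alpha> K (coord_space n) (rep_action n P)) (induced_action G \<alpha> (coord_space n))"
      by (rule induced_module_iso[OF G fin F K P BM FB rep spans direct])
    moreover have "twisted_module (G\<lparr>carrier := K\<rparr>) \<alpha> (coord_space n) (rep_action n P)"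
      by (rule rep_action_twisted_module[OF P n subgroup.subgroup_is_group[OF K G]])
    ultimately show False using prim K proper unfolding primitive_module_def by blast
  qed
  then have stable: "tw g z = \<chi> z" if "g \<in> carrier G" "z \<in> Z" for g z
    using that unfolding K_def by blast
  have "W \<chi> = Mat d 1"
  proof (rule irr[OF W_sub W_Mat])
    show "W \<chi> \<noteq> {0}" using W_ne by auto
    fix g w assume g: "g \<in> carrier G" and w: "w \<in> W \<chi>"
    show "F g * w \<in> W \<chi>" using moves[OF g w] stable[OF g] by (auto simp: W_def joint_eigenspace_def)
  qed
  then have "z * v = (\<chi> z *\<^sub>C idm d) * v" if "v \<in> Mat d 1" for v
    using that z by (auto simp: W_def joint_eigenspace_def)
  then have "z = \<chi> z *\<^sub>C idm d"
    using z Z by (intro Mat_ext[of z d d "\<chi> z *\<^sub>C idm d"]) auto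
  then show ?thesis by blast
qed

section \<open>Tensor products\<close>

definition kron :: "nat \<Rightarrow> nat \<Rightarrow> fmat \<Rightarrow> fmat \<Rightarrow> fmat" where
  "kron m n X Y = mk (m * n) (m * n) (\<lambda>s t. entry X (s div n) (t div n) * entry Y (s mod n) (t mod n))"

lemma kron_Mat [simp, intro]: "kron m n X Y \<in> Mat (m * n) (m * n)"
  by (simp add: kron_def)

lemma sum_lessThan_mult:
  "(\<Sum>t<m * n. f t) = (\<Sum>i<m. \<Sum>q<n. f (i * n + q) :: complex)" for n :: nat
proof (induction m)
  case (Suc m)
  have add: "(\<Sum>t<a + b. f t) = (\<Sum>t<a. f t) + (\<Sum>r<b. f (a + r))" for a b :: nat
    by (induction b) (auto simp: add.assoc)
  show ?case using add[of "m * n" n] Suc by (simp add: add.commute)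
qed simp

lemma index_lt: "i < m \<Longrightarrow> q < n \<Longrightarrow> i * n + q < m * n" for i m q n :: nat
  using nat_le_iff_add[of "Suc i" m] by (metis add_less_cancel_left less_le_trans mult_Suc
      mult_le_mono1 Suc_leI add.commute)

lemma kron_mult:
  assumes A: "A \<in> Mat m m" and B: "B \<in> Mat n n"
  shows "kron m n A B * kron m n C D = kron m n (A * C) (B * D)"
proof (rule Mat_eqI[of _ "m * n" "m * n"])
  fix s t assume st: "s < m * n" "t < m * n"
  then have n: "0 < n" by (cases n) auto
  have st': "s div n < m" "t div n < m" "s mod n < n" "t mod n < n"
    using st n by (auto simp: less_mult_imp_div_less)
  have "entry (kron m n A B * kron m n C D) s t
      = (\<Sum>i<m. \<Sum>q<n. entry (kron m n A B) s (i * n + q) * entry (kron m n C D) (i * n + q) t)"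
    by (simp add: entry_mult_Mat[OF kron_Mat] sum_lessThan_mult)
  also have "\<dots> = (\<Sum>i<m. \<Sum>q<n. (entry A (s div n) i * entry C i (t div n)) * (entry B (s mod n) q * entry D q (t mod n)))"
    by (intro sum.cong refl) (use st n index_lt in \<open>simp add: kron_def\<close>)
  also have "\<dots> = entry (kron m n (A * C) (B * D)) s t"
    using st by (simp add: kron_def entry_mult_Mat[OF A] entry_mult_Mat[OF B] sum_product)
  finally show "entry (kron m n A B * kron m n C D) s t = entry (kron m n (A * C) (B * D)) s t" .
qed auto

lemma inj_mat_le:
  assumes "inj_mat d k B" shows "k \<le> d"
proof (rule ccontr)
  assume "\<not> k \<le> d"
  then have dk: "d < k" by simp
  have BM: "B \<in> Mat d k" using assms by (simp add: inj_mat_def)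
  then have BM': "B \<in> Mat k k" using dk by (auto simp: Mat_def)
  then have "inj_mat k k B" using assms by (simp add: inj_mat_def)
  then have "B \<in> GL k" by (simp only: inj_mat_GL)
  then have "B * minv k B = idm k" by (rule minv)
  then have "entry (B * minv k B) d d = 1" using dk by simp
  moreover have "entry (B * minv k B) d d = 0" using BM by (simp add: entry_mult_Mat[OF BM] Mat_entry)
  ultimately show False by simp
qed

text \<open>Commuting with the \<open>F j\<close> means commuting with their span.\<close>

lemma scalar_commutant_mono:
  assumes sc: "scalar_commutant d I F" and sub: "F ` I \<subseteq> fm.span (F ` J)"
  shows "scalar_commutant d J F"
  unfolding scalar_commutant_def
proof (intro ballI impI)
  fix M assume M: "M \<in> Mat d d" "\<forall>i\<in>J. M * F i = F i * M"
  have "M * s = s * M" if "s \<in> fm.span (F ` J)" for s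
    using that by (induction rule: fm.span_induct_alt) (use M in \<open>auto simp: distrib_left distrib_right\<close>)
  then show "\<exists>c. M = c *\<^sub>C idm d" using sc M sub unfolding scalar_commutant_def by blast
qed

lemma cancel_scaleC: "A \<in> GL d \<Longrightarrow> 0 < d \<Longrightarrow> a *\<^sub>C A = b *\<^sub>C A \<Longrightarrow> a = b"
proof -
  assume A: "A \<in> GL d" and d: "0 < d" and eq: "a *\<^sub>C A = b *\<^sub>C A"
  have "(a *\<^sub>C A) * minv d A = (b *\<^sub>C A) * minv d A" by (simp only: eq)
  then have "a *\<^sub>C idm d = b *\<^sub>C idm d" using minv(2)[OF A] by simp
  then have "entry (a *\<^sub>C idm d) 0 0 = entry (b *\<^sub>C idm d) 0 0" by (rule arg_cong)
  then show ?thesis using d by simp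
qed

text \<open>The span of \<open>x(G)\<close> has scalar centre, since a central element also commutes with
  \<open>y(G)\<close>, so it contains matrix units \<open>e i j\<close>, and \<open>X\<close> consists of the coordinates of \<open>x\<close>
  with respect to them. The image of \<open>e 0 0\<close> is a space on which \<open>y(G)\<close> acts; this action is
  \<open>Y\<close>. Applying \<open>e i 0\<close> to a basis \<open>B\<close> of that image, for all \<open>i\<close>, gives a basis of the
  whole space, the columns of \<open>S\<close>, in which \<open>F\<close> is the Kronecker product. Irreducibility on
  \<open>H\<close> and \<open>H'\<close> follows since restricting \<open>X\<close> and \<open>Y\<close> does not change their spans.\<close>

lemma tensor_decomposition:
  assumes G: "group G" and fin: "finite (carrier G)" and F: "proj_rep G \<alpha> d F" and d: "0 < d"
    and sc: "scalar_commutant d (carrier G) F"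
    and x: "\<And>g. g \<in> carrier G \<Longrightarrow> x g \<in> GL d" and y: "\<And>g. g \<in> carrier G \<Longrightarrow> y g \<in> GL d"
    and Fxy: "\<And>g. g \<in> carrier G \<Longrightarrow> F g = x g * y g"
    and comm: "\<And>g h. g \<in> carrier G \<Longrightarrow> h \<in> carrier G \<Longrightarrow> x g * y h = y h * x g"
    and H: "H \<subseteq> carrier G" "x ` carrier G \<subseteq> fm.span (x ` H)"
    and H': "H' \<subseteq> carrier G" "y ` carrier G \<subseteq> fm.span (y ` H')"
  obtains m n \<beta> \<gamma> X Y S where "0 < m" "0 < n" "d = m * n" "S \<in> GL d"
    "proj_rep G \<beta> m X" "proj_rep G \<gamma> n Y" "scalar_commutant m H X" "scalar_commutant n H' Y"
    "\<forall>g\<in>carrier G. F g * S = S * kron m n (X g) (Y g)"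
    "\<forall>g\<in>carrier G. \<forall>h\<in>carrier G. \<alpha> (g, h) = \<beta> (g, h) * \<gamma> (g, h)"
proof -
  interpret group G by fact
  obtain \<beta> where xrep: "proj_rep G \<beta> d x"
    by (rule proj_rep_of_commuting_factor[where u = x and v = y, OF G F d sc x y Fxy comm])
  have Fyx: "F g = y g * x g" if "g \<in> carrier G" for g using Fxy comm that by simp
  obtain \<gamma> where yrep: "proj_rep G \<gamma> d y"
    by (rule proj_rep_of_commuting_factor[where u = y and v = x, OF G F d sc y x Fyx comm[symmetric]])
  note xM = proj_repD(2)[OF xrep] and yM = proj_repD(2)[OF yrep]
  have comm_span: "s * y h = y h * s" if "s \<in> fm.span (x ` carrier G)" "h \<in> carrier G" for s h
    using that(1) by (induction rule: fm.span_induct_alt) (use that comm in \<open>auto simp: distrib_left distrib_right\<close>)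
  have center: "\<exists>c. z = c *\<^sub>C idm d"
    if z: "z \<in> fm.span (x ` carrier G)" "\<And>g. g \<in> carrier G \<Longrightarrow> z * x g = x g * z" for z
  proof -
    have "z * F g = F g * z" if g: "g \<in> carrier G" for g
      using comm_span[OF z(1) g] z(2)[OF g] by (simp add: Fxy[OF g]) (metis mult.assoc)
    moreover have "z \<in> Mat d d" using z(1) span_image_Mat[of "carrier G" x d] xM by auto
    ultimately show ?thesis using sc unfolding scalar_commutant_def by blast
  qed
  obtain m X e where X: "proj_rep G \<beta> m X" and scX: "scalar_commutant m (carrier G) X"
    and e: "matrix_units d m e" and e_span: "\<forall>i<m. \<forall>j<m. e i j \<in> fm.span (x ` carrier G)"
    and xe: "\<forall>g\<in>carrier G. x g = (\<Sum>i<m. \<Sum>j<m. entry (X g) i j *\<^sub>C e i j)"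
    by (rule span_scalar_center_matrix_units[OF G fin xrep d center])
  note E = matrix_unitsD[OF e]
  have m: "0 < m" by (rule E(1))
  have ye: "y g * e i j = e i j * y g" if "g \<in> carrier G" "i < m" "j < m" for g i j
    using comm_span[of "e i j" g] e_span that by simp
  \<comment> \<open>the image of \<open>e 0 0\<close>; the factor \<open>1\<close> gives it the form of an eigenspace\<close>
  define W where "W = {v \<in> Mat d 1. e 0 0 * v = 1 *\<^sub>C v}"
  have W: "fm.subspace W" "W \<subseteq> Mat d 1"
    unfolding W_def using eigenspace_subspace[OF E(2)[OF m m]] by blast+
  obtain n B where B: "inj_mat d n B" and WB: "W = {B * v | v. v \<in> Mat n 1}"
    and "n \<le> d" "W \<noteq> Mat d 1 \<longrightarrow> n < d"
    by (rule subspace_basis[OF W])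
  have BM: "B \<in> Mat d n" using B by (simp add: inj_mat_def)
  have e00B: "e 0 0 * B = B"
  proof (rule Mat_ext[of _ d n])
    fix u assume "u \<in> Mat n 1"
    then have "B * u \<in> W" using WB by auto
    then show "e 0 0 * B * u = B * u" by (simp add: W_def mult.assoc)
  qed (use BM Mat_mult[OF E(2)[OF m m] BM] in auto)
  have "\<exists>Z. Z \<in> Mat n n \<and> y g * B = B * Z" if g: "g \<in> carrier G" for g
  proof -
    have "\<exists>v\<in>Mat n 1. y g * B * u = B * v" if u: "u \<in> Mat n 1" for u
    proof -
      have M: "y g * B * u \<in> Mat d 1" using Mat_mult[OF Mat_mult[OF yM[OF g] BM] u] .
      have "e 0 0 * (y g * B * u) = y g * (e 0 0 * B) * u"
        using ye[OF g m m] by (simp add: mult.assoc[symmetric])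
      then have "y g * B * u \<in> W" using M by (simp add: W_def e00B)
      then show ?thesis using WB by auto
    qed
    then show ?thesis using factor_through[OF Mat_mult[OF yM[OF g] BM] BM] by metis
  qed
  then obtain Y where YM: "\<And>g. g \<in> carrier G \<Longrightarrow> Y g \<in> Mat n n" and yB: "\<And>g. g \<in> carrier G \<Longrightarrow> y g * B = B * Y g"
    by metis
  have Y: "proj_rep G \<gamma> n Y" by (rule sub_rep[OF G yrep B YM yB])
  note XM = proj_repD(2)[OF X]
  \<comment> \<open>the part of a vector of length \<open>m * n\<close> in the copy of the multiplicity space with index
    \<open>i\<close>\<close>
  define slice where "slice i u = mk n 1 (\<lambda>q _. entry u (i * n + q) 0)" for i u
  have slM: "slice i u \<in> Mat n 1" for i u by (simp add: slice_def)
  \<comment> \<open>the bases \<open>e i 0 * B\<close> of the images of the \<open>e i i\<close>, side by side\<close>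
  define S where "S = mk d (m * n) (\<lambda>r t. entry (e (t div n) 0 * B) r (t mod n))"
  have SM: "S \<in> Mat d (m * n)" by (simp add: S_def)
  have eB: "e i 0 * B \<in> Mat d n" if "i < m" for i using Mat_mult[OF E(2)[OF that m] BM] .
  have Su: "S * u = (\<Sum>i<m. e i 0 * B * slice i u)" if u: "u \<in> Mat (m * n) 1" for u
  proof (rule Mat_eqI[of _ d 1])
    show "S * u \<in> Mat d 1" using Mat_mult[OF SM u] .
    show "(\<Sum>i<m. e i 0 * B * slice i u) \<in> Mat d 1" using Mat_mult[OF eB slM] by auto
    fix r c assume r: "r < d" and c: "c < (1::nat)"
    have "entry (S * u) r c = (\<Sum>i<m. \<Sum>q<n. entry S r (i * n + q) * entry u (i * n + q) c)"
      by (simp add: entry_mult_Mat[OF SM] sum_lessThan_mult)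
    also have "\<dots> = (\<Sum>i<m. \<Sum>q<n. entry (e i 0 * B) r q * entry (slice i u) q c)"
      by (intro sum.cong refl) (use r c index_lt in \<open>simp add: S_def slice_def\<close>)
    also have "\<dots> = entry (\<Sum>i<m. e i 0 * B * slice i u) r c"
      unfolding entry_sum by (intro sum.cong refl) (simp add: entry_mult_Mat[OF eB])
    finally show "entry (S * u) r c = entry (\<Sum>i<m. e i 0 * B * slice i u) r c" .
  qed
  have Sinj: "inj_mat d (m * n) S"
    unfolding inj_mat_def
  proof (intro conjI ballI impI SM)
    fix u assume u: "u \<in> Mat (m * n) 1" and 0: "S * u = 0"
    have sl0: "slice j u = 0" if j: "j < m" for j
    proof -
      have "e 0 j * (S * u) = (\<Sum>i<m. if i = j then e 0 0 * B * slice i u else 0)"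
        unfolding Su[OF u] sum_distrib_left
        by (intro sum.cong refl) (use E(3)[OF m j _ m] in \<open>auto simp: mult.assoc[symmetric]\<close>)
      also have "\<dots> = B * slice j u" using j by (simp add: sum.delta e00B)
      finally have "B * slice j u = 0" using 0 by simp
      then show ?thesis using B slM by (auto simp: inj_mat_def)
    qed
    show "u = 0"
    proof (rule Mat_eqI[OF u Mat_closed(1)])
      fix t c assume t: "t < m * n" and c: "c < (1::nat)"
      then have n: "0 < n" by (cases n) auto
      have "t div n < m" "t mod n < n" using t n by (auto simp: less_mult_imp_div_less)
      then have "entry (slice (t div n) u) (t mod n) 0 = 0" using sl0 by simp
      then show "entry u t c = entry 0 t c" using \<open>t mod n < n\<close> c by (simp add: slice_def)
    qed
  qed
  have Ssurj: "\<exists>u\<in>Mat (m * n) 1. v = S * u" if v: "v \<in> Mat d 1" for v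
  proof -
    have "\<exists>s. s \<in> Mat n 1 \<and> e 0 i * v = B * s" if i: "i < m" for i
    proof -
      have "e 0 0 * (e 0 i * v) = e 0 i * v" using E(3)[OF m m m i] by (simp add: mult.assoc[symmetric])
      then have "e 0 i * v \<in> W" using Mat_mult[OF E(2)[OF m i] v] by (simp add: W_def)
      then show ?thesis using WB by auto
    qed
    then obtain s where s: "\<And>i. i < m \<Longrightarrow> s i \<in> Mat n 1" "\<And>i. i < m \<Longrightarrow> e 0 i * v = B * s i" by metis
    define u where "u = mk (m * n) 1 (\<lambda>t _. entry (s (t div n)) (t mod n) 0)"
    have sl: "slice i u = s i" if i: "i < m" for i
      by (rule Mat_eqI[OF slM s(1)[OF i]]) (use i index_lt in \<open>simp add: slice_def u_def\<close>)
    have uM: "u \<in> Mat (m * n) 1" by (simp add: u_def)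
    have "S * u = (\<Sum>i<m. e i 0 * B * s i)" unfolding Su[OF uM] using sl by (intro sum.cong refl) simp
    also have "\<dots> = (\<Sum>i<m. e i i * v)"
    proof (intro sum.cong refl)
      fix i assume "i \<in> {..<m}"
      then have i: "i < m" by simp
      have "e i 0 * B * s i = e i 0 * (e 0 i * v)" using s(2)[OF i] by (simp add: mult.assoc)
      then show "e i 0 * B * s i = e i i * v" using E(3)[OF i m m i] by (simp add: mult.assoc[symmetric])
    qed
    also have "\<dots> = v" using v E(4) by (simp add: sum_distrib_right[symmetric])
    finally show ?thesis using uM by auto
  qed
  have dmn: "d = m * n"
  proof -
    have "\<exists>w\<in>Mat (m * n) 1. idm d * v = S * w" if "v \<in> Mat d 1" for v
      using Ssurj[OF that] that by simp
    then obtain R where R: "R \<in> Mat (m * n) d" "idm d = S * R"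
      by (rule factor_through[OF idm_Mat SM])
    have "inj_mat (m * n) d R"
      unfolding inj_mat_def
    proof (intro conjI ballI impI R(1))
      fix v assume v: "v \<in> Mat d 1" "R * v = 0"
      have "v = idm d * v" using v by simp
      also have "\<dots> = S * R * v" by (simp only: R(2))
      finally have "v = S * R * v" .
      then show "v = 0" using v by (simp add: mult.assoc)
    qed
    then show ?thesis using inj_mat_le Sinj by (metis le_antisym)
  qed
  have n: "0 < n" using d dmn by (cases n) auto
  have SGL: "S \<in> GL d" using Sinj inj_mat_GL dmn by simp
  have intertwine: "F g * S = S * kron m n (X g) (Y g)" if g: "g \<in> carrier G" for g
  proof (rule Mat_ext[of _ d "m * n"])
    show "F g * S \<in> Mat d (m * n)" using Mat_mult[OF proj_repD(2)[OF F g] SM] .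
    show "S * kron m n (X g) (Y g) \<in> Mat d (m * n)" using Mat_mult[OF SM kron_Mat] .
    fix u assume u: "u \<in> Mat (m * n) 1"
    have kM: "kron m n (X g) (Y g) * u \<in> Mat (m * n) 1" using Mat_mult[OF kron_Mat u] .
    have sl: "slice a (kron m n (X g) (Y g) * u) = (\<Sum>i<m. entry (X g) a i *\<^sub>C (Y g * slice i u))" if a: "a < m" for a
    proof (rule Mat_eqI[OF slM])
      show "(\<Sum>i<m. entry (X g) a i *\<^sub>C (Y g * slice i u)) \<in> Mat n 1" using Mat_mult[OF YM[OF g] slM] by auto
      fix q c assume q: "q < n" and c: "c < (1::nat)"
      have aq: "a * n + q < m * n" using a q by (rule index_lt)
      have "entry (slice a (kron m n (X g) (Y g) * u)) q c
          = (\<Sum>i<m. \<Sum>r<n. entry (kron m n (X g) (Y g)) (a * n + q) (i * n + r) * entry u (i * n + r) 0)"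
        using q c by (simp add: slice_def entry_mult_Mat[OF kron_Mat] sum_lessThan_mult)
      also have "\<dots> = (\<Sum>i<m. \<Sum>r<n. entry (X g) a i * (entry (Y g) q r * entry (slice i u) r c))"
        by (intro sum.cong refl) (use aq q c index_lt in \<open>simp add: kron_def slice_def\<close>)
      also have "\<dots> = entry (\<Sum>i<m. entry (X g) a i *\<^sub>C (Y g * slice i u)) q c"
        by (simp add: entry_mult_Mat[OF YM[OF g]] sum_distrib_left)
      finally show "entry (slice a (kron m n (X g) (Y g) * u)) q c
          = entry (\<Sum>i<m. entry (X g) a i *\<^sub>C (Y g * slice i u)) q c" .
    qed
    have xei: "x g * e i 0 = (\<Sum>a<m. entry (X g) a i *\<^sub>C e a 0)" if i: "i < m" for i
    proof -
      have "x g * e i 0 = (\<Sum>a<m. \<Sum>b<m. if b = i then entry (X g) a b *\<^sub>C e a 0 else 0)"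
        unfolding xe[rule_format, OF g] sum_distrib_right
        by (intro sum.cong refl) (use E(3)[OF _ _ i m] in auto)
      then show ?thesis using i by (simp add: sum.delta)
    qed
    have "F g * S * u = (\<Sum>i<m. x g * (y g * e i 0) * B * slice i u)"
      by (simp add: mult.assoc Su[OF u] sum_distrib_left Fxy[OF g])
    also have "\<dots> = (\<Sum>i<m. \<Sum>a<m. e a 0 * B * (entry (X g) a i *\<^sub>C (Y g * slice i u)))"
    proof (intro sum.cong refl)
      fix i assume "i \<in> {..<m}"
      then have i: "i < m" by simp
      have "x g * (y g * e i 0) * B * slice i u = x g * e i 0 * (y g * B) * slice i u"
        by (simp add: ye[OF g i m] mult.assoc)
      also have "\<dots> = (\<Sum>a<m. entry (X g) a i *\<^sub>C e a 0) * B * (Y g * slice i u)"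
        by (simp only: yB[OF g] xei[OF i] mult.assoc)
      finally show "x g * (y g * e i 0) * B * slice i u = (\<Sum>a<m. e a 0 * B * (entry (X g) a i *\<^sub>C (Y g * slice i u)))"
        by (simp add: sum_distrib_right)
    qed
    also have "\<dots> = (\<Sum>a<m. e a 0 * B * (\<Sum>i<m. entry (X g) a i *\<^sub>C (Y g * slice i u)))"
      by (subst sum.swap) (simp only: sum_distrib_left)
    also have "\<dots> = S * (kron m n (X g) (Y g) * u)"
      unfolding Su[OF kM] by (intro sum.cong refl) (simp add: sl)
    finally show "F g * S * u = S * kron m n (X g) (Y g) * u" by (simp add: mult.assoc)
  qed
  have "X ` carrier G \<subseteq> fm.span (X ` H)"
  proof safe
    fix g assume g: "g \<in> carrier G"
    have "finite H" using H(1) fin finite_subset by blast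
    moreover have "x g \<in> fm.span (x ` H)" using H(2) g by auto
    ultimately obtain c where c: "x g = (\<Sum>h\<in>H. c h *\<^sub>C x h)" by (rule span_image_finite)
    have coeff: "e 0 a * x h * e b 0 = entry (X h) a b *\<^sub>C e 0 0" if h: "h \<in> carrier G" and a: "a < m" and b: "b < m" for h a b
    proof -
      have "e 0 a * x h * e b 0 = (\<Sum>i<m. \<Sum>j<m. if j = b then (if i = a then entry (X h) i j *\<^sub>C e 0 0 else 0) else 0)"
        unfolding xe[rule_format, OF h] sum_distrib_right sum_distrib_left
        by (intro sum.cong refl) (use E(3)[OF m a] E(3)[OF _ _ b m] E(3)[OF m _ b m] b m in auto)
      then show ?thesis using a b by (simp add: sum.delta)
    qed
    have e0: "e 0 0 \<noteq> 0" by (rule matrix_units_nonzero[OF e d m m])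
    have "X g = (\<Sum>h\<in>H. c h *\<^sub>C X h)"
    proof (rule Mat_eqI[OF XM[OF g]])
      show "(\<Sum>h\<in>H. c h *\<^sub>C X h) \<in> Mat m m" using XM H(1) by auto
      fix a b assume ab: "a < m" "b < m"
      have "entry (X g) a b *\<^sub>C e 0 0 = e 0 a * x g * e b 0" using coeff[OF g ab] by simp
      also have "\<dots> = (\<Sum>h\<in>H. c h *\<^sub>C (e 0 a * x h * e b 0))"
        by (simp add: c sum_distrib_left sum_distrib_right)
      also have "\<dots> = (\<Sum>h\<in>H. c h * entry (X h) a b) *\<^sub>C e 0 0"
        unfolding fm.scale_sum_left using H(1) ab by (intro sum.cong refl) (auto simp: coeff)
      finally show "entry (X g) a b = entry (\<Sum>h\<in>H. c h *\<^sub>C X h) a b" using e0 by simp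
    qed
    then show "X g \<in> fm.span (X ` H)"
      by (simp only:) (intro fm.span_sum fm.span_scale fm.span_base imageI)
  qed
  then have scXH: "scalar_commutant m H X" by (rule scalar_commutant_mono[OF scX])
  have scY: "scalar_commutant n (carrier G) Y"
    unfolding scalar_commutant_def
  proof (intro ballI impI)
    fix M assume M: "M \<in> Mat n n" and MY: "\<forall>g\<in>carrier G. M * Y g = Y g * M"
    \<comment> \<open>A matrix commuting with \<open>Y\<close> gives one commuting with \<open>F\<close>.\<close>
    let ?k = "kron m n (idm m) M"
    have SiM: "minv d S \<in> Mat d d" by (rule minv(1)[OF SGL])
    have SMd: "S \<in> Mat d d" by (rule GL_Mat[OF SGL])
    have kd: "kron m n A C \<in> Mat d d" for A C using dmn by simp
    have "(S * ?k * minv d S) * F g = F g * (S * ?k * minv d S)" if g: "g \<in> carrier G" for g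
    proof -
      let ?K = "kron m n (X g) (Y g)"
      have FM: "F g \<in> Mat d d" by (rule proj_repD(2)[OF F g])
      have kk: "?k * ?K = ?K * ?k"
        using MY g M XM[OF g] YM[OF g] by (simp add: kron_mult)
      have i1: "minv d S * F g = ?K * minv d S"
      proof -
        have "minv d S * F g = minv d S * (F g * S) * minv d S"
          using minv_cancel(3)[OF SGL Mat_mult[OF SiM FM]] by (simp add: mult.assoc)
        also have "\<dots> = minv d S * (S * (?K * minv d S))" by (simp add: intertwine[OF g] mult.assoc)
        also have "\<dots> = ?K * minv d S" by (rule minv_cancel(2)[OF SGL Mat_mult[OF kd SiM]])
        finally show ?thesis .
      qed
      have "(S * ?k * minv d S) * F g = S * (?k * ?K) * minv d S" by (simp add: i1 mult.assoc)
      also have "\<dots> = (S * ?K) * ?k * minv d S" by (simp add: kk mult.assoc)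
      also have "\<dots> = F g * (S * ?k * minv d S)" by (simp add: intertwine[OF g, symmetric] mult.assoc)
      finally show ?thesis .
    qed
    moreover have "S * ?k * minv d S \<in> Mat d d" using Mat_mult[OF Mat_mult[OF SMd kd] SiM] .
    ultimately obtain c where c: "S * ?k * minv d S = c *\<^sub>C idm d" using sc unfolding scalar_commutant_def by blast
    have "?k = minv d S * (S * ?k * minv d S) * S"
      using minv_cancel(2)[OF SGL kd] minv_cancel(4)[OF SGL kd] by (simp add: mult.assoc)
    also have "\<dots> = c *\<^sub>C idm d" unfolding c using SMd minv(3)[OF SGL] SiM by simp
    finally have k: "?k = c *\<^sub>C idm d" .
    have "M = c *\<^sub>C idm n"
    proof (rule Mat_eqI[OF M])
      fix q r assume qr: "q < n" "r < n"
      have mn: "q < m * n" "r < m * n" using index_lt[of 0 m q n] index_lt[of 0 m r n] m qr by auto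
      have "entry ?k q r = entry M q r" using mn qr m by (simp add: kron_def)
      then show "entry M q r = entry (c *\<^sub>C idm n) q r" using mn qr dmn by (simp add: k)
    qed auto
    then show "\<exists>c. M = c *\<^sub>C idm n" by blast
  qed
  have "Y ` carrier G \<subseteq> fm.span (Y ` H')"
  proof safe
    fix g assume g: "g \<in> carrier G"
    have "finite H'" using H'(1) fin finite_subset by blast
    moreover have "y g \<in> fm.span (y ` H')" using H'(2) g by auto
    ultimately obtain c where c: "y g = (\<Sum>h\<in>H'. c h *\<^sub>C y h)" by (rule span_image_finite)
    have "B * Y g = B * (\<Sum>h\<in>H'. c h *\<^sub>C Y h)"
      unfolding yB[OF g, symmetric] c sum_distrib_right sum_distrib_left
      using H'(1) by (intro sum.cong refl) (auto simp: yB subset_iff)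
    moreover have "(\<Sum>h\<in>H'. c h *\<^sub>C Y h) \<in> Mat n n"
      using YM H'(1) by (intro Mat_sum Mat_closed(5)) auto
    ultimately have "Y g = (\<Sum>h\<in>H'. c h *\<^sub>C Y h)"
      by (intro inj_mat_cancel[OF B YM[OF g]])
    then show "Y g \<in> fm.span (Y ` H')"
      by (simp only:) (intro fm.span_sum fm.span_scale fm.span_base imageI)
  qed
  then have scYH: "scalar_commutant n H' Y" by (rule scalar_commutant_mono[OF scY])
  have "\<alpha> (g, h) = \<beta> (g, h) * \<gamma> (g, h)" if g: "g \<in> carrier G" and h: "h \<in> carrier G" for g h
  proof -
    let ?gh = "g \<otimes>\<^bsub>G\<^esub> h"
    have "\<alpha> (g, h) *\<^sub>C F ?gh = x h * (y h * x g) * y g"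
      using proj_repD(4)[OF F g h] by (simp add: Fxy[OF g] Fxy[OF h] mult.assoc)
    also have "\<dots> = (x h * x g) * (y h * y g)" by (simp add: comm[OF g h, symmetric] mult.assoc)
    also have "\<dots> = (\<beta> (g, h) * \<gamma> (g, h)) *\<^sub>C F ?gh"
      using g h by (simp add: proj_repD(4)[OF xrep] proj_repD(4)[OF yrep] Fxy mult.commute)
    finally show ?thesis using cancel_scaleC[OF proj_repD(1)[OF F] d] g h by blast
  qed
  then show ?thesis
    using that[OF m n dmn SGL X Y scXH scYH] intertwine by blast
qed

section \<open>Coclasses\<close>

lemma Z2_simps:
  "carrier (Z2 G) = {\<alpha> \<in> carrier G \<times> carrier G \<rightarrow>\<^sub>E UNIV - {0}.
        \<forall>x\<in>carrier G. \<forall>y\<in>carrier G. \<forall>z\<in>carrier G.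
          \<alpha> (x, y) * \<alpha> (x \<otimes>\<^bsub>G\<^esub> y, z) = \<alpha> (x, y \<otimes>\<^bsub>G\<^esub> z) * \<alpha> (y, z)}"
  "\<alpha> \<otimes>\<^bsub>Z2 G\<^esub> \<beta> = (\<lambda>p\<in>carrier G \<times> carrier G. \<alpha> p * \<beta> p)"
  "\<one>\<^bsub>Z2 G\<^esub> = (\<lambda>p\<in>carrier G \<times> carrier G. 1)"
  by (simp_all add: Z2_def)

context group
begin

lemma Z2I:
  assumes "\<And>x y. x \<in> carrier G \<Longrightarrow> y \<in> carrier G \<Longrightarrow> \<beta> (x, y) \<noteq> 0"
    and "\<And>x y z. x \<in> carrier G \<Longrightarrow> y \<in> carrier G \<Longrightarrow> z \<in> carrier G \<Longrightarrow>
      \<beta> (x, y) * \<beta> (x \<otimes> y, z) = \<beta> (x, y \<otimes> z) * \<beta> (y, z)"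
  shows "restrict \<beta> (carrier G \<times> carrier G) \<in> carrier (Z2 G)"
  using assms by (auto simp: Z2_simps)

lemma Z2_comm_group: "comm_group (Z2 G)"
proof (rule comm_groupI)
  fix \<alpha> \<beta> assume a: "\<alpha> \<in> carrier (Z2 G)" and b: "\<beta> \<in> carrier (Z2 G)"
  show "\<alpha> \<otimes>\<^bsub>Z2 G\<^esub> \<beta> \<in> carrier (Z2 G)"
    unfolding Z2_simps(2)
  proof (rule Z2I)
    fix x y z assume xyz: "x \<in> carrier G" "y \<in> carrier G" "z \<in> carrier G"
    have "\<alpha> (x, y) * \<alpha> (x \<otimes> y, z) = \<alpha> (x, y \<otimes> z) * \<alpha> (y, z)"
      "\<beta> (x, y) * \<beta> (x \<otimes> y, z) = \<beta> (x, y \<otimes> z) * \<beta> (y, z)"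
      using a b xyz by (simp_all add: Z2_simps)
    then have "(\<alpha> (x, y) * \<alpha> (x \<otimes> y, z)) * (\<beta> (x, y) * \<beta> (x \<otimes> y, z))
        = (\<alpha> (x, y \<otimes> z) * \<alpha> (y, z)) * (\<beta> (x, y \<otimes> z) * \<beta> (y, z))" by (simp only:)
    then show "\<alpha> (x, y) * \<beta> (x, y) * (\<alpha> (x \<otimes> y, z) * \<beta> (x \<otimes> y, z))
        = \<alpha> (x, y \<otimes> z) * \<beta> (x, y \<otimes> z) * (\<alpha> (y, z) * \<beta> (y, z))"
      by (simp only: mult_ac)
  qed (use a b in \<open>auto simp: Z2_simps\<close>)
  show "\<alpha> \<otimes>\<^bsub>Z2 G\<^esub> \<beta> = \<beta> \<otimes>\<^bsub>Z2 G\<^esub> \<alpha>" by (simp add: Z2_simps mult.commute)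
next
  show "\<one>\<^bsub>Z2 G\<^esub> \<in> carrier (Z2 G)" by (simp add: Z2_simps(3)) (rule Z2I, auto)
  fix \<alpha> assume a: "\<alpha> \<in> carrier (Z2 G)"
  then show "\<one>\<^bsub>Z2 G\<^esub> \<otimes>\<^bsub>Z2 G\<^esub> \<alpha> = \<alpha>"
    by (auto simp: Z2_simps fun_eq_iff PiE_def extensional_def)
  have "restrict (\<lambda>p. inverse (\<alpha> p)) (carrier G \<times> carrier G) \<in> carrier (Z2 G)"
  proof (rule Z2I)
    fix x y z assume xyz: "x \<in> carrier G" "y \<in> carrier G" "z \<in> carrier G"
    have "\<alpha> (x, y) * \<alpha> (x \<otimes> y, z) = \<alpha> (x, y \<otimes> z) * \<alpha> (y, z)" using a xyz by (simp add: Z2_simps)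
    then show "inverse (\<alpha> (x, y)) * inverse (\<alpha> (x \<otimes> y, z)) = inverse (\<alpha> (x, y \<otimes> z)) * inverse (\<alpha> (y, z))"
      by (simp only: inverse_mult_distrib[symmetric])
  qed (use a in \<open>auto simp: Z2_simps\<close>)
  moreover have "restrict (\<lambda>p. inverse (\<alpha> p)) (carrier G \<times> carrier G) \<otimes>\<^bsub>Z2 G\<^esub> \<alpha> = \<one>\<^bsub>Z2 G\<^esub>"
  proof -
    have "\<alpha> (x, y) \<noteq> 0" if "x \<in> carrier G" "y \<in> carrier G" for x y
      using a that by (auto simp: Z2_simps)
    then show ?thesis by (auto simp: Z2_simps fun_eq_iff)
  qed
  ultimately show "\<exists>\<beta>\<in>carrier (Z2 G). \<beta> \<otimes>\<^bsub>Z2 G\<^esub> \<alpha> = \<one>\<^bsub>Z2 G\<^esub>" by blast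
qed (auto simp: Z2_simps fun_eq_iff)

lemma B2_iff: "\<beta> \<in> B2 G \<longleftrightarrow> \<beta> \<in> extensional (carrier G \<times> carrier G) \<and>
   (\<exists>\<mu>. (\<forall>x\<in>carrier G. \<mu> x \<noteq> 0) \<and> (\<forall>x\<in>carrier G. \<forall>y\<in>carrier G. \<beta> (x, y) = \<mu> x * \<mu> y / \<mu> (x \<otimes> y)))"
  (is "?l \<longleftrightarrow> ?r")
proof
  assume ?l
  then obtain \<mu> where "\<mu> \<in> carrier G \<rightarrow> UNIV - {0}"
    "\<beta> = (\<lambda>(x, y)\<in>carrier G \<times> carrier G. \<mu> x * \<mu> y / \<mu> (x \<otimes> y))" unfolding B2_def by blast
  then show ?r by (auto intro!: exI[of _ \<mu>])
next
  assume ?r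
  then obtain \<mu> where e: "\<beta> \<in> extensional (carrier G \<times> carrier G)" and "\<forall>x\<in>carrier G. \<mu> x \<noteq> 0"
    "\<forall>x\<in>carrier G. \<forall>y\<in>carrier G. \<beta> (x, y) = \<mu> x * \<mu> y / \<mu> (x \<otimes> y)" by blast
  then have "\<mu> \<in> carrier G \<rightarrow> UNIV - {0}" "\<beta> = (\<lambda>(x, y)\<in>carrier G \<times> carrier G. \<mu> x * \<mu> y / \<mu> (x \<otimes> y))"
    by (auto simp: fun_eq_iff extensional_def restrict_def)
  then show ?l unfolding B2_def by blast
qed

lemma B2I:
  assumes "\<beta> \<in> extensional (carrier G \<times> carrier G)" "\<And>x. x \<in> carrier G \<Longrightarrow> \<mu> x \<noteq> 0"
    "\<And>x y. x \<in> carrier G \<Longrightarrow> y \<in> carrier G \<Longrightarrow> \<beta> (x, y) = \<mu> x * \<mu> y / \<mu> (x \<otimes> y)"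
  shows "\<beta> \<in> B2 G"
  using assms B2_iff by blast

lemma B2E:
  assumes "\<beta> \<in> B2 G"
  obtains \<mu> where "\<beta> \<in> extensional (carrier G \<times> carrier G)" "\<forall>x\<in>carrier G. \<mu> x \<noteq> 0"
    "\<forall>x\<in>carrier G. \<forall>y\<in>carrier G. \<beta> (x, y) = \<mu> x * \<mu> y / \<mu> (x \<otimes> y)"
  using assms B2_iff by blast

lemma B2_subgroup: "subgroup (B2 G) (Z2 G)"
proof -
  interpret Z: comm_group "Z2 G" by (rule Z2_comm_group)
  have sub: "B2 G \<subseteq> carrier (Z2 G)"
  proof
    fix \<beta> assume "\<beta> \<in> B2 G"
    then obtain \<mu> where e: "\<beta> \<in> extensional (carrier G \<times> carrier G)" and nz: "\<forall>x\<in>carrier G. \<mu> x \<noteq> 0"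
      and eq: "\<forall>x\<in>carrier G. \<forall>y\<in>carrier G. \<beta> (x, y) = \<mu> x * \<mu> y / \<mu> (x \<otimes> y)" by (rule B2E)
    have nz': "\<mu> x \<noteq> 0" if "x \<in> carrier G" for x using nz that by blast
    have eq': "\<beta> (x, y) = \<mu> x * \<mu> y / \<mu> (x \<otimes> y)" if "x \<in> carrier G" "y \<in> carrier G" for x y
      using eq that by blast
    have "restrict \<beta> (carrier G \<times> carrier G) \<in> carrier (Z2 G)"
      by (rule Z2I) (simp_all add: eq' nz' m_assoc)
    then show "\<beta> \<in> carrier (Z2 G)" using e by (simp add: extensional_restrict)
  qed
  show ?thesis
  proof (rule Z.subgroupI)
    show "B2 G \<subseteq> carrier (Z2 G)" by (rule sub)
    have "\<one>\<^bsub>Z2 G\<^esub> \<in> B2 G" by (rule B2I[of _ "\<lambda>_. 1"]) (auto simp: Z2_simps)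
    then show "B2 G \<noteq> {}" by blast
    fix \<beta> assume b: "\<beta> \<in> B2 G"
    then obtain \<mu> where e: "\<beta> \<in> extensional (carrier G \<times> carrier G)" and nz: "\<forall>x\<in>carrier G. \<mu> x \<noteq> 0"
      and eq: "\<forall>x\<in>carrier G. \<forall>y\<in>carrier G. \<beta> (x, y) = \<mu> x * \<mu> y / \<mu> (x \<otimes> y)" by (rule B2E)
    have nz': "\<mu> x \<noteq> 0" if "x \<in> carrier G" for x using nz that by blast
    have eq': "\<beta> (x, y) = \<mu> x * \<mu> y / \<mu> (x \<otimes> y)" if "x \<in> carrier G" "y \<in> carrier G" for x y
      using eq that by blast
    let ?i = "restrict (\<lambda>p. inverse (\<beta> p)) (carrier G \<times> carrier G)"
    have iB: "?i \<in> B2 G"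
      by (rule B2I[of _ "\<lambda>x. inverse (\<mu> x)"]) (simp_all add: eq' nz' divide_inverse)
    have "?i \<otimes>\<^bsub>Z2 G\<^esub> \<beta> = \<one>\<^bsub>Z2 G\<^esub>"
      by (auto simp: Z2_simps fun_eq_iff eq' nz')
    then have "inv\<^bsub>Z2 G\<^esub> \<beta> = ?i" using iB b sub by (intro Z.inv_equality) auto
    then show "inv\<^bsub>Z2 G\<^esub> \<beta> \<in> B2 G" using iB by simp
    fix \<gamma> assume "\<gamma> \<in> B2 G"
    then obtain \<nu> where e': "\<gamma> \<in> extensional (carrier G \<times> carrier G)" and nz': "\<forall>x\<in>carrier G. \<nu> x \<noteq> 0"
      and eq': "\<forall>x\<in>carrier G. \<forall>y\<in>carrier G. \<gamma> (x, y) = \<nu> x * \<nu> y / \<nu> (x \<otimes> y)" by (rule B2E)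
    show "\<beta> \<otimes>\<^bsub>Z2 G\<^esub> \<gamma> \<in> B2 G"
      by (rule B2I[of _ "\<lambda>x. \<mu> x * \<nu> x"]) (use nz nz' eq eq' in \<open>auto simp: Z2_simps field_simps\<close>)
  qed
qed

lemma Z2_pow:
  assumes "\<beta> \<in> carrier (Z2 G)"
  shows "\<beta> [^]\<^bsub>Z2 G\<^esub> (n :: nat) = (\<lambda>p\<in>carrier G \<times> carrier G. \<beta> p ^ n)"
proof (induction n)
  case 0
  then show ?case by (simp add: Z2_simps)
next
  case (Suc n)
  then show ?case by (auto simp: Z2_simps fun_eq_iff mult.commute)
qed

lemma H2_comm_group: "comm_group (H2 G)"
  unfolding H2_def by (rule comm_group.abelian_FactGroup[OF Z2_comm_group B2_subgroup])

lemma B2_normal: "B2 G \<lhd> Z2 G"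
  by (rule comm_group.subgroup_imp_normal[OF Z2_comm_group B2_subgroup])

abbreviation coclass :: "('a \<times> 'a \<Rightarrow> complex) \<Rightarrow> ('a \<times> 'a \<Rightarrow> complex) set" where
  "coclass \<beta> \<equiv> B2 G #>\<^bsub>Z2 G\<^esub> \<beta>"

lemma coclass_H2: "\<beta> \<in> carrier (Z2 G) \<Longrightarrow> coclass \<beta> \<in> carrier (H2 G)"
  by (auto simp: H2_def FactGroup_def RCOSETS_def)

lemma coclass_mult:
  assumes "\<beta> \<in> carrier (Z2 G)" "\<gamma> \<in> carrier (Z2 G)"
  shows "coclass \<beta> \<otimes>\<^bsub>H2 G\<^esub> coclass \<gamma> = coclass (\<beta> \<otimes>\<^bsub>Z2 G\<^esub> \<gamma>)"
  using normal.rcos_sum[OF B2_normal assms] by (simp add: H2_def)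

lemma coclass_eq_one_iff:
  assumes "\<beta> \<in> carrier (Z2 G)"
  shows "coclass \<beta> = \<one>\<^bsub>H2 G\<^esub> \<longleftrightarrow> \<beta> \<in> B2 G"
proof -
  interpret Z: comm_group "Z2 G" by (rule Z2_comm_group)
  show ?thesis
    using Z.coset_join1[OF _ assms B2_subgroup] Z.coset_join2[OF assms B2_subgroup]
    by (auto simp: H2_def)
qed

lemma coclass_pow:
  assumes "\<beta> \<in> carrier (Z2 G)"
  shows "coclass \<beta> [^]\<^bsub>H2 G\<^esub> (n :: nat) = coclass (\<beta> [^]\<^bsub>Z2 G\<^esub> n)"
proof -
  interpret Z: comm_group "Z2 G" by (rule Z2_comm_group)
  show ?thesis
  proof (induction n)
    case 0
    show ?case using coclass_eq_one_iff[OF Z.one_closed] subgroup.one_closed[OF B2_subgroup] by simp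
  next
    case (Suc n)
    then show ?case using assms coclass_mult[OF Z.nat_pow_closed[OF assms] assms] by simp
  qed
qed

lemma coclass_representative:
  assumes "c \<in> carrier (H2 G)" "\<alpha> \<in> c"
  shows "\<alpha> \<in> carrier (Z2 G)" "c = coclass \<alpha>"
proof -
  interpret Z: comm_group "Z2 G" by (rule Z2_comm_group)
  obtain \<alpha>0 where a: "\<alpha>0 \<in> carrier (Z2 G)" "c = coclass \<alpha>0"
    using assms(1) by (auto simp: H2_def FactGroup_def RCOSETS_def)
  show "\<alpha> \<in> carrier (Z2 G)"
    using assms(2) a Z.r_coset_subset_G[OF subgroup.subset[OF B2_subgroup] a(1)] by auto
  show "c = coclass \<alpha>" using Z.repr_independence[OF _ a(1) B2_subgroup] assms(2) a(2) by simp
qed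

text \<open>The product over all \<open>g\<close> of the cocycle identity for \<open>(g, x, y)\<close> exhibits the power as
  a coboundary.\<close>

lemma cocycle_order:
  assumes fin: "finite (carrier G)" and b: "\<beta> \<in> carrier (Z2 G)"
  shows "\<beta> [^]\<^bsub>Z2 G\<^esub> card (carrier G) \<in> B2 G"
proof (rule B2I[of _ "\<lambda>x. \<Prod>g\<in>carrier G. \<beta> (g, x)"])
  have nz: "\<beta> (x, y) \<noteq> 0" if "x \<in> carrier G" "y \<in> carrier G" for x y
    using b that by (auto simp: Z2_simps)
  show "(\<Prod>g\<in>carrier G. \<beta> (g, x)) \<noteq> 0" if "x \<in> carrier G" for x using nz that fin by simp
  fix x y assume x: "x \<in> carrier G" and y: "y \<in> carrier G"
  have "(\<Prod>g\<in>carrier G. \<beta> (g, x)) * (\<Prod>g\<in>carrier G. \<beta> (g, y))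
      = (\<Prod>g\<in>carrier G. \<beta> (g, x)) * (\<Prod>g\<in>carrier G. \<beta> (g \<otimes> x, y))"
    using prod.reindex_bij_betw[OF bij_betw_mult_right[OF x], of "\<lambda>g. \<beta> (g, y)"] by simp
  also have "\<dots> = (\<Prod>g\<in>carrier G. \<beta> (g, x \<otimes> y) * \<beta> (x, y))"
    unfolding prod.distrib[symmetric] using b x y by (intro prod.cong refl) (auto simp: Z2_simps)
  also have "\<dots> = (\<Prod>g\<in>carrier G. \<beta> (g, x \<otimes> y)) * \<beta> (x, y) ^ card (carrier G)"
    by (simp add: prod.distrib)
  finally show "(\<beta> [^]\<^bsub>Z2 G\<^esub> card (carrier G)) (x, y)
      = (\<Prod>g\<in>carrier G. \<beta> (g, x)) * (\<Prod>g\<in>carrier G. \<beta> (g, y)) / (\<Prod>g\<in>carrier G. \<beta> (g, x \<otimes> y))"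
    using x y nz fin by (simp add: Z2_pow[OF b])
qed (simp add: Z2_pow[OF b])

text \<open>Associativity of matrix multiplication gives the cocycle identity, and determinants
  the coboundary.\<close>

lemma proj_rep_cocycle:
  assumes X: "proj_rep G \<beta> m X" and m: "0 < m"
  shows "restrict \<beta> (carrier G \<times> carrier G) \<in> carrier (Z2 G)"
    "(restrict \<beta> (carrier G \<times> carrier G)) [^]\<^bsub>Z2 G\<^esub> m \<in> B2 G"
proof -
  show Z: "restrict \<beta> (carrier G \<times> carrier G) \<in> carrier (Z2 G)"
  proof (rule Z2I)
    show "\<beta> (x, y) \<noteq> 0" if "x \<in> carrier G" "y \<in> carrier G" for x y using proj_repD(3)[OF X that] .
    fix x y z assume x: "x \<in> carrier G" and y: "y \<in> carrier G" and z: "z \<in> carrier G"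
    note M = proj_repD(4)[OF X]
    have "X z * (X y * X x) = (\<beta> (x, y) * \<beta> (x \<otimes> y, z)) *\<^sub>C X (x \<otimes> y \<otimes> z)"
      using x y z by (simp add: M)
    moreover have "X z * X y * X x = (\<beta> (x, y \<otimes> z) * \<beta> (y, z)) *\<^sub>C X (x \<otimes> y \<otimes> z)"
      using x y z by (simp add: M m_assoc mult.commute)
    ultimately show "\<beta> (x, y) * \<beta> (x \<otimes> y, z) = \<beta> (x, y \<otimes> z) * \<beta> (y, z)"
      using cancel_scaleC[OF proj_repD(1)[OF X] m] x y z by (metis m_closed mult.assoc)
  qed
  show "(restrict \<beta> (carrier G \<times> carrier G)) [^]\<^bsub>Z2 G\<^esub> m \<in> B2 G"
  proof (rule B2I[of _ "\<lambda>g. mdet m (X g)"])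
    show "mdet m (X x) \<noteq> 0" if "x \<in> carrier G" for x using mdet_nonzero[OF proj_repD(1)[OF X that]] .
    then show "((restrict \<beta> (carrier G \<times> carrier G)) [^]\<^bsub>Z2 G\<^esub> m) (x, y)
        = mdet m (X x) * mdet m (X y) / mdet m (X (x \<otimes> y))" if "x \<in> carrier G" "y \<in> carrier G" for x y
      using cocycle_power_degree[OF X that] that by (simp add: Z2_pow[OF Z] field_simps)
  qed (simp add: Z2_pow[OF Z])
qed

end

lemma pi_number_dvd: "pi_number \<pi> n \<Longrightarrow> m dvd n \<Longrightarrow> pi_number \<pi> m"
  unfolding pi_number_def by (auto intro: dvd_trans dest: dvd_pos_nat)

lemma pi_number_mult: "pi_number \<pi> m \<Longrightarrow> pi_number \<pi> n \<Longrightarrow> pi_number \<pi> (m * n)"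
  unfolding pi_number_def by (auto simp: prime_dvd_mult_iff)

lemma pi_number_coprime:
  assumes "pi_number \<pi> m" "pi_number (compl_primes \<pi>) n" shows "coprime m n"
proof (rule ccontr)
  assume "\<not> coprime m n"
  then have "gcd m n \<noteq> 1" by (simp add: coprime_iff_gcd_eq_1)
  then obtain p where "prime p" "p dvd gcd m n" using prime_factor_nat by blast
  then have "prime p" "p dvd m" "p dvd n" by simp_all
  then show False using assms by (auto simp: pi_number_def compl_primes_def)
qed

text \<open>Two decompositions of the same element differ by an element \<open>t\<close> whose order is both a
  \<open>\<pi>\<close>-number and a \<open>\<pi>'\<close>-number.\<close>

lemma pi_component_eqI:
  assumes A: "comm_group A" and a: "a \<in> carrier A" and b: "b \<in> carrier A"
    and pa: "pi_number \<pi> m" "a [^]\<^bsub>A\<^esub> m = \<one>\<^bsub>A\<^esub>"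
    and pb: "pi_number (compl_primes \<pi>) n" "b [^]\<^bsub>A\<^esub> n = \<one>\<^bsub>A\<^esub>"
  shows "pi_component \<pi> A (a \<otimes>\<^bsub>A\<^esub> b) = a"
proof -
  interpret comm_group A by fact
  have oa: "pi_number \<pi> (ord a)" using pa a by (auto simp: pow_eq_id intro: pi_number_dvd)
  have ob: "pi_number (compl_primes \<pi>) (ord b)" using pb b by (auto simp: pow_eq_id intro: pi_number_dvd)
  show ?thesis
    unfolding pi_component_def
  proof (rule the_equality)
    show "a \<in> carrier A \<and> pi_number \<pi> (ord a) \<and>
       (\<exists>b'\<in>carrier A. pi_number (compl_primes \<pi>) (ord b') \<and> a \<otimes>\<^bsub>A\<^esub> b = a \<otimes>\<^bsub>A\<^esub> b')"
      using a b oa ob by blast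
    fix a' assume "a' \<in> carrier A \<and> pi_number \<pi> (ord a') \<and>
       (\<exists>b'\<in>carrier A. pi_number (compl_primes \<pi>) (ord b') \<and> a \<otimes>\<^bsub>A\<^esub> b = a' \<otimes>\<^bsub>A\<^esub> b')"
    then obtain b' where a': "a' \<in> carrier A" "pi_number \<pi> (ord a')" and b': "b' \<in> carrier A"
      "pi_number (compl_primes \<pi>) (ord b')" and eq: "a \<otimes>\<^bsub>A\<^esub> b = a' \<otimes>\<^bsub>A\<^esub> b'" by blast
    \<comment> \<open>the quotient of the two \<open>\<pi>\<close>-parts, hence also of the two \<open>\<pi>'\<close>-parts\<close>
    define t where "t = a \<otimes>\<^bsub>A\<^esub> inv\<^bsub>A\<^esub> a'"
    have t: "t \<in> carrier A" using a a' by (simp add: t_def)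
    have t2: "t = b' \<otimes>\<^bsub>A\<^esub> inv\<^bsub>A\<^esub> b"
    proof -
      have c: "b' \<otimes>\<^bsub>A\<^esub> inv\<^bsub>A\<^esub> b \<in> carrier A" using b b' by simp
      have "a = a \<otimes>\<^bsub>A\<^esub> b \<otimes>\<^bsub>A\<^esub> inv\<^bsub>A\<^esub> b" using a b by (simp add: m_assoc)
      also have "\<dots> = a' \<otimes>\<^bsub>A\<^esub> (b' \<otimes>\<^bsub>A\<^esub> inv\<^bsub>A\<^esub> b)" unfolding eq using a' b b' by (simp add: m_assoc)
      also have "\<dots> = (b' \<otimes>\<^bsub>A\<^esub> inv\<^bsub>A\<^esub> b) \<otimes>\<^bsub>A\<^esub> a'" by (rule m_comm[OF a'(1) c])
      finally have "t = (b' \<otimes>\<^bsub>A\<^esub> inv\<^bsub>A\<^esub> b) \<otimes>\<^bsub>A\<^esub> a' \<otimes>\<^bsub>A\<^esub> inv\<^bsub>A\<^esub> a'" by (simp add: t_def)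
      then show ?thesis using a' c by (simp add: m_assoc)
    qed
    have pow1: "x [^]\<^bsub>A\<^esub> (ord x * k) = \<one>\<^bsub>A\<^esub>" "x [^]\<^bsub>A\<^esub> (k * ord x) = \<one>\<^bsub>A\<^esub>"
      if "x \<in> carrier A" for x and k :: nat
      using that by (simp_all add: pow_eq_id)
    have "t [^]\<^bsub>A\<^esub> (ord a * ord a') = \<one>\<^bsub>A\<^esub>"
      unfolding t_def using a a' by (simp add: pow_mult_distrib[OF m_comm] nat_pow_inv pow1)
    then have "ord t dvd ord a * ord a'" using t by (simp add: pow_eq_id)
    then have p1: "pi_number \<pi> (ord t)" using pi_number_dvd pi_number_mult oa a' by blast
    have "t [^]\<^bsub>A\<^esub> (ord b' * ord b) = \<one>\<^bsub>A\<^esub>"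
      unfolding t2 using b b' by (simp add: pow_mult_distrib[OF m_comm] nat_pow_inv pow1)
    then have "ord t dvd ord b' * ord b" using t by (simp add: pow_eq_id)
    then have "pi_number (compl_primes \<pi>) (ord t)" using pi_number_dvd pi_number_mult ob b' by blast
    then have "coprime (ord t) (ord t)" by (rule pi_number_coprime[OF p1])
    then have "ord t = 1" by simp
    then have "t = \<one>\<^bsub>A\<^esub>" using t by (simp add: ord_eq_1)
    then have "a \<otimes>\<^bsub>A\<^esub> inv\<^bsub>A\<^esub> a' \<otimes>\<^bsub>A\<^esub> a' = a'" using a' by (simp add: t_def)
    then show "a' = a" using a a' by (simp add: m_assoc)
  qed
qed

text \<open>The order of the restricted coclass divides \<open>m\<close> and the order of \<open>K\<close>. The second claim
  also needs that every coboundary of \<open>K\<close> is a restriction of one of \<open>G\<close>: a function on \<open>K\<close>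
  extends to \<open>G\<close> by the value \<open>1\<close>.\<close>

lemma restrict_coclass_trivial:
  assumes G: "group G" and fin: "finite (carrier G)" and K: "subgroup K G"
    and b: "\<beta> \<in> carrier (Z2 G)" "\<beta> [^]\<^bsub>Z2 G\<^esub> m \<in> B2 G" and cop: "coprime m (card K)"
  shows "restrict \<beta> (K \<times> K) \<in> B2 (G\<lparr>carrier := K\<rparr>)"
    "restrict_coclass K (B2 G #>\<^bsub>Z2 G\<^esub> \<beta>) = \<one>\<^bsub>H2 (G\<lparr>carrier := K\<rparr>)\<^esub>"
proof -
  interpret group G by fact
  let ?K = "G\<lparr>carrier := K\<rparr>"
  interpret K: group ?K by (rule subgroup.subgroup_is_group[OF K G])
  interpret ZK: comm_group "Z2 ?K" by (rule K.Z2_comm_group)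
  interpret HK: comm_group "H2 ?K" by (rule K.H2_comm_group)
  note KG = subgroup.subset[OF K]
  let ?b = "restrict \<beta> (K \<times> K)"
  have "restrict \<beta> (carrier ?K \<times> carrier ?K) \<in> carrier (Z2 ?K)"
    by (rule K.Z2I) (use b(1) KG in \<open>auto simp: Z2_simps subset_iff\<close>)
  then have bZ: "?b \<in> carrier (Z2 ?K)" by simp
  have rB: "restrict \<gamma> (K \<times> K) \<in> B2 ?K" if g: "\<gamma> \<in> B2 G" for \<gamma>
  proof -
    obtain \<mu> where "\<gamma> \<in> extensional (carrier G \<times> carrier G)" "\<forall>x\<in>carrier G. \<mu> x \<noteq> 0"
      "\<forall>x\<in>carrier G. \<forall>y\<in>carrier G. \<gamma> (x, y) = \<mu> x * \<mu> y / \<mu> (x \<otimes>\<^bsub>G\<^esub> y)" by (rule B2E[OF g])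
    then show ?thesis using KG by (intro K.B2I[of _ \<mu>]) auto
  qed
  have "?b [^]\<^bsub>Z2 ?K\<^esub> m = restrict (\<beta> [^]\<^bsub>Z2 G\<^esub> m) (K \<times> K)"
    unfolding K.Z2_pow[OF bZ] Z2_pow[OF b(1)] using KG
    by (auto simp: fun_eq_iff restrict_def subset_iff)
  then have "?b [^]\<^bsub>Z2 ?K\<^esub> m \<in> B2 ?K" using rB[OF b(2)] by simp
  then have "K.coclass ?b [^]\<^bsub>H2 ?K\<^esub> m = \<one>\<^bsub>H2 ?K\<^esub>"
    using K.coclass_eq_one_iff[OF ZK.nat_pow_closed[OF bZ]] by (simp add: K.coclass_pow[OF bZ])
  then have d1: "HK.ord (K.coclass ?b) dvd m" using K.coclass_H2[OF bZ] by (simp add: HK.pow_eq_id)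
  have "finite (carrier ?K)" using fin KG finite_subset by auto
  then have "?b [^]\<^bsub>Z2 ?K\<^esub> card K \<in> B2 ?K" using K.cocycle_order[OF _ bZ] by simp
  then have "K.coclass ?b [^]\<^bsub>H2 ?K\<^esub> card K = \<one>\<^bsub>H2 ?K\<^esub>"
    using K.coclass_eq_one_iff[OF ZK.nat_pow_closed[OF bZ]] by (simp add: K.coclass_pow[OF bZ])
  then have d2: "HK.ord (K.coclass ?b) dvd card K" using K.coclass_H2[OF bZ] by (simp add: HK.pow_eq_id)
  have "HK.ord (K.coclass ?b) = 1" using d1 d2 cop by (meson coprime_common_divisor_nat)
  then have "K.coclass ?b = \<one>\<^bsub>H2 ?K\<^esub>" using K.coclass_H2[OF bZ] by (simp add: HK.ord_eq_1)
  then show bB: "?b \<in> B2 ?K" using K.coclass_eq_one_iff[OF bZ] by simp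
  have "restrict_coclass K (coclass \<beta>) = B2 ?K"
  proof
    show "restrict_coclass K (coclass \<beta>) \<subseteq> B2 ?K"
    proof
      fix \<gamma> assume "\<gamma> \<in> restrict_coclass K (coclass \<beta>)"
      then obtain \<delta> where d: "\<delta> \<in> B2 G" "\<gamma> = restrict (\<delta> \<otimes>\<^bsub>Z2 G\<^esub> \<beta>) (K \<times> K)"
        by (auto simp: restrict_coclass_def r_coset_def)
      have "\<gamma> = restrict \<delta> (K \<times> K) \<otimes>\<^bsub>Z2 ?K\<^esub> ?b"
        unfolding d(2) using KG by (auto simp: Z2_simps fun_eq_iff restrict_def subset_iff)
      then show "\<gamma> \<in> B2 ?K" using subgroup.m_closed[OF K.B2_subgroup rB[OF d(1)] bB] by simp
    qed
    show "B2 ?K \<subseteq> restrict_coclass K (coclass \<beta>)"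
    proof
      fix \<gamma> assume g: "\<gamma> \<in> B2 ?K"
      let ?d = "\<gamma> \<otimes>\<^bsub>Z2 ?K\<^esub> inv\<^bsub>Z2 ?K\<^esub> ?b"
      have dB: "?d \<in> B2 ?K"
        using g bB by (intro subgroup.m_closed[OF K.B2_subgroup] subgroup.m_inv_closed[OF K.B2_subgroup])
      obtain \<mu> where mu': "?d \<in> extensional (carrier ?K \<times> carrier ?K)" "\<forall>x\<in>carrier ?K. \<mu> x \<noteq> 0"
        "\<forall>x\<in>carrier ?K. \<forall>y\<in>carrier ?K. ?d (x, y) = \<mu> x * \<mu> y / \<mu> (x \<otimes>\<^bsub>?K\<^esub> y)"
        by (rule K.B2E[OF dB])
      then have mu: "\<forall>x\<in>K. \<mu> x \<noteq> 0" "\<forall>x\<in>K. \<forall>y\<in>K. ?d (x, y) = \<mu> x * \<mu> y / \<mu> (x \<otimes>\<^bsub>G\<^esub> y)"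
        by simp_all
      define \<nu> where "\<nu> x = (if x \<in> K then \<mu> x else 1)" for x
      define \<delta> where "\<delta> = (\<lambda>(x, y)\<in>carrier G \<times> carrier G. \<nu> x * \<nu> y / \<nu> (x \<otimes>\<^bsub>G\<^esub> y))"
      have "\<delta> \<in> B2 G" by (rule B2I[of _ \<nu>]) (use mu in \<open>auto simp: \<delta>_def \<nu>_def\<close>)
      moreover have "restrict (\<delta> \<otimes>\<^bsub>Z2 G\<^esub> \<beta>) (K \<times> K) = \<gamma>"
      proof -
        have gZ: "\<gamma> \<in> carrier (Z2 ?K)" using g subgroup.subset[OF K.B2_subgroup] by auto
        have dZ: "?d \<in> carrier (Z2 ?K)" using dB subgroup.subset[OF K.B2_subgroup] by auto
        have "restrict \<delta> (K \<times> K) = ?d"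
        proof
          fix p show "restrict \<delta> (K \<times> K) p = ?d p"
          proof (cases "p \<in> K \<times> K")
            case True
            then obtain x y where xy: "p = (x, y)" "x \<in> K" "y \<in> K" by auto
            then have "x \<otimes>\<^bsub>G\<^esub> y \<in> K" using subgroup.m_closed[OF K] by simp
            then show ?thesis using xy mu KG by (auto simp: \<delta>_def \<nu>_def)
          next
            case False
            then show ?thesis by (auto simp: Z2_simps)
          qed
        qed
        moreover have "restrict (\<delta> \<otimes>\<^bsub>Z2 G\<^esub> \<beta>) (K \<times> K) = restrict \<delta> (K \<times> K) \<otimes>\<^bsub>Z2 ?K\<^esub> ?b"
          using KG by (auto simp: Z2_simps(2) fun_eq_iff restrict_def subset_iff)
        ultimately have "restrict (\<delta> \<otimes>\<^bsub>Z2 G\<^esub> \<beta>) (K \<times> K) = ?d \<otimes>\<^bsub>Z2 ?K\<^esub> ?b"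
          by simp
        also have "\<dots> = \<gamma>" using gZ bZ by (simp add: ZK.m_assoc)
        finally show ?thesis .
      qed
      ultimately show "\<gamma> \<in> restrict_coclass K (coclass \<beta>)"
        unfolding restrict_coclass_def r_coset_def by blast
    qed
  qed
  then show "restrict_coclass K (coclass \<beta>) = \<one>\<^bsub>H2 ?K\<^esub>" by (simp add: H2_def)
qed

lemma pi_part_mult:
  assumes "pi_number \<pi> m" "pi_number (compl_primes \<pi>) n"
  shows "pi_part \<pi> (m * n) = m" "pi_part (compl_primes \<pi>) (m * n) = n"
proof -
  have pos: "0 < m" "0 < n" using assms by (auto simp: pi_number_def)
  have pf: "prime_factors (m * n) \<inter> \<pi> = prime_factors m" "prime_factors (m * n) \<inter> compl_primes \<pi> = prime_factors n"
    using assms pos by (auto simp: pi_number_def compl_primes_def prime_factors_product in_prime_factors_iff)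
  have mu: "multiplicity p (m * n) = multiplicity p m" if "p \<in> prime_factors m" for p
  proof -
    have "prime p" "\<not> p dvd n" using that assms by (auto simp: pi_number_def compl_primes_def in_prime_factors_iff)
    then show ?thesis using pos by (simp add: prime_elem_multiplicity_mult_distrib not_dvd_imp_multiplicity_0)
  qed
  have mu': "multiplicity p (m * n) = multiplicity p n" if "p \<in> prime_factors n" for p
  proof -
    have "prime p" "\<not> p dvd m" using that assms by (auto simp: pi_number_def compl_primes_def in_prime_factors_iff)
    then show ?thesis using pos by (simp add: prime_elem_multiplicity_mult_distrib not_dvd_imp_multiplicity_0)
  qed
  show "pi_part \<pi> (m * n) = m"
    unfolding pi_part_def pf using prod.cong[OF refl, of "prime_factors m" "\<lambda>p. p ^ multiplicity p (m * n)"] mu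
      prime_factorization_nat[OF pos(1)] by simp
  show "pi_part (compl_primes \<pi>) (m * n) = n"
    unfolding pi_part_def pf using prod.cong[OF refl, of "prime_factors n" "\<lambda>p. p ^ multiplicity p (m * n)"] mu'
      prime_factorization_nat[OF pos(2)] by simp
qed

section \<open>Modules in coordinates\<close>

lemma coord_linear_maps_agree:
  assumes f: "linear_map complex_field (coord_space d) W f" and h: "linear_map complex_field (coord_space d) W h"
    and eq: "\<And>i. i < d \<Longrightarrow> f (unit_vec d i) = h (unit_vec d i)" and v: "v \<in> carrier_vec d"
  shows "f v = h v"
proof -
  have "k \<le> d \<Longrightarrow> f (vec d (\<lambda>i. if i < k then v $ i else 0)) = h (vec d (\<lambda>i. if i < k then v $ i else 0))" for k
  proof (induction k)
    case 0
    have "vec d (\<lambda>i. if i < 0 then v $ i else 0) = \<zero>\<^bsub>coord_space d\<^esub>" by (auto simp: module_vec_simps)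
    then show ?case using linear_mapD(6)[OF f] linear_mapD(6)[OF h] by simp
  next
    case (Suc k)
    let ?w = "vec d (\<lambda>i. if i < k then v $ i else 0)"
    have split: "vec d (\<lambda>i. if i < Suc k then v $ i else 0)
        = ?w \<oplus>\<^bsub>coord_space d\<^esub> (v $ k) \<odot>\<^bsub>coord_space d\<^esub> unit_vec d k"
      using Suc.prems by (intro eq_vecI) (auto simp: module_vec_simps less_Suc_eq)
    have car: "?w \<in> carrier (coord_space d)" "unit_vec d k \<in> carrier (coord_space d)"
      "(v $ k) \<odot>\<^bsub>coord_space d\<^esub> unit_vec d k \<in> carrier (coord_space d)" by (auto simp: module_vec_simps)
    show ?case
      unfolding split using Suc car eq[of k]
      by (simp add: linear_mapD(4,5)[OF f] linear_mapD(4,5)[OF h])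
  qed
  from this[of d] have "f (vec d (\<lambda>i. if i < d then v $ i else 0)) = h (vec d (\<lambda>i. if i < d then v $ i else 0))" by simp
  moreover have "vec d (\<lambda>i. if i < d then v $ i else 0) = v" using v by auto
  ultimately show ?thesis by simp
qed

lemma linear_map_matrix:
  assumes T: "linear_map complex_field (coord_space d) (coord_space d) T" and v: "v \<in> carrier_vec d"
  shows "T v = rep_action d (\<lambda>_. mk d d (\<lambda>i j. T (unit_vec d j) $ i)) g v"
proof (rule coord_linear_maps_agree[OF T rep_action_linear _ v])
  fix j assume j: "j < d"
  have "of_vec (unit_vec d j) = (eunit j 0 :: fmat)" using j by (intro fmat_eqI) (auto simp: of_vec_def)
  moreover have "T (unit_vec d j) \<in> carrier_vec d"
    using linear_mapD(3)[OF T, of "unit_vec d j"] by (simp add: module_vec_simps)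
  ultimately show "T (unit_vec d j) = rep_action d (\<lambda>_. mk d d (\<lambda>i j. T (unit_vec d j) $ i)) g (unit_vec d j)"
    using j by (intro eq_vecI) (auto simp: rep_action_def to_vec_def entry_mult_eunit)
qed

lemma coordinates:
  assumes V: "vectorspace complex_field V" and fd: "vectorspace.fin_dim complex_field V"
  obtains L where "linear_map complex_field (coord_space (cdim V)) V L"
    "bij_betw L (carrier (coord_space (cdim V))) (carrier V)"
proof -
  interpret V: vectorspace complex_field V by fact
  obtain A where A: "finite A" "V.basis A" using V.finite_basis_exists[OF fd] by blast
  have AC: "A \<subseteq> carrier V" using A by (simp add: V.basis_def)
  define d where "d = card A"
  have dim: "cdim V = d" using V.dim_basis[OF A] by (simp add: d_def)
  obtain b where b: "bij_betw b {..<d} A"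
    using ex_bij_betw_nat_finite[OF A(1)] by (metis atLeast0LessThan d_def)
  define idx where "idx = the_inv_into {..<d} b"
  have idx: "bij_betw idx A {..<d}" unfolding idx_def by (rule bij_betw_the_inv_into[OF b])
  have idx_b: "idx (b i) = i" if "i < d" for i
    using b that by (simp add: idx_def bij_betw_def the_inv_into_f_f)
  have b_idx: "b (idx a) = a" if "a \<in> A" for a
    using b that by (simp add: idx_def f_the_inv_into_f_bij_betw)
  have idx_lt: "idx a < d" if "a \<in> A" for a using idx that by (auto simp: bij_betw_def)
  define L where "L v = V.lincomb (\<lambda>a. v $ idx a) A" for v :: "complex vec"
  have Pi: "f \<in> A \<rightarrow> carrier complex_field" for f :: "_ \<Rightarrow> complex" by (simp add: class_ring_simps)
  have lin: "linear_map complex_field (coord_space d) V L"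
  proof (rule linear_mapI[OF coord_vectorspace V])
    fix v w assume "v \<in> carrier (coord_space d)" "w \<in> carrier (coord_space d)"
    then have vw: "v \<in> carrier_vec d" "w \<in> carrier_vec d" by (auto simp: module_vec_simps)
    have "L (v + w) = V.lincomb (\<lambda>a. v $ idx a + w $ idx a) A"
      unfolding L_def by (rule V.lincomb_cong) (use AC vw idx_lt in \<open>auto simp: class_ring_simps\<close>)
    also have "\<dots> = L v \<oplus>\<^bsub>V\<^esub> L w"
      unfolding L_def using V.lincomb_sum[OF A(1) AC Pi Pi] by (simp add: class_ring_simps)
    finally show "L (v \<oplus>\<^bsub>coord_space d\<^esub> w) = L v \<oplus>\<^bsub>V\<^esub> L w" by (simp add: module_vec_simps)
  next
    fix c v assume "v \<in> carrier (coord_space d)"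
    then have v: "v \<in> carrier_vec d" by (auto simp: module_vec_simps)
    show "L v \<in> carrier V" unfolding L_def by (rule V.lincomb_closed[OF AC Pi])
    have "L (c \<cdot>\<^sub>v v) = V.lincomb (\<lambda>a. c * v $ idx a) A"
      unfolding L_def by (rule V.lincomb_cong) (use AC v idx_lt in \<open>auto simp: class_ring_simps\<close>)
    also have "\<dots> = c \<odot>\<^bsub>V\<^esub> L v"
      unfolding L_def using V.lincomb_smult[OF AC Pi, of c] by (simp add: class_ring_simps)
    finally show "L (c \<odot>\<^bsub>coord_space d\<^esub> v) = c \<odot>\<^bsub>V\<^esub> L v" by (simp add: module_vec_simps)
  qed
  have ex1: "\<exists>!a. a \<in> A \<rightarrow>\<^sub>E carrier complex_field \<and> V.lincomb a A = v" if "v \<in> carrier V" for v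
    using V.basis_criterion[OF A(1) AC] A(2) that by blast
  have restr: "L v = V.lincomb (\<lambda>a\<in>A. v $ idx a) A" for v
    unfolding L_def by (rule V.lincomb_cong) (use AC in \<open>auto simp: class_ring_simps\<close>)
  have "bij_betw L (carrier (coord_space d)) (carrier V)"
    unfolding bij_betw_def
  proof
    show "inj_on L (carrier (coord_space d))"
    proof (rule inj_onI)
      fix v w assume v: "v \<in> carrier (coord_space d)" and w: "w \<in> carrier (coord_space d)" and eq: "L v = L w"
      have "(\<lambda>a\<in>A. v $ idx a) = (\<lambda>a\<in>A. w $ idx a)"
        using ex1[OF linear_mapD(3)[OF lin w]] eq restr[of v] restr[of w]
        by (metis (no_types, lifting) Pi PiE_restrict restrict_PiE_iff Pi_I UNIV_I class_ring_simps(1))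
      then have "v $ idx a = w $ idx a" if "a \<in> A" for a using that by (metis restrict_apply')
      then have "v $ i = w $ i" if "i < d" for i
        using that idx_b b by (metis bij_betw_apply lessThan_iff)
      then show "v = w" using v w by (auto simp: module_vec_simps)
    qed
    show "L ` carrier (coord_space d) = carrier V"
    proof
      show "L ` carrier (coord_space d) \<subseteq> carrier V" using linear_mapD(3)[OF lin] by auto
      show "carrier V \<subseteq> L ` carrier (coord_space d)"
      proof
        fix x assume x: "x \<in> carrier V"
        obtain a where a: "V.lincomb a A = x" using ex1[OF x] by blast
        define v where "v = vec d (\<lambda>i. a (b i))"
        have "L v = V.lincomb a A"
          unfolding L_def by (rule V.lincomb_cong) (use AC idx_lt b_idx in \<open>auto simp: v_def class_ring_simps\<close>)
        then show "x \<in> L ` carrier (coord_space d)" using a by (auto simp: v_def module_vec_simps)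
      qed
    qed
  qed
  then show ?thesis using that lin dim by simp
qed

lemma inverse_linear_map:
  assumes L: "linear_map complex_field U V L" and bij: "bij_betw L (carrier U) (carrier V)"
  shows "linear_map complex_field V U (the_inv_into (carrier U) L)"
    "bij_betw (the_inv_into (carrier U) L) (carrier V) (carrier U)"
proof -
  let ?I = "the_inv_into (carrier U) L"
  note l = linear_mapD[OF L]
  note vU = complex_vectorspaceD[OF l(1)]
  interpret U: abelian_group U by (rule vU(1))
  show bI: "bij_betw ?I (carrier V) (carrier U)" by (rule bij_betw_the_inv_into[OF bij])
  have inj: "inj_on L (carrier U)" using bij by (simp add: bij_betw_def)
  have I: "?I v \<in> carrier U" "L (?I v) = v" if "v \<in> carrier V" for v
    using bI bij that by (auto simp: bij_betw_def f_the_inv_into_f)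
  show "linear_map complex_field V U ?I"
  proof (rule linear_mapI[OF l(2,1)])
    fix v w assume vw: "v \<in> carrier V" "w \<in> carrier V"
    have "L (?I v \<oplus>\<^bsub>U\<^esub> ?I w) = v \<oplus>\<^bsub>V\<^esub> w" using I vw by (simp add: l(4))
    then show "?I (v \<oplus>\<^bsub>V\<^esub> w) = ?I v \<oplus>\<^bsub>U\<^esub> ?I w"
      using the_inv_into_f_f[OF inj, of "?I v \<oplus>\<^bsub>U\<^esub> ?I w"] I vw by simp
  next
    fix a v assume v: "v \<in> carrier V"
    show "?I v \<in> carrier U" using I v by simp
    have "L (a \<odot>\<^bsub>U\<^esub> ?I v) = a \<odot>\<^bsub>V\<^esub> v" using I v by (simp add: l(5))
    then show "?I (a \<odot>\<^bsub>V\<^esub> v) = a \<odot>\<^bsub>U\<^esub> ?I v"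
      using the_inv_into_f_f[OF inj, of "a \<odot>\<^bsub>U\<^esub> ?I v"] I v vU by simp
  qed
qed

lemma module_iso_trans:
  assumes "module_iso G U \<phi> V \<psi>" "module_iso G V \<psi> W \<rho>" shows "module_iso G U \<phi> W \<rho>"
proof -
  obtain f where f: "linear_map complex_field U V f" "bij_betw f (carrier U) (carrier V)"
    "\<forall>g\<in>carrier G. \<forall>v\<in>carrier U. f (\<phi> g v) = \<psi> g (f v)" using assms(1) by (auto simp: module_iso_def)
  obtain h where h: "linear_map complex_field V W h" "bij_betw h (carrier V) (carrier W)"
    "\<forall>g\<in>carrier G. \<forall>v\<in>carrier V. h (\<psi> g v) = \<rho> g (h v)" using assms(2) by (auto simp: module_iso_def)
  show ?thesis
    unfolding module_iso_def
  proof (intro exI[of _ "\<lambda>v. h (f v)"] conjI ballI)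
    show "linear_map complex_field U W (\<lambda>v. h (f v))" by (rule linear_map_comp[OF f(1) h(1)])
    show "bij_betw (\<lambda>v. h (f v)) (carrier U) (carrier W)"
      using bij_betw_trans[OF f(2) h(2)] by (simp add: comp_def)
    show "h (f (\<phi> g v)) = \<rho> g (h (f v))" if "g \<in> carrier G" "v \<in> carrier U" for g v
      using that f h linear_mapD(3)[OF f(1)] by simp
  qed
qed

text \<open>Both directions of the isomorphism are recorded, since irreducibility and primitivity
  are transported along isomorphisms in opposite directions.\<close>

lemma module_matrices:
  assumes G: "group G" and V: "twisted_module G \<alpha> V \<phi>" and \<alpha>: "\<And>g h. g \<in> carrier G \<Longrightarrow> h \<in> carrier G \<Longrightarrow> \<alpha> (g, h) \<noteq> 0"
  obtains F where "0 < cdim V" "proj_rep G \<alpha> (cdim V) F"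
    "module_iso G V \<phi> (coord_space (cdim V)) (rep_action (cdim V) F)"
    "module_iso G (coord_space (cdim V)) (rep_action (cdim V) F) V \<phi>"
proof -
  interpret group G by fact
  have vs: "vectorspace complex_field V" and fd: "vectorspace.fin_dim complex_field V"
    and ne: "carrier V \<noteq> {\<zero>\<^bsub>V\<^esub>}"
    and \<phi>: "\<And>g. g \<in> carrier G \<Longrightarrow> linear_map complex_field V V (\<phi> g)"
      "\<And>g. g \<in> carrier G \<Longrightarrow> bij_betw (\<phi> g) (carrier V) (carrier V)"
    and mul: "\<And>x y v. x \<in> carrier G \<Longrightarrow> y \<in> carrier G \<Longrightarrow> v \<in> carrier V \<Longrightarrow>
       \<phi> y (\<phi> x v) = \<alpha> (x, y) \<odot>\<^bsub>V\<^esub> \<phi> (x \<otimes>\<^bsub>G\<^esub> y) v"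
    using V unfolding twisted_module_def by auto
  define d where "d = cdim V"
  let ?C = "coord_space d"
  obtain L where L: "linear_map complex_field ?C V L" "bij_betw L (carrier ?C) (carrier V)"
    using coordinates[OF vs fd] by (auto simp: d_def)
  define I where "I = the_inv_into (carrier ?C) L"
  have I: "linear_map complex_field V ?C I" "bij_betw I (carrier V) (carrier ?C)"
    unfolding I_def by (rule inverse_linear_map[OF L])+
  have IL: "I (L v) = v" if "v \<in> carrier ?C" for v
    using L(2) that by (simp add: I_def bij_betw_def the_inv_into_f_f)
  have LI: "L (I v) = v" if "v \<in> carrier V" for v
    using L(2) that by (simp add: I_def bij_betw_def f_the_inv_into_f)
  note l = linear_mapD[OF L(1)] and i = linear_mapD[OF I(1)]
  define T where "T g v = I (\<phi> g (L v))" for g v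
  have T: "linear_map complex_field ?C ?C (T g)" if "g \<in> carrier G" for g
    unfolding T_def using linear_map_comp[OF linear_map_comp[OF L(1) \<phi>(1)[OF that]] I(1)] .
  define F where "F g = mk d d (\<lambda>i j. T g (unit_vec d j) $ i)" for g
  have FM: "F g \<in> Mat d d" for g by (simp add: F_def)
  have act: "rep_action d F g v = T g v" if "g \<in> carrier G" "v \<in> carrier_vec d" for g v
    using linear_map_matrix[OF T[OF that(1)] that(2)] by (simp add: F_def rep_action_def)
  have Fv: "F g * of_vec v = of_vec (T g v)" if "g \<in> carrier G" "v \<in> carrier_vec d" for g v
    using act[OF that] rep_action_alt(2)[where F = F and g = g, OF FM that(2)] by simp
  have Tcar: "T g v \<in> carrier_vec d" if "g \<in> carrier G" "v \<in> carrier_vec d" for g v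
    using linear_mapD(3)[OF T[OF that(1)], of v] that(2) by (simp add: module_vec_simps)
  have mult: "F h * F g = \<alpha> (g, h) *\<^sub>C F (g \<otimes>\<^bsub>G\<^esub> h)" if g: "g \<in> carrier G" and h: "h \<in> carrier G" for g h
  proof (rule Mat_ext[OF Mat_mult[OF FM FM] Mat_closed(5)[OF FM]])
    fix u assume u: "u \<in> Mat d 1"
    let ?v = "to_vec d u"
    have v: "?v \<in> carrier_vec d" "?v \<in> carrier ?C" "of_vec ?v = u" using u by (auto simp: module_vec_simps)
    have Lv: "L ?v \<in> carrier V" using l(3) v by simp
    have pl: "\<phi> g (L ?v) \<in> carrier V" "\<phi> (g \<otimes>\<^bsub>G\<^esub> h) (L ?v) \<in> carrier V"
      using linear_mapD(3)[OF \<phi>(1) Lv] g h by auto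
    have "T h (T g ?v) = I (\<phi> h (\<phi> g (L ?v)))" using LI[OF pl(1)] by (simp add: T_def)
    also have "\<dots> = \<alpha> (g, h) \<cdot>\<^sub>v T (g \<otimes>\<^bsub>G\<^esub> h) ?v"
      using i(5)[OF pl(2)] mul[OF g h Lv] by (simp add: T_def module_vec_simps)
    finally have TT: "T h (T g ?v) = \<alpha> (g, h) \<cdot>\<^sub>v T (g \<otimes>\<^bsub>G\<^esub> h) ?v" .
    have "F h * F g * u = F h * (F g * of_vec ?v)" by (simp add: v mult.assoc)
    also have "\<dots> = of_vec (T h (T g ?v))" using Fv[OF g v(1)] Fv[OF h Tcar[OF g v(1)]] by simp
    also have "\<dots> = \<alpha> (g, h) *\<^sub>C (F (g \<otimes>\<^bsub>G\<^esub> h) * of_vec ?v)" using Fv[of "g \<otimes>\<^bsub>G\<^esub> h" ?v] g h v by (simp add: TT of_vec_simps)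
    finally show "F h * F g * u = (\<alpha> (g, h) *\<^sub>C F (g \<otimes>\<^bsub>G\<^esub> h)) * u" by (simp add: v)
  qed
  have "F g \<in> GL d" if g: "g \<in> carrier G" for g
    unfolding inj_mat_GL[symmetric] inj_mat_def
  proof (intro conjI ballI impI FM)
    fix u assume u: "u \<in> Mat d 1" and 0: "F g * u = 0"
    let ?v = "to_vec d u"
    have v: "?v \<in> carrier_vec d" "?v \<in> carrier ?C" "of_vec ?v = u" using u by (auto simp: module_vec_simps)
    have Lv: "L ?v \<in> carrier V" using l(3) v by simp
    have pl: "\<phi> g (L ?v) \<in> carrier V" using linear_mapD(3)[OF \<phi>(1)[OF g] Lv] .
    have "of_vec (T g ?v) = 0" using Fv[OF g v(1)] v(3) 0 by simp
    then have "to_vec d (of_vec (T g ?v)) = 0\<^sub>v d" by (simp add: to_vec_simps)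
    then have "T g ?v = \<zero>\<^bsub>?C\<^esub>" using Tcar[OF g v(1)] by (simp add: module_vec_simps)
    then have "\<phi> g (L ?v) = \<zero>\<^bsub>V\<^esub>" using LI[OF pl] l(6) by (simp add: T_def)
    also have "\<dots> = \<phi> g (L \<zero>\<^bsub>?C\<^esub>)" using l(6) linear_mapD(6)[OF \<phi>(1)[OF g]] by simp
    finally have "L ?v = L \<zero>\<^bsub>?C\<^esub>"
      using \<phi>(2)[OF g] Lv l(3)[of "\<zero>\<^bsub>?C\<^esub>"] by (auto simp: bij_betw_def module_vec_simps dest!: inj_onD)
    then have "?v = \<zero>\<^bsub>?C\<^esub>" using IL[OF v(2)] IL[of "\<zero>\<^bsub>?C\<^esub>"] by (simp add: module_vec_simps)
    then have "of_vec ?v = 0" by (simp add: module_vec_simps of_vec_simps)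
    then show "u = 0" using v by simp
  qed
  then have F: "proj_rep G \<alpha> d F" unfolding proj_rep_def using mult \<alpha> by blast
  have d: "0 < d"
  proof (rule ccontr)
    assume "\<not> 0 < d"
    then have "carrier ?C = {\<zero>\<^bsub>?C\<^esub>}" by (auto simp: module_vec_simps)
    then have "carrier V = {\<zero>\<^bsub>V\<^esub>}" using L(2) l(6) by (auto simp: bij_betw_def)
    then show False using ne by simp
  qed
  have iso1: "module_iso G V \<phi> ?C (rep_action d F)"
    unfolding module_iso_def
  proof (intro exI[of _ I] conjI I ballI)
    fix g v assume g: "g \<in> carrier G" and v: "v \<in> carrier V"
    have "I v \<in> carrier_vec d" using i(3)[OF v] by (simp add: module_vec_simps)
    then show "I (\<phi> g v) = rep_action d F g (I v)" using act[OF g] LI[OF v] by (simp add: T_def)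
  qed
  have iso2: "module_iso G ?C (rep_action d F) V \<phi>"
    unfolding module_iso_def
  proof (intro exI[of _ L] conjI L ballI)
    fix g v assume g: "g \<in> carrier G" and v: "v \<in> carrier ?C"
    have "\<phi> g (L v) \<in> carrier V" using linear_mapD(3)[OF \<phi>(1)[OF g] l(3)[OF v]] .
    then show "L (rep_action d F g v) = \<phi> g (L v)" using act[OF g] v LI by (simp add: T_def module_vec_simps)
  qed
  show ?thesis using that[of F] d F iso1 iso2 by (simp add: d_def)
qed

lemma of_vec_subspace:
  assumes "subspace complex_field W (coord_space d)"
  shows "fm.subspace (of_vec ` W)" "of_vec ` W \<subseteq> Mat d 1"
proof -
  have sub: "submodule complex_field W (coord_space d)" using assms by (simp add: subspace_def)
  have W: "W \<subseteq> carrier_vec d" using submodule.subset[OF sub] by (simp add: module_vec_simps)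
  show "of_vec ` W \<subseteq> Mat d 1" using W by auto
  have "0\<^sub>v d \<in> W" using submodule.zero_closed[OF sub] by (simp add: module_vec_simps)
  then have z: "0 \<in> of_vec ` W" using of_vec_simps(3)[of d] by force
  show "fm.subspace (of_vec ` W)"
    unfolding fm.subspace_def
  proof (intro conjI ballI allI z)
    fix x y assume "x \<in> of_vec ` W" "y \<in> of_vec ` W"
    then obtain v w where vw: "v \<in> W" "w \<in> W" "x = of_vec v" "y = of_vec w" by auto
    have "v + w \<in> W" using submodule.m_closed[OF sub vw(1,2)] by (simp add: module_vec_simps)
    moreover have "x + y = of_vec (v + w)"
      using vw(3,4) of_vec_simps(1)[OF subsetD[OF W vw(1)] subsetD[OF W vw(2)]] by simp
    ultimately show "x + y \<in> of_vec ` W" by blast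
  next
    fix c x assume "x \<in> of_vec ` W"
    then obtain v where v: "v \<in> W" "x = of_vec v" by auto
    have "c \<cdot>\<^sub>v v \<in> W" using submodule.smult_closed[OF sub _ v(1), of c] by (simp add: module_vec_simps class_ring_simps)
    moreover have "c *\<^sub>C x = of_vec (c \<cdot>\<^sub>v v)" using v by (simp add: of_vec_simps)
    ultimately show "c *\<^sub>C x \<in> of_vec ` W" by blast
  qed
qed

text \<open>By \<open>schur_expansion\<close> an invariant subspace is invariant under all matrices, and a
  matrix can map a nonzero vector to any other vector.\<close>

lemma scalar_commutant_irreducible:
  assumes G: "group G" and fin: "finite (carrier G)" and F: "proj_rep G \<alpha> d F" and d: "0 < d"
    and sc: "scalar_commutant d (carrier G) F"
  shows "irreducible_module G (coord_space d) (rep_action d F)"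
  unfolding irreducible_module_def
proof (intro conjI allI impI)
  have "unit_vec d 0 \<in> carrier (coord_space d)" "unit_vec d 0 \<noteq> \<zero>\<^bsub>coord_space d\<^esub>"
    using d by (auto simp: module_vec_simps)
  then show "carrier (coord_space d) \<noteq> {\<zero>\<^bsub>coord_space d\<^esub>}" by blast
  interpret group G by fact
  fix W assume W: "subspace complex_field W (coord_space d) \<and> (\<forall>g\<in>carrier G. rep_action d F g ` W \<subseteq> W)"
  define W' where "W' = of_vec ` W"
  have sub: "fm.subspace W'" "W' \<subseteq> Mat d 1" unfolding W'_def using of_vec_subspace W by auto
  have Wc: "W \<subseteq> carrier_vec d"
    using W submodule.subset[of complex_field W "coord_space d"] by (auto simp: subspace_def module_vec_simps)
  have z: "0\<^sub>v d \<in> W"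
    using W submodule.zero_closed[of complex_field W "coord_space d"] by (auto simp: subspace_def module_vec_simps)
  have inv: "F g * w \<in> W'" if g: "g \<in> carrier G" and w: "w \<in> W'" for g w
  proof -
    obtain v where v: "v \<in> W" "w = of_vec v" using w by (auto simp: W'_def)
    have "rep_action d F g v \<in> W" using W g v by auto
    moreover have "of_vec (rep_action d F g v) = F g * w"
      using rep_action_alt(2)[where F = F and g = g, OF proj_repD(2)[OF F g], of v] v Wc by auto
    ultimately show ?thesis unfolding W'_def by (metis imageI)
  qed
  have all: "M * w \<in> W'" if M: "M \<in> Mat d d" and w: "w \<in> W'" for M w
  proof -
    let ?q = "of_nat (card (carrier G)) / of_nat d :: complex"
    have "?q \<noteq> 0" using d fin one_closed by auto
    have "?q *\<^sub>C (M * w) = (\<Sum>g\<in>carrier G. tr d (minv d (F g) * M) *\<^sub>C (F g * w))"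
      using arg_cong[OF schur_expansion[OF G F d sc M], of "\<lambda>x. x * w"] by (simp add: sum_distrib_right)
    also have "\<dots> \<in> W'" using inv w by (intro fm.subspace_sum[OF sub(1)] fm.subspace_scale[OF sub(1)]) auto
    finally have "inverse ?q *\<^sub>C (?q *\<^sub>C (M * w)) \<in> W'" by (rule fm.subspace_scale[OF sub(1)])
    then show ?thesis using \<open>?q \<noteq> 0\<close> by (simp only: fm.scale_scale left_inverse fm.scale_one not_False_eq_True)
  qed
  show "W = {\<zero>\<^bsub>coord_space d\<^esub>} \<or> W = carrier (coord_space d)"
  proof (rule disjCI)
    assume "W \<noteq> carrier (coord_space d)"
    show "W = {\<zero>\<^bsub>coord_space d\<^esub>}"
    proof (rule ccontr)
      assume "W \<noteq> {\<zero>\<^bsub>coord_space d\<^esub>}"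
      then obtain v where v: "v \<in> W" "v \<noteq> 0\<^sub>v d" using z by (auto simp: module_vec_simps)
      then obtain j where j: "j < d" "v $ j \<noteq> 0" using Wc by (metis carrier_vecD eq_vecI index_zero_vec subsetD)
      have "u \<in> W" if u: "u \<in> carrier_vec d" for u
      proof -
        let ?M = "mk d d (\<lambda>i k. if k = j then u $ i / v $ j else 0)"
        have "?M * of_vec v = of_vec u"
        proof (rule Mat_eqI[of _ d 1])
          show "?M * of_vec v \<in> Mat d 1" using v Wc by (intro Mat_mult[OF mk_Mat of_vec_Mat]) auto
          show "of_vec u \<in> Mat d 1" using u by simp
          fix i c assume i: "i < d" and c: "c < (1::nat)"
          have "entry (?M * of_vec v) i c = (\<Sum>k<d. if k = j then u $ i / v $ j * entry (of_vec v) k c else 0)"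
            unfolding entry_mult_Mat[OF mk_Mat] using i by (intro sum.cong refl) auto
          also have "\<dots> = entry (of_vec u) i c"
            using i j c u v Wc by (auto simp: sum.delta of_vec_def)
          finally show "entry (?M * of_vec v) i c = entry (of_vec u) i c" .
        qed
        moreover have "?M * of_vec v \<in> W'" using v by (intro all) (auto simp: W'_def)
        ultimately obtain w where w: "w \<in> W" "of_vec u = of_vec w" by (auto simp: W'_def)
        then have "u = w" using u Wc by (metis to_vec_of_vec subsetD)
        then show ?thesis using w by simp
      qed
      then have "W = carrier (coord_space d)" using Wc by (auto simp: module_vec_simps)
      then show False using \<open>W \<noteq> carrier (coord_space d)\<close> by simp
    qed
  qed
qed

lemma irreducible_module_iso:
  assumes iso: "module_iso G U \<phi> V \<psi>" and irr: "irreducible_module G V \<psi>"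
    and \<phi>: "\<And>g u. g \<in> carrier G \<Longrightarrow> u \<in> carrier U \<Longrightarrow> \<phi> g u \<in> carrier U"
  shows "irreducible_module G U \<phi>"
proof -
  obtain f where f: "linear_map complex_field U V f" "bij_betw f (carrier U) (carrier V)"
    and eq: "\<And>g u. g \<in> carrier G \<Longrightarrow> u \<in> carrier U \<Longrightarrow> f (\<phi> g u) = \<psi> g (f u)"
    using iso by (auto simp: module_iso_def)
  note l = linear_mapD[OF f(1)]
  have inj: "inj_on f (carrier U)" and img: "f ` carrier U = carrier V" using f(2) by (auto simp: bij_betw_def)
  interpret U: abelian_group U by (rule complex_vectorspaceD(1)[OF l(1)])
  interpret V: vectorspace complex_field V by (rule l(2))
  show ?thesis
    unfolding irreducible_module_def
  proof (intro conjI allI impI)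
    show "carrier U \<noteq> {\<zero>\<^bsub>U\<^esub>}"
    proof
      assume "carrier U = {\<zero>\<^bsub>U\<^esub>}"
      then have "carrier V = {\<zero>\<^bsub>V\<^esub>}" using img l(6) by auto
      then show False using irr by (simp add: irreducible_module_def)
    qed
    fix W assume W: "subspace complex_field W U \<and> (\<forall>g\<in>carrier G. \<phi> g ` W \<subseteq> W)"
    then have sub: "submodule complex_field W U" by (simp add: subspace_def)
    have WU: "W \<subseteq> carrier U" by (rule submodule.subset[OF sub])
    have "submodule complex_field (f ` W) V"
    proof (rule submodule.intro)
      show "module complex_field V" by unfold_locales
      show "f ` W \<subseteq> carrier V" using WU l(3) by auto
      show "\<zero>\<^bsub>V\<^esub> \<in> f ` W" using submodule.zero_closed[OF sub] l(6) by (metis imageI)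
      fix v w assume "v \<in> f ` W" "w \<in> f ` W"
      then obtain a b where ab: "a \<in> W" "b \<in> W" "v = f a" "w = f b" by auto
      then have "v \<oplus>\<^bsub>V\<^esub> w = f (a \<oplus>\<^bsub>U\<^esub> b)" using ab WU by (simp add: l(4) subset_iff)
      then show "v \<oplus>\<^bsub>V\<^esub> w \<in> f ` W" using submodule.m_closed[OF sub ab(1,2)] by blast
    next
      fix c v assume c: "c \<in> carrier complex_field" and "v \<in> f ` W"
      then obtain a where a: "a \<in> W" "v = f a" by auto
      then have "c \<odot>\<^bsub>V\<^esub> v = f (c \<odot>\<^bsub>U\<^esub> a)" using WU l(5) by auto
      then show "c \<odot>\<^bsub>V\<^esub> v \<in> f ` W" using submodule.smult_closed[OF sub c a(1)] by blast
    qed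
    then have "subspace complex_field (f ` W) V" using l(2) by (simp add: subspace_def)
    moreover have "\<psi> g ` (f ` W) \<subseteq> f ` W" if "g \<in> carrier G" for g
    proof safe
      fix w assume w: "w \<in> W"
      then have "\<psi> g (f w) = f (\<phi> g w)" using eq that WU by auto
      then show "\<psi> g (f w) \<in> f ` W" using W that w by blast
    qed
    ultimately have "f ` W = {\<zero>\<^bsub>V\<^esub>} \<or> f ` W = carrier V" using irr by (auto simp: irreducible_module_def)
    then show "W = {\<zero>\<^bsub>U\<^esub>} \<or> W = carrier U"
    proof
      assume "f ` W = {\<zero>\<^bsub>V\<^esub>}"
      then have "f ` W = f ` {\<zero>\<^bsub>U\<^esub>}" using l(6) by simp
      then have "W = {\<zero>\<^bsub>U\<^esub>}" using inj_on_image_eq_iff[OF inj WU, of "{\<zero>\<^bsub>U\<^esub>}"] by simp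
      then show ?thesis ..
    next
      assume "f ` W = carrier V"
      then have "W = carrier U" using inj_on_image_eq_iff[OF inj WU subset_refl] img by simp
      then show ?thesis ..
    qed
  qed
qed

lemma irreducible_invariant_subspace:
  assumes irr: "irreducible_module G (coord_space d) (rep_action d F)"
    and FM: "\<And>g. g \<in> carrier G \<Longrightarrow> F g \<in> Mat d d"
    and W: "fm.subspace W" "W \<subseteq> Mat d 1" "W \<noteq> {0}"
    and inv: "\<And>g w. g \<in> carrier G \<Longrightarrow> w \<in> W \<Longrightarrow> F g * w \<in> W"
  shows "W = Mat d 1"
proof -
  let ?W = "to_vec d ` W"
  have ov: "of_vec (to_vec d w) = w" if "w \<in> W" for w using W(2) that by auto
  have "submodule complex_field ?W (coord_space d)"
  proof (rule submodule.intro)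
    show "module complex_field (coord_space d)" by (rule vec_module)
    show "?W \<subseteq> carrier (coord_space d)" by (auto simp: module_vec_simps)
    have "to_vec d 0 \<in> ?W" using fm.subspace_0[OF W(1)] by blast
    then show "\<zero>\<^bsub>coord_space d\<^esub> \<in> ?W" by (simp add: module_vec_simps to_vec_simps)
    fix v w assume "v \<in> ?W" "w \<in> ?W"
    then obtain a b where ab: "a \<in> W" "b \<in> W" "v = to_vec d a" "w = to_vec d b" by auto
    then have "v + w = to_vec d (a + b)" by (simp add: to_vec_simps)
    then show "v \<oplus>\<^bsub>coord_space d\<^esub> w \<in> ?W" using fm.subspace_add[OF W(1) ab(1,2)] by (simp add: module_vec_simps)
  next
    fix c v assume "v \<in> ?W"
    then obtain a where a: "a \<in> W" "v = to_vec d a" by auto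
    then have "c \<cdot>\<^sub>v v = to_vec d (c *\<^sub>C a)" by (simp add: to_vec_simps)
    then show "c \<odot>\<^bsub>coord_space d\<^esub> v \<in> ?W" using fm.subspace_scale[OF W(1) a(1)] by (simp add: module_vec_simps)
  qed
  then have "subspace complex_field ?W (coord_space d)" by (simp add: subspace_def coord_vectorspace)
  moreover have "rep_action d F g ` ?W \<subseteq> ?W" if g: "g \<in> carrier G" for g
    using inv[OF g] ov by (auto simp: rep_action_def)
  ultimately have "?W = {\<zero>\<^bsub>coord_space d\<^esub>} \<or> ?W = carrier (coord_space d)"
    using irr by (auto simp: irreducible_module_def)
  then show ?thesis
  proof
    assume 0: "?W = {\<zero>\<^bsub>coord_space d\<^esub>}"
    have "w = 0" if w: "w \<in> W" for w
    proof -
      have "to_vec d w = 0\<^sub>v d" using 0 w by (auto simp: module_vec_simps)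
      then have "of_vec (to_vec d w) = 0" by (simp add: of_vec_simps)
      then show ?thesis using ov[OF w] by simp
    qed
    then show ?thesis using W(3) fm.subspace_0[OF W(1)] by blast
  next
    assume all: "?W = carrier (coord_space d)"
    have "u \<in> W" if u: "u \<in> Mat d 1" for u
    proof -
      have "to_vec d u \<in> ?W" using all by (simp add: module_vec_simps)
      then obtain w where "w \<in> W" "to_vec d u = to_vec d w" by auto
      then show ?thesis using to_vec_inj[OF u, of w] W(2) by auto
    qed
    then show ?thesis using W(2) by auto
  qed
qed

text \<open>An eigenspace of a matrix commuting with the action is invariant.\<close>

lemma irreducible_scalar_commutant:
  assumes irr: "irreducible_module G (coord_space d) (rep_action d F)" and d: "0 < d"
    and FM: "\<And>g. g \<in> carrier G \<Longrightarrow> F g \<in> Mat d d"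
  shows "scalar_commutant d (carrier G) F"
  unfolding scalar_commutant_def
proof (intro ballI impI)
  fix M assume M: "M \<in> Mat d d" and comm: "\<forall>g\<in>carrier G. M * F g = F g * M"
  obtain \<mu> v where v: "v \<in> Mat d 1" "v \<noteq> 0" "M * v = \<mu> *\<^sub>C v" using eigenvector_exists[OF M d] .
  define W where "W = {w \<in> Mat d 1. M * w = \<mu> *\<^sub>C w}"
  have "W = Mat d 1"
  proof (rule irreducible_invariant_subspace[OF irr FM])
    show "fm.subspace W" unfolding W_def by (rule eigenspace_subspace[OF M])
    show "W \<subseteq> Mat d 1" by (auto simp: W_def)
    show "W \<noteq> {0}" using v by (auto simp: W_def)
    fix g w assume g: "g \<in> carrier G" and w: "w \<in> W"
    have "M * (F g * w) = F g * (M * w)" using comm g by (metis mult.assoc)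
    then show "F g * w \<in> W" using w Mat_mult[OF FM[OF g]] by (auto simp: W_def)
  qed
  then have "M * u = (\<mu> *\<^sub>C idm d) * u" if "u \<in> Mat d 1" for u using that by (auto simp: W_def)
  then have "M = \<mu> *\<^sub>C idm d" using M by (intro Mat_ext[of M d d "\<mu> *\<^sub>C idm d"]) auto
  then show "\<exists>c. M = c *\<^sub>C idm d" by blast
qed

lemma primitive_module_iso:
  assumes iso: "module_iso G V \<phi> U \<psi>" and prim: "primitive_module G \<alpha> V \<phi>"
  shows "primitive_module G \<alpha> U \<psi>"
  using prim module_iso_trans[OF iso] unfolding primitive_module_def by blast

text \<open>The centre of the algebra spanned by \<open>F(N)\<close> is a commuting set of matrices, and it is
  normalized by \<open>F(G)\<close> because \<open>N\<close> is normal.\<close>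

lemma primitive_quasi_primitive:
  assumes G: "group G" and fin: "finite (carrier G)" and F: "proj_rep G \<alpha> d F" and d: "0 < d"
    and irr: "irreducible_module G (coord_space d) (rep_action d F)"
    and prim: "primitive_module G \<alpha> (coord_space d) (rep_action d F)"
  shows "quasi_primitive G \<alpha> d F"
proof -
  interpret group G by fact
  note FM = proj_repD(2)[OF F] and GLF = proj_repD(1)[OF F]
  show ?thesis
  proof
    show "finite (carrier G)" "proj_rep G \<alpha> d F" "0 < d" by fact+
    show "scalar_commutant d (carrier G) F" by (rule irreducible_scalar_commutant[OF irr d FM])
    fix N z assume N: "N \<lhd> G" and z: "z \<in> fm.span (F ` N)" "\<And>g. g \<in> N \<Longrightarrow> z * F g = F g * z"
    have NG: "N \<subseteq> carrier G" using subgroup.subset[OF normal_imp_subgroup[OF N]] .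
    let ?A = "fm.span (F ` N)"
    have AM: "?A \<subseteq> Mat d d" using FM NG by (intro span_image_Mat) auto
    define Z where "Z = {z \<in> ?A. \<forall>n\<in>N. z * F n = F n * z}"
    have Zspan: "z * s = s * z" if z: "z \<in> Z" and s: "s \<in> ?A" for z s
      using s by (induction rule: fm.span_induct_alt) (use z in \<open>auto simp: Z_def distrib_left distrib_right\<close>)
    show "\<exists>c. z = c *\<^sub>C idm d"
    proof (rule primitive_commuting_scalar[OF G fin F d _ prim, of Z])
      show "W = Mat d 1" if "fm.subspace W" "W \<subseteq> Mat d 1" "W \<noteq> {0}"
        "\<And>g w. g \<in> carrier G \<Longrightarrow> w \<in> W \<Longrightarrow> F g * w \<in> W" for W
        using irreducible_invariant_subspace[OF irr FM that] .
      show "Z \<subseteq> Mat d d" using AM by (auto simp: Z_def)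
      show "y * z = z * y" if "y \<in> Z" "z \<in> Z" for y z
        using Zspan[OF that(1), of z] that(2) by (simp add: Z_def)
      show "z \<in> Z" using z by (simp add: Z_def)
      fix g y assume g: "g \<in> carrier G" and y: "y \<in> Z"
      note GLg = GLF[OF g]
      have "minv d (F g) * s * F g \<in> ?A" if "s \<in> ?A" for s
        using that
      proof (induction rule: fm.span_induct_alt)
        case base
        then show ?case by (simp add: fm.span_zero)
      next
        case (step c s t)
        then obtain n where n: "n \<in> N" "s = F n" by auto
        then show ?case using step proj_rep_conj_span(2)[OF F N g n(1)]
          by (simp add: distrib_left distrib_right fm.span_add fm.span_scale)
      qed
      moreover have "(minv d (F g) * y * F g) * F n = F n * (minv d (F g) * y * F g)" if n: "n \<in> N" for n
      proof -
        have nG: "n \<in> carrier G" using n NG by auto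
        define s where "s = F g * F n * minv d (F g)"
        have s: "s \<in> ?A" unfolding s_def by (rule proj_rep_conj_span(1)[OF F N g n])
        have yM: "y \<in> Mat d d" using y AM by (auto simp: Z_def)
        have e1: "F g * F n = s * F g"
          unfolding s_def using minv_cancel(4)[OF GLg Mat_mult[OF FM[OF g] FM[OF nG]]] by simp
        have e2: "minv d (F g) * s = F n * minv d (F g)"
          unfolding s_def using minv_cancel(2)[OF GLg Mat_mult[OF FM[OF nG] minv(1)[OF GLg]]] by (simp add: mult.assoc)
        have "(minv d (F g) * y * F g) * F n = minv d (F g) * y * (F g * F n)" by (simp only: mult.assoc)
        also have "\<dots> = minv d (F g) * (y * s) * F g" by (simp only: e1 mult.assoc)
        also have "\<dots> = (minv d (F g) * s) * y * F g" by (simp only: Zspan[OF y s] mult.assoc)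
        also have "\<dots> = F n * (minv d (F g) * y * F g)" by (simp only: e2 mult.assoc)
        finally show ?thesis .
      qed
      ultimately show "minv d (F g) * y * F g \<in> Z" using y by (simp add: Z_def)
    qed
  qed
qed

section \<open>The factorization theorem\<close>

text \<open>The coordinate at \<open>i * n + j\<close> belongs to the pair \<open>(i, j)\<close> in both descriptions.\<close>

lemma tensor_action_kron:
  assumes w: "w \<in> carrier_vec (m * n)"
  shows "tensor_action m n (rep_action m X) (rep_action n Y) g w
    = rep_action (m * n) (\<lambda>g. kron m n (X g) (Y g)) g w"
proof (rule eq_vecI)
  let ?f = "\<lambda>(i, j). w $ (i * n + j) \<cdot>\<^sub>v
    tensor_vec m n (rep_action m X g (unit_vec m i)) (rep_action n Y g (unit_vec n j))"
  interpret C: vec_space "TYPE(complex)" "m * n" .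
  have fin: "tensor_action m n (rep_action m X) (rep_action n Y) g w
      = finsum_vec TYPE(complex) (m * n) ?f ({..<m} \<times> {..<n})"
    unfolding tensor_action_def C.finsum_vec ..
  have car: "?f \<in> {..<m} \<times> {..<n} \<rightarrow> carrier_vec (m * n)" by (auto simp: tensor_vec_def)
  have col: "rep_action k Z g (unit_vec k i) $ a = entry (Z g) a i" if "i < k" "a < k" for k i a and Z :: "'a \<Rightarrow> fmat"
  proof -
    have "of_vec (unit_vec k i) = (eunit i 0 :: fmat)" using that by (intro fmat_eqI) (auto simp: of_vec_def)
    then show ?thesis using that by (simp add: rep_action_def to_vec_def entry_mult_eunit)
  qed
  show "dim_vec (tensor_action m n (rep_action m X) (rep_action n Y) g w)
      = dim_vec (rep_action (m * n) (\<lambda>g. kron m n (X g) (Y g)) g w)"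
    unfolding fin using finsum_vec_closed[OF car] by (simp add: rep_action_def)
  fix t assume "t < dim_vec (rep_action (m * n) (\<lambda>g. kron m n (X g) (Y g)) g w)"
  then have t: "t < m * n" by (simp add: rep_action_def)
  then have n: "0 < n" by (cases n) auto
  have t': "t div n < m" "t mod n < n" using t n by (auto simp: less_mult_imp_div_less)
  have "tensor_action m n (rep_action m X) (rep_action n Y) g w $ t = (\<Sum>q\<in>{..<m} \<times> {..<n}. ?f q $ t)"
    unfolding fin by (rule index_finsum_vec[OF _ t car]) simp
  also have "\<dots> = (\<Sum>i<m. \<Sum>j<n. ?f (i, j) $ t)" by (subst sum.cartesian_product) (rule sum.cong, auto)
  also have "\<dots> = (\<Sum>i<m. \<Sum>j<n. entry (kron m n (X g) (Y g)) t (i * n + j) * entry (of_vec w) (i * n + j) 0)"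
  proof (intro sum.cong refl)
    fix i j assume "i \<in> {..<m}" "j \<in> {..<n}"
    then have ij: "i < m" "j < n" "i * n + j < m * n" using index_lt by auto
    have "?f (i, j) $ t = w $ (i * n + j) * (entry (X g) (t div n) i * entry (Y g) (t mod n) j)"
      using t t' ij by (simp add: tensor_vec_def col)
    then show "?f (i, j) $ t = entry (kron m n (X g) (Y g)) t (i * n + j) * entry (of_vec w) (i * n + j) 0"
      using t ij w by (simp add: kron_def of_vec_def)
  qed
  also have "\<dots> = rep_action (m * n) (\<lambda>g. kron m n (X g) (Y g)) g w $ t"
    using t by (simp add: rep_action_def to_vec_def entry_mult_Mat[OF kron_Mat] sum_lessThan_mult)
  finally show "tensor_action m n (rep_action m X) (rep_action n Y) g w $ t
      = rep_action (m * n) (\<lambda>g. kron m n (X g) (Y g)) g w $ t" .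
qed

lemma intertwiner_module_iso:
  assumes F: "proj_rep G \<alpha> d F" and S: "S \<in> GL d" and E: "\<And>g. g \<in> carrier G \<Longrightarrow> E g \<in> Mat d d"
    and FS: "\<And>g. g \<in> carrier G \<Longrightarrow> F g * S = S * E g"
  shows "module_iso G (coord_space d) (rep_action d F) (coord_space d) (rep_action d E)"
proof -
  let ?T = "\<lambda>_::unit. minv d S"
  have TM: "?T () \<in> Mat d d" by (rule minv(1)[OF S])
  show ?thesis
    unfolding module_iso_def
  proof (intro exI[of _ "rep_action d ?T ()"] conjI ballI)
    show "linear_map complex_field (coord_space d) (coord_space d) (rep_action d ?T ())" by (rule rep_action_linear)
    show "bij_betw (rep_action d ?T ()) (carrier (coord_space d)) (carrier (coord_space d))"
      by (rule rep_action_bij) (rule GL_minv[OF S])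
    fix g v assume g: "g \<in> carrier G" and "v \<in> carrier (coord_space d)"
    then have v: "v \<in> carrier_vec d" by (simp add: module_vec_simps)
    note FM = proj_repD(2)[OF F g]
    have "minv d S * F g = E g * minv d S"
    proof -
      have "minv d S * F g = minv d S * (F g * S) * minv d S"
        using minv_cancel(3)[OF S Mat_mult[OF minv(1)[OF S] FM]] by (simp add: mult.assoc)
      also have "\<dots> = minv d S * (S * (E g * minv d S))" by (simp add: FS[OF g] mult.assoc)
      also have "\<dots> = E g * minv d S" by (rule minv_cancel(2)[OF S Mat_mult[OF E[OF g] minv(1)[OF S]]])
      finally show ?thesis .
    qed
    then have "minv d S * (F g * of_vec v) = E g * (minv d S * of_vec v)" by (simp add: mult.assoc[symmetric])
    then show "rep_action d ?T () (rep_action d F g v) = rep_action d E g (rep_action d ?T () v)"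
      using rep_action_alt(2)[where F = F and g = g, OF FM v] rep_action_alt(2)[where F = ?T and g = "()", OF TM v]
      by (simp add: rep_action_def)
  qed
qed

text \<open>If the cocycle is the coboundary of \<open>\<nu>\<close>, dividing each \<open>X g\<close> by \<open>\<nu> g\<close> makes it \<open>1\<close>.\<close>

lemma ordinary_moduleI:
  assumes G: "group G" and X: "proj_rep G \<beta> m X" and m: "0 < m"
    and b: "restrict \<beta> (carrier G \<times> carrier G) \<in> B2 G"
  shows "ordinary_module G (coord_space m) (rep_action m X)"
proof -
  interpret group G by fact
  obtain \<nu> where "restrict \<beta> (carrier G \<times> carrier G) \<in> extensional (carrier G \<times> carrier G)"
    and nz: "\<forall>x\<in>carrier G. \<nu> x \<noteq> 0"
    and eq: "\<forall>x\<in>carrier G. \<forall>y\<in>carrier G. restrict \<beta> (carrier G \<times> carrier G) (x, y) = \<nu> x * \<nu> y / \<nu> (x \<otimes>\<^bsub>G\<^esub> y)"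
    by (rule B2E[OF b])
  define \<mu> where "\<mu> x = inverse (\<nu> x)" for x
  define X' where "X' g = \<mu> g *\<^sub>C X g" for g
  have "proj_rep G (\<lambda>_. 1) m X'"
    unfolding proj_rep_def
  proof (intro conjI ballI)
    fix g assume g: "g \<in> carrier G"
    then show "X' g \<in> GL m" unfolding X'_def using proj_repD(1)[OF X g] nz by (auto simp: \<mu>_def)
    fix h assume h: "h \<in> carrier G"
    have "\<beta> (g, h) = \<nu> g * \<nu> h / \<nu> (g \<otimes>\<^bsub>G\<^esub> h)" using eq g h by simp
    then have "\<mu> h * (\<mu> g * \<beta> (g, h)) = \<mu> (g \<otimes>\<^bsub>G\<^esub> h)" using nz g h by (simp add: \<mu>_def field_simps)
    then show "X' h * X' g = 1 *\<^sub>C X' (g \<otimes>\<^bsub>G\<^esub> h)"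
      by (simp add: X'_def proj_repD(4)[OF X g h] mult.assoc mult.left_commute)
  qed simp
  then have "twisted_module G (\<lambda>_. 1) (coord_space m) (rep_action m X')"
    by (rule rep_action_twisted_module[OF _ m G])
  moreover have "rep_action m X' = (\<lambda>g v. \<mu> g \<odot>\<^bsub>coord_space m\<^esub> rep_action m X g v)"
    by (simp add: fun_eq_iff rep_action_def X'_def to_vec_simps module_vec_simps)
  moreover have "\<mu> \<in> carrier G \<rightarrow> UNIV - {0}" using nz by (auto simp: \<mu>_def)
  ultimately show ?thesis unfolding ordinary_module_def by (intro bexI[of _ \<mu>]) simp_all
qed

lemma proj_rep_cocycle_cong:
  assumes "proj_rep G \<beta> m X" "\<And>x y. x \<in> carrier G \<Longrightarrow> y \<in> carrier G \<Longrightarrow> \<beta>' (x, y) = \<beta> (x, y)"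
  shows "proj_rep G \<beta>' m X"
  using assms unfolding proj_rep_def by auto

lemma compl_compl_primes: "\<forall>p\<in>\<pi>. prime p \<Longrightarrow> compl_primes (compl_primes \<pi>) = \<pi>"
  by (auto simp: compl_primes_def)

theorem theorem3:
  fixes G :: "('a, 'b) monoid_scheme" (structure)
    and \<pi> :: "nat set"
    and H H' :: "'a set"
    and c :: "('a \<times> 'a \<Rightarrow> complex) set"
    and \<alpha> :: "'a \<times> 'a \<Rightarrow> complex"
    and V :: "(complex, 'v, 'm) module_scheme"
    and \<phi> :: "'a \<Rightarrow> 'v \<Rightarrow> 'v"
  defines "c\<^sub>\<pi> \<equiv> pi_component \<pi> (H2 G) c"
    and "c\<^sub>\<pi>' \<equiv> pi_component (compl_primes \<pi>) (H2 G) c"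
  assumes "\<forall>p\<in>\<pi>. prime p"
    and "group G" and "finite (carrier G)" and "pi_separable \<pi> G"
    and "hall_subgroup \<pi> G H" and "hall_subgroup (compl_primes \<pi>) G H'"
    and "c \<in> carrier (H2 G)" and "\<alpha> \<in> c"
    and "twisted_module G \<alpha> V \<phi>"
    and "irreducible_module G V \<phi>"
    and "primitive_module G \<alpha> V \<phi>"
  shows "\<exists>\<beta>\<in>c\<^sub>\<pi>. \<exists>\<gamma>\<in>c\<^sub>\<pi>'. \<exists>m n \<rho> \<rho>'.
    \<alpha> = \<beta> \<otimes>\<^bsub>Z2 G\<^esub> \<gamma> \<and>
    twisted_module G \<beta> (coord_space m) \<rho> \<and>
    twisted_module G \<gamma> (coord_space n) \<rho>' \<and>
    module_iso G V \<phi> (coord_space (m * n)) (tensor_action m n \<rho> \<rho>') \<and>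
    irreducible_module (G\<lparr>carrier := H\<rparr>) (coord_space m) \<rho> \<and>
    irreducible_module (G\<lparr>carrier := H'\<rparr>) (coord_space n) \<rho>' \<and>
    pi_part \<pi> (cdim V) = cdim (coord_space m) \<and>
    pi_part (compl_primes \<pi>) (cdim V) = cdim (coord_space n) \<and>
    restrict_coclass H' c\<^sub>\<pi> = \<one>\<^bsub>H2 (G\<lparr>carrier := H'\<rparr>)\<^esub> \<and>
    restrict_coclass H c\<^sub>\<pi>' = \<one>\<^bsub>H2 (G\<lparr>carrier := H\<rparr>)\<^esub> \<and>
    ordinary_module (G\<lparr>carrier := H'\<rparr>) (coord_space m) \<rho> \<and>
    ordinary_module (G\<lparr>carrier := H\<rparr>) (coord_space n) \<rho>'"
proof -
  interpret group G by fact
  note G = \<open>group G\<close> and fin = \<open>finite (carrier G)\<close>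
  interpret Z: comm_group "Z2 G" by (rule Z2_comm_group)
  interpret HH: comm_group "H2 G" by (rule H2_comm_group)
  have \<alpha>: "\<alpha> \<in> carrier (Z2 G)" "c = coclass \<alpha>"
    using coclass_representative[OF \<open>c \<in> carrier (H2 G)\<close> \<open>\<alpha> \<in> c\<close>] by auto
  have \<alpha>nz: "\<alpha> (g, h) \<noteq> 0" if "g \<in> carrier G" "h \<in> carrier G" for g h
    using \<alpha>(1) that by (auto simp: Z2_simps)
  define d where "d = cdim V"
  obtain F where d: "0 < d" and F: "proj_rep G \<alpha> d F"
    and VF: "module_iso G V \<phi> (coord_space d) (rep_action d F)"
    and FV: "module_iso G (coord_space d) (rep_action d F) V \<phi>"
    unfolding d_def by (rule module_matrices[OF G \<open>twisted_module G \<alpha> V \<phi>\<close> \<alpha>nz])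
  have irr: "irreducible_module G (coord_space d) (rep_action d F)"
    by (rule irreducible_module_iso[OF FV \<open>irreducible_module G V \<phi>\<close>]) (simp add: module_vec_simps)
  have prim: "primitive_module G \<alpha> (coord_space d) (rep_action d F)"
    by (rule primitive_module_iso[OF VF \<open>primitive_module G \<alpha> V \<phi>\<close>])
  interpret Q: quasi_primitive G \<alpha> d F by (rule primitive_quasi_primitive[OF G fin F d irr prim])
  have H: "subgroup H G" "pi_number \<pi> (card H)" "pi_number (compl_primes \<pi>) (card (rcosets H))"
    using \<open>hall_subgroup \<pi> G H\<close> by (auto simp: hall_subgroup_def)
  have cc: "compl_primes (compl_primes \<pi>) = \<pi>" using compl_compl_primes \<open>\<forall>p\<in>\<pi>. prime p\<close> by blast
  have H': "subgroup H' G" "pi_number (compl_primes \<pi>) (card H')" "pi_number \<pi> (card (rcosets H'))"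
    using \<open>hall_subgroup (compl_primes \<pi>) G H'\<close> cc by (auto simp: hall_subgroup_def)
  obtain N :: "nat \<Rightarrow> 'a set" and l where N0: "N 0 = {\<one>}" and Nl: "N l = carrier G"
    and Nn: "\<forall>i\<le>l. N i \<lhd> G" and Nq: "\<forall>i<l. N i \<subseteq> N (Suc i) \<and>
          (pi_number \<pi> (Coset.order (G\<lparr>carrier := N (Suc i)\<rparr> Mod N i)) \<or>
           pi_number (compl_primes \<pi>) (Coset.order (G\<lparr>carrier := N (Suc i)\<rparr> Mod N i)))"
    using \<open>pi_separable \<pi> G\<close> unfolding pi_separable_def Let_def by blast
  have cover: "N i \<subseteq> N (Suc i) \<and>
      (N (Suc i) \<subseteq> (H \<inter> N (Suc i)) <#> N i \<or> N (Suc i) \<subseteq> (H' \<inter> N (Suc i)) <#> N i)" if i: "i < l" for i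
  proof -
    let ?q = "Coset.order (G\<lparr>carrier := N (Suc i)\<rparr> Mod N i)"
    have n: "N i \<lhd> G" "N (Suc i) \<lhd> G" "N i \<subseteq> N (Suc i)" using Nn Nq i by auto
    consider "pi_number \<pi> ?q" | "pi_number (compl_primes \<pi>) ?q" using Nq i by blast
    then show ?thesis
    proof cases
      case 1
      have "coprime (card (rcosets H)) ?q" using pi_number_coprime[OF 1 H(3)] by (simp add: coprime_commute)
      then show ?thesis using coprime_index_covers[OF fin H(1) n] n(3) by blast
    next
      case 2
      have "coprime (card (rcosets H')) ?q" by (rule pi_number_coprime[OF H'(3) 2])
      then show ?thesis using coprime_index_covers[OF fin H'(1) n] n(3) by blast
    qed
  qed
  obtain x y where x: "\<forall>g\<in>carrier G. x g \<in> GL d" and y: "\<forall>g\<in>carrier G. y g \<in> GL d"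
    and Fxy: "\<forall>g\<in>carrier G. F g = x g * y g" and comm: "\<forall>g\<in>carrier G. \<forall>h\<in>carrier G. x g * y h = y h * x g"
    and xH: "x ` carrier G \<subseteq> fm.span (x ` H)" and yH: "y ` carrier G \<subseteq> fm.span (y ` H')"
    by (rule Q.commuting_factorization[where N = N and l = l, OF H(1) H'(1) N0 Nl _ cover]) (use Nn in auto)
  obtain m n \<beta>0 \<gamma>0 X Y S where m: "0 < m" and n: "0 < n" and dmn: "d = m * n" and S: "S \<in> GL d"
    and X0: "proj_rep G \<beta>0 m X" and Y0: "proj_rep G \<gamma>0 n Y"
    and scX: "scalar_commutant m H X" and scY: "scalar_commutant n H' Y"
    and FS: "\<forall>g\<in>carrier G. F g * S = S * kron m n (X g) (Y g)"
    and \<alpha>\<beta>\<gamma>: "\<forall>g\<in>carrier G. \<forall>h\<in>carrier G. \<alpha> (g, h) = \<beta>0 (g, h) * \<gamma>0 (g, h)"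
    by (rule tensor_decomposition[where x = x and y = y, OF G fin F d Q.sc _ _ _ _ subgroup.subset[OF H(1)] xH
          subgroup.subset[OF H'(1)] yH]) (use x y Fxy comm in auto)
  \<comment> \<open>A representation only fixes its cocycle on \<open>carrier G\<close>; elements of \<open>Z2 G\<close> are
    extensional.\<close>
  define \<beta> where "\<beta> = restrict \<beta>0 (carrier G \<times> carrier G)"
  define \<gamma> where "\<gamma> = restrict \<gamma>0 (carrier G \<times> carrier G)"
  have X: "proj_rep G \<beta> m X" by (rule proj_rep_cocycle_cong[OF X0]) (simp add: \<beta>_def)
  have Y: "proj_rep G \<gamma> n Y" by (rule proj_rep_cocycle_cong[OF Y0]) (simp add: \<gamma>_def)
  have \<beta>: "\<beta> \<in> carrier (Z2 G)" "\<beta> [^]\<^bsub>Z2 G\<^esub> m \<in> B2 G"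
    unfolding \<beta>_def by (rule proj_rep_cocycle[OF X0 m])+
  have \<gamma>: "\<gamma> \<in> carrier (Z2 G)" "\<gamma> [^]\<^bsub>Z2 G\<^esub> n \<in> B2 G"
    unfolding \<gamma>_def by (rule proj_rep_cocycle[OF Y0 n])+
  have prod: "\<alpha> = \<beta> \<otimes>\<^bsub>Z2 G\<^esub> \<gamma>"
  proof
    fix p
    show "\<alpha> p = (\<beta> \<otimes>\<^bsub>Z2 G\<^esub> \<gamma>) p"
    proof (cases "p \<in> carrier G \<times> carrier G")
      case True
      then show ?thesis using \<alpha>\<beta>\<gamma> unfolding Z2_simps(2) \<beta>_def \<gamma>_def by auto
    next
      case False
      have "\<alpha> \<in> extensional (carrier G \<times> carrier G)" using \<alpha>(1) by (simp only: Z2_simps(1) PiE_def) blast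
      then have "\<alpha> p = undefined" using False by (rule extensional_arb)
      then show ?thesis unfolding Z2_simps(2) restrict_apply using False by simp
    qed
  qed
  let ?H = "G\<lparr>carrier := H\<rparr>" and ?H' = "G\<lparr>carrier := H'\<rparr>"
  have gH: "group ?H" and gH': "group ?H'"
    using subgroup.subgroup_is_group[OF H(1) G] subgroup.subgroup_is_group[OF H'(1) G] by auto
  have finH: "finite (carrier ?H)" "finite (carrier ?H')"
    using finite_subset[OF subgroup.subset[OF H(1)] fin] finite_subset[OF subgroup.subset[OF H'(1)] fin] by auto
  note XH = proj_rep_restrict[OF X H(1)] and YH = proj_rep_restrict[OF Y H'(1)]
  have scXH: "scalar_commutant m (carrier ?H) X" and scYH: "scalar_commutant n (carrier ?H') Y"
    using scX scY by simp_all
  \<comment> \<open>Irreducibility on the Hall subgroups bounds the prime divisors of the degrees.\<close>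
  have "m dvd card H" using degree_dvd_order[OF gH finH(1) XH m scXH] by simp
  then have pm: "pi_number \<pi> m" by (rule pi_number_dvd[OF H(2)])
  have "n dvd card H'" using degree_dvd_order[OF gH' finH(2) YH n scYH] by simp
  then have pn: "pi_number (compl_primes \<pi>) n" by (rule pi_number_dvd[OF H'(2)])
  have b1: "coclass \<beta> [^]\<^bsub>H2 G\<^esub> m = \<one>\<^bsub>H2 G\<^esub>"
    using coclass_eq_one_iff[OF Z.nat_pow_closed[OF \<beta>(1)]] \<beta>(2) by (simp add: coclass_pow[OF \<beta>(1)])
  have c1: "coclass \<gamma> [^]\<^bsub>H2 G\<^esub> n = \<one>\<^bsub>H2 G\<^esub>"
    using coclass_eq_one_iff[OF Z.nat_pow_closed[OF \<gamma>(1)]] \<gamma>(2) by (simp add: coclass_pow[OF \<gamma>(1)])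
  have cprod: "c = coclass \<beta> \<otimes>\<^bsub>H2 G\<^esub> coclass \<gamma>" "c = coclass \<gamma> \<otimes>\<^bsub>H2 G\<^esub> coclass \<beta>"
    using coclass_mult[OF \<beta>(1) \<gamma>(1)] HH.m_comm[OF coclass_H2[OF \<beta>(1)] coclass_H2[OF \<gamma>(1)]] \<alpha>(2) prod by simp_all
  have c\<pi>: "c\<^sub>\<pi> = coclass \<beta>"
    unfolding c\<^sub>\<pi>_def cprod(1)
    by (rule pi_component_eqI[OF H2_comm_group coclass_H2[OF \<beta>(1)] coclass_H2[OF \<gamma>(1)] pm b1 pn c1])
  have pm': "pi_number (compl_primes (compl_primes \<pi>)) m" using pm cc by simp
  have c\<pi>': "c\<^sub>\<pi>' = coclass \<gamma>"
    unfolding c\<^sub>\<pi>'_def cprod(2)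
    by (rule pi_component_eqI[OF H2_comm_group coclass_H2[OF \<gamma>(1)] coclass_H2[OF \<beta>(1)] pn c1 pm' b1])
  have cop: "coprime m (card H')" "coprime n (card H)"
    using pi_number_coprime[OF pm H'(2)] pi_number_coprime[OF H(2) pn] by (simp_all add: coprime_commute)
  note r\<beta> = restrict_coclass_trivial[OF G fin H'(1) \<beta> cop(1)]
  note r\<gamma> = restrict_coclass_trivial[OF G fin H(1) \<gamma> cop(2)]
  let ?\<rho> = "rep_action m X" and ?\<rho>' = "rep_action n Y"
  have "module_iso G (coord_space d) (rep_action d F) (coord_space (m * n)) (tensor_action m n ?\<rho> ?\<rho>')"
  proof -
    have "module_iso G (coord_space d) (rep_action d F) (coord_space d) (rep_action d (\<lambda>g. kron m n (X g) (Y g)))"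
      by (rule intertwiner_module_iso[OF F S]) (use FS dmn in auto)
    then obtain f where f: "linear_map complex_field (coord_space d) (coord_space d) f"
      "bij_betw f (carrier (coord_space d)) (carrier (coord_space d))"
      "\<forall>g\<in>carrier G. \<forall>v\<in>carrier (coord_space d). f (rep_action d F g v) = rep_action d (\<lambda>g. kron m n (X g) (Y g)) g (f v)"
      unfolding module_iso_def by blast
    have "f (rep_action d F g v) = tensor_action m n ?\<rho> ?\<rho>' g (f v)"
      if "g \<in> carrier G" "v \<in> carrier (coord_space d)" for g v
    proof -
      have "f v \<in> carrier_vec (m * n)" using linear_mapD(3)[OF f(1) that(2)] dmn by (simp add: module_vec_simps)
      then show ?thesis using f(3) that tensor_action_kron[of "f v" m n X Y g] dmn by simp
    qed
    then show ?thesis unfolding module_iso_def using f(1,2) dmn by blast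
  qed
  then have iso: "module_iso G V \<phi> (coord_space (m * n)) (tensor_action m n ?\<rho> ?\<rho>')"
    by (rule module_iso_trans[OF VF])
  have dims: "cdim (coord_space k) = k" for k
  proof -
    interpret C: vec_space "TYPE(complex)" k .
    show ?thesis by (rule C.dim_is_n)
  qed
  have parts: "pi_part \<pi> (cdim V) = cdim (coord_space m)" "pi_part (compl_primes \<pi>) (cdim V) = cdim (coord_space n)"
    using pi_part_mult[OF pm pn] dmn by (simp_all add: d_def dims)
  have ord1: "ordinary_module ?H' (coord_space m) ?\<rho>"
    by (rule ordinary_moduleI[OF gH' proj_rep_restrict[OF X H'(1)] m]) (use r\<beta>(1) in simp)
  have ord2: "ordinary_module ?H (coord_space n) ?\<rho>'"
    by (rule ordinary_moduleI[OF gH proj_rep_restrict[OF Y H(1)] n]) (use r\<gamma>(1) in simp)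
  have irrH: "irreducible_module ?H (coord_space m) ?\<rho>"
    by (rule scalar_commutant_irreducible[OF gH finH(1) XH m scXH])
  have irrH': "irreducible_module ?H' (coord_space n) ?\<rho>'"
    by (rule scalar_commutant_irreducible[OF gH' finH(2) YH n scYH])
  have mem: "\<beta> \<in> c\<^sub>\<pi>" "\<gamma> \<in> c\<^sub>\<pi>'"
    unfolding c\<pi> c\<pi>' using Z.rcos_self[OF \<beta>(1) B2_subgroup] Z.rcos_self[OF \<gamma>(1) B2_subgroup] by auto
  have res: "restrict_coclass H' c\<^sub>\<pi> = \<one>\<^bsub>H2 ?H'\<^esub>" "restrict_coclass H c\<^sub>\<pi>' = \<one>\<^bsub>H2 ?H\<^esub>"
    unfolding c\<pi> c\<pi>' by (rule r\<beta>(2), rule r\<gamma>(2))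
  have tm: "twisted_module G \<beta> (coord_space m) ?\<rho>" "twisted_module G \<gamma> (coord_space n) ?\<rho>'"
    by (rule rep_action_twisted_module[OF X m G], rule rep_action_twisted_module[OF Y n G])
  show ?thesis
    by (intro bexI[OF _ mem(1)] bexI[OF _ mem(2)] exI[of _ m] exI[of _ n] exI[of _ ?\<rho>] exI[of _ ?\<rho>'] conjI
        prod tm iso irrH irrH' parts res ord1 ord2)
qed

end
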